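(* Let $u$ be a potential whose scattering coefficient $a(k)$ satisfies $$|a(k)|\ge 1-\tfrac12\|u\|_{L^1}e^{\|Q_1\|_{L^1}}>0,\qquad k\in\mathbb{R}.$$ If $u\in H^{1,1}(\mathbb{R})$, then $r_\pm(z)\in H^1(\mathbb{R})$; and if $u\in H^2(\mathbb{R})\cap H^{1,1}(\mathbb{R})$, then $r_\pm(z)\in L^{2,1}(\mathbb{R})$. Moreover, the map $$H^2(\mathbb{R})\cap H^{1,1}(\mathbb{R})\ni u\mapsto (r_-,r_+)\in H^1(\mathbb{R})\cap L^{2,1}(\mathbb{R})$$ (defined on the $u$ satisfying $|a(k)|\ge 1-\tfrac12\|u\|_{L^1}e^{\|Q_1\|_{L^1}}>0$ for all $k\in\mathbb{R}$) is Lipschitz continuous.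
   Context: Spaces: $\langle x\rangle=(1+x^2)^{1/2}$; $L^{2,1}(\mathbb{R})=\{f:\langle x\rangle f\in L^2(\mathbb{R})\}$; $H^{1,1}(\mathbb{R})=\{f:f,f'\in L^{2,1}(\mathbb{R})\}$; $H^m$ are the usual Sobolev spaces; intersections carry the sum of the norms. Let $w=-iu_x+2u-\frac12|u|^2u$, $Q_1=\begin{pmatrix}0&u/2\\ \overline w&0\end{pmatrix}$, and $\|Q_1\|_{L^1}=\int_{\mathbb{R}}\sqrt{\mathrm{tr}(Q_1^\dagger Q_1)}\,dx$. Scattering data: $z=k^2$. For $k\in\mathbb{R}\cup i\mathbb{R}$ let $Q(x;k)=\begin{pmatrix}\frac i2|u|^2 & ku\\ -k\overline u & -\frac i2|u|^2\end{pmatrix}$, and let $\varphi_\pm(x;k),\phi_\pm(x;k)\in\mathbb{C}^2$ solve $\varphi_\pm(x;k)=e_1+\int_{\pm\infty}^x\mathrm{diag}(1,e^{2i(k^2+1)(x-y)})Q(y;k)\varphi_\pm(y;k)\,dy$, $\phi_\pm(x;k)=e_2+\int_{\pm\infty}^x\mathrm{diag}(e^{-2i(k^2+1)(x-y)},1)Q(y;k)\phi_\pm(y;k)\,dy$, with $e_1=(1,0)^T$, $e_2=(0,1)^T$. The coefficients $a(k),b(k)$ are defined by $\varphi_-(x;k)=a(k)\varphi_+(x;k)+b(k)e^{2i(k^2+1)x}\phi_+(x;k)$; $a$ is even and $b$ is odd in $k$. The reflection coefficient is $r(k)=b(k)/a(k)$, $k\in\mathbb{R}\cup i\mathbb{R}$,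 and $$r_+(z)=\frac{r(k)}{2k},\qquad r_-(z)=2k\,r(k),\qquad z=k^2\in\mathbb{R},$$ which are functions of $z\in\mathbb{R}$ since $r$ is odd in $k$. "Lipschitz continuous" is meant on bounded sets: for every $B>0$ there is $C(B)>0$ such that the norm of the difference of the images of $u,\tilde u$ is at most $C(B)\|u-\tilde u\|$ whenever $\|u\|,\|\tilde u\|\le B$ (norms of $H^2\cap H^{1,1}$). *)

theory Defs
  imports "HOL-Analysis.Analysis"
begin

text \<open>
  The function spaces below are sets of representatives: complex-valued Lebesgue measurable
  functions, to be read modulo equality almost everywhere. All memberships and (semi)norms are
  invariant under changing a function on a null set.
\<close>

section \<open>Weak derivatives and Sobolev spaces on the line\<close>

definition test_function :: "(real \<Rightarrow> real) \<Rightarrow> bool" where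
  "test_function \<eta> \<longleftrightarrow>
     (\<forall>n x. (deriv ^^ n) \<eta> differentiable (at x)) \<and> compact (closure {x. \<eta> x \<noteq> 0})"

definition locally_integrable :: "(real \<Rightarrow> complex) \<Rightarrow> bool" where
  "locally_integrable f \<longleftrightarrow> (\<forall>K. compact K \<longrightarrow> set_integrable lebesgue K f)"

definition has_weak_deriv :: "(real \<Rightarrow> complex) \<Rightarrow> (real \<Rightarrow> complex) \<Rightarrow> bool" where
  "has_weak_deriv f g \<longleftrightarrow> locally_integrable f \<and> locally_integrable g \<and>
     (\<forall>\<eta>. test_function \<eta> \<longrightarrow>
        (LINT x|lebesgue. deriv \<eta> x *\<^sub>R f x) = - (LINT x|lebesgue. \<eta> x *\<^sub>R g x))"

definition weakly_differentiable :: "(real \<Rightarrow> complex) \<Rightarrow> bool" where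
  "weakly_differentiable f \<longleftrightarrow> (\<exists>g. has_weak_deriv f g)"

text \<open>A representative of the weak derivative, which is unique up to null sets.\<close>

definition wderiv :: "(real \<Rightarrow> complex) \<Rightarrow> real \<Rightarrow> complex" where
  "wderiv f = (SOME g. has_weak_deriv f g)"

definition L1_norm :: "(real \<Rightarrow> complex) \<Rightarrow> real" where
  "L1_norm f = (LINT x|lebesgue. cmod (f x))"

definition L2 :: "(real \<Rightarrow> complex) set" where
  "L2 = {f. f \<in> borel_measurable lebesgue \<and> integrable lebesgue (\<lambda>x. (cmod (f x))\<^sup>2)}"

definition L2_norm :: "(real \<Rightarrow> complex) \<Rightarrow> real" where
  "L2_norm f = sqrt (LINT x|lebesgue. (cmod (f x))\<^sup>2)"

definition japanese :: "real \<Rightarrow> real" where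
  "japanese x = sqrt (1 + x\<^sup>2)"

definition L21 :: "(real \<Rightarrow> complex) set" where
  "L21 = {f. (\<lambda>x. japanese x *\<^sub>R f x) \<in> L2}"

definition L21_norm :: "(real \<Rightarrow> complex) \<Rightarrow> real" where
  "L21_norm f = L2_norm (\<lambda>x. japanese x *\<^sub>R f x)"

definition Hm :: "nat \<Rightarrow> (real \<Rightarrow> complex) set" where
  "Hm m = {f. (\<forall>j<m. weakly_differentiable ((wderiv ^^ j) f)) \<and> (\<forall>j\<le>m. (wderiv ^^ j) f \<in> L2)}"

definition Hm_norm :: "nat \<Rightarrow> (real \<Rightarrow> complex) \<Rightarrow> real" where
  "Hm_norm m f = sqrt (\<Sum>j\<le>m. (L2_norm ((wderiv ^^ j) f))\<^sup>2)"

definition H11 :: "(real \<Rightarrow> complex) set" where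
  "H11 = {f. weakly_differentiable f \<and> f \<in> L21 \<and> wderiv f \<in> L21}"

definition H11_norm :: "(real \<Rightarrow> complex) \<Rightarrow> real" where
  "H11_norm f = sqrt ((L21_norm f)\<^sup>2 + (L21_norm (wderiv f))\<^sup>2)"

definition H2_H11_norm :: "(real \<Rightarrow> complex) \<Rightarrow> real" where
  "H2_H11_norm f = Hm_norm 2 f + H11_norm f"

definition H1_L21_norm :: "(real \<Rightarrow> complex) \<Rightarrow> real" where
  "H1_L21_norm f = Hm_norm 1 f + L21_norm f"

section \<open>The matrix potential \<open>Q\<^sub>1\<close>\<close>

definition mat22 :: "complex \<Rightarrow> complex \<Rightarrow> complex \<Rightarrow> complex \<Rightarrow> complex^2^2" where
  "mat22 a b c d = vector [vector [a, b], vector [c, d]]"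

definition adjoint_mat :: "complex^2^2 \<Rightarrow> complex^2^2" where
  "adjoint_mat A = (\<chi> i j. cnj (A $ j $ i))"

definition w_pot :: "(real \<Rightarrow> complex) \<Rightarrow> real \<Rightarrow> complex" where
  "w_pot u x = - \<i> * wderiv u x + 2 * u x - 1/2 * of_real ((cmod (u x))\<^sup>2) * u x"

definition Q1 :: "(real \<Rightarrow> complex) \<Rightarrow> real \<Rightarrow> complex^2^2" where
  "Q1 u x = mat22 0 (u x / 2) (cnj (w_pot u x)) 0"

text \<open>The trace is real and nonnegative, so taking its real part only changes the type.\<close>

definition Q1_L1_norm :: "(real \<Rightarrow> complex) \<Rightarrow> real" where
  "Q1_L1_norm u = (LINT x|lebesgue. sqrt (Re (trace (adjoint_mat (Q1 u x) ** Q1 u x))))"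

section \<open>Jost functions and scattering data\<close>

definition e1 :: "complex^2" where "e1 = vector [1, 0]"
definition e2 :: "complex^2" where "e2 = vector [0, 1]"

definition Q :: "(real \<Rightarrow> complex) \<Rightarrow> complex \<Rightarrow> real \<Rightarrow> complex^2^2" where
  "Q u k x = mat22 (\<i> / 2 * of_real ((cmod (u x))\<^sup>2)) (k * u x)
                   (- k * cnj (u x)) (- \<i> / 2 * of_real ((cmod (u x))\<^sup>2))"

definition phase :: "complex \<Rightarrow> real \<Rightarrow> complex" where
  "phase k x = exp (2 * \<i> * (k\<^sup>2 + 1) * of_real x)"

text \<open>
  Solutions of \<open>f x = c + \<integral>\<^sub>s\<^sup>x D (x - y) (A y) (f y) dy\<close> with \<open>s = \<infinity>\<close> or \<open>s = -\<infinity>\<close>. The interval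
  integral is oriented, hence carries a minus sign for \<open>s = \<infinity>\<close>. Integrability is required
  explicitly because the integral of a non-integrable function is \<open>0\<close> by convention.
\<close>

definition volterra_solution ::
    "ereal \<Rightarrow> complex^2 \<Rightarrow> (real \<Rightarrow> complex^2^2) \<Rightarrow> (real \<Rightarrow> complex^2^2) \<Rightarrow> (real \<Rightarrow> complex^2) \<Rightarrow> bool"
  where
  "volterra_solution s c D A f \<longleftrightarrow> (\<forall>x::real.
     interval_lebesgue_integrable lebesgue s (ereal x) (\<lambda>y. D (x - y) *v (A y *v f y)) \<and>
     f x = c + interval_lebesgue_integral lebesgue s (ereal x) (\<lambda>y. D (x - y) *v (A y *v f y)))"

text \<open>
  The endpoint \<open>s\<close> is \<open>\<infinity>\<close> or \<open>-\<infinity>\<close>. If \<open>Q u k\<close> is absolutely integrable and \<open>k\<^sup>2\<close> is real, then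
  the integrability demanded above forces solutions to be bounded near \<open>s\<close>, hence unique.
\<close>

definition jost_varphi :: "ereal \<Rightarrow> (real \<Rightarrow> complex) \<Rightarrow> complex \<Rightarrow> real \<Rightarrow> complex^2" where
  "jost_varphi s u k = (THE f. volterra_solution s e1 (\<lambda>t. mat22 1 0 0 (phase k t)) (Q u k) f)"

definition jost_phi :: "ereal \<Rightarrow> (real \<Rightarrow> complex) \<Rightarrow> complex \<Rightarrow> real \<Rightarrow> complex^2" where
  "jost_phi s u k = (THE f. volterra_solution s e2 (\<lambda>t. mat22 (phase k (- t)) 0 0 1) (Q u k) f)"

definition scattering_coeffs :: "(real \<Rightarrow> complex) \<Rightarrow> complex \<Rightarrow> complex \<times> complex" where
  "scattering_coeffs u k = (THE (a, b). \<forall>x.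
     jost_varphi (-\<infinity>) u k x = a *s jost_varphi \<infinity> u k x + (b * phase k x) *s jost_phi \<infinity> u k x)"

definition coeff_a :: "(real \<Rightarrow> complex) \<Rightarrow> complex \<Rightarrow> complex" where
  "coeff_a u k = fst (scattering_coeffs u k)"

definition coeff_b :: "(real \<Rightarrow> complex) \<Rightarrow> complex \<Rightarrow> complex" where
  "coeff_b u k = snd (scattering_coeffs u k)"

definition refl_coeff :: "(real \<Rightarrow> complex) \<Rightarrow> complex \<Rightarrow> complex" where
  "refl_coeff u k = coeff_b u k / coeff_a u k"

text \<open>
  For real \<open>z\<close> the root \<open>k = csqrt z\<close> lies in \<open>\<real> \<union> \<i>\<real>\<close>. As \<open>refl_coeff u\<close> is odd in \<open>k\<close>, the other
  root \<open>- k\<close> gives the same values. At \<open>z = 0\<close> division by zero makes \<open>r_plus u 0 = 0\<close>, which is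
  immaterial for a function defined up to null sets.
\<close>

definition r_plus :: "(real \<Rightarrow> complex) \<Rightarrow> real \<Rightarrow> complex" where
  "r_plus u z = (let k = csqrt (of_real z) in refl_coeff u k / (2 * k))"

definition r_minus :: "(real \<Rightarrow> complex) \<Rightarrow> real \<Rightarrow> complex" where
  "r_minus u z = (let k = csqrt (of_real z) in 2 * k * refl_coeff u k)"

definition admissible :: "(real \<Rightarrow> complex) \<Rightarrow> bool" where
  "admissible u \<longleftrightarrow> (\<forall>k::real.
     cmod (coeff_a u (of_real k)) \<ge> 1 - 1/2 * L1_norm u * exp (Q1_L1_norm u) \<and>
     1 - 1/2 * L1_norm u * exp (Q1_L1_norm u) > 0)"

end

theory Submission
  imports Defs "HOL-Probability.Probability"
begin

text \<open>
  Each of \<open>r_minus\<close> and \<open>r_plus\<close> is, up to a constant factor and the shift \<open>l = z + 1\<close>, the quotient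
  \<open>\<rho> = b / a\<close> of the limits at infinity of a system \<open>P = 1 + \<integral> \<alpha> e\<^sup>2\<^sup>i\<^sup>l\<^sup>y E\<close>, \<open>E = \<integral> \<beta> e\<^sup>-\<^sup>2\<^sup>i\<^sup>l\<^sup>y P\<close> on the
  whole line, whose potentials \<open>\<alpha>, \<beta>\<close> are multiples of \<open>u\<close>, \<open>w\<close> or their conjugates. Admissibility
  makes \<open>\<parallel>\<alpha>\<parallel>\<^sub>1 \<parallel>\<beta>\<parallel>\<^sub>1\<close> at most \<open>5/12\<close>, so the system is solved perturbatively and \<open>a\<close> is bounded below
  uniformly. By Plancherel, first and second differences of \<open>\<rho>\<close> in the potentials are bounded in
  \<open>L\<^sup>2(dl)\<close> by the corresponding differences of \<open>\<alpha>, \<beta>\<close> in \<open>L\<^sup>2(dx)\<close>. Everything follows from these two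
  estimates: the first gives the Lipschitz bound in \<open>L\<^sup>2\<close>; as modulating the potentials translates \<open>\<rho>\<close>,
  the second bounds \<open>\<rho>'\<close> and its differences by the norms of \<open>x \<alpha>\<close>, \<open>x \<beta>\<close>; as translating the
  potentials modulates \<open>\<rho>\<close>, it also bounds \<open>l \<rho>\<close> and its differences by the norms of \<open>\<alpha>'\<close>, \<open>\<beta>'\<close>.
\<close>

text \<open>Read as a smallness condition on the potentials, the positivity demanded by
  \<open>admissible\<close> controls \<open>zs_a\<close> for every real l at once, hence for
  imaginary k as well as for real k. The margin matters: norms in l are kept squared, so every
  triangle inequality costs a factor 2, and the two equations of a system close up only if the
  product of the L1 norms of the potentials is below 1/2. The obstacle is that a derivative in l
  produces a factor y in front of P and E, which do not decay. Finite differences shift that factor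
  onto the potentials. Second differences are taken over a square of potentials 0, 1, 2, 3: the
  sides 0-1 and 2-3 carry multipliers \<open>c1\<close>, \<open>c2\<close> of size 1/h and are
  measured in L2, the sides 0-2 and 1-3 are measured in L1. One potential with two step sizes gives
  the Cauchy property that produces the derivative; two potentials with one step size give its
  Lipschitz bound; the zero potential as the second one gives membership in the spaces.\<close>

abbreviation borel_fun :: "('a::topological_space => 'b::topological_space) => bool" where
  "borel_fun f \<equiv> f \<in> borel_measurable borel"

abbreviation jointly_borel :: "('a::topological_space => 'b::topological_space => 'c::topological_space) => bool" where
  "jointly_borel f \<equiv> (%(l, y). f l y) \<in> borel_measurable (borel \<Otimes>\<^sub>M borel)"

abbreviation sq_integrable :: "(real => complex) => bool" where
  "sq_integrable f \<equiv> integrable lborel (%y. (cmod (f y))^2)"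

section \<open>Integrals over half-lines\<close>

definition cumint :: "(real => 'a) => real => 'a::{banach, second_countable_topology}" where
  "cumint f x = (LBINT y:{..x}. f y)"

lemma set_integrable_lborel:
  fixes f :: "real => 'a::{banach, second_countable_topology}"
  assumes "integrable lborel f" "S \<in> sets borel"
  shows "set_integrable lborel S f"
  using assms unfolding set_integrable_def by (intro integrable_mult_indicator) auto

text \<open>Parameter and endpoint vary together because the Picard iterates of
  \<open>volterra_exists\<close> need measurability in both, and Tonelli's theorem over l and y is
  used later. The point is that \<open>y \<le> g l\<close> cuts out a measurable set of
  pairs.\<close>

lemma cumint_measurable [measurable (raw)]:
  fixes f :: "'l => real => 'a::{banach, second_countable_topology}"
  assumes [measurable]: "(%(l, y). f l y) \<in> borel_measurable (M \<Otimes>\<^sub>M lborel)"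
    "g \<in> borel_measurable M"
  shows "(%l. cumint (f l) (g l)) \<in> borel_measurable M"
proof -
  have [measurable]: "(%(l, y::real). indicator {..g l} y :: real) \<in> borel_measurable (M \<Otimes>\<^sub>M lborel)"
    unfolding indicator_def atMost_iff by measurable
  show ?thesis
    unfolding cumint_def set_lebesgue_integral_def by measurable
qed

lemma cumint_measurable1 [measurable]:
  fixes f :: "real => 'a::{banach, second_countable_topology}"
  assumes [measurable]: "borel_fun f"
  shows "cumint f \<in> borel_measurable borel"
proof -
  have "borel_fun (%x. cumint f x)"
    by (rule cumint_measurable) measurable
  then show ?thesis by simp
qed

text \<open>If \<open>f\<close> is not integrable over the half-line, its integral is the default 0,
  and the bound persists because \<open>h\<close> is nonnegative there.\<close>

lemma cumint_norm_le:
  fixes f :: "real => 'a::{banach, second_countable_topology}"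
  assumes "integrable lborel h" "\<And>y. y \<le> x \<Longrightarrow> norm (f y) \<le> h y"
  shows "norm (cumint f x) \<le> cumint h x"
proof -
  have "norm (cumint f x) \<le> (LBINT y. norm (indicator {..x} y *\<^sub>R f y))"
    unfolding cumint_def set_lebesgue_integral_def by (rule integral_norm_bound)
  also have "\<dots> \<le> (LBINT y. indicator {..x} y *\<^sub>R h y)"
    by (rule integral_mono')
       (use assms set_integrable_lborel[OF assms(1), of "{..x}"] order_trans[OF norm_ge_zero assms(2)] in
         \<open>auto simp: set_integrable_def indicator_def\<close>)
  finally show ?thesis by (simp add: cumint_def set_lebesgue_integral_def)
qed

lemma cumint_le_integral:
  fixes h :: "real => real"
  assumes "integrable lborel h" "\<And>y. 0 \<le> h y"
  shows "cumint h x \<le> (LBINT y. h y)" "0 \<le> cumint h x"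
proof -
  show "cumint h x \<le> (LBINT y. h y)"
    unfolding cumint_def set_lebesgue_integral_def
    by (rule integral_mono')
       (use assms in \<open>auto simp: indicator_def\<close>)
  show "0 \<le> cumint h x"
    unfolding cumint_def set_lebesgue_integral_def
    by (rule Bochner_Integration.integral_nonneg) (use assms in \<open>auto simp: indicator_def\<close>)
qed

lemma cumint_norm_le_integral:
  fixes f :: "real => 'a::{banach, second_countable_topology}"
  assumes "integrable lborel h" "\<And>y. norm (f y) \<le> h y"
  shows "norm (cumint f x) \<le> (LBINT y. h y)"
  using cumint_norm_le[of h x f] cumint_le_integral(1)[of h x] assms
  by (meson norm_ge_zero order_trans)

lemma cumint_diff:
  fixes f :: "real => 'a::{banach, second_countable_topology}"
  assumes "integrable lborel f" "a \<le> x"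
  shows "cumint f x - cumint f a = (LBINT y:{a<..x}. f y)"
proof -
  have "{..x} = {..a} \<union> {a<..x}" using assms by auto
  then have "cumint f x = cumint f a + (LBINT y:{a<..x}. f y)"
    unfolding cumint_def
    by (simp only:) (intro set_integral_Un set_integrable_lborel assms(1), auto)
  then show ?thesis by simp
qed

lemma LBINT_atLeast_greaterThan:
  fixes f :: "real => 'a::{banach, second_countable_topology}"
  assumes [measurable]: "borel_fun f"
  shows "(LBINT y:{a..x}. f y) = (LBINT y:{a<..x}. f y)"
  unfolding set_lebesgue_integral_def
  by (rule integral_cong_AE)
     (use AE_lborel_singleton[of a] in \<open>auto simp: indicator_def elim!: eventually_mono\<close>)

lemma cumint_add:
  fixes f g :: "real => 'a::{banach, second_countable_topology}"
  assumes "integrable lborel f" "integrable lborel g"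
  shows "cumint (%y. f y + g y) x = cumint f x + cumint g x"
  unfolding cumint_def by (intro set_integral_add set_integrable_lborel assms) auto

lemma cumint_minus:
  fixes f g :: "real => 'a::{banach, second_countable_topology}"
  assumes "integrable lborel f" "integrable lborel g"
  shows "cumint (%y. f y - g y) x = cumint f x - cumint g x"
  unfolding cumint_def by (intro set_integral_diff set_integrable_lborel assms) auto

lemma cumint_cmult:
  fixes f :: "real => 'a::{real_normed_field, banach, second_countable_topology}"
  shows "cumint (%y. c * f y) x = c * cumint f x"
  unfolding cumint_def by simp

lemma cumint_multc:
  fixes f :: "real => 'a::{real_normed_field, banach, second_countable_topology}"
  shows "cumint (%y. f y * c) x = cumint f x * c"
  unfolding cumint_def by simp

lemma cumint_cong:
  assumes "\<And>y. y \<le> x \<Longrightarrow> f y = g y"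
  shows "cumint f x = cumint g x"
  unfolding cumint_def by (rule set_lebesgue_integral_cong) (use assms in auto)

lemma cumint_tendsto_top:
  fixes f :: "real => 'a::{banach, second_countable_topology}"
  assumes "integrable lborel f"
  shows "(cumint f \<longlongrightarrow> (LBINT y. f y)) at_top"
  unfolding cumint_def set_lebesgue_integral_def
proof (rule integral_dominated_convergence_at_top[where w="%y. norm (f y)"])
  show "AE x in lborel. ((%i. indicator {..i} x *\<^sub>R f x) \<longlongrightarrow> f x) at_top"
  proof (rule AE_I2)
    fix x
    have "eventually (%i. indicator {..i} x *\<^sub>R f x = f x) at_top"
      using eventually_ge_at_top[of x] by eventually_elim (auto simp: indicator_def)
    then show "((%i. indicator {..i} x *\<^sub>R f x) \<longlongrightarrow> f x) at_top" by (rule tendsto_eventually)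
  qed
qed (use assms in \<open>auto simp: indicator_def\<close>)

lemma cumint_tendsto_bot:
  fixes f :: "real => 'a::{banach, second_countable_topology}"
  assumes "integrable lborel f"
  shows "(cumint f \<longlongrightarrow> 0) at_bot"
proof -
  have "((%x. \<integral>y. indicator {..-x} y *\<^sub>R f y \<partial>lborel) \<longlongrightarrow> (\<integral>y. 0 \<partial>(lborel::real measure))) at_top"
  proof (rule integral_dominated_convergence_at_top[where w="%y. norm (f y)"])
    show "AE x in lborel. ((%i. indicator {..- i} x *\<^sub>R f x) \<longlongrightarrow> 0) at_top"
    proof (rule AE_I2)
      fix x
      have "eventually (%i. indicator {..-i} x *\<^sub>R f x = 0) at_top"
        using eventually_gt_at_top[of "-x"] by eventually_elim (auto simp: indicator_def)
      then show "((%i. indicator {..-i} x *\<^sub>R f x) \<longlongrightarrow> 0) at_top" by (rule tendsto_eventually)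
    qed
  qed (use assms in \<open>auto simp: indicator_def\<close>)
  then have "((%x. cumint f (- x)) \<longlongrightarrow> 0) at_top"
    by (simp add: cumint_def set_lebesgue_integral_def)
  then show ?thesis by (simp add: filterlim_at_bot_mirror)
qed

lemma cumint_continuous:
  fixes f :: "real => 'a::{banach, second_countable_topology}"
  assumes "integrable lborel f"
  shows "isCont (cumint f) x"
  unfolding continuous_at_sequentially
proof (intro allI impI, unfold comp_def)
  fix X :: "nat => real" assume X: "X \<longlonglongrightarrow> x"
  show "(%n. cumint f (X n)) \<longlonglongrightarrow> cumint f x"
    unfolding cumint_def set_lebesgue_integral_def
  proof (rule integral_dominated_convergence[where w="%y. norm (f y)"])
    show "AE y in lborel. (%n. indicator {..X n} y *\<^sub>R f y) \<longlonglongrightarrow> indicator {..x} y *\<^sub>R f y"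
      using AE_lborel_singleton[of x]
    proof eventually_elim
      case (elim y)
      have "eventually (%n. indicator {..X n} y = (indicator {..x} y :: real)) sequentially"
      proof (cases "y < x")
        case True
        show ?thesis using order_tendstoD(1)[OF X True]
          by eventually_elim (use True in \<open>auto simp: indicator_def\<close>)
      next
        case False
        then have "x < y" using elim by auto
        show ?thesis using order_tendstoD(2)[OF X \<open>x < y\<close>]
          by eventually_elim (use \<open>x < y\<close> in \<open>auto simp: indicator_def\<close>)
      qed
      then show ?case by (intro tendsto_eventually) (auto elim: eventually_mono)
    qed
  qed (use assms in \<open>auto simp: indicator_def\<close>)
qed

lemma integrable_bounded_mult:
  fixes f g :: "real => 'a::{real_normed_field, banach, second_countable_topology}"
  assumes "integrable lborel f" "borel_fun g" "\<And>y. norm (g y) \<le> B"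
  shows "integrable lborel (%y. f y * g y)" "integrable lborel (%y. g y * f y)"
proof -
  have [measurable]: "borel_fun f" "borel_fun g"
    using assms by auto
  show "integrable lborel (%y. f y * g y)"
  proof (rule Bochner_Integration.integrable_bound[where f="%y. B * norm (f y)"])
    show "AE x in lborel. norm (f x * g x) \<le> norm (B * norm (f x))"
      using assms(3) order_trans[OF norm_ge_zero assms(3)]
      by (auto simp: norm_mult abs_mult mult.commute[of B] intro!: mult_left_mono)
  qed (use assms in auto)
  then show "integrable lborel (%y. g y * f y)" by (simp add: mult.commute)
qed

text \<open>Fubini on the triangle \<open>y' \<le> y \<le> x\<close>: with \<open>y'\<close>
  outside, the inner variable ranges over \<open>{y'..x}\<close>, where the integral of
  \<open>f\<close> is a difference of two values of \<open>cumint f\<close>.\<close>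

lemma cumint_swap:
  fixes f g :: "real => 'a::{real_normed_field, banach, second_countable_topology}"
  assumes f: "integrable lborel f" and g: "integrable lborel g"
  shows "cumint (%y. f y * cumint g y) x = cumint (%y. g y * (cumint f x - cumint f y)) x"
proof -
  have [measurable]: "borel_fun f" "borel_fun g"
    using assms by auto
  let ?k = "%y y'. (if y \<le> x \<and> y' \<le> y then f y * g y' else 0)"
  have int: "integrable (lborel \<Otimes>\<^sub>M lborel) (%(y', y). ?k y y')"
  proof (rule Bochner_Integration.integrable_bound[where f="%(y', y). g y' * f y"])
    show "integrable (lborel \<Otimes>\<^sub>M lborel) (%(y', y). g y' * f y)"
    proof (rule lborel_pair.Fubini_integrable)
      show "integrable lborel (%x. LBINT y. norm (case (x, y) of (y', y) => g y' * f y))"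
        using g by (simp add: norm_mult)
    qed (use f in \<open>auto intro!: integrable_mult_right\<close>)
  qed (auto simp: norm_mult)
  have "cumint (%y. f y * cumint g y) x = (LBINT y. LBINT y'. ?k y y')"
    unfolding cumint_def set_lebesgue_integral_def
  proof (rule Bochner_Integration.integral_cong[OF refl])
    fix y
    have "(LBINT y'. ?k y y') = (LBINT y'. (indicator {..x} y *\<^sub>R f y) * (indicator {..y} y' *\<^sub>R g y'))"
      by (rule Bochner_Integration.integral_cong) (auto simp: indicator_def)
    also have "\<dots> = (indicator {..x} y *\<^sub>R f y) * (LBINT y'. indicator {..y} y' *\<^sub>R g y')"
      by (rule integral_mult_right_zero)
    finally show "indicator {..x} y *\<^sub>R (f y * (LBINT y'. indicator {..y} y' *\<^sub>R g y')) = (LBINT y'. ?k y y')"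
      by simp
  qed
  also have "\<dots> = (LBINT y'. LBINT y. ?k y y')"
    by (rule lborel_pair.Fubini_integral[OF int])
  also have "\<dots> = cumint (%y. g y * (cumint f x - cumint f y)) x"
    unfolding cumint_def[of "%y. g y * (cumint f x - cumint f y)"] set_lebesgue_integral_def
  proof (rule Bochner_Integration.integral_cong[OF refl])
    fix y'
    have "(LBINT y. ?k y y') = (LBINT y. (indicator {..x} y' *\<^sub>R g y') * (indicator {y'..x} y *\<^sub>R f y))"
      by (rule Bochner_Integration.integral_cong) (auto simp: indicator_def)
    also have "\<dots> = (indicator {..x} y' *\<^sub>R g y') * (LBINT y:{y'..x}. f y)"
      unfolding set_lebesgue_integral_def by (rule integral_mult_right_zero)
    also have "\<dots> = indicator {..x} y' *\<^sub>R (g y' * (cumint f x - cumint f y'))"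
      by (auto simp: indicator_def LBINT_atLeast_greaterThan cumint_diff[OF f])
    finally show "(LBINT y. ?k y y') = indicator {..x} y' *\<^sub>R (g y' * (cumint f x - cumint f y'))" .
  qed
  finally show ?thesis .
qed

lemma cumint_bounded:
  fixes f :: "real => 'a::{banach, second_countable_topology}"
  assumes "integrable lborel f"
  shows "norm (cumint f x) \<le> (LBINT y. norm (f y))"
  by (rule cumint_norm_le_integral) (use assms in auto)

text \<open>Integration by parts for indefinite integrals: by \<open>cumint_swap\<close> the first
  mixed term equals \<open>cumint f x * cumint g x\<close> minus the second. This is the product
  rule behind \<open>cumint_power\<close> and \<open>ac_mult\<close>.\<close>

lemma cumint_product:
  fixes f g :: "real => 'a::{real_normed_field, banach, second_countable_topology}"
  assumes f: "integrable lborel f" and g: "integrable lborel g"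
  shows "(c + cumint f x) * (d + cumint g x) =
    c * d + cumint (%y. f y * (d + cumint g y) + (c + cumint f y) * g y) x"
proof -
  have [measurable]: "borel_fun f" "borel_fun g"
    using assms by auto
  have i1: "integrable lborel (%y. f y * cumint g y)"
    using cumint_bounded[OF g] by (intro integrable_bounded_mult[OF f]) auto
  have i2: "integrable lborel (%y. g y * cumint f y)"
    using cumint_bounded[OF f] by (intro integrable_bounded_mult[OF g]) auto
  have "cumint (%y. f y * cumint g y) x + cumint (%y. g y * cumint f y) x = cumint f x * cumint g x"
    unfolding cumint_swap[OF f g]
    by (subst cumint_add[symmetric])
       (use i2 g in \<open>auto simp: algebra_simps cumint_cmult cumint_multc intro!: Bochner_Integration.integrable_diff\<close>)
  moreover have "cumint (%y. f y * (d + cumint g y) + (c + cumint f y) * g y) x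
    = cumint (%y. (d * f y + c * g y) + (f y * cumint g y + g y * cumint f y)) x"
    by (rule cumint_cong) (simp add: algebra_simps)
  moreover have "\<dots> = d * cumint f x + c * cumint g x + (cumint (%y. f y * cumint g y) x + cumint (%y. g y * cumint f y) x)"
    using f g i1 i2 by (simp add: cumint_add cumint_cmult)
  ultimately show ?thesis by (simp add: algebra_simps)
qed

section \<open>Square norms in the spectral parameter\<close>

text \<open>Valued in \<open>ennreal\<close>, so that Tonelli and Fatou apply before finiteness is
  known. The square is kept throughout, at the price of a factor 2 in each triangle
  inequality.\<close>

definition nsq :: "(real => complex) => ennreal" where
  "nsq f = (\<integral>\<^sup>+ l. ennreal ((cmod (f l))^2) \<partial>lborel)"

text \<open>The factor 2 makes \<open>ee (l * x)\<close> the phase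
  \<open>exp (2 * \<i> * l * x)\<close> of the Jost equations, with
  \<open>l = z + 1\<close>.\<close>

definition ee :: "real => complex" where "ee t = cis (2 * t)"

lemma norm_ee [simp]: "cmod (ee t) = 1" by (simp add: ee_def)
lemma ee_add: "ee (a + b) = ee a * ee b" by (simp add: ee_def cis_mult distrib_left)
lemma ee_0 [simp]: "ee 0 = 1" by (simp add: ee_def)
lemma ee_minus_mult [simp]: "ee (- a) * ee a = 1" "ee a * ee (- a) = 1"
  by (simp_all add: ee_add[symmetric])
lemma cnj_ee: "cnj (ee t) = ee (- t)" by (simp add: ee_def cis_cnj)
lemma continuous_ee: "continuous_on UNIV ee"
  unfolding ee_def by (intro continuous_intros)
lemma ee_measurable [measurable]: "borel_fun ee"
  by (rule borel_measurable_continuous_onI[OF continuous_ee])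

lemma cnj_measurable [measurable]: "borel_fun cnj"
  by (intro borel_measurable_continuous_onI continuous_intros)

text \<open>Fatou's lemma; used to remove truncations and to pass to limits in x and in difference
  quotients.\<close>

lemma nsq_liminf:
  assumes "\<And>n. f n \<in> borel_measurable borel" "\<And>l. (%n. f n l) \<longlonglongrightarrow> g l"
    "\<And>n. nsq (f n) \<le> C"
  shows "nsq g \<le> C"
proof -
  have [measurable]: "f n \<in> borel_measurable borel" for n by fact
  have "nsq g = (\<integral>\<^sup>+ l. liminf (%n. ennreal ((cmod (f n l))^2)) \<partial>lborel)"
    unfolding nsq_def
  proof (rule nn_integral_cong)
    fix l
    have "(%n. ennreal ((cmod (f n l))^2)) \<longlonglongrightarrow> ennreal ((cmod (g l))^2)"
      by (intro tendsto_intros assms)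
    then show "ennreal ((cmod (g l))^2) = liminf (%n. ennreal ((cmod (f n l))^2))"
      by (metis lim_imp_Liminf sequentially_bot)
  qed
  also have "\<dots> \<le> liminf (%n. nsq (f n))"
    unfolding nsq_def by (rule nn_integral_liminf) measurable
  also have "\<dots> \<le> C"
    using assms(3) by (intro Liminf_le) auto
  finally show ?thesis .
qed

section \<open>Plancherel's inequality\<close>

lemma integrable_gauss: "s > 0 \<Longrightarrow> integrable lborel (%l::real. std_normal_density (l / s))"
  using lborel_integrable_real_affine[of std_normal_density "1 / s" 0] integrable_std_normal_moment[of 0]
  by simp

text \<open>The characteristic function of the standard normal law at \<open>- 2 * s * t\<close>,
  after the substitution \<open>l = s * x\<close>.\<close>

lemma gauss_fourier:
  assumes "s > 0"
  shows "(LBINT l. of_real (std_normal_density (l / s)) * ee (- l * t)) =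
     of_real (s * exp (- (2 * s * t)\<^sup>2 / 2))"
proof -
  have "char std_normal_distribution (- 2 * s * t) = (LBINT x. of_real (std_normal_density x) * iexp (- 2 * s * t * x))"
    unfolding char_def by (subst integral_density) (auto simp: scaleR_conv_of_real normal_density_nonneg)
  also have "\<dots> = (1 / s) *\<^sub>R (LBINT l. of_real (std_normal_density (l / s)) * iexp (- 2 * s * t * (l / s)))"
    by (subst lborel_integral_real_affine[where c="1 / s" and t=0]) (use assms in auto)
  also have "(%l. of_real (std_normal_density (l / s)) * iexp (- 2 * s * t * (l / s)))
    = (%l. of_real (std_normal_density (l / s)) * ee (- l * t))"
    using assms by (auto simp: ee_def cis_conv_exp intro!: ext) (simp add: mult_ac)
  finally have "(1 / s) *\<^sub>R (LBINT l. of_real (std_normal_density (l / s)) * ee (- l * t)) = of_real (exp (- (2 * s * t)\<^sup>2 / 2))"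
    by (simp add: char_std_normal_distribution)
  then show ?thesis
    using assms by (simp add: scaleR_conv_of_real field_simps)
qed

text \<open>Half of Plancherel's theorem, by Gaussian regularization.\<close>

lemma nsq_fourier_le:
  fixes g :: "real => complex"
  assumes g: "integrable lborel g" and g2: "sq_integrable g"
  shows "nsq (%l. \<integral>y. ee (- l * y) * g y \<partial>lborel) \<le> ennreal (pi * (LBINT y. (cmod (g y))^2))"
proof -
  have [measurable]: "borel_fun g" using g by auto
  define G where "G l = (LBINT y. ee (- l * y) * g y)" for l
  define L where "L = (LBINT y. (cmod (g y))^2)"
  have [measurable]: "borel_fun G"
    unfolding G_def by measurable
  have Gb: "cmod (G l) \<le> (LBINT y. cmod (g y))" for l
    unfolding G_def using integral_norm_bound[of lborel "%y. ee (- l * y) * g y"]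
    by (simp add: norm_mult)
  have Gc: "cnj (G l) = (LBINT y. ee (l * y) * cnj (g y))" for l
  proof -
    have "cnj (G l) = (LBINT y. cnj (ee (- l * y) * g y))"
      unfolding G_def
      by (rule Bochner_Integration.integral_cnj[symmetric])
    then show ?thesis by (simp add: cnj_ee)
  qed
  \<comment> \<open>With a Gaussian weight the squared modulus expands, by Fubini, into a double
    integral of \<open>g y * cnj (g y')\<close> against the kernel \<open>k (y - y')\<close>, whose
    mass \<open>sqrt (pi / 2)\<close> does not depend on \<open>s\<close>.\<close>
  have main: "(\<integral>\<^sup>+ l. ennreal (std_normal_density (l / s) * (cmod (G l))^2) \<partial>lborel) \<le> ennreal (sqrt (pi / 2) * L)"
    if s: "s > 0" for s :: real
  proof -
    define w where "w l = std_normal_density (l / s)" for l :: real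
    have [measurable]: "borel_fun w" unfolding w_def by measurable
    have w0: "w l \<ge> 0" for l by (simp add: w_def normal_density_nonneg)
    have wi: "integrable lborel w" unfolding w_def by (rule integrable_gauss[OF s])
    define k where "k t = s * exp (- (2 * s * t)\<^sup>2 / 2)" for t :: real
    have [measurable]: "borel_fun k" unfolding k_def by measurable
    have k0: "k t \<ge> 0" for t using s by (simp add: k_def)
    have inner: "(LBINT l. of_real (w l) * ee (- l * y) * cnj (G l)) = (LBINT y'. of_real (k (y - y')) * cnj (g y'))" for y
    proof -
      have int: "integrable (lborel \<Otimes>\<^sub>M lborel) (%(l, y'). of_real (w l) * ee (- l * y) * ee (l * y') * cnj (g y'))"
      proof (rule lborel_pair.Fubini_integrable)
        show "integrable lborel (%x. \<integral>y'. norm (case (x, y') of (l, y') => of_real (w l) * ee (- l * y) * ee (l * y') * cnj (g y')) \<partial>lborel)"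
          using wi w0 by (simp add: norm_mult)
        show "AE x in lborel. integrable lborel (%y'. case (x, y') of (l, y') => of_real (w l) * ee (- l * y) * ee (l * y') * cnj (g y'))"
        proof (rule AE_I2, rule Bochner_Integration.integrable_bound[where f="%y'. w x * cmod (g y')" for x])
          fix x show "integrable lborel (%y'. w x * cmod (g y'))" using g by auto
        qed (auto simp: norm_mult w0)
      qed measurable
      have "(LBINT l. of_real (w l) * ee (- l * y) * cnj (G l))
         = (LBINT l. \<integral>y'. of_real (w l) * ee (- l * y) * ee (l * y') * cnj (g y') \<partial>lborel)"
        by (simp add: Gc mult.assoc)
      also have "\<dots> = (LBINT y'. \<integral>l. of_real (w l) * ee (- l * y) * ee (l * y') * cnj (g y') \<partial>lborel)"
        by (rule lborel_pair.Fubini_integral[OF int, symmetric])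
      also have "\<dots> = (LBINT y'. of_real (k (y - y')) * cnj (g y'))"
      proof (rule Bochner_Integration.integral_cong[OF refl])
        fix y'
        have "(%l. of_real (w l) * ee (- l * y) * ee (l * y') * cnj (g y')) = (%l. of_real (w l) * ee (- l * (y - y')) * cnj (g y'))"
          by (rule ext) (simp add: ee_add[symmetric] mult.assoc algebra_simps)
        then show "(LBINT l. of_real (w l) * ee (- l * y) * ee (l * y') * cnj (g y')) = of_real (k (y - y')) * cnj (g y')"
          using gauss_fourier[OF s, of "y - y'"] by (simp add: w_def k_def)
      qed
      finally show ?thesis .
    qed
    have int2: "integrable (lborel \<Otimes>\<^sub>M lborel) (%(l, y). of_real (w l) * ee (- l * y) * cnj (G l) * g y)"
    proof (rule lborel_pair.Fubini_integrable)
      have "integrable lborel (%l. w l * cmod (G l))"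
        by (rule integrable_bounded_mult(1)[OF wi]) (use Gb in auto)
      then show "integrable lborel (%x. \<integral>y'. norm (case (x, y') of (l, y) => of_real (w l) * ee (- l * y) * cnj (G l) * g y) \<partial>lborel)"
        using w0 by (simp add: norm_mult)
      show "AE x in lborel. integrable lborel (%y. case (x, y) of (l, y) => of_real (w l) * ee (- l * y) * cnj (G l) * g y)"
      proof (rule AE_I2, rule Bochner_Integration.integrable_bound[where f="%y. (w x * cmod (G x)) * cmod (g y)" for x])
        fix x show "integrable lborel (%y. (w x * cmod (G x)) * cmod (g y))" using g by auto
      qed (auto simp: norm_mult w0)
    qed measurable
    have iwG: "integrable lborel (%l. w l * (cmod (G l))^2)"
      by (rule integrable_bounded_mult(1)[OF wi, where B="(LBINT y. cmod (g y))^2"]) (auto intro!: power_mono Gb)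
    have "complex_of_real (LBINT l. w l * (cmod (G l))^2) = (LBINT l. of_real (w l) * (G l * cnj (G l)))"
      by (subst integral_complex_of_real[symmetric]) (simp add: complex_norm_square[symmetric])
    also have "\<dots> = (LBINT l. \<integral>y. of_real (w l) * ee (- l * y) * cnj (G l) * g y \<partial>lborel)"
    proof (rule Bochner_Integration.integral_cong[OF refl])
      fix l
      have "of_real (w l) * (G l * cnj (G l)) = (of_real (w l) * cnj (G l)) * (LBINT y. ee (- l * y) * g y)"
        by (simp add: G_def mult_ac)
      also have "\<dots> = (LBINT y. (of_real (w l) * cnj (G l)) * (ee (- l * y) * g y))"
        by (rule integral_mult_right_zero[symmetric])
      finally show "of_real (w l) * (G l * cnj (G l)) = (LBINT y. of_real (w l) * ee (- l * y) * cnj (G l) * g y)"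
        by (simp add: mult_ac)
    qed
    also have "\<dots> = (LBINT y. \<integral>l. of_real (w l) * ee (- l * y) * cnj (G l) * g y \<partial>lborel)"
      by (rule lborel_pair.Fubini_integral[OF int2, symmetric])
    also have "\<dots> = (LBINT y. g y * (LBINT y'. of_real (k (y - y')) * cnj (g y')))"
      by (simp only: integral_mult_left_zero inner, intro Bochner_Integration.integral_cong refl, rule mult.commute)
    finally have eq: "complex_of_real (LBINT l. w l * (cmod (G l))^2) = \<dots>" .
    have "(\<integral>\<^sup>+ l. ennreal (w l * (cmod (G l))^2) \<partial>lborel) = ennreal (LBINT l. w l * (cmod (G l))^2)"
      using iwG w0 by (intro nn_integral_eq_integral) auto
    also have "(LBINT l. w l * (cmod (G l))^2) = cmod (complex_of_real (LBINT l. w l * (cmod (G l))^2))"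
      using w0 by (subst norm_of_real) (simp add: integral_nonneg_AE)
    also have "ennreal \<dots> \<le> (\<integral>\<^sup>+y. ennreal (cmod (g y * (LBINT y'. of_real (k (y - y')) * cnj (g y')))) \<partial>lborel)"
      unfolding eq by (cases "integrable lborel (%y. g y * (LBINT y'. of_real (k (y - y')) * cnj (g y')))")
        (auto simp: integral_norm_bound_ennreal not_integrable_integral_eq)
    \<comment> \<open>Schur's test: the product of the two values of \<open>g\<close> is split by
      the arithmetic-geometric mean inequality; as \<open>k\<close> is even, both halves contribute
      the same.\<close>
    also have "\<dots> \<le> (\<integral>\<^sup>+y. \<integral>\<^sup>+y'. ennreal (k (y - y') * ((cmod (g y))^2 / 2 + (cmod (g y'))^2 / 2)) \<partial>lborel \<partial>lborel)"
    proof (rule nn_integral_mono)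
      fix y :: real
      have "ennreal (cmod (LBINT y'. of_real (k (y - y')) * cnj (g y'))) \<le> (\<integral>\<^sup>+y'. ennreal (k (y - y') * cmod (g y')) \<partial>lborel)"
      proof (cases "integrable lborel (%y'. complex_of_real (k (y - y')) * cnj (g y'))")
        case True
        show ?thesis using integral_norm_bound_ennreal[OF True] k0 by (simp add: norm_mult)
      qed (simp add: not_integrable_integral_eq)
      then have "ennreal (cmod (g y * (LBINT y'. of_real (k (y - y')) * cnj (g y'))))
         \<le> ennreal (cmod (g y)) * (\<integral>\<^sup>+y'. ennreal (k (y - y') * cmod (g y')) \<partial>lborel)"
        by (simp add: norm_mult ennreal_mult' mult_left_mono)
      also have "\<dots> = (\<integral>\<^sup>+y'. ennreal (cmod (g y)) * ennreal (k (y - y') * cmod (g y')) \<partial>lborel)"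
        by (rule nn_integral_cmult[symmetric]) measurable
      also have "\<dots> \<le> (\<integral>\<^sup>+y'. ennreal (k (y - y') * ((cmod (g y))^2 / 2 + (cmod (g y'))^2 / 2)) \<partial>lborel)"
      proof (rule nn_integral_mono)
        fix y'
        have "cmod (g y) * cmod (g y') \<le> (cmod (g y))^2 / 2 + (cmod (g y'))^2 / 2"
          using sum_squares_bound[of "cmod (g y)" "cmod (g y')"] by simp
        then have "k (y - y') * (cmod (g y) * cmod (g y')) \<le> k (y - y') * ((cmod (g y))^2 / 2 + (cmod (g y'))^2 / 2)"
          by (intro mult_left_mono k0)
        then show "ennreal (cmod (g y)) * ennreal (k (y - y') * cmod (g y')) \<le> ennreal (k (y - y') * ((cmod (g y))^2 / 2 + (cmod (g y'))^2 / 2))"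
          by (subst ennreal_mult'[symmetric]) (auto simp: mult_ac intro!: ennreal_leI)
      qed
      finally show "ennreal (cmod (g y * (LBINT y'. of_real (k (y - y')) * cnj (g y')))) \<le> \<dots>" .
    qed
    also have "\<dots> = (\<integral>\<^sup>+y. \<integral>\<^sup>+y'. ennreal ((cmod (g y))^2 / 2) * ennreal (k (y - y')) \<partial>lborel \<partial>lborel)
       + (\<integral>\<^sup>+y. \<integral>\<^sup>+y'. ennreal ((cmod (g y'))^2 / 2) * ennreal (k (y - y')) \<partial>lborel \<partial>lborel)"
      by (subst nn_integral_add[symmetric], measurable, rule nn_integral_cong, subst nn_integral_add[symmetric], measurable, rule nn_integral_cong)
         (simp add: ennreal_mult'[symmetric] ennreal_plus[symmetric] k0 algebra_simps del: ennreal_plus)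
    also have "(\<integral>\<^sup>+y. \<integral>\<^sup>+y'. ennreal ((cmod (g y'))^2 / 2) * ennreal (k (y - y')) \<partial>lborel \<partial>lborel)
        = (\<integral>\<^sup>+y'. \<integral>\<^sup>+y. ennreal ((cmod (g y'))^2 / 2) * ennreal (k (y - y')) \<partial>lborel \<partial>lborel)"
      by (rule lborel_pair.Fubini') measurable
    also have "\<dots> = (\<integral>\<^sup>+y. \<integral>\<^sup>+y'. ennreal ((cmod (g y))^2 / 2) * ennreal (k (y - y')) \<partial>lborel \<partial>lborel)"
      by (intro nn_integral_cong) (simp add: k_def power2_commute power_mult_distrib)
    also have "(\<integral>\<^sup>+y. \<integral>\<^sup>+y'. ennreal ((cmod (g y))^2 / 2) * ennreal (k (y - y')) \<partial>lborel \<partial>lborel)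
       = (\<integral>\<^sup>+y. ennreal ((cmod (g y))^2 / 2) * ennreal (sqrt (pi / 2)) \<partial>lborel)"
    proof (rule nn_integral_cong)
      fix y :: real
      have "(\<integral>\<^sup>+y'. ennreal (k (y - y')) \<partial>lborel) = (\<integral>\<^sup>+y'. ennreal (sqrt (2 * pi) * s) * ennreal (std_normal_density (- 2 * s * y + 2 * s * y')) \<partial>lborel)"
      proof (intro nn_integral_cong)
        fix y' :: real
        have "- 2 * s * y + 2 * s * y' = - (2 * s * (y - y'))" by (simp add: algebra_simps)
        then have "(- 2 * s * y + 2 * s * y')^2 = (2 * s * (y - y'))^2" by simp
        then have "k (y - y') = sqrt (2 * pi) * s * std_normal_density (- 2 * s * y + 2 * s * y')"
          by (simp add: k_def normal_density_def)
        then show "ennreal (k (y - y')) = ennreal (sqrt (2 * pi) * s) * ennreal (std_normal_density (- 2 * s * y + 2 * s * y'))"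
          using s by (simp add: ennreal_mult normal_density_nonneg)
      qed
      also have "\<dots> = ennreal (sqrt (2 * pi) * s) * (\<integral>\<^sup>+y'. ennreal (std_normal_density (- 2 * s * y + 2 * s * y')) \<partial>lborel)"
        by (rule nn_integral_cmult) measurable
      also have "(\<integral>\<^sup>+y'. ennreal (std_normal_density (- 2 * s * y + 2 * s * y')) \<partial>lborel) = ennreal (1 / (2 * s))"
      proof -
        have "(\<integral>\<^sup>+x. ennreal (std_normal_density x) \<partial>lborel) = 1"
          using prob_space.emeasure_space_1[OF prob_space_normal_density[of 1 0]]
          by (simp add: emeasure_density)
        then have "1 = ennreal \<bar>2 * s\<bar> * (\<integral>\<^sup>+y'. ennreal (std_normal_density (- 2 * s * y + 2 * s * y')) \<partial>lborel)"
          using nn_integral_real_affine[of "%x. ennreal (std_normal_density x)" "2 * s" "- 2 * s * y"] s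
          by simp
        then have "ennreal (1 / (2 * s)) * 1 = ennreal (1 / (2 * s)) * (ennreal (2 * s) * (\<integral>\<^sup>+y'. ennreal (std_normal_density (- 2 * s * y + 2 * s * y')) \<partial>lborel))"
          using s by simp
        then show ?thesis
          using s by (simp only: mult.assoc[symmetric] ennreal_mult'[symmetric]) (simp add: ennreal_mult'[symmetric])
      qed
      also have "ennreal (sqrt (2 * pi) * s) * ennreal (1 / (2 * s)) = ennreal (sqrt (pi / 2))"
        using s by (subst ennreal_mult'[symmetric]) (auto simp: real_sqrt_mult real_sqrt_divide field_simps)
      finally have *: "(\<integral>\<^sup>+y'. ennreal (k (y - y')) \<partial>lborel) = ennreal (sqrt (pi / 2))" .
      have "(\<integral>\<^sup>+y'. ennreal ((cmod (g y))^2 / 2) * ennreal (k (y - y')) \<partial>lborel) = ennreal ((cmod (g y))^2 / 2) * (\<integral>\<^sup>+y'. ennreal (k (y - y')) \<partial>lborel)"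
        by (rule nn_integral_cmult) measurable
      then show "(\<integral>\<^sup>+y'. ennreal ((cmod (g y))^2 / 2) * ennreal (k (y - y')) \<partial>lborel) = ennreal ((cmod (g y))^2 / 2) * ennreal (sqrt (pi / 2))"
        unfolding * .
    qed
    also have "\<dots> = ennreal (L / 2 * sqrt (pi / 2))"
    proof -
      have "(\<integral>\<^sup>+y. ennreal ((cmod (g y))^2 / 2) * ennreal (sqrt (pi / 2)) \<partial>lborel) = (\<integral>\<^sup>+y. ennreal ((cmod (g y))^2 / 2 * sqrt (pi / 2)) \<partial>lborel)"
        by (intro nn_integral_cong ennreal_mult'[symmetric]) simp
      also have "\<dots> = ennreal (LBINT y. (cmod (g y))^2 / 2 * sqrt (pi / 2))"
        using g2 by (intro nn_integral_eq_integral) auto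
      finally show ?thesis by (simp add: L_def)
    qed
    also have "ennreal (L / 2 * sqrt (pi / 2)) + ennreal (L / 2 * sqrt (pi / 2)) = ennreal (sqrt (pi / 2) * L)"
      unfolding L_def by (subst ennreal_plus[symmetric]) (auto simp: integral_nonneg_AE)
    finally show ?thesis by (simp add: w_def)
  qed
  \<comment> \<open>The square root of the weight, so that \<open>cmod (G' n l)^2\<close> is
    \<open>sqrt (2 * pi)\<close> times the weighted integrand of \<open>main\<close> for
    \<open>s = n + 1\<close>; the constants combine to
    \<open>sqrt (2 * pi) * sqrt (pi / 2) = pi\<close>.\<close>
  define G' where "G' n l = of_real (sqrt (exp (- (l / real (Suc n))\<^sup>2 / 2))) * G l" for n l
  have "nsq G \<le> ennreal (pi * L)"
  proof (rule nsq_liminf)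
    show "G' n \<in> borel_measurable borel" for n unfolding G'_def by measurable
    show "(%n. G' n l) \<longlonglongrightarrow> G l" for l
    proof -
      have "(%n. l / real (Suc n)) \<longlonglongrightarrow> 0"
        by (rule LIMSEQ_Suc) (rule lim_const_over_n)
      then have "(%n. complex_of_real (sqrt (exp (- (l / real (Suc n))\<^sup>2 / 2))) * G l) \<longlonglongrightarrow> of_real (sqrt (exp (- (0)\<^sup>2 / 2))) * G l"
        by (intro tendsto_intros) auto
      then show ?thesis by (simp add: G'_def)
    qed
    show "nsq (G' n) \<le> ennreal (pi * L)" for n
    proof -
      have "nsq (G' n) = (\<integral>\<^sup>+ l. ennreal (sqrt (2 * pi)) * ennreal (std_normal_density (l / real (Suc n)) * (cmod (G l))^2) \<partial>lborel)"
        unfolding nsq_def G'_def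
        by (intro nn_integral_cong, subst ennreal_mult'[symmetric])
           (auto simp: norm_mult power_mult_distrib normal_density_def)
      also have "\<dots> = ennreal (sqrt (2 * pi)) * (\<integral>\<^sup>+ l. ennreal (std_normal_density (l / real (Suc n)) * (cmod (G l))^2) \<partial>lborel)"
        by (rule nn_integral_cmult) measurable
      also have "\<dots> \<le> ennreal (sqrt (2 * pi)) * ennreal (sqrt (pi / 2) * L)"
        by (intro mult_left_mono main) auto
      also have "\<dots> = ennreal (pi * L)"
        by (subst ennreal_mult'[symmetric])
           (auto simp: real_sqrt_mult[symmetric] mult.assoc[symmetric])
      finally show ?thesis .
    qed
  qed
  then show ?thesis by (simp add: G_def[abs_def] L_def)
qed

section \<open>Norm inequalities and oscillatory integrals\<close>

definition nm1 :: "(real => complex) => real" where "nm1 g = (LBINT y. cmod (g y))"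
definition nm2 :: "(real => complex) => real" where "nm2 g = (LBINT y. (cmod (g y))^2)"

lemma nm1_nonneg [simp]: "0 \<le> nm1 g" and nm2_nonneg [simp]: "0 \<le> nm2 g"
  by (simp_all add: nm1_def nm2_def)

lemma norm_diff_square: "(norm (x - y))^2 \<le> 2 * (norm x)^2 + 2 * (norm y)^2"
proof -
  have "(norm (x - y))^2 \<le> (norm x + norm y)^2" by (intro power_mono norm_triangle_ineq4) auto
  also have "\<dots> \<le> 2 * (norm x)^2 + 2 * (norm y)^2"
    using sum_squares_bound[of "norm x" "norm y"] by (simp add: power2_sum)
  finally show ?thesis .
qed

lemma square_integrable_diff:
  fixes f g :: "real => complex"
  assumes m: "borel_fun f" "borel_fun g" "borel_fun \<omega>" and \<omega>: "\<And>y. 0 \<le> (\<omega> y :: real)"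
    and i: "integrable lborel (%y. \<omega> y * (cmod (f y))^2)" "integrable lborel (%y. \<omega> y * (cmod (g y))^2)"
  shows "integrable lborel (%y. \<omega> y * (cmod (f y - g y))^2)"
proof (rule Bochner_Integration.integrable_bound)
  show "integrable lborel (%y. 2 * (\<omega> y * (cmod (f y))^2) + 2 * (\<omega> y * (cmod (g y))^2))" using i by simp
  have "norm (\<omega> y * (cmod (f y - g y))^2) \<le> norm (2 * (\<omega> y * (cmod (f y))^2) + 2 * (\<omega> y * (cmod (g y))^2))" for y
    using mult_left_mono[OF norm_diff_square[of "f y" "g y"] \<omega>[of y]] \<omega>[of y] by (simp add: algebra_simps)
  then show "AE y in lborel. norm (\<omega> y * (cmod (f y - g y))^2) \<le> norm (2 * (\<omega> y * (cmod (f y))^2) + 2 * (\<omega> y * (cmod (g y))^2))" by simp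
qed (use m in measurable)

lemmas square_integrable_diff1 = square_integrable_diff[where \<omega>="%y. 1", simplified]

lemma nsq_eq_nm2: "sq_integrable g \<Longrightarrow> nsq g = ennreal (nm2 g)"
  unfolding nm2_def nsq_def by (rule nn_integral_eq_integral) auto

lemma nsq_mono: "(\<And>l. cmod (f l) \<le> cmod (g l)) \<Longrightarrow> nsq f \<le> nsq g"
  unfolding nsq_def by (intro nn_integral_mono ennreal_leI power_mono) auto

lemma nsq_cmult:
  assumes [measurable]: "borel_fun f"
  shows "nsq (%l. c * f l) = ennreal ((cmod c)^2) * nsq f"
  unfolding nsq_def by (subst nn_integral_cmult[symmetric]) (auto simp: norm_mult power_mult_distrib ennreal_mult')

lemma nsq_uminus: "nsq (%l. - f l) = nsq f" by (simp add: nsq_def)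

lemma nsq_bounded_mult:
  assumes [measurable]: "borel_fun f" and "\<And>l. cmod (g l) \<le> B * cmod (f l)" "B \<ge> 0"
  shows "nsq g \<le> ennreal (B^2) * nsq f"
proof -
  have "nsq g \<le> nsq (%l. of_real B * f l)" using assms by (intro nsq_mono) (auto simp: norm_mult)
  then show ?thesis using assms(3) by (simp add: nsq_cmult)
qed

lemma nsq_add:
  assumes [measurable]: "borel_fun f" "borel_fun g"
  shows "nsq (%l. f l + g l) \<le> 2 * nsq f + 2 * nsq g"
proof -
  have "nsq (%l. f l + g l) \<le> (\<integral>\<^sup>+ l. 2 * ennreal ((cmod (f l))^2) + 2 * ennreal ((cmod (g l))^2) \<partial>lborel)"
    unfolding nsq_def
  proof (rule nn_integral_mono)
    fix l
    have "(cmod (f l + g l))^2 \<le> (cmod (f l) + cmod (g l))^2"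
      by (intro power_mono norm_triangle_ineq) auto
    also have "\<dots> \<le> 2 * (cmod (f l))^2 + 2 * (cmod (g l))^2"
      using sum_squares_bound[of "cmod (f l)" "cmod (g l)"] by (simp add: power2_sum)
    finally have "ennreal ((cmod (f l + g l))^2) \<le> ennreal (2 * (cmod (f l))^2 + 2 * (cmod (g l))^2)"
      by (rule ennreal_leI)
    then show "ennreal ((cmod (f l + g l))^2) \<le> 2 * ennreal ((cmod (f l))^2) + 2 * ennreal ((cmod (g l))^2)"
      by (simp add: ennreal_plus ennreal_mult')
  qed
  also have "\<dots> = 2 * nsq f + 2 * nsq g"
    unfolding nsq_def by (subst nn_integral_add) (auto simp: nn_integral_cmult)
  finally show ?thesis .
qed

lemma nsq_diff:
  assumes "borel_fun f" "borel_fun g"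
  shows "nsq (%l. f l - g l) \<le> 2 * nsq f + 2 * nsq g"
  using nsq_add[OF assms(1) borel_measurable_uminus[OF assms(2)]] by (simp add: nsq_uminus)

text \<open>Cauchy--Schwarz for the measure with density \<open>H\<close>, then Tonelli. The guard
  \<open>H y \<noteq> 0\<close> lets an indicator inside \<open>H\<close> restrict the range of
  \<open>y\<close> on which \<open>q\<close> has to be controlled.\<close>

lemma nsq_integral_le:
  fixes f q :: "real => real => complex"
  assumes [measurable]: "jointly_borel f"
    "jointly_borel q"
    and H: "integrable lborel H" "\<And>y. 0 \<le> H y"
    and f: "\<And>l y. cmod (f l y) \<le> H y * cmod (q l y)"
    and S: "\<And>y. H y \<noteq> 0 \<Longrightarrow> nsq (%l. q l y) \<le> S"
  shows "nsq (%l. \<integral>y. f l y \<partial>lborel) \<le> ennreal ((LBINT y. H y)^2) * S"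
proof -
  have [measurable]: "borel_fun H" using H by auto
  have I: "(\<integral>\<^sup>+y. ennreal (H y) \<partial>lborel) = ennreal (LBINT y. H y)"
    by (rule nn_integral_eq_integral) (use H in auto)
  have pt: "ennreal ((cmod (LBINT y. f l y))^2) \<le> ennreal (LBINT y. H y) * (\<integral>\<^sup>+y. ennreal (H y) * ennreal ((cmod (q l y))^2) \<partial>lborel)" for l
  proof -
    have "ennreal (cmod (LBINT y. f l y)) \<le> (\<integral>\<^sup>+y. ennreal (cmod (f l y)) \<partial>lborel)"
      by (cases "integrable lborel (f l)") (auto simp: integral_norm_bound_ennreal not_integrable_integral_eq)
    also have "\<dots> \<le> (\<integral>\<^sup>+y. ennreal (sqrt (H y)) * ennreal (sqrt (H y) * cmod (q l y)) \<partial>lborel)"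
    proof (rule nn_integral_mono)
      fix y
      have "cmod (f l y) \<le> sqrt (H y) * (sqrt (H y) * cmod (q l y))"
        using f[of l y] H(2)[of y] by (simp add: mult.assoc[symmetric])
      then show "ennreal (cmod (f l y)) \<le> ennreal (sqrt (H y)) * ennreal (sqrt (H y) * cmod (q l y))"
        using H(2)[of y] by (subst ennreal_mult'[symmetric]) (auto intro!: ennreal_leI)
    qed
    finally have "ennreal ((cmod (LBINT y. f l y))^2) \<le> (\<integral>\<^sup>+y. ennreal (sqrt (H y)) * ennreal (sqrt (H y) * cmod (q l y)) \<partial>lborel)^2"
      by (simp add: power_mono ennreal_power[symmetric])
    also have "\<dots> \<le> (\<integral>\<^sup>+y. (ennreal (sqrt (H y)))^2 \<partial>lborel) * (\<integral>\<^sup>+y. (ennreal (sqrt (H y) * cmod (q l y)))^2 \<partial>lborel)"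
      by (rule Cauchy_Schwarz_nn_integral) measurable
    also have "(\<integral>\<^sup>+y. (ennreal (sqrt (H y)))^2 \<partial>lborel) = ennreal (LBINT y. H y)"
      unfolding I[symmetric] by (intro nn_integral_cong) (use H in \<open>auto simp: ennreal_power\<close>)
    also have "(\<integral>\<^sup>+y. (ennreal (sqrt (H y) * cmod (q l y)))^2 \<partial>lborel) = (\<integral>\<^sup>+y. ennreal (H y) * ennreal ((cmod (q l y))^2) \<partial>lborel)"
      by (intro nn_integral_cong) (use H in \<open>auto simp: ennreal_power power_mult_distrib ennreal_mult'\<close>)
    finally show ?thesis .
  qed
  have "nsq (%l. \<integral>y. f l y \<partial>lborel) \<le> (\<integral>\<^sup>+l. ennreal (LBINT y. H y) * (\<integral>\<^sup>+y. ennreal (H y) * ennreal ((cmod (q l y))^2) \<partial>lborel) \<partial>lborel)"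
    unfolding nsq_def by (intro nn_integral_mono pt)
  also have "\<dots> = ennreal (LBINT y. H y) * (\<integral>\<^sup>+l. (\<integral>\<^sup>+y. ennreal (H y) * ennreal ((cmod (q l y))^2) \<partial>lborel) \<partial>lborel)"
    by (rule nn_integral_cmult) measurable
  also have "(\<integral>\<^sup>+l. (\<integral>\<^sup>+y. ennreal (H y) * ennreal ((cmod (q l y))^2) \<partial>lborel) \<partial>lborel) = (\<integral>\<^sup>+y. (\<integral>\<^sup>+l. ennreal (H y) * ennreal ((cmod (q l y))^2) \<partial>lborel) \<partial>lborel)"
    by (rule lborel_pair.Fubini'[symmetric]) measurable
  also have "\<dots> = (\<integral>\<^sup>+y. ennreal (H y) * nsq (%l. q l y) \<partial>lborel)"
    unfolding nsq_def by (intro nn_integral_cong nn_integral_cmult) measurable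
  also have "\<dots> \<le> (\<integral>\<^sup>+y. ennreal (H y) * S \<partial>lborel)"
  proof (rule nn_integral_mono)
    fix y show "ennreal (H y) * nsq (%l. q l y) \<le> ennreal (H y) * S"
      using S[of y] by (cases "H y = 0") (auto intro!: mult_left_mono)
  qed
  also have "\<dots> = ennreal (LBINT y. H y) * S"
    by (subst nn_integral_multc) (auto simp: I)
  finally show ?thesis
    using H by (simp add: mult_left_mono mult.assoc[symmetric] power2_eq_square ennreal_mult' integral_nonneg_AE)
qed

lemma nsq_cumint_le:
  fixes f q :: "real => real => complex"
  assumes [measurable]: "jointly_borel f"
    "jointly_borel q"
    and H: "integrable lborel H" "\<And>y. 0 \<le> H y"
    and f: "\<And>l y. y \<le> x \<Longrightarrow> cmod (f l y) \<le> H y * cmod (q l y)"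
    and S: "\<And>y. y \<le> x \<Longrightarrow> nsq (%l. q l y) \<le> S"
  shows "nsq (%l. cumint (f l) x) \<le> ennreal ((LBINT y. H y)^2) * S"
proof -
  have [measurable]: "{..x} \<in> sets borel" by simp
  have "nsq (%l. cumint (f l) x) \<le> ennreal ((LBINT y. indicator {..x} y *\<^sub>R H y)^2) * S"
    unfolding cumint_def set_lebesgue_integral_def
    by (rule nsq_integral_le[where q=q])
       (use H f S set_integrable_lborel[OF H(1), of "{..x}"] in \<open>auto simp: indicator_def set_integrable_def split: if_splits\<close>)
  also have "\<dots> \<le> ennreal ((LBINT y. H y)^2) * S"
    using cumint_le_integral[OF H, of x]
    by (intro mult_right_mono ennreal_leI power_mono) (auto simp: cumint_def set_lebesgue_integral_def)
  finally show ?thesis .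
qed

lemma nsq_reflect:
  assumes [measurable]: "borel_fun f"
  shows "nsq (%l. f (- l)) = nsq f"
  unfolding nsq_def
  using nn_integral_real_affine[of "%l. ennreal ((cmod (f l))^2)" "-1" 0] by simp

lemma nsq_shift:
  assumes [measurable]: "borel_fun f"
  shows "nsq (%l. f (l + h)) = nsq f"
  unfolding nsq_def
  using nn_integral_real_affine[of "%l. ennreal ((cmod (f l))^2)" 1 h] by (simp add: add.commute)

lemma nsq_fourier_sign:
  assumes g: "integrable lborel g" and g2: "sq_integrable g"
    and s: "s = 1 \<or> s = - 1"
  shows "nsq (%l. \<integral>y. ee (s * l * y) * g y \<partial>lborel) \<le> ennreal (pi * nm2 g)"
proof -
  have [measurable]: "borel_fun g" using g by auto
  have 1: "nsq (%l. \<integral>y. ee (- l * y) * g y \<partial>lborel) \<le> ennreal (pi * nm2 g)"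
    using nsq_fourier_le[OF g g2] by (simp add: nm2_def)
  then show ?thesis
    using s nsq_reflect[of "%l. \<integral>y. ee (- l * y) * g y \<partial>lborel"] by auto
qed

text \<open>Both phases in one predicate: the two equations of a system carry opposite phases and
  are treated by the same lemmas with the roles of the potentials exchanged.\<close>

definition osc :: "(real => real => complex) => bool" where
  "osc \<theta> \<longleftrightarrow> \<theta> = (%l y. ee (l * y)) \<or> \<theta> = (%l y. ee (- (l * y)))"

lemma osc_ee [simp]: "osc (%l y. ee (l * y))" "osc (%l y. ee (- (l * y)))"
  by (auto simp: osc_def)

lemma osc_sign:
  assumes "osc \<theta>"
  obtains s where "s = 1 \<or> s = - 1" "\<theta> = (%l y. ee (s * l * y))"
proof (cases "\<theta> = (%l y. ee (l * y))")
  case True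
  then show ?thesis using that[of 1] by simp
next
  case False
  then show ?thesis using assms that[of "- 1"] by (auto simp: osc_def)
qed

lemma osc_norm [simp]: "osc \<theta> \<Longrightarrow> cmod (\<theta> l y) = 1"
  by (auto simp: osc_def)

lemma osc_measurable: "osc \<theta> \<Longrightarrow> jointly_borel \<theta>"
  by (erule osc_sign) simp

lemma nsq_fourier_set:
  assumes g: "integrable lborel g" and g2: "sq_integrable g"
    and \<theta>: "osc \<theta>" and [measurable]: "T \<in> sets borel"
  shows "nsq (%l. LBINT y:T. \<theta> l y * g y) \<le> ennreal (pi * nm2 g)"
proof -
  obtain s where s: "s = 1 \<or> s = - 1" and \<theta>s: "\<theta> = (%l y. ee (s * l * y))"
    using \<theta> by (rule osc_sign)
  let ?g = "%y. indicator T y *\<^sub>R g y"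
  have g': "integrable lborel ?g" using g by (intro integrable_mult_indicator) auto
  have "integrable lborel (%y. indicator T y *\<^sub>R (cmod (g y))\<^sup>2)"
    using g2 by (intro integrable_mult_indicator) auto
  moreover have "(%y. indicator T y *\<^sub>R (cmod (g y))\<^sup>2) = (%y. (cmod (?g y))^2)"
    by (auto simp: indicator_def)
  ultimately have g2': "integrable lborel (%y. (cmod (?g y))^2)" by simp
  have "nsq (%l. LBINT y:T. \<theta> l y * g y) = nsq (%l. \<integral>y. ee (s * l * y) * ?g y \<partial>lborel)"
    by (simp add: set_lebesgue_integral_def \<theta>s)
  also have "\<dots> \<le> ennreal (pi * nm2 ?g)" by (rule nsq_fourier_sign[OF g' g2' s])
  also have "\<dots> \<le> ennreal (pi * nm2 g)"
    unfolding nm2_def using g2 by (intro ennreal_leI mult_left_mono integral_mono') (auto simp: indicator_def)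
  finally show ?thesis .
qed

text \<open>
  The main gain over the triangle inequality: \<open>g\<close> only enters through its \<open>L\<^sup>2\<close> norm. Exchanging
  the order of integration puts \<open>g\<close> innermost, where Plancherel applies on each \<open>(t, x]\<close>.
\<close>

lemma nsq_oscillatory:
  fixes h f :: "real => real => complex"
  assumes g: "integrable lborel g" and g2: "sq_integrable g"
    and \<theta>: "osc \<theta>"
    and h [measurable]: "jointly_borel h"
    and H: "integrable lborel H" "\<And>l y. cmod (h l y) \<le> H y"
    and f: "\<And>l y. f l y = c + cumint (h l) y"
  shows "nsq (%l. cumint (%y. \<theta> l y * (g y * f l y)) x)
    \<le> ennreal (2 * pi * ((cmod c)^2 + (LBINT y. H y)^2) * nm2 g)"
proof -
  note osc_measurable[OF \<theta>, measurable]
  have [measurable]: "borel_fun g" "borel_fun H" using g H by auto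
  have H0: "H y \<ge> 0" for y using H(2)[of 0 y] by (meson norm_ge_zero order_trans)
  define F where "F l y = \<theta> l y * g y" for l y
  have [measurable]: "jointly_borel F"
    unfolding F_def by measurable
  have Fi: "integrable lborel (F l)" for l
    unfolding F_def by (rule integrable_bounded_mult(2)[OF g, where B=1]) (use \<theta> in auto)
  have hi: "integrable lborel (h l)" for l
    by (rule Bochner_Integration.integrable_bound[OF H(1)]) (use H(2) H0 in auto)
  \<comment> \<open>\<open>c\<close> multiplies the transform of \<open>g\<close> over
    \<open>{..x}\<close>, and \<open>h l t\<close> the one over \<open>{t<..x}\<close>; Plancherel
    bounds both, uniformly in \<open>t\<close>.\<close>
  have eq: "cumint (%y. \<theta> l y * (g y * f l y)) x
     = c * cumint (F l) x + cumint (%t. h l t * (cumint (F l) x - cumint (F l) t)) x" for l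
  proof -
    have "integrable lborel (%y. F l y * cumint (h l) y)"
      using cumint_bounded[OF hi[of l]] by (intro integrable_bounded_mult[OF Fi]) auto
    then have "cumint (%y. c * F l y + F l y * cumint (h l) y) x = c * cumint (F l) x + cumint (%y. F l y * cumint (h l) y) x"
      using Fi[of l] by (subst cumint_add) (auto simp: cumint_cmult)
    also have "cumint (%y. c * F l y + F l y * cumint (h l) y) x = cumint (%y. \<theta> l y * (g y * f l y)) x"
      by (rule cumint_cong) (simp add: f F_def algebra_simps)
    finally show ?thesis using cumint_swap[OF Fi[of l] hi[of l]] by simp
  qed
  have n1: "nsq (%l. cumint (F l) x) \<le> ennreal (pi * nm2 g)"
    unfolding F_def cumint_def by (rule nsq_fourier_set[OF g g2 \<theta>]) auto
  have n2: "nsq (%l. cumint (%t. h l t * (cumint (F l) x - cumint (F l) t)) x) \<le> ennreal ((LBINT y. H y)^2) * ennreal (pi * nm2 g)"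
  proof (rule nsq_cumint_le[where q="%l t. cumint (F l) x - cumint (F l) t"])
    show "nsq (%l. cumint (F l) x - cumint (F l) t) \<le> ennreal (pi * nm2 g)" if "t \<le> x" for t
      unfolding cumint_diff[OF Fi that] unfolding F_def by (rule nsq_fourier_set[OF g g2 \<theta>]) auto
  qed (use H H0 in \<open>auto simp: norm_mult intro!: mult_right_mono\<close>)
  have "nsq (%l. cumint (%y. \<theta> l y * (g y * f l y)) x)
    \<le> 2 * (ennreal ((cmod c)^2) * nsq (%l. cumint (F l) x)) + 2 * nsq (%l. cumint (%t. h l t * (cumint (F l) x - cumint (F l) t)) x)"
    unfolding eq by (rule order_trans[OF nsq_add]) (auto simp: nsq_cmult)
  also have "\<dots> \<le> 2 * (ennreal ((cmod c)^2) * ennreal (pi * nm2 g)) + 2 * (ennreal ((LBINT y. H y)^2) * ennreal (pi * nm2 g))"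
    by (intro add_mono mult_left_mono n1 n2) auto
  also have "\<dots> = ennreal (2 * pi * ((cmod c)^2 + (LBINT y. H y)^2) * nm2 g)"
  proof -
    have "ennreal (2 * ((cmod c)^2 * (pi * nm2 g)) + 2 * ((LBINT y. H y)^2 * (pi * nm2 g))) =
       2 * (ennreal ((cmod c)^2) * ennreal (pi * nm2 g)) + 2 * (ennreal ((LBINT y. H y)^2) * ennreal (pi * nm2 g))"
      by (simp add: ennreal_mult')
    then show ?thesis by (simp add: algebra_simps)
  qed
  finally show ?thesis .
qed

text \<open>Finiteness of \<open>S\<close> is what allows \<open>ennreal c * S\<close> to be
  subtracted; \<open>forced_system_nsq\<close> secures it by truncation in l.\<close>

lemma ennreal_absorb:
  fixes S a :: ennreal
  assumes "S \<le> a + ennreal c * S" "S < \<infinity>" "0 \<le> c" "c < 1"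
  shows "S \<le> ennreal (1 / (1 - c)) * a"
proof (cases "a = \<infinity>")
  case False
  then obtain a' where a': "a = ennreal a'" "a' \<ge> 0" by (cases a) (auto simp: top_unique)
  from assms(2) obtain S' where S': "S = ennreal S'" "S' \<ge> 0" by (cases S) auto
  have "ennreal S' \<le> ennreal (a' + c * S')"
    using assms(1,3) a' S' by (simp add: ennreal_mult')
  then have "S' \<le> a' + c * S'" using a' S' assms by (subst (asm) ennreal_le_iff) auto
  then have "S' \<le> a' / (1 - c)" using assms by (simp add: field_simps)
  then show ?thesis using a' S' assms by (simp add: ennreal_mult'[symmetric] ennreal_leI)
qed (use assms in \<open>auto simp: ennreal_mult_top\<close>)

text \<open>Suprema over x of the norms in l: each equation costs a factor 2, so inserting one into
  the other gives the contraction factor \<open>4 * (5 / 12)^2 = 25 / 36\<close>, and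
  \<open>36 / 11 \<le> 7 / 2\<close> accounts for the constants 7 and 14. Restricting l to
  \<open>{-R..R}\<close> makes the supremum finite, as \<open>X\<close> is bounded; Fatou's lemma
  then lets R grow.\<close>

lemma forced_system_nsq:
  fixes X Y F G :: "real => real => complex"
  assumes \<alpha>: "integrable lborel \<alpha>" and \<beta>: "integrable lborel \<beta>"
    and small: "nm1 \<alpha> * nm1 \<beta> \<le> 5 / 12"
    and [measurable]: "jointly_borel X"
      "jointly_borel Y"
      "\<And>x. borel_fun (%l. F l x)" "\<And>x. borel_fun (%l. G l x)"
    and \<theta>: "osc \<theta>X" "osc \<theta>Y"
    and Xb: "\<And>l x. cmod (X l x) \<le> Bd"
    and X: "\<And>l x. X l x = F l x + cumint (%y. \<theta>X l y * (\<beta> y * Y l y)) x"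
    and Y: "\<And>l x. Y l x = G l x + cumint (%y. \<theta>Y l y * (\<alpha> y * X l y)) x"
    and F: "\<And>x. nsq (%l. F l x) \<le> a" and G: "\<And>x. nsq (%l. G l x) \<le> b"
  shows "nsq (%l. X l x) \<le> 7 * a + ennreal (14 * (nm1 \<beta>)^2) * b"
proof -
  have [measurable]: "borel_fun \<alpha>" "borel_fun \<beta>"
    using \<alpha> \<beta> by auto
  have R: "nsq (%l. indicator {-R..R} l * X l x) \<le> 7 * a + ennreal (14 * (nm1 \<beta>)^2) * b" for R x
  proof -
    let ?i = "%l. indicator {-R..R} l :: complex"
    define SX SY where "SX = (SUP x. nsq (%l. ?i l * X l x))" and "SY = (SUP x. nsq (%l. ?i l * Y l x))"
    have Bd: "Bd \<ge> 0" using Xb[of 0 0] by (meson norm_ge_zero order_trans)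
    have fin: "SX < \<infinity>"
    proof -
      have "nsq (%l. ?i l * X l x) \<le> ennreal (Bd^2) * emeasure lborel {-R..R}" for x
      proof -
        have "nsq (%l. ?i l * X l x) \<le> (\<integral>\<^sup>+l. ennreal (Bd^2) * indicator {-R..R} l \<partial>lborel)"
          unfolding nsq_def
          by (intro nn_integral_mono) (auto simp: indicator_def intro!: ennreal_leI power_mono Xb)
        then show ?thesis by (simp add: nn_integral_cmult_indicator)
      qed
      then have "SX \<le> ennreal (Bd^2) * emeasure lborel {-R..R}" unfolding SX_def by (rule SUP_least)
      also have "\<dots> < \<infinity>" by (cases "R \<ge> 0") (auto simp: ennreal_mult_less_top)
      finally show ?thesis .
    qed
    have step: "nsq (%l. ?i l * X' l x) \<le> 2 * a' + ennreal (2 * (nm1 \<beta>')^2) * (SUP x. nsq (%l. ?i l * Y' l x))"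
      if [measurable]: "jointly_borel Y'"
        "\<And>x. borel_fun (%l. F' l x)" "integrable lborel \<beta>'"
        and \<theta>: "osc \<theta>"
        and X': "\<And>l x. X' l x = F' l x + cumint (%y. \<theta> l y * (\<beta>' y * Y' l y)) x"
        and F': "\<And>x. nsq (%l. F' l x) \<le> a'"
      for X' Y' F' :: "real => real => complex" and \<beta>' \<theta> a' x
    proof -
      have [measurable]: "borel_fun \<beta>'" using that by auto
      note osc_measurable[OF \<theta>, measurable]
      have e: "?i l * X' l x = ?i l * F' l x + cumint (%y. \<theta> l y * (\<beta>' y * (?i l * Y' l y))) x" for l
        by (simp add: X' indicator_def cumint_def)
      have "nsq (%l. ?i l * X' l x) \<le> 2 * nsq (%l. ?i l * F' l x) + 2 * nsq (%l. cumint (%y. \<theta> l y * (\<beta>' y * (?i l * Y' l y))) x)"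
        unfolding e by (rule nsq_add) measurable
      also have "nsq (%l. ?i l * F' l x) \<le> a'"
        by (rule order_trans[OF nsq_mono F'[of x]]) (auto simp: indicator_def)
      also have "nsq (%l. cumint (%y. \<theta> l y * (\<beta>' y * (?i l * Y' l y))) x) \<le>
          ennreal ((LBINT y. cmod (\<beta>' y))^2) * (SUP x. nsq (%l. ?i l * Y' l x))"
        by (rule nsq_cumint_le[where q="%l y. ?i l * Y' l y"])
           (use that(3) \<theta> in \<open>auto simp: norm_mult intro!: SUP_upper\<close>)
      finally show ?thesis
        by (simp add: nm1_def ennreal_mult' mult.assoc add_mono mult_left_mono)
    qed
    have 1: "SX \<le> 2 * a + ennreal (2 * (nm1 \<beta>)^2) * SY"
      unfolding SX_def SY_def
      by (rule SUP_least, rule step[where F'=F and \<theta>=\<theta>X]) (use \<beta> F X \<theta> in auto)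
    have 2: "SY \<le> 2 * b + ennreal (2 * (nm1 \<alpha>)^2) * SX"
      unfolding SX_def SY_def
      by (rule SUP_least, rule step[where F'=G and \<theta>=\<theta>Y]) (use \<alpha> G Y \<theta> in auto)
    define c where "c = 4 * (nm1 \<alpha> * nm1 \<beta>)^2"
    have c: "0 \<le> c" "c \<le> 25 / 36"
      using power_mono[OF small, of 2] by (auto simp: c_def power_divide)
    have "SX \<le> 2 * a + ennreal (2 * (nm1 \<beta>)^2) * (2 * b + ennreal (2 * (nm1 \<alpha>)^2) * SX)"
      by (rule order_trans[OF 1]) (intro add_mono mult_left_mono 2, auto)
    also have "\<dots> = (2 * a + ennreal (4 * (nm1 \<beta>)^2) * b) + ennreal c * SX"
    proof -
      have "ennreal (2 * (nm1 \<beta>)^2) * 2 = ennreal (4 * (nm1 \<beta>)^2)"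
        by (simp add: ennreal_mult'[symmetric] flip: ennreal_numeral)
      moreover have "ennreal (2 * (nm1 \<beta>)^2) * ennreal (2 * (nm1 \<alpha>)^2) = ennreal c"
        by (simp add: ennreal_mult'[symmetric] c_def power_mult_distrib mult_ac)
      ultimately show ?thesis by (simp add: distrib_left mult.assoc[symmetric] add.assoc)
    qed
    finally have "SX \<le> ennreal (1 / (1 - c)) * (2 * a + ennreal (4 * (nm1 \<beta>)^2) * b)"
      using fin c by (intro ennreal_absorb) auto
    also have "\<dots> \<le> ennreal (7 / 2) * (2 * a + ennreal (4 * (nm1 \<beta>)^2) * b)"
      using c by (intro mult_right_mono ennreal_leI) (auto simp: field_simps)
    also have "\<dots> = 7 * a + ennreal (14 * (nm1 \<beta>)^2) * b"
    proof -
      have "ennreal (7 / 2) * 2 = 7" by (simp add: ennreal_mult'[symmetric] flip: ennreal_numeral)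
      moreover have "ennreal (7 / 2) * ennreal (4 * (nm1 \<beta>)^2) = ennreal (14 * (nm1 \<beta>)^2)"
        by (simp add: ennreal_mult'[symmetric])
      ultimately show ?thesis by (simp add: distrib_left mult.assoc[symmetric])
    qed
    finally have "SX \<le> 7 * a + ennreal (14 * (nm1 \<beta>)^2) * b" .
    moreover have "nsq (%l. ?i l * X l x) \<le> SX" unfolding SX_def by (rule SUP_upper) simp
    ultimately show ?thesis by (rule order_trans[rotated])
  qed
  show ?thesis
  proof (rule nsq_liminf[where f="%n l. indicator {- real n..real n} l * X l x"])
    show "(%n. indicator {- real n..real n} l * X l x) \<longlonglongrightarrow> X l x" for l
    proof (rule tendsto_eventually)
      obtain N where N: "\<bar>l\<bar> \<le> real N" using real_arch_simple by blast
      show "eventually (%n. indicator {- real n..real n} l * X l x = X l x) sequentially"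
        using eventually_ge_at_top[of N] by eventually_elim (use N in \<open>auto simp: indicator_def\<close>)
    qed
  qed (use R in auto)
qed

section \<open>Volterra equations\<close>

text \<open>The chain rule for powers of \<open>m = cumint \<kappa>\<close>, by induction with
  \<open>cumint_product\<close>. It yields the factorials in the Picard bounds.\<close>

lemma cumint_power:
  fixes \<kappa> :: "real => real"
  assumes \<kappa>: "integrable lborel \<kappa>"
  shows "cumint (%y. \<kappa> y * cumint \<kappa> y ^ n) x = cumint \<kappa> x ^ Suc n / Suc n"
    and "integrable lborel (%y. \<kappa> y * cumint \<kappa> y ^ n)"
proof -
  have [measurable]: "borel_fun \<kappa>" using \<kappa> by auto
  define m where "m = cumint \<kappa>"
  have [measurable]: "borel_fun m" unfolding m_def by measurable
  have mb: "\<bar>m y\<bar> \<le> (LBINT y. norm (\<kappa> y))" for y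
    using cumint_bounded[OF \<kappa>, of y] by (simp add: m_def)
  have int: "integrable lborel (%y. \<kappa> y * m y ^ n)" for n
  proof (rule integrable_bounded_mult(1)[OF \<kappa>])
    show "norm (m y ^ n) \<le> (LBINT y. norm (\<kappa> y)) ^ n" for y
      unfolding norm_power by (rule power_mono) (use mb in auto)
  qed auto
  then show "integrable lborel (%y. \<kappa> y * cumint \<kappa> y ^ n)" by (simp add: m_def)
  have "m x ^ Suc n = cumint (%y. real (Suc n) * (\<kappa> y * m y ^ n)) x" for x
  proof (induction n arbitrary: x)
    case 0
    then show ?case by (simp add: m_def)
  next
    case (Suc n)
    have "m x ^ Suc (Suc n) = (0 + cumint \<kappa> x) * (0 + cumint (%y. real (Suc n) * (\<kappa> y * m y ^ n)) x)"
      unfolding Suc.IH[symmetric] by (simp add: m_def)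
    also have "\<dots> = cumint (%y. \<kappa> y * m y ^ Suc n + m y * (real (Suc n) * (\<kappa> y * m y ^ n))) x"
      by (subst cumint_product[OF \<kappa> integrable_mult_right[OF int]])
         (simp only: Suc.IH[symmetric] m_def[symmetric] add_0 mult_zero_left)
    also have "\<dots> = cumint (%y. real (Suc (Suc n)) * (\<kappa> y * m y ^ Suc n)) x"
      by (rule cumint_cong) (simp add: algebra_simps)
    finally show ?case .
  qed
  then show "cumint (%y. \<kappa> y * cumint \<kappa> y ^ n) x = cumint \<kappa> x ^ Suc n / Suc n"
    by (simp add: cumint_cmult m_def[symmetric] del: power_Suc of_nat_Suc)
qed

text \<open>Gronwall by iteration. Integrability of \<open>k y (F y)\<close> and
  \<open>k y (G y)\<close> up to \<open>z\<close> bounds \<open>F - G\<close> there by a constant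
  \<open>C\<close>; feeding the bound \<open>C * (m x ^ n / fact n)\<close> through the equation
  improves it to the next n, by \<open>cumint_power\<close>.\<close>

lemma volterra_unique:
  fixes F G :: "real => 'b::{banach, second_countable_topology}"
  assumes \<kappa>: "integrable lborel \<kappa>"
    and k: "\<And>y a b. norm (k y a - k y b) \<le> \<kappa> y * norm (a - b)"
    and F: "\<And>x. x \<le> z \<Longrightarrow> F x = c + cumint (%y. k y (F y)) x" "set_integrable lborel {..z} (%y. k y (F y))"
    and G: "\<And>x. x \<le> z \<Longrightarrow> G x = c + cumint (%y. k y (G y)) x" "set_integrable lborel {..z} (%y. k y (G y))"
  shows "F z = G z"
proof -
  have k0: "0 \<le> \<kappa> y * norm (a - b)" for y and a b :: 'b using k order_trans[OF norm_ge_zero k] by blast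
  define D where "D y = k y (F y) - k y (G y)" for y
  have Di: "set_integrable lborel {..x} D" if "x \<le> z" for x
    unfolding D_def by (intro set_integral_diff) (use that in \<open>auto intro: set_integrable_subset[OF F(2)] set_integrable_subset[OF G(2)]\<close>)
  have FG: "F x - G x = cumint D x" if "x \<le> z" for x
  proof -
    have "cumint D x = cumint (%y. k y (F y)) x - cumint (%y. k y (G y)) x"
      unfolding cumint_def D_def
      by (rule set_integral_diff) (use that in \<open>auto intro: set_integrable_subset[OF F(2)] set_integrable_subset[OF G(2)]\<close>)
    then show ?thesis by (simp add: F(1)[OF that] G(1)[OF that])
  qed
  define C where "C = (LBINT y:{..z}. norm (D y))"
  have Dn: "set_integrable lborel {..z} (%y. norm (D y))" using Di[of z] by (auto intro: set_integrable_norm)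
  have C: "norm (F x - G x) \<le> C" if "x \<le> z" for x
  proof -
    have "norm (F x - G x) \<le> (LBINT y:{..x}. norm (D y))"
      unfolding FG[OF that] cumint_def by (rule set_integral_norm_bound[OF Di[OF that]])
    also have "\<dots> \<le> C"
      unfolding C_def set_lebesgue_integral_def using Dn that
      by (intro integral_mono') (auto simp: indicator_def set_integrable_def)
    finally show ?thesis .
  qed
  define m where "m = cumint \<kappa>"
  have bound: "norm (F x - G x) \<le> C * (m x ^ n / fact n)" if "x \<le> z" for x n
    using that
  proof (induction n arbitrary: x)
    case 0
    then show ?case using C by simp
  next
    case (Suc n)
    have "norm (F x - G x) \<le> cumint (%y. (C / fact n) * (\<kappa> y * m y ^ n)) x"
      unfolding FG[OF Suc.prems]
    proof (rule cumint_norm_le)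
      show "integrable lborel (%y. (C / fact n) * (\<kappa> y * m y ^ n))"
        unfolding m_def by (intro integrable_mult_right cumint_power \<kappa>)
      fix y assume y: "y \<le> x"
      have "norm (D y) \<le> \<kappa> y * norm (F y - G y)" unfolding D_def by (rule k)
      also have "\<dots> \<le> \<kappa> y * (C * (m y ^ n / fact n))"
      proof (cases "F y = G y")
        case True
        \<comment> \<open>A negative value of \<open>\<kappa>\<close> forces
          \<open>norm (a - b) \<le> 0\<close> for all a and b, that is a one-point type, where the
          claim is trivial.\<close>
        consider "\<kappa> y \<ge> 0" | "\<kappa> y < 0" by linarith
        then show ?thesis
        proof cases
          case 1
          then show ?thesis using Suc.IH[of y] y Suc.prems by (intro mult_left_mono; simp)
        next
          case 2
          then have "\<And>a b :: 'b. norm (a - b) \<le> 0" using k0[of y] by (simp add: zero_le_mult_iff)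
          then have "\<And>a b :: 'b. a = b" by simp
          then have "norm (D t) = 0" for t by (metis norm_zero)
          then have "C = 0" by (simp add: C_def)
          then show ?thesis using True by simp
        qed
      next
        case False
        then have "\<kappa> y \<ge> 0" using k0[of y "F y" "G y"] by (simp add: zero_le_mult_iff)
        then show ?thesis using Suc.IH[of y] y Suc.prems by (intro mult_left_mono; simp)
      qed
      finally show "norm (D y) \<le> (C / fact n) * (\<kappa> y * m y ^ n)" by (simp add: mult_ac)
    qed
    also have "\<dots> = C * (m x ^ Suc n / fact (Suc n))"
      unfolding cumint_cmult m_def cumint_power[OF \<kappa>] by simp
    finally show ?case .
  qed
  have "(%n. C * (m z ^ n / fact n)) \<longlonglongrightarrow> C * 0"
    using summable_LIMSEQ_zero[OF summable_exp[of "m z"]]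
    by (intro tendsto_intros) (simp add: field_simps)
  then have "norm (F z - G z) \<le> 0"
    using bound by (intro LIMSEQ_le_const[of "%n. C * (m z ^ n / fact n)"]) auto
  then show ?thesis by simp
qed

text \<open>Picard iteration with increments dominated by the terms of the exponential series of
  \<open>cumint \<kappa>\<close>. It is run for all parameters \<open>l\<close> simultaneously, so
  that the limit is jointly measurable; \<open>km\<close> says that one step preserves this.\<close>

lemma volterra_exists:
  fixes k :: "'l => real => 'b => 'b::{banach, second_countable_topology}"
  assumes \<kappa>: "integrable lborel \<kappa>" "\<And>y. 0 \<le> \<kappa> y"
    and k: "\<And>l y a b. norm (k l y a - k l y b) \<le> \<kappa> y * norm (a - b)" "\<And>l y. k l y 0 = 0"
    and km: "\<And>f. (%(l, y). f l y) \<in> borel_measurable (M \<Otimes>\<^sub>M borel) \<Longrightarrow>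
      (%(l, y). k l y (f l y)) \<in> borel_measurable (M \<Otimes>\<^sub>M borel)"
    and sp: "space M = UNIV"
  obtains F where "(%(l, y). F l y) \<in> borel_measurable (M \<Otimes>\<^sub>M borel)"
    "\<And>l x. F l x = c + cumint (%y. k l y (F l y)) x"
    "\<And>l x. norm (F l x) \<le> norm c * exp (LBINT y. \<kappa> y)"
    "\<And>l. integrable lborel (%y. k l y (F l y))"
proof -
  define m where "m = cumint \<kappa>"
  have m: "0 \<le> m x" "m x \<le> (LBINT y. \<kappa> y)" for x
    unfolding m_def using cumint_le_integral[OF \<kappa>] by auto
  define I where "I = rec_nat (%(l::'l) (x::real). c) (%_ f l x. c + cumint (%y. k l y (f l y)) x)"
  have I0: "I 0 = (%l x. c)" and IS: "I (Suc n) = (%l x. c + cumint (%y. k l y (I n l y)) x)" for n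
    by (simp_all add: I_def)
  have meas [measurable]: "(%(l, y). I n l y) \<in> borel_measurable (M \<Otimes>\<^sub>M borel)" for n
  proof (induction n)
    case (Suc n)
    have [measurable]: "(%(l, y). k l y (I n l y)) \<in> borel_measurable (M \<Otimes>\<^sub>M borel)"
      by (rule km[OF Suc])
    have [measurable]: "(%(w, y). k (fst w) y (I n (fst w) y)) \<in> borel_measurable ((M \<Otimes>\<^sub>M borel) \<Otimes>\<^sub>M lborel)"
      by measurable
    show ?case unfolding IS case_prod_beta by measurable
  qed (simp add: I0)
  have sec: "f l \<in> borel_measurable borel" if "(%(l, y). f l y) \<in> borel_measurable (M \<Otimes>\<^sub>M borel)" for f :: "'l => real => 'b" and l
    using measurable_compose[OF measurable_Pair1'[of l M borel] that] sp by simp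
  have kb: "norm (k l y a) \<le> \<kappa> y * norm a" for l y a using k(1)[of l y a 0] k(2) by simp
  have ki: "integrable lborel (%y. k l y (f l y))"
    if "(%(l, y). f l y) \<in> borel_measurable (M \<Otimes>\<^sub>M borel)" "\<And>x. norm (f l x) \<le> C" for f l C
  proof (rule Bochner_Integration.integrable_bound[where f="%y. \<kappa> y * C"])
    show "(%y. k l y (f l y)) \<in> borel_measurable lborel"
      using sec[OF km[OF that(1)], of l] by simp
    have "norm (k l y (f l y)) \<le> norm (\<kappa> y * C)" for y
      using kb[of l y "f l y"] mult_left_mono[OF that(2)[of y] \<kappa>(2)[of y]]
      unfolding real_norm_def by linarith
    then show "AE y in lborel. norm (k l y (f l y)) \<le> norm (\<kappa> y * C)" by simp
  qed (use \<kappa> in auto)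
  have sumexp: "(\<Sum>j\<le>n. m x ^ j / fact j) \<le> exp (m x)" for n x
  proof -
    have s: "summable (%j. m x ^ j / fact j)" using summable_exp[of "m x"] by (simp add: field_simps)
    have "(\<Sum>j\<le>n. m x ^ j / fact j) \<le> (\<Sum>j. m x ^ j / fact j)"
      by (rule sum_le_suminf[OF s]) (use m in auto)
    then show ?thesis by (simp add: exp_def field_simps)
  qed
  have expM: "exp (m x) \<le> exp (LBINT y. \<kappa> y)" for x using m by simp
  have step: "norm (I (Suc n) l x - I n l x) \<le> norm c * (m x ^ Suc n / fact (Suc n)) \<and> norm (I n l x) \<le> norm c * (\<Sum>j\<le>n. m x ^ j / fact j)" for n l x
  proof (induction n arbitrary: x)
    case 0
    have "norm (cumint (%y. k l y c) x) \<le> cumint (%y. norm c * \<kappa> y) x"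
      by (rule cumint_norm_le) (use \<kappa> kb in \<open>auto simp: mult.commute\<close>)
    then show ?case by (simp add: I0 IS cumint_cmult m_def)
  next
    case (Suc n)
    have b1: "norm (I (Suc n) l x) \<le> norm c * (\<Sum>j\<le>Suc n. m x ^ j / fact j)" for x
      using Suc[of x] norm_triangle_ineq[of "I n l x" "I (Suc n) l x - I n l x"]
      by (simp add: distrib_left del: power_Suc fact_Suc)
    have b2: "norm (I n l x) \<le> norm c * (\<Sum>j\<le>n. m x ^ j / fact j)" for x using Suc[of x] by simp
    have i1: "integrable lborel (%y. k l y (I (Suc n) l y))"
      by (rule ki[OF meas, where C="norm c * exp (LBINT y. \<kappa> y)"])
         (meson b1 order_trans mult_left_mono norm_ge_zero sumexp expM)
    have i2: "integrable lborel (%y. k l y (I n l y))"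
      by (rule ki[OF meas, where C="norm c * exp (LBINT y. \<kappa> y)"])
         (meson b2 order_trans mult_left_mono norm_ge_zero sumexp expM)
    have "I (Suc (Suc n)) l x - I (Suc n) l x = cumint (%y. k l y (I (Suc n) l y) - k l y (I n l y)) x"
      by (subst cumint_minus[OF i1 i2]) (simp add: IS)
    also have "norm \<dots> \<le> cumint (%y. (norm c / fact (Suc n)) * (\<kappa> y * m y ^ Suc n)) x"
    proof (rule cumint_norm_le)
      show "integrable lborel (%y. (norm c / fact (Suc n)) * (\<kappa> y * m y ^ Suc n))"
        unfolding m_def by (intro integrable_mult_right cumint_power \<kappa>)
      fix y
      have "norm (k l y (I (Suc n) l y) - k l y (I n l y)) \<le> \<kappa> y * norm (I (Suc n) l y - I n l y)" by (rule k)
      also have "\<dots> \<le> \<kappa> y * (norm c * (m y ^ Suc n / fact (Suc n)))"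
        using Suc[of y] by (intro mult_left_mono \<kappa>) auto
      finally show "norm (k l y (I (Suc n) l y) - k l y (I n l y)) \<le> (norm c / fact (Suc n)) * (\<kappa> y * m y ^ Suc n)"
        by (simp add: mult_ac)
    qed
    also have "\<dots> = norm c * (m x ^ Suc (Suc n) / fact (Suc (Suc n)))"
      unfolding cumint_cmult m_def cumint_power[OF \<kappa>(1)] by simp
    finally show ?case using b1[of x] by simp
  qed
  have Ib: "norm (I n l x) \<le> norm c * exp (LBINT y. \<kappa> y)" for n l x
    by (meson step order_trans mult_left_mono norm_ge_zero sumexp expM)
  have conv: "convergent (%n. I n l x)" for l x
  proof -
    have "summable (%n. I (Suc n) l x - I n l x)"
    proof (rule summable_comparison_test)
      show "\<exists>N. \<forall>n\<ge>N. norm (I (Suc n) l x - I n l x) \<le> norm c * (m x ^ Suc n / fact (Suc n))"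
        using step by blast
      have "summable (%n. m x ^ n / fact n)" using summable_exp[of "m x"] by (simp add: field_simps)
      then have "summable (%n. m x ^ Suc n / fact (Suc n))" by (subst summable_Suc_iff)
      then show "summable (%n. norm c * (m x ^ Suc n / fact (Suc n)))" by (rule summable_mult)
    qed
    then have "convergent (%n. \<Sum>j<n. I (Suc j) l x - I j l x)" by (simp add: summable_iff_convergent)
    then have "convergent (%n. I n l x + (- c))"
      unfolding sum_lessThan_telescope[of "%j. I j l x"] by (simp add: I0)
    then show ?thesis by (rule convergent_add_const_right_iff[THEN iffD1])
  qed
  define F where "F l x = lim (%n. I n l x)" for l x
  have lim: "(%n. I n l x) \<longlonglongrightarrow> F l x" for l x
    unfolding F_def using conv convergent_LIMSEQ_iff by blast
  have Fm: "(%(l, y). F l y) \<in> borel_measurable (M \<Otimes>\<^sub>M borel)"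
  proof (rule borel_measurable_LIMSEQ_metric[where f="%n (l, y). I n l y"])
    show "(%i. case w of (l, y) => I i l y) \<longlonglongrightarrow> (case w of (l, y) => F l y)" for w
      using lim[of "fst w" "snd w"] by (simp add: case_prod_beta)
  qed (rule meas)
  have Fb: "norm (F l x) \<le> norm c * exp (LBINT y. \<kappa> y)" for l x
    by (rule LIMSEQ_le_const2[OF tendsto_norm[OF lim]]) (use Ib in blast)
  have Fi: "integrable lborel (%y. k l y (F l y))" for l by (rule ki[OF Fm Fb])
  have Feq: "F l x = c + cumint (%y. k l y (F l y)) x" for l x
  proof -
    have "(%n. cumint (%y. k l y (I n l y)) x) \<longlonglongrightarrow> cumint (%y. k l y (F l y)) x"
      unfolding cumint_def set_lebesgue_integral_def
    proof (rule integral_dominated_convergence[where w="%y. \<kappa> y * (norm c * exp (LBINT y. \<kappa> y))"])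
      show "AE y in lborel. (%n. indicator {..x} y *\<^sub>R k l y (I n l y)) \<longlonglongrightarrow> indicator {..x} y *\<^sub>R k l y (F l y)"
      proof (rule AE_I2, rule tendsto_scaleR[OF tendsto_const])
        fix y
        have "(%n. \<kappa> y * norm (I n l y - F l y)) \<longlonglongrightarrow> \<kappa> y * 0"
          by (intro tendsto_mult tendsto_const tendsto_norm_zero LIM_zero lim)
        then have "(%n. k l y (I n l y) - k l y (F l y)) \<longlonglongrightarrow> 0"
          by (intro Lim_null_comparison[OF always_eventually, OF allI, OF k(1)]) simp
        then show "(%n. k l y (I n l y)) \<longlonglongrightarrow> k l y (F l y)" by (rule LIM_zero_cancel)
      qed
      show "AE y in lborel. norm (indicator {..x} y *\<^sub>R k l y (I n l y)) \<le> \<kappa> y * (norm c * exp (LBINT y. \<kappa> y))" for n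
      proof (rule AE_I2)
        fix y
        have "norm (k l y (I n l y)) \<le> \<kappa> y * (norm c * exp (LBINT y. \<kappa> y))"
          by (rule order_trans[OF kb mult_left_mono[OF Ib \<kappa>(2)]])
        moreover from order_trans[OF norm_ge_zero this] have "0 \<le> \<kappa> y * (norm c * exp (LBINT y. \<kappa> y))" .
        ultimately show "norm (indicator {..x} y *\<^sub>R k l y (I n l y)) \<le> \<kappa> y * (norm c * exp (LBINT y. \<kappa> y))"
          by (cases "y \<le> x") simp_all
      qed
      show "(%y. indicator {..x} y *\<^sub>R k l y (F l y)) \<in> borel_measurable lborel"
        using set_integrable_lborel[OF Fi[of l], of "{..x}"] by (simp add: set_integrable_def)
      show "(%y. indicator {..x} y *\<^sub>R k l y (I n l y)) \<in> borel_measurable lborel" for n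
        using set_integrable_lborel[OF ki[OF meas Ib], of "{..x}"] by (simp add: set_integrable_def)
      show "integrable lborel (%y. \<kappa> y * (norm c * exp (LBINT y. \<kappa> y)))"
        using \<kappa>(1) by (rule integrable_mult_left)
    qed
    then have "(%n. I (Suc n) l x) \<longlonglongrightarrow> c + cumint (%y. k l y (F l y)) x"
      unfolding IS by (rule tendsto_add[OF tendsto_const])
    moreover have "(%n. I (Suc n) l x) \<longlonglongrightarrow> F l x" using lim by (rule LIMSEQ_Suc)
    ultimately show ?thesis by (rule LIMSEQ_unique[symmetric])
  qed
  show ?thesis by (rule that[OF Fm Feq Fb Fi])
qed

section \<open>Zakharov--Shabat systems\<close>

text \<open>Smallness is imposed on the product of the L1 norms; \<open>B\<close> bounds the single
  factors and enters the constants. \<open>5 / 12\<close> is half of the \<open>5 / 6\<close> in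
  \<open>admissible_small\<close>, and lies below the threshold \<open>1 / 2\<close> of
  \<open>forced_system_nsq\<close>.\<close>

definition zs_ok :: "real => (real => complex) => (real => complex) => bool" where
  "zs_ok B \<alpha> \<beta> \<longleftrightarrow> integrable lborel \<alpha> \<and> integrable lborel \<beta> \<and>
     sq_integrable \<alpha> \<and> sq_integrable \<beta> \<and>
     nm1 \<alpha> \<le> B \<and> nm1 \<beta> \<le> B \<and> nm1 \<alpha> * nm1 \<beta> \<le> 5 / 12"

text \<open>A solution for all l at once. The bound \<open>D\<close> is qualitative: it makes
  suprema finite, after which \<open>zs_sol_bound\<close> supplies an explicit one.\<close>

definition zs_sol :: "(real => complex) => (real => complex) =>
    (real => real => complex) => (real => real => complex) => bool" where
  "zs_sol \<alpha> \<beta> P E \<longleftrightarrow>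
     jointly_borel P \<and>
     jointly_borel E \<and>
     (\<exists>D. \<forall>l x. cmod (P l x) \<le> D \<and> cmod (E l x) \<le> D) \<and>
     (\<forall>l x. P l x = 1 + cumint (%y. ee (l * y) * (\<alpha> y * E l y)) x) \<and>
     (\<forall>l x. E l x = cumint (%y. ee (- (l * y)) * (\<beta> y * P l y)) x)"

lemma cumint_bounded_linear:
  fixes f :: "real => 'a::{banach, second_countable_topology}" and T :: "'a => 'b::{banach, second_countable_topology}"
  assumes "bounded_linear T" "set_integrable lborel {..x} f"
  shows "T (cumint f x) = cumint (%y. T (f y)) x"
  unfolding cumint_def set_lebesgue_integral_def
  using integral_bounded_linear[OF assms(1) assms(2)[unfolded set_integrable_def]]
  by (simp add: linear_scale[OF bounded_linear.linear[OF assms(1)]])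

text \<open>A single Volterra equation for the pair (P, E), with Lipschitz constant
  \<open>cmod (\<alpha> y) + cmod (\<beta> y)\<close>.\<close>

lemma zs_sol_exists:
  assumes \<alpha>: "integrable lborel \<alpha>" and \<beta>: "integrable lborel \<beta>"
  obtains P E where "zs_sol \<alpha> \<beta> P E"
proof -
  have [measurable]: "borel_fun \<alpha>" "borel_fun \<beta>"
    using \<alpha> \<beta> by auto
  define k where "k l y v = (ee (l * y) * (\<alpha> y * snd v), ee (- (l * y)) * (\<beta> y * fst v))"
    for l y :: real and v :: "complex \<times> complex"
  define \<kappa> where "\<kappa> y = cmod (\<alpha> y) + cmod (\<beta> y)" for y
  have \<kappa>: "integrable lborel \<kappa>" "\<And>y. 0 \<le> \<kappa> y" unfolding \<kappa>_def using \<alpha> \<beta> by auto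
  have k: "norm (k l y a - k l y b) \<le> \<kappa> y * norm (a - b)" for l y a b
  proof -
    have "norm (k l y a - k l y b) \<le> norm (fst (k l y a - k l y b)) + norm (snd (k l y a - k l y b))"
      by (metis norm_Pair_le prod.collapse)
    also have "\<dots> = cmod (\<alpha> y) * cmod (snd (a - b)) + cmod (\<beta> y) * cmod (fst (a - b))"
      by (simp add: k_def norm_mult right_diff_distrib[symmetric])
    also have "\<dots> \<le> \<kappa> y * norm (a - b)"
      unfolding \<kappa>_def distrib_right using norm_fst_le[of "fst (a - b)" "snd (a - b)"] norm_snd_le[of "snd (a - b)" "fst (a - b)"]
      by (intro add_mono mult_left_mono) (simp_all only: prod.collapse norm_ge_zero)
    finally show ?thesis .
  qed
  have k0: "k l y 0 = 0" for l y by (simp add: k_def zero_prod_def)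
  have km: "(%(l, y). k l y (f l y)) \<in> borel_measurable (borel \<Otimes>\<^sub>M borel)"
    if "jointly_borel f" for f
    proof -
      have fm: "(%w. f (fst w) (snd w)) \<in> borel_measurable (borel \<Otimes>\<^sub>M borel)" using that by (simp add: case_prod_beta)
      have [measurable]: "(%w. fst (f (fst w) (snd w))) \<in> borel_measurable (borel \<Otimes>\<^sub>M borel)"
        by (rule borel_measurable_continuous_on[OF continuous_on_fst[OF continuous_on_id] fm])
      have [measurable]: "(%w. snd (f (fst w) (snd w))) \<in> borel_measurable (borel \<Otimes>\<^sub>M borel)"
        by (rule borel_measurable_continuous_on[OF continuous_on_snd[OF continuous_on_id] fm])
      show ?thesis unfolding k_def case_prod_beta
        by (intro borel_measurable_Pair; measurable)
    qed
  obtain F where F: "jointly_borel F"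
    "\<And>l x. F l x = (1, 0) + cumint (%y. k l y (F l y)) x"
    "\<And>l x. norm (F l x) \<le> norm (1::complex, 0::complex) * exp (LBINT y. \<kappa> y)"
    "\<And>l. integrable lborel (%y. k l y (F l y))"
  proof (rule volterra_exists[OF \<kappa> k k0 km space_borel, where c="(1, 0)"])
    fix F
    assume F: "jointly_borel F"
      "\<And>l x. F l x = (1, 0) + cumint (%y. k l y (F l y)) x"
      "\<And>l x. norm (F l x) \<le> norm (1::complex, 0::complex) * exp (LBINT y. \<kappa> y)"
      "\<And>l. integrable lborel (%y. k l y (F l y))"
    show thesis by (rule that[of F, OF F])
  qed
  have si: "set_integrable lborel {..x} (%y. k l y (F l y))" for l x
    by (rule set_integrable_lborel[OF F(4)]) auto
  have Fm: "(%w. F (fst w) (snd w)) \<in> borel_measurable (borel \<Otimes>\<^sub>M borel)" using F(1) by (simp add: case_prod_beta)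
  show ?thesis
  proof (rule that[of "%l x. fst (F l x)" "%l x. snd (F l x)"], unfold zs_sol_def, intro conjI allI)
    show "(%(l, y). fst (F l y)) \<in> borel_measurable (borel \<Otimes>\<^sub>M borel)"
      unfolding case_prod_beta by (rule borel_measurable_continuous_on[OF continuous_on_fst[OF continuous_on_id] Fm])
    show "(%(l, y). snd (F l y)) \<in> borel_measurable (borel \<Otimes>\<^sub>M borel)"
      unfolding case_prod_beta by (rule borel_measurable_continuous_on[OF continuous_on_snd[OF continuous_on_id] Fm])
    show "\<exists>D. \<forall>l x. cmod (fst (F l x)) \<le> D \<and> cmod (snd (F l x)) \<le> D"
    proof (intro exI allI conjI)
      fix l x
      show "cmod (fst (F l x)) \<le> norm (1::complex, 0::complex) * exp (LBINT y. \<kappa> y)"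
        using F(3)[of l x] norm_fst_le[of "fst (F l x)" "snd (F l x)"] by simp
      show "cmod (snd (F l x)) \<le> norm (1::complex, 0::complex) * exp (LBINT y. \<kappa> y)"
        using F(3)[of l x] norm_snd_le[of "snd (F l x)" "fst (F l x)"] by simp
    qed
    fix l x
    have "fst (F l x) = 1 + fst (cumint (%y. k l y (F l y)) x)"
      using arg_cong[OF F(2)[of l x], of fst] by (simp only: fst_add fst_conv)
    also have "fst (cumint (%y. k l y (F l y)) x) = cumint (%y. fst (k l y (F l y))) x"
      by (rule cumint_bounded_linear[OF bounded_linear_fst si])
    finally show "fst (F l x) = 1 + cumint (%y. ee (l * y) * (\<alpha> y * snd (F l y))) x"
      by (simp only: k_def fst_conv)
    have "snd (F l x) = 0 + snd (cumint (%y. k l y (F l y)) x)"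
      using arg_cong[OF F(2)[of l x], of snd] by (simp only: snd_add snd_conv)
    also have "snd (cumint (%y. k l y (F l y)) x) = cumint (%y. snd (k l y (F l y))) x"
      by (rule cumint_bounded_linear[OF bounded_linear_snd si])
    finally show "snd (F l x) = cumint (%y. ee (- (l * y)) * (\<beta> y * fst (F l y))) x"
      by (simp only: k_def snd_conv add_0)
  qed
qed

text \<open>The analogue of \<open>forced_system_nsq\<close> at a fixed l: without squares nothing
  doubles, and the constant is \<open>1 / (1 - 5 / 12) = 12 / 7\<close>. The bound \<open>D\<close>
  makes the suprema of X and Y finite.\<close>

lemma forced_system_sup:
  fixes X Y F G :: "real => complex"
  assumes \<alpha>: "integrable lborel \<alpha>" and \<beta>: "integrable lborel \<beta>"
    and small: "nm1 \<alpha> * nm1 \<beta> \<le> 5 / 12"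
    and Xb: "\<And>x. cmod (X x) \<le> D" and Yb: "\<And>x. cmod (Y x) \<le> D"
    and \<theta>: "\<And>y. cmod (\<theta>X y) = 1" "\<And>y. cmod (\<theta>Y y) = 1"
    and X: "\<And>x. X x = F x + cumint (%y. \<theta>X y * (\<beta> y * Y y)) x"
    and Y: "\<And>x. Y x = G x + cumint (%y. \<theta>Y y * (\<alpha> y * X y)) x"
    and F: "\<And>x. cmod (F x) \<le> a" and G: "\<And>x. cmod (G x) \<le> b"
  shows "cmod (X x) \<le> 12 / 7 * (a + nm1 \<beta> * b)"
proof -
  define SX SY where "SX = (SUP x. cmod (X x))" and "SY = (SUP x. cmod (Y x))"
  have SX: "cmod (X x) \<le> SX" for x unfolding SX_def by (rule cSUP_upper) (use Xb in \<open>auto intro!: bdd_aboveI\<close>)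
  have SY: "cmod (Y x) \<le> SY" for x unfolding SY_def by (rule cSUP_upper) (use Yb in \<open>auto intro!: bdd_aboveI\<close>)
  have step: "cmod (cumint (%y. \<theta> y * (\<gamma> y * Z y)) x) \<le> nm1 \<gamma> * S"
    if "integrable lborel \<gamma>" "\<And>y. cmod (\<theta> y) = 1" "\<And>y. cmod (Z y) \<le> S" for \<theta> \<gamma> Z S x
  proof -
    have "cmod (cumint (%y. \<theta> y * (\<gamma> y * Z y)) x) \<le> (LBINT y. cmod (\<gamma> y) * S)"
      by (rule cumint_norm_le_integral) (use that in \<open>auto simp: norm_mult intro!: mult_left_mono\<close>)
    then show ?thesis by (simp add: nm1_def)
  qed
  have "SX \<le> a + nm1 \<beta> * SY"
    unfolding SX_def
  proof (rule cSUP_least)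
    show "cmod (X x) \<le> a + nm1 \<beta> * SY" for x
      unfolding X using step[where \<theta>=\<theta>X and Z=Y and x=x, OF \<beta> \<theta>(1) SY] F[of x] norm_triangle_ineq[of "F x" "cumint (%y. \<theta>X y * (\<beta> y * Y y)) x"] by linarith
  qed auto
  moreover have "SY \<le> b + nm1 \<alpha> * SX"
    unfolding SY_def
  proof (rule cSUP_least)
    show "cmod (Y x) \<le> b + nm1 \<alpha> * SX" for x
      unfolding Y using step[where \<theta>=\<theta>Y and Z=X and x=x, OF \<alpha> \<theta>(2) SX] G[of x] norm_triangle_ineq[of "G x" "cumint (%y. \<theta>Y y * (\<alpha> y * X y)) x"] by linarith
  qed auto
  then have "nm1 \<beta> * SY \<le> nm1 \<beta> * (b + nm1 \<alpha> * SX)" by (rule mult_left_mono) simp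
  ultimately have "SX \<le> a + nm1 \<beta> * b + (nm1 \<alpha> * nm1 \<beta>) * SX"
    by (simp add: algebra_simps)
  moreover have "(nm1 \<alpha> * nm1 \<beta>) * SX \<le> 5 / 12 * SX"
    using small SX[of 0] order_trans[OF norm_ge_zero SX[of 0]] by (intro mult_right_mono) auto
  ultimately have "SX \<le> 12 / 7 * (a + nm1 \<beta> * b)" by simp
  then show ?thesis using SX[of x] by linarith
qed

lemma zs_sol_bound:
  assumes ok: "zs_ok B \<alpha> \<beta>" and sol: "zs_sol \<alpha> \<beta> P E"
  shows "cmod (P l x) \<le> 2" "cmod (E l x) \<le> 2 * B"
proof -
  from sol obtain D where D: "\<And>l x. cmod (P l x) \<le> D" "\<And>l x. cmod (E l x) \<le> D"
    and P: "\<And>l x. P l x = 1 + cumint (%y. ee (l * y) * (\<alpha> y * E l y)) x"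
    and E: "\<And>l x. E l x = cumint (%y. ee (- (l * y)) * (\<beta> y * P l y)) x"
    unfolding zs_sol_def by blast
  have ok': "integrable lborel \<alpha>" "integrable lborel \<beta>" "nm1 \<alpha> * nm1 \<beta> \<le> 5 / 12" "nm1 \<beta> \<le> B"
    using ok by (auto simp: zs_ok_def)
  have small': "nm1 \<beta> * nm1 \<alpha> \<le> 5 / 12" using ok'(3) by (simp add: mult.commute)
  have P0: "P l x = 1 + cumint (%y. ee (l * y) * (\<alpha> y * E l y)) x" "E l x = 0 + cumint (%y. ee (- (l * y)) * (\<beta> y * P l y)) x" for x
    using P[of l x] E[of l x] by simp_all
  have "cmod (P l x) \<le> 12 / 7 * (1 + nm1 \<alpha> * 0)"
    by (rule forced_system_sup[OF ok'(2,1) small' D norm_ee norm_ee P0]) simp_all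
  then show "cmod (P l x) \<le> 2" by simp
  have "cmod (E l x) \<le> 12 / 7 * (0 + nm1 \<beta> * 1)"
    by (rule forced_system_sup[OF ok'(1-3) D(2,1) norm_ee norm_ee P0(2,1)]) simp_all
  also have "\<dots> \<le> 2 * B" using ok'(4) order_trans[OF nm1_nonneg ok'(4)] by simp
  finally show "cmod (E l x) \<le> 2 * B" .
qed

lemma borel_section:
  assumes "jointly_borel f"
  shows "f l \<in> borel_measurable borel"
  using measurable_compose[OF measurable_Pair1'[of l borel borel] assms] by simp

lemma zs_sol_section:
  assumes "zs_sol \<alpha> \<beta> P E"
  shows "P l \<in> borel_measurable borel" "E l \<in> borel_measurable borel"
proof -
  note d = assms[unfolded zs_sol_def]
  show "P l \<in> borel_measurable borel" by (rule borel_section[OF d[THEN conjunct1]])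
  show "E l \<in> borel_measurable borel" by (rule borel_section[OF d[THEN conjunct2, THEN conjunct1]])
qed

lemma zs_integrable:
  assumes ok: "zs_ok B \<alpha> \<beta>" and sol: "zs_sol \<alpha> \<beta> P E" and g: "integrable lborel g" and \<theta>: "osc \<theta>"
  shows "integrable lborel (%y. \<theta> l y * (g y * P l y))" "integrable lborel (%y. \<theta> l y * (g y * E l y))"
proof -
  note [measurable] = zs_sol_section[OF sol]
  have [measurable]: "\<theta> l \<in> borel_measurable borel"
    using measurable_compose[OF measurable_Pair1'[of l borel borel] osc_measurable[OF \<theta>]] by simp
  have "integrable lborel (%y. g y * (\<theta> l y * P l y))"
    by (rule integrable_bounded_mult[OF g, where B=2]) (use zs_sol_bound[OF ok sol] \<theta> in \<open>auto simp: norm_mult\<close>)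
  then show "integrable lborel (%y. \<theta> l y * (g y * P l y))" by (simp add: mult_ac)
  have "integrable lborel (%y. g y * (\<theta> l y * E l y))"
    by (rule integrable_bounded_mult[OF g, where B="2 * B"]) (use zs_sol_bound[OF ok sol] \<theta> in \<open>auto simp: norm_mult\<close>)
  then show "integrable lborel (%y. \<theta> l y * (g y * E l y))" by (simp add: mult_ac)
qed

section \<open>First and second differences of solutions\<close>

text \<open>A discrete product rule arranged so that the unknown second difference of
  \<open>p\<close> occurs once, in the last term and next to the single potential \<open>b4\<close>;
  every other term contains a difference of potentials. In a system the last term is the homogeneous
  part and the others are the forcing.\<close>

lemma cumint_difference_identity:
  fixes p1 p2 p3 p4 b1 b2 b3 b4 \<theta> :: "real => complex"
  assumes b: "integrable lborel b1" "integrable lborel b2" "integrable lborel b3" "integrable lborel b4"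
    and p: "borel_fun p1" "borel_fun p2" "borel_fun p3" "borel_fun p4"
    and D: "\<And>y. cmod (p1 y) \<le> D" "\<And>y. cmod (p2 y) \<le> D" "\<And>y. cmod (p3 y) \<le> D" "\<And>y. cmod (p4 y) \<le> D"
    and \<theta>: "borel_fun \<theta>" "\<And>y. cmod (\<theta> y) = 1"
  shows "c1 * (cumint (%y. \<theta> y * (b1 y * p1 y)) x - cumint (%y. \<theta> y * (b2 y * p2 y)) x)
     - c2 * (cumint (%y. \<theta> y * (b3 y * p3 y)) x - cumint (%y. \<theta> y * (b4 y * p4 y)) x) =
     (cumint (%y. \<theta> y * ((c1 * (b1 y - b2 y) - c2 * (b3 y - b4 y)) * p1 y)) x
      + cumint (%y. \<theta> y * ((c2 * (b3 y - b4 y)) * (p1 y - p3 y))) x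
      + cumint (%y. \<theta> y * ((b2 y - b4 y) * (c1 * (p1 y - p2 y)))) x)
      + cumint (%y. \<theta> y * (b4 y * (c1 * (p1 y - p2 y) - c2 * (p3 y - p4 y)))) x"
proof -
  have J: "integrable lborel (%y. \<theta> y * (g y * q y))"
    if "integrable lborel g" "borel_fun q" "\<And>y. cmod (q y) \<le> K" for g q K
  proof -
    have "integrable lborel (%y. g y * (\<theta> y * q y))"
      by (rule integrable_bounded_mult[OF that(1), where B=K]) (use that \<theta> in \<open>auto simp: norm_mult\<close>)
    then show ?thesis by (simp add: mult_ac)
  qed
  note J1 = J[OF _ p(1) D(1)] J[OF _ p(2) D(2)] J[OF _ p(3) D(3)] J[OF _ p(4) D(4)]
  have d13: "cmod (p1 y - p3 y) \<le> D + D" for y using norm_triangle_ineq4[of "p1 y" "p3 y"] D(1)[of y] D(3)[of y] by linarith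
  have d12: "cmod (c1 * (p1 y - p2 y)) \<le> cmod c1 * (D + D)" for y
    unfolding norm_mult using norm_triangle_ineq4[of "p1 y" "p2 y"] D(1)[of y] D(2)[of y] by (intro mult_left_mono) auto
  have d34: "cmod (c2 * (p3 y - p4 y)) \<le> cmod c2 * (D + D)" for y
    unfolding norm_mult using norm_triangle_ineq4[of "p3 y" "p4 y"] D(3)[of y] D(4)[of y] by (intro mult_left_mono) auto
  have d1234: "cmod (c1 * (p1 y - p2 y) - c2 * (p3 y - p4 y)) \<le> cmod c1 * (D + D) + cmod c2 * (D + D)" for y
    using norm_triangle_ineq4[of "c1 * (p1 y - p2 y)" "c2 * (p3 y - p4 y)"] d12[of y] d34[of y] by linarith
  have L: "integrable lborel (%y. c1 * (\<theta> y * (b1 y * p1 y) - \<theta> y * (b2 y * p2 y)))"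
      "integrable lborel (%y. c2 * (\<theta> y * (b3 y * p3 y) - \<theta> y * (b4 y * p4 y)))"
    by (rule integrable_mult_right, rule Bochner_Integration.integrable_diff, rule J1, rule b, rule J1, rule b)+
  have bs: "integrable lborel (%y. c1 * (b1 y - b2 y) - c2 * (b3 y - b4 y))"
    "integrable lborel (%y. c2 * (b3 y - b4 y))" "integrable lborel (%y. b2 y - b4 y)"
    using b by simp_all
  have ps: "borel_fun (%y. p1 y - p3 y)" "borel_fun (%y. c1 * (p1 y - p2 y))"
     "borel_fun (%y. c1 * (p1 y - p2 y) - c2 * (p3 y - p4 y))"
    using p by simp_all
  note R = J1(1)[OF bs(1)] J[OF bs(2) ps(1) d13] J[OF bs(3) ps(2) d12] J[OF b(4) ps(3) d1234]
  have "c1 * (cumint (%y. \<theta> y * (b1 y * p1 y)) x - cumint (%y. \<theta> y * (b2 y * p2 y)) x)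
     - c2 * (cumint (%y. \<theta> y * (b3 y * p3 y)) x - cumint (%y. \<theta> y * (b4 y * p4 y)) x)
    = cumint (%y. c1 * (\<theta> y * (b1 y * p1 y) - \<theta> y * (b2 y * p2 y)) - c2 * (\<theta> y * (b3 y * p3 y) - \<theta> y * (b4 y * p4 y))) x"
    unfolding cumint_minus[OF L] cumint_cmult cumint_minus[OF J1(1)[OF b(1)] J1(2)[OF b(2)]] cumint_minus[OF J1(3)[OF b(3)] J1(4)[OF b(4)]] ..
  also have "\<dots> = cumint (%y. (\<theta> y * ((c1 * (b1 y - b2 y) - c2 * (b3 y - b4 y)) * p1 y)
      + \<theta> y * ((c2 * (b3 y - b4 y)) * (p1 y - p3 y))
      + \<theta> y * ((b2 y - b4 y) * (c1 * (p1 y - p2 y))))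
      + \<theta> y * (b4 y * (c1 * (p1 y - p2 y) - c2 * (p3 y - p4 y)))) x"
    by (rule cumint_cong) (simp add: algebra_simps)
  finally show ?thesis
    by (simp only: cumint_add R Bochner_Integration.integrable_add)
qed

text \<open>The difference of two solutions solves the system of the second pair of potentials,
  forced by the differences of the potentials times the bounded first solution. The constant 8 is a
  crude bound for \<open>12 / 7 * (2 + 2)\<close>.\<close>

lemma zs_diff_bound:
  assumes ok: "zs_ok B \<alpha> \<beta>" and sol: "zs_sol \<alpha> \<beta> P E" and B: "1 \<le> B"
    and ok': "zs_ok B \<alpha>' \<beta>'" and sol': "zs_sol \<alpha>' \<beta>' P' E'"
    and d: "nm1 (%y. \<alpha> y - \<alpha>' y) + nm1 (%y. \<beta> y - \<beta>' y) \<le> d"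
  shows "cmod (P l x - P' l x) \<le> 8 * B^2 * d" "cmod (E l x - E' l x) \<le> 8 * B^2 * d"
proof -
  have P: "\<And>l x. P l x = 1 + cumint (%y. ee (l * y) * (\<alpha> y * E l y)) x"
    and E: "\<And>l x. E l x = cumint (%y. ee (- (l * y)) * (\<beta> y * P l y)) x"
    using sol unfolding zs_sol_def by blast+
  have P': "\<And>l x. P' l x = 1 + cumint (%y. ee (l * y) * (\<alpha>' y * E' l y)) x"
    and E': "\<And>l x. E' l x = cumint (%y. ee (- (l * y)) * (\<beta>' y * P' l y)) x"
    using sol' unfolding zs_sol_def by blast+
  have i: "integrable lborel \<alpha>" "integrable lborel \<beta>" using ok by (auto simp: zs_ok_def)
  have i': "integrable lborel \<alpha>'" "integrable lborel \<beta>'" "nm1 \<alpha>' * nm1 \<beta>' \<le> 5 / 12" "nm1 \<beta>' \<le> B" "nm1 \<alpha>' \<le> B"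
    using ok' by (auto simp: zs_ok_def)
  have small': "nm1 \<beta>' * nm1 \<alpha>' \<le> 5 / 12" using i'(3) by (simp add: mult.commute)
  note b = zs_sol_bound[OF ok sol] zs_sol_bound[OF ok' sol']
  note m = zs_sol_section[OF sol] zs_sol_section[OF sol']
  define F where "F x = cumint (%y. ee (- (l * y)) * ((\<beta> y - \<beta>' y) * P l y)) x" for x
  define G where "G x = cumint (%y. ee (l * y) * ((\<alpha> y - \<alpha>' y) * E l y)) x" for x
  \<comment> \<open>The identity for second differences with \<open>c1 = 1\<close> and
    \<open>c2 = 0\<close> is the product rule for first differences.\<close>
  have X: "E l x - E' l x = F x + cumint (%y. ee (- (l * y)) * (\<beta>' y * (P l y - P' l y))) x" for x
    using cumint_difference_identity[of \<beta> \<beta>' \<beta> \<beta>' "P l" "P' l" "P l" "P' l" 2 "%y. ee (- (l * y))" 1 x 0]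
      i i' m b by (simp add: E[symmetric] E'[symmetric] F_def cumint_def)
  have Y: "P l x - P' l x = G x + cumint (%y. ee (l * y) * (\<alpha>' y * (E l y - E' l y))) x" for x
    unfolding P P'
    using cumint_difference_identity[of \<alpha> \<alpha>' \<alpha> \<alpha>' "E l" "E' l" "E l" "E' l" "2 * B" "%y. ee (l * y)" 1 x 0]
      i i' m b by (simp add: G_def cumint_def)
  have F: "cmod (F x) \<le> 2 * d" for x
  proof -
    have "cmod (F x) \<le> (LBINT y. cmod (\<beta> y - \<beta>' y) * 2)"
      unfolding F_def by (rule cumint_norm_le_integral) (use i i' b in \<open>simp_all add: norm_mult mult_left_mono\<close>)
    also have "\<dots> = nm1 (%y. \<beta> y - \<beta>' y) * 2" by (simp add: nm1_def)
    finally show ?thesis using d nm1_nonneg[of "%y. \<alpha> y - \<alpha>' y"] by linarith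
  qed
  have G: "cmod (G x) \<le> 2 * B * d" for x
  proof -
    have "cmod (G x) \<le> (LBINT y. cmod (\<alpha> y - \<alpha>' y) * (2 * B))"
      unfolding G_def by (rule cumint_norm_le_integral) (use i i' b in \<open>simp_all add: norm_mult mult_left_mono\<close>)
    also have "\<dots> = nm1 (%y. \<alpha> y - \<alpha>' y) * (2 * B)" by (simp add: nm1_def)
    also have "\<dots> \<le> d * (2 * B)" using d nm1_nonneg[of "%y. \<beta> y - \<beta>' y"] B by (intro mult_right_mono; linarith)
    finally show ?thesis by (simp add: mult_ac)
  qed
  have d0: "0 \<le> d" using d nm1_nonneg[of "%y. \<beta> y - \<beta>' y"] nm1_nonneg[of "%y. \<alpha> y - \<alpha>' y"] by linarith
  have B2: "B \<le> B^2" "1 \<le> B^2" using B by (auto intro: self_le_power one_le_power)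
  have Db: "cmod (E l x - E' l x) \<le> 4 * B + 4" "cmod (P l x - P' l x) \<le> 4 * B + 4" for x
    using b[of l x] norm_triangle_ineq4[of "E l x" "E' l x"] norm_triangle_ineq4[of "P l x" "P' l x"] B by linarith+
  have "cmod (E l x - E' l x) \<le> 12 / 7 * (2 * d + nm1 \<beta>' * (2 * B * d))"
    by (rule forced_system_sup[OF i'(1-3) Db norm_ee norm_ee X Y F G])
  also have "\<dots> \<le> 12 / 7 * (2 * (B^2 * d) + 2 * (B^2 * d))"
  proof -
    have "1 * d \<le> B^2 * d" by (intro mult_right_mono B2 d0)
    moreover have "nm1 \<beta>' * (2 * B * d) \<le> B * (2 * B * d)" using i' d0 B by (intro mult_right_mono) auto
    ultimately show ?thesis by (simp add: power2_eq_square mult_ac)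
  qed
  also have "\<dots> \<le> 8 * B^2 * d" using d0 B2 by simp
  finally show "cmod (E l x - E' l x) \<le> 8 * B^2 * d" .
  have "cmod (P l x - P' l x) \<le> 12 / 7 * (2 * B * d + nm1 \<alpha>' * (2 * d))"
    by (rule forced_system_sup[OF i'(2,1) small' Db(2,1) norm_ee norm_ee Y X G F])
  also have "\<dots> \<le> 12 / 7 * (2 * (B^2 * d) + 2 * (B^2 * d))"
  proof -
    have "B * d \<le> B^2 * d" by (intro mult_right_mono B2 d0)
    moreover have "nm1 \<alpha>' * (2 * d) \<le> B * (2 * d)" using i' d0 B by (intro mult_right_mono) auto
    ultimately show ?thesis by (simp add: mult_ac)
  qed
  also have "\<dots> \<le> 8 * B^2 * d" using d0 B2 by simp
  finally show "cmod (P l x - P' l x) \<le> 8 * B^2 * d" .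
qed

definition l12 :: "(real => complex) => bool" where
  "l12 g \<longleftrightarrow> integrable lborel g \<and> sq_integrable g"

lemma l12_cmult: "l12 g \<Longrightarrow> l12 (%y. c * g y)"
  by (auto simp: l12_def norm_mult power_mult_distrib)

lemma l12_diff: "l12 f \<Longrightarrow> l12 g \<Longrightarrow> l12 (%y. f y - g y)"
  using square_integrable_diff1[of f g] by (auto simp: l12_def)

lemma zs_ok_l12: "zs_ok B \<alpha> \<beta> \<Longrightarrow> l12 \<alpha>" "zs_ok B \<alpha> \<beta> \<Longrightarrow> l12 \<beta>"
  by (auto simp: zs_ok_def l12_def)

text \<open>The three forcing terms of \<open>cumint_difference_identity\<close>. In the first two,
  \<open>p1\<close> and \<open>p1 - p3\<close> are indefinite integrals with dominated densities, so
  \<open>nsq_oscillatory\<close> charges \<open>g1\<close> and \<open>g2\<close> in L2. Of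
  \<open>Z\<close> only a norm in l is known, so \<open>dd\<close> is charged in L1.\<close>

lemma nsq_component:
  fixes h1 h3 p1 p3 Z :: "real => real => complex"
  assumes \<theta>: "osc \<theta>" and g: "l12 g1" "l12 g2" and dd: "integrable lborel dd"
    and h [measurable]: "jointly_borel h1"
      "jointly_borel h3"
      "jointly_borel Z"
    and p: "\<And>l y. p1 l y = c + cumint (h1 l) y" "\<And>l y. p3 l y = c + cumint (h3 l) y"
    and H1: "integrable lborel H1" "\<And>l y. cmod (h1 l y) \<le> H1 y" "(LBINT y. H1 y) \<le> M1"
    and H3: "integrable lborel H3" "\<And>l y. cmod (h3 l y) \<le> H3 y"
    and H13: "integrable lborel H13" "\<And>l y. cmod (h1 l y - h3 l y) \<le> H13 y" "(LBINT y. H13 y) \<le> M13"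
    and Z: "\<And>y. nsq (%l. Z l y) \<le> \<zeta>"
  shows "nsq (%l. cumint (%y. \<theta> l y * (g1 y * p1 l y)) x + cumint (%y. \<theta> l y * (g2 y * (p1 l y - p3 l y))) x
      + cumint (%y. \<theta> l y * (dd y * Z l y)) x)
    \<le> ennreal (8 * pi * ((cmod c)^2 + M1^2) * nm2 g1 + 8 * pi * M13^2 * nm2 g2) + ennreal (4 * (nm1 dd)^2) * \<zeta>"
proof -
  note osc_measurable[OF \<theta>, measurable]
  have [measurable]: "borel_fun g1" "borel_fun g2" "borel_fun dd"
    using g dd by (auto simp: l12_def)
  have [measurable]: "jointly_borel p1" "jointly_borel p3"
    unfolding p by measurable
  have hi: "integrable lborel (h1 l)" "integrable lborel (h3 l)" for l
    by (rule Bochner_Integration.integrable_bound[OF H1(1)], simp add: borel_section[OF h(1)],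
        intro AE_I2, use H1(2) in \<open>simp add: order_trans[OF _ abs_ge_self]\<close>)
       (rule Bochner_Integration.integrable_bound[OF H3(1)], simp add: borel_section[OF h(2)],
        intro AE_I2, use H3(2) in \<open>simp add: order_trans[OF _ abs_ge_self]\<close>)
  have p13: "p1 l y - p3 l y = 0 + cumint (%y. h1 l y - h3 l y) y" for l y
    unfolding p cumint_minus[OF hi] by simp
  have I0: "0 \<le> (LBINT y. H1 y)" "0 \<le> (LBINT y. H13 y)"
    by (auto intro!: Bochner_Integration.integral_nonneg order_trans[OF norm_ge_zero H1(2)] order_trans[OF norm_ge_zero H13(2)])
  let ?a = "%l. cumint (%y. \<theta> l y * (g1 y * p1 l y)) x"
  let ?b = "%l. cumint (%y. \<theta> l y * (g2 y * (p1 l y - p3 l y))) x"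
  let ?c = "%l. cumint (%y. \<theta> l y * (dd y * Z l y)) x"
  have na: "nsq ?a \<le> ennreal (2 * pi * ((cmod c)^2 + M1^2) * nm2 g1)"
  proof -
    have "nsq ?a \<le> ennreal (2 * pi * ((cmod c)^2 + (LBINT y. H1 y)^2) * nm2 g1)"
      by (rule nsq_oscillatory[OF _ _ \<theta> h(1) H1(1,2) p(1)]) (use g in \<open>auto simp: l12_def\<close>)
    also have "\<dots> \<le> ennreal (2 * pi * ((cmod c)^2 + M1^2) * nm2 g1)"
      using I0 H1(3) by (intro ennreal_leI mult_right_mono mult_left_mono add_left_mono power_mono) auto
    finally show ?thesis .
  qed
  have nb: "nsq ?b \<le> ennreal (2 * pi * M13^2 * nm2 g2)"
  proof -
    have "nsq ?b \<le> ennreal (2 * pi * ((cmod 0)^2 + (LBINT y. H13 y)^2) * nm2 g2)"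
      by (rule nsq_oscillatory[OF _ _ \<theta> _ H13(1,2) p13]) (use g in \<open>auto simp: l12_def\<close>)
    also have "\<dots> \<le> ennreal (2 * pi * M13^2 * nm2 g2)"
      using I0 H13(3) by (intro ennreal_leI) (auto intro!: mult_right_mono mult_left_mono power_mono)
    finally show ?thesis .
  qed
  have nc: "nsq ?c \<le> ennreal ((nm1 dd)^2) * \<zeta>"
    unfolding nm1_def
    by (rule nsq_cumint_le[where q=Z]) (use dd Z \<theta> in \<open>auto simp: norm_mult\<close>)
  have "nsq (%l. ?a l + ?b l + ?c l) \<le> 2 * nsq (%l. ?a l + ?b l) + 2 * nsq ?c"
    by (rule nsq_add) measurable
  also have "nsq (%l. ?a l + ?b l) \<le> 2 * nsq ?a + 2 * nsq ?b"
    by (rule nsq_add) measurable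
  finally have "nsq (%l. ?a l + ?b l + ?c l) \<le> 2 * (2 * nsq ?a + 2 * nsq ?b) + 2 * nsq ?c"
    by (simp add: mult_left_mono add_right_mono)
  also have "\<dots> \<le> 2 * (2 * ennreal (2 * pi * ((cmod c)^2 + M1^2) * nm2 g1) + 2 * ennreal (2 * pi * M13^2 * nm2 g2)) + 4 * (ennreal ((nm1 dd)^2) * \<zeta>)"
  proof (intro add_mono mult_left_mono na nb)
    have "2 * nsq ?c \<le> 4 * nsq ?c" by (intro mult_right_mono) auto
    also have "\<dots> \<le> 4 * (ennreal ((nm1 dd)^2) * \<zeta>)" by (intro mult_left_mono nc) auto
    finally show "2 * nsq ?c \<le> 4 * (ennreal ((nm1 dd)^2) * \<zeta>)" .
  qed auto
  also have "\<dots> = ennreal (8 * pi * ((cmod c)^2 + M1^2) * nm2 g1 + 8 * pi * M13^2 * nm2 g2) + ennreal (4 * (nm1 dd)^2) * \<zeta>"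
  proof -
    have "ennreal (8 * pi * ((cmod c)^2 + M1^2) * nm2 g1 + 8 * pi * M13^2 * nm2 g2)
      = ennreal (2 * (2 * (2 * pi * ((cmod c)^2 + M1^2) * nm2 g1) + 2 * (2 * pi * M13^2 * nm2 g2)))"
      by (simp add: algebra_simps)
    also have "\<dots> = 2 * (2 * ennreal (2 * pi * ((cmod c)^2 + M1^2) * nm2 g1) + 2 * ennreal (2 * pi * M13^2 * nm2 g2))"
    proof -
      have gen: "ennreal (2 * (2 * u + 2 * v)) = 2 * (2 * ennreal u + 2 * ennreal v)" if "0 \<le> u" "0 \<le> v" for u v
        using that by (simp add: ennreal_mult' ennreal_plus)
      show ?thesis by (rule gen) auto
    qed
    finally show ?thesis by (simp add: ennreal_mult' mult.assoc)
  qed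
  finally show ?thesis .
qed

text \<open>\<open>16800 = 21 * 800\<close>: the forcing costs \<open>800 * pi * B ^ 6\<close>, and
  \<open>7 + 14 * n^2 \<le> 21 * B^2\<close> comes from \<open>forced_system_nsq\<close>.\<close>

definition zs_const :: "real => real" where "zs_const B = 16800 * pi * B ^ 8"

text \<open>A product rule on the square of potentials: a second difference of solutions is driven
  by second differences of the potentials and by products of a first difference along 0-1 or 2-3 (in
  L2) with one along 0-2 or 1-3 (in L1). \<open>\<zeta>\<close> stays a parameter since it bounds
  first differences of solutions, which are themselves obtained from this lemma.\<close>

lemma zs_second_difference_aux:
  fixes \<alpha> \<beta> :: "nat => real => complex" and P E :: "nat => real => real => complex"
  assumes B: "1 \<le> B" and ok: "\<And>i. zs_ok B (\<alpha> i) (\<beta> i)" and sol: "\<And>i. zs_sol (\<alpha> i) (\<beta> i) (P i) (E i)"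
    and A1: "nm2 (%y. c1 * (\<alpha> 0 y - \<alpha> 1 y) - c2 * (\<alpha> 2 y - \<alpha> 3 y)) + nm2 (%y. c1 * (\<beta> 0 y - \<beta> 1 y) - c2 * (\<beta> 2 y - \<beta> 3 y)) \<le> A1"
    and A2: "nm2 (%y. c2 * (\<alpha> 2 y - \<alpha> 3 y)) + nm2 (%y. c2 * (\<beta> 2 y - \<beta> 3 y)) \<le> A2"
    and d02: "nm1 (%y. \<alpha> 0 y - \<alpha> 2 y) + nm1 (%y. \<beta> 0 y - \<beta> 2 y) \<le> d02"
    and d13: "nm1 (%y. \<alpha> 1 y - \<alpha> 3 y) + nm1 (%y. \<beta> 1 y - \<beta> 3 y) \<le> d13"
    and \<zeta>: "\<And>y. nsq (%l. c1 * (P 0 l y - P 1 l y)) \<le> \<zeta>" "\<And>y. nsq (%l. c1 * (E 0 l y - E 1 l y)) \<le> \<zeta>"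
  shows "nsq (%l. c1 * (P 0 l x - P 1 l x) - c2 * (P 2 l x - P 3 l x)) \<le> ennreal (zs_const B * (A1 + d02^2 * A2)) + ennreal (zs_const B * d13^2) * \<zeta>"
    and "nsq (%l. c1 * (E 0 l x - E 1 l x) - c2 * (E 2 l x - E 3 l x)) \<le> ennreal (zs_const B * (A1 + d02^2 * A2)) + ennreal (zs_const B * d13^2) * \<zeta>"
proof -
  have Pe: "\<And>i l x. P i l x = 1 + cumint (%y. ee (l * y) * (\<alpha> i y * E i l y)) x"
    and Ee: "\<And>i l x. E i l x = 0 + cumint (%y. ee (- (l * y)) * (\<beta> i y * P i l y)) x"
    and Pm [measurable]: "\<And>i. jointly_borel (P i)"
    and Em [measurable]: "\<And>i. jointly_borel (E i)"
    using sol unfolding zs_sol_def add_0 by blast+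
  have i: "integrable lborel (\<alpha> j)" "integrable lborel (\<beta> j)" "nm1 (\<alpha> j) \<le> B" "nm1 (\<beta> j) \<le> B" for j
    using ok[of j] by (auto simp: zs_ok_def)
  have [measurable]: "\<alpha> j \<in> borel_measurable borel" "\<beta> j \<in> borel_measurable borel" for j using i[of j] by auto
  note l12 = zs_ok_l12[OF ok]
  note b = zs_sol_bound[OF ok sol]
  note m = zs_sol_section[OF sol]
  note db = zs_diff_bound[OF ok sol B ok sol d02]
  have dnn: "0 \<le> d02" "0 \<le> d13"
    using d02 d13 nm1_nonneg[of "%y. \<alpha> 0 y - \<alpha> 2 y"] nm1_nonneg[of "%y. \<beta> 0 y - \<beta> 2 y"]
      nm1_nonneg[of "%y. \<alpha> 1 y - \<alpha> 3 y"] nm1_nonneg[of "%y. \<beta> 1 y - \<beta> 3 y"] by linarith+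
  have Ann: "0 \<le> A1" "0 \<le> A2"
    using A1 A2 nm2_nonneg order_trans add_nonneg_nonneg by meson+
  have B4: "1 \<le> B ^ 4" "B ^ 4 \<le> B ^ 6" "1 \<le> B ^ 6" "1 \<le> B^2" "B \<le> B ^ 3" "1 \<le> B ^ 3" "B^2 \<le> B ^ 8" "B^6 \<le> B^8" "1 \<le> B ^ 8"
    using B by (auto intro: power_increasing self_le_power)
  \<comment> \<open>\<open>800 = 8 * 10^2\<close>: \<open>10 * B ^ 3 * d02\<close> bounds the
    integrated density of \<open>p 0 - p 2\<close>, with \<open>2 * B * d02\<close> from the
    difference of the potentials and \<open>B * (8 * B^2 * d02)\<close> from
    \<open>zs_diff_bound\<close>.\<close>
  define a where "a = ennreal (800 * pi * B ^ 6 * (A1 + d02^2 * A2)) + ennreal (4 * d13^2) * \<zeta>"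
  define F where "F \<theta> b p l x = cumint (%y. \<theta> l y * ((c1 * (b 0 y - b 1 y) - c2 * (b 2 y - b 3 y)) * p 0 l y)) x
      + cumint (%y. \<theta> l y * ((c2 * (b 2 y - b 3 y)) * (p 0 l y - p 2 l y))) x
      + cumint (%y. \<theta> l y * ((b 1 y - b 3 y) * (c1 * (p 0 l y - p 1 l y)))) x"
    for \<theta> and b :: "nat => real => complex" and p :: "nat => real => real => complex" and l x
  have num: "ennreal (8 * pi * ((cmod c)^2 + (2 * B^2)^2) * n1 + 8 * pi * (10 * B ^ 3 * d02)^2 * n2) + ennreal (4 * e^2) * \<zeta> \<le> a"
    if "n1 \<le> A1" "n2 \<le> A2" "0 \<le> n1" "0 \<le> n2" "0 \<le> e" "e \<le> d13" "cmod c \<le> 1" for c :: complex and n1 n2 e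
  proof -
    have "(cmod c)^2 \<le> 1" using that by (simp add: power_le_one)
    then have "8 * pi * ((cmod c)^2 + (2 * B^2)^2) \<le> 8 * pi * (B ^ 4 + 4 * B ^ 4)"
      using B4 by (intro mult_left_mono add_mono) (auto simp: power_mult_distrib simp flip: power_mult)
    also have "\<dots> \<le> 8 * pi * (100 * B ^ 6)" using B4 by (intro mult_left_mono) auto
    also have "\<dots> = 800 * pi * B ^ 6" by simp
    finally have 1: "8 * pi * ((cmod c)^2 + (2 * B^2)^2) * n1 \<le> 800 * pi * B ^ 6 * A1"
      by (rule mult_mono[OF _ that(1)]) (use that B in simp_all)
    have "8 * pi * (10 * B ^ 3 * d02)^2 * n2 = 800 * pi * B ^ 6 * (d02^2 * n2)"
      by (simp add: power_mult_distrib flip: power_mult)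
    also have "\<dots> \<le> 800 * pi * B ^ 6 * (d02^2 * A2)"
      using that Ann B by (intro mult_left_mono) auto
    finally have 2: "8 * pi * (10 * B ^ 3 * d02)^2 * n2 \<le> 800 * pi * B ^ 6 * (d02^2 * A2)" .
    have "8 * pi * ((cmod c)^2 + (2 * B^2)^2) * n1 + 8 * pi * (10 * B ^ 3 * d02)^2 * n2 \<le> 800 * pi * B ^ 6 * (A1 + d02^2 * A2)"
      using add_mono[OF 1 2] by (simp only: distrib_left[of "800 * pi * B ^ 6"])
    moreover have "4 * e^2 \<le> 4 * d13^2" using that by (intro mult_left_mono power_mono) auto
    ultimately show ?thesis unfolding a_def by (intro add_mono mult_right_mono ennreal_leI) auto
  qed
  \<comment> \<open>Stated once for both equations: \<open>b\<close> is the potential of the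
    equation whose forcing is estimated, while \<open>b'\<close> and \<open>q\<close> belong to the
    other equation, which presents \<open>p\<close> as an indefinite integral.\<close>
  have Fbound: "nsq (%l. F \<theta> b p l x) \<le> a"
    if \<theta>: "osc \<theta>" and \<theta>': "osc \<theta>'" and bl: "\<And>j. l12 (b j)" and e: "\<And>l y. p 0 l y = c + cumint (%y. \<theta>' l y * (b' 0 y * q 0 l y)) y"
      "\<And>l y. p 2 l y = c + cumint (%y. \<theta>' l y * (b' 2 y * q 2 l y)) y"
      and c: "cmod c \<le> 1" and bi: "\<And>j. integrable lborel (b' j)" and bn: "\<And>j. nm1 (b' j) \<le> B"
      and qm [measurable]: "\<And>j. jointly_borel (q j)"
      and pm [measurable]: "\<And>j. jointly_borel (p j)"
      and qb: "\<And>j l y. cmod (q j l y) \<le> 2 * B" and qd: "\<And>l y. cmod (q 0 l y - q 2 l y) \<le> 8 * B^2 * d02"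
      and bd: "nm1 (%y. b' 0 y - b' 2 y) \<le> d02" and bd': "nm1 (%y. b 1 y - b 3 y) \<le> d13"
      and z: "\<And>y. nsq (%l. c1 * (p 0 l y - p 1 l y)) \<le> \<zeta>"
      and n1: "nm2 (%y. c1 * (b 0 y - b 1 y) - c2 * (b 2 y - b 3 y)) \<le> A1" and n2: "nm2 (%y. c2 * (b 2 y - b 3 y)) \<le> A2"
    for \<theta> \<theta>' b b' p q c x
  proof -
    note osc_measurable[OF \<theta>', measurable]
    have [measurable]: "b' j \<in> borel_measurable borel" for j using bi[of j] by auto
    have "nsq (%l. F \<theta> b p l x) \<le> ennreal (8 * pi * ((cmod c)^2 + (2 * B^2)^2) * nm2 (%y. c1 * (b 0 y - b 1 y) - c2 * (b 2 y - b 3 y))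
        + 8 * pi * (10 * B ^ 3 * d02)^2 * nm2 (%y. c2 * (b 2 y - b 3 y))) + ennreal (4 * (nm1 (%y. b 1 y - b 3 y))^2) * \<zeta>"
      unfolding F_def
    proof (rule nsq_component[OF \<theta> _ _ _ _ _ _ e, where \<zeta>=\<zeta>])
      show "l12 (%y. c1 * (b 0 y - b 1 y) - c2 * (b 2 y - b 3 y))" "l12 (%y. c2 * (b 2 y - b 3 y))"
        by (intro l12_diff l12_cmult bl)+
      show "integrable lborel (%y. b 1 y - b 3 y)" using l12_diff[OF bl bl, of 1 3] by (simp add: l12_def)
      show "integrable lborel (%y. cmod (b' 0 y) * (2 * B))" "integrable lborel (%y. cmod (b' 2 y) * (2 * B))" using bi by auto
      show "cmod (\<theta>' l y * (b' 0 y * q 0 l y)) \<le> cmod (b' 0 y) * (2 * B)" for l y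
        using qb \<theta>' by (simp add: norm_mult mult_left_mono)
      show "cmod (\<theta>' l y * (b' 2 y * q 2 l y)) \<le> cmod (b' 2 y) * (2 * B)" for l y
        using qb \<theta>' by (simp add: norm_mult mult_left_mono)
      have "(LBINT y. cmod (b' 0 y) * (2 * B)) = nm1 (b' 0) * (2 * B)" by (simp add: nm1_def)
      also have "\<dots> \<le> B * (2 * B)" using B by (intro mult_right_mono bn) auto
      finally show "(LBINT y. cmod (b' 0 y) * (2 * B)) \<le> 2 * B^2" by (simp add: power2_eq_square)
      let ?H = "%y. cmod (b' 0 y - b' 2 y) * (2 * B) + cmod (b' 2 y) * (8 * B^2 * d02)"
      show "integrable lborel ?H" using bi by auto
      show "cmod (\<theta>' l y * (b' 0 y * q 0 l y) - \<theta>' l y * (b' 2 y * q 2 l y)) \<le> ?H y" for l y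
      proof -
        have "\<theta>' l y * (b' 0 y * q 0 l y) - \<theta>' l y * (b' 2 y * q 2 l y) = \<theta>' l y * ((b' 0 y - b' 2 y) * q 0 l y + b' 2 y * (q 0 l y - q 2 l y))"
          by (simp add: algebra_simps)
        then have "cmod (\<theta>' l y * (b' 0 y * q 0 l y) - \<theta>' l y * (b' 2 y * q 2 l y)) = cmod ((b' 0 y - b' 2 y) * q 0 l y + b' 2 y * (q 0 l y - q 2 l y))"
          using \<theta>' by (simp add: norm_mult)
        also have "\<dots> \<le> ?H y"
          by (rule order_trans[OF norm_triangle_ineq]) (simp only: norm_mult, intro add_mono mult_left_mono qb qd norm_ge_zero)
        finally show ?thesis .
      qed
      have "(LBINT y. ?H y) = nm1 (%y. b' 0 y - b' 2 y) * (2 * B) + nm1 (b' 2) * (8 * B^2 * d02)"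
        using bi by (simp add: nm1_def)
      also have "\<dots> \<le> d02 * (2 * B) + B * (8 * B^2 * d02)"
        using B dnn by (intro add_mono mult_right_mono bd bn) auto
      also have "\<dots> \<le> d02 * (2 * B ^ 3) + B * (8 * B^2 * d02)" using B4 dnn B by (intro add_mono mult_left_mono) auto
      also have "\<dots> = 10 * B ^ 3 * d02" by (simp add: power3_eq_cube power2_eq_square)
      finally show "(LBINT y. ?H y) \<le> 10 * B ^ 3 * d02" .
    qed (use z in measurable)
    also have "\<dots> \<le> a" by (rule num[OF n1 n2 nm2_nonneg nm2_nonneg nm1_nonneg bd' c])
    finally show ?thesis .
  qed
  have n1s: "nm2 (%y. c1 * (\<alpha> 0 y - \<alpha> 1 y) - c2 * (\<alpha> 2 y - \<alpha> 3 y)) \<le> A1" "nm2 (%y. c1 * (\<beta> 0 y - \<beta> 1 y) - c2 * (\<beta> 2 y - \<beta> 3 y)) \<le> A1"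
     "nm2 (%y. c2 * (\<alpha> 2 y - \<alpha> 3 y)) \<le> A2" "nm2 (%y. c2 * (\<beta> 2 y - \<beta> 3 y)) \<le> A2"
     "nm1 (%y. \<alpha> 0 y - \<alpha> 2 y) \<le> d02" "nm1 (%y. \<beta> 0 y - \<beta> 2 y) \<le> d02" "nm1 (%y. \<alpha> 1 y - \<alpha> 3 y) \<le> d13" "nm1 (%y. \<beta> 1 y - \<beta> 3 y) \<le> d13"
    using A1 A2 d02 d13 nm1_nonneg[of "%y. \<alpha> 0 y - \<alpha> 2 y"] nm1_nonneg[of "%y. \<beta> 0 y - \<beta> 2 y"]
      nm1_nonneg[of "%y. \<alpha> 1 y - \<alpha> 3 y"] nm1_nonneg[of "%y. \<beta> 1 y - \<beta> 3 y"]
      nm2_nonneg[of "%y. c1 * (\<alpha> 0 y - \<alpha> 1 y) - c2 * (\<alpha> 2 y - \<alpha> 3 y)"] nm2_nonneg[of "%y. c1 * (\<beta> 0 y - \<beta> 1 y) - c2 * (\<beta> 2 y - \<beta> 3 y)"]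
      nm2_nonneg[of "%y. c2 * (\<alpha> 2 y - \<alpha> 3 y)"] nm2_nonneg[of "%y. c2 * (\<beta> 2 y - \<beta> 3 y)"] by linarith+
  have Pb: "cmod (P j l y) \<le> 2 * B" for j l y using b(1)[of j l y] B by linarith
  have FE: "nsq (%l. F (%l y. ee (- (l * y))) \<beta> P l x) \<le> a" for x
    by (rule Fbound[OF osc_ee(2) osc_ee(1) l12(2) Pe[of 0] Pe[of 2] _ i(1) i(3) Em Pm b(2) db(2) n1s(5) n1s(8) \<zeta>(1) n1s(2) n1s(4)]) simp
  have FP: "nsq (%l. F (%l y. ee (l * y)) \<alpha> E l x) \<le> a" for x
    by (rule Fbound[OF osc_ee(1) osc_ee(2) l12(1) Ee[of 0] Ee[of 2] _ i(2) i(4) Pm Em Pb db(1) n1s(6) n1s(7) \<zeta>(2) n1s(1) n1s(3)]) simp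
  define X where "X l x = c1 * (E 0 l x - E 1 l x) - c2 * (E 2 l x - E 3 l x)" for l x
  define Y where "Y l x = c1 * (P 0 l x - P 1 l x) - c2 * (P 2 l x - P 3 l x)" for l x
  have [measurable]: "jointly_borel X" "jointly_borel Y"
    unfolding X_def Y_def by measurable
  have ee1: "borel_fun (%y. ee (l * y))" "borel_fun (%y. ee (- (l * y)))" for l by measurable
  have X: "X l x = F (%l y. ee (- (l * y))) \<beta> P l x + cumint (%y. ee (- (l * y)) * (\<beta> 3 y * Y l y)) x" for l x
    unfolding X_def Y_def F_def Ee add_0
    by (rule cumint_difference_identity[OF i(2) i(2) i(2) i(2) m(1) m(1) m(1) m(1) b(1) b(1) b(1) b(1) ee1(2) norm_ee])
  have Y: "Y l x = F (%l y. ee (l * y)) \<alpha> E l x + cumint (%y. ee (l * y) * (\<alpha> 3 y * X l y)) x" for l x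
    unfolding X_def Y_def F_def Pe add_diff_add[of 1 _ 1] diff_self add_0
    by (rule cumint_difference_identity[OF i(1) i(1) i(1) i(1) m(2) m(2) m(2) m(2) b(2) b(2) b(2) b(2) ee1(1) norm_ee])
  have comb: "cmod (c1 * (u - v) - c2 * (w - z)) \<le> cmod c1 * (4 * B) + cmod c2 * (4 * B)"
    if "cmod u \<le> 2 * B" "cmod v \<le> 2 * B" "cmod w \<le> 2 * B" "cmod z \<le> 2 * B" for u v w z
  proof -
    have "cmod (c1 * (u - v) - c2 * (w - z)) \<le> cmod c1 * cmod (u - v) + cmod c2 * cmod (w - z)"
      using norm_triangle_ineq4[of "c1 * (u - v)" "c2 * (w - z)"] by (simp add: norm_mult)
    also have "\<dots> \<le> cmod c1 * (4 * B) + cmod c2 * (4 * B)"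
      using norm_triangle_ineq4[of u v] norm_triangle_ineq4[of w z] that by (intro add_mono mult_left_mono) auto
    finally show ?thesis .
  qed
  have Xb: "cmod (X l x) \<le> cmod c1 * (4 * B) + cmod c2 * (4 * B)" for l x unfolding X_def by (rule comb; rule b)
  have Yb: "cmod (Y l x) \<le> cmod c1 * (4 * B) + cmod c2 * (4 * B)" for l x unfolding Y_def by (rule comb; rule Pb)
  have Fm: "borel_fun (%l. F (%l y. ee (- (l * y))) \<beta> P l x)" "borel_fun (%l. F (%l y. ee (l * y)) \<alpha> E l x)" for x
    unfolding F_def by measurable
  have fin: "7 * a + ennreal (14 * n^2) * a \<le> ennreal (zs_const B * (A1 + d02^2 * A2)) + ennreal (zs_const B * d13^2) * \<zeta>"
    if "0 \<le> n" "n \<le> B" for n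
  proof -
    have "n^2 \<le> B^2" using that by (intro power_mono) auto
    have "7 * a + ennreal (14 * n^2) * a = ennreal (7 + 14 * n^2) * a"
      by (simp add: ennreal_plus distrib_right)
    also have "\<dots> \<le> ennreal (21 * B^2) * a"
      using \<open>n\<^sup>2 \<le> B^2\<close> B4 by (intro mult_right_mono ennreal_leI) auto
    also have "\<dots> = ennreal (21 * B^2 * (800 * pi * B ^ 6 * (A1 + d02^2 * A2))) + ennreal (21 * B^2 * (4 * d13^2)) * \<zeta>"
      unfolding a_def using Ann B by (simp add: distrib_left mult.assoc[symmetric] ennreal_mult'[symmetric])
    also have "21 * B^2 * (800 * pi * B ^ 6 * (A1 + d02^2 * A2)) = zs_const B * (A1 + d02^2 * A2)"
      by (simp add: zs_const_def power_add[symmetric])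
    also have "ennreal (21 * B^2 * (4 * d13^2)) * \<zeta> \<le> ennreal (zs_const B * d13^2) * \<zeta>"
    proof (intro mult_right_mono ennreal_leI)
      have "84 * B^2 \<le> 16800 * 1 * B ^ 8" using B4 by simp
      also have "\<dots> \<le> 16800 * pi * B ^ 8" using pi_gt3 B by (intro mult_right_mono mult_left_mono) auto
      finally have "84 * B^2 * d13^2 \<le> 16800 * pi * B ^ 8 * d13^2" by (rule mult_right_mono) auto
      then show "21 * B^2 * (4 * d13^2) \<le> zs_const B * d13^2" by (simp add: zs_const_def)
    qed auto
    finally show ?thesis by (simp add: add_left_mono)
  qed
  have sm: "nm1 (\<alpha> 3) * nm1 (\<beta> 3) \<le> 5 / 12" "nm1 (\<beta> 3) * nm1 (\<alpha> 3) \<le> 5 / 12" using ok[of 3] by (auto simp: zs_ok_def mult.commute)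
  have "nsq (%l. X l x) \<le> 7 * a + ennreal (14 * (nm1 (\<beta> 3))^2) * a"
    by (rule forced_system_nsq[OF i(1) i(2) sm(1) _ _ Fm osc_ee(2) osc_ee(1) Xb X Y FE FP]) measurable
  also have "\<dots> \<le> ennreal (zs_const B * (A1 + d02^2 * A2)) + ennreal (zs_const B * d13^2) * \<zeta>" by (rule fin) (use i in auto)
  finally show "nsq (%l. c1 * (E 0 l x - E 1 l x) - c2 * (E 2 l x - E 3 l x)) \<le> \<dots>" by (simp only: X_def)
  have "nsq (%l. Y l x) \<le> 7 * a + ennreal (14 * (nm1 (\<alpha> 3))^2) * a"
    by (rule forced_system_nsq[OF i(2) i(1) sm(2) _ _ Fm(2) Fm(1) osc_ee(1) osc_ee(2) Yb Y X FP FE]) measurable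
  also have "\<dots> \<le> ennreal (zs_const B * (A1 + d02^2 * A2)) + ennreal (zs_const B * d13^2) * \<zeta>" by (rule fin) (use i in auto)
  finally show "nsq (%l. c1 * (P 0 l x - P 1 l x) - c2 * (P 2 l x - P 3 l x)) \<le> \<dots>" by (simp only: Y_def)
qed

section \<open>Limits at infinity and their quotient\<close>

definition zs_PE :: "(real => complex) => (real => complex) => (real => real => complex) \<times> (real => real => complex)" where
  "zs_PE \<alpha> \<beta> = (SOME (P, E). zs_sol \<alpha> \<beta> P E)"

definition zs_P where "zs_P \<alpha> \<beta> = fst (zs_PE \<alpha> \<beta>)"
definition zs_E where "zs_E \<alpha> \<beta> = snd (zs_PE \<alpha> \<beta>)"

lemma zs_sol_PE:
  assumes "zs_ok B \<alpha> \<beta>"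
  shows "zs_sol \<alpha> \<beta> (zs_P \<alpha> \<beta>) (zs_E \<alpha> \<beta>)"
proof -
  obtain P E where "zs_sol \<alpha> \<beta> P E"
    using assms zs_sol_exists[of \<alpha> \<beta>] by (auto simp: zs_ok_def)
  then have "case (P, E) of (P, E) => zs_sol \<alpha> \<beta> P E" by simp
  then have "case (zs_PE \<alpha> \<beta>) of (P, E) => zs_sol \<alpha> \<beta> P E"
    unfolding zs_PE_def by (rule someI)
  then show ?thesis by (simp add: zs_P_def zs_E_def case_prod_beta)
qed

text \<open>The limits of \<open>zs_P\<close> and \<open>zs_E\<close> at infinity, see
  \<open>zs_limits\<close>; up to constants their quotient becomes a reflection coefficient.\<close>

definition zs_a where "zs_a \<alpha> \<beta> l = 1 + (LBINT y. ee (l * y) * (\<alpha> y * zs_E \<alpha> \<beta> l y))"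
definition zs_b where "zs_b \<alpha> \<beta> l = (LBINT y. ee (- (l * y)) * (\<beta> y * zs_P \<alpha> \<beta> l y))"
definition zs_rho where "zs_rho \<alpha> \<beta> l = zs_b \<alpha> \<beta> l / zs_a \<alpha> \<beta> l"

lemma zs_tendsto:
  assumes ok: "zs_ok B \<alpha> \<beta>" and sol: "zs_sol \<alpha> \<beta> P E"
  shows "(P l \<longlongrightarrow> 1 + (LBINT y. ee (l * y) * (\<alpha> y * E l y))) at_top"
    and "(E l \<longlongrightarrow> (LBINT y. ee (- (l * y)) * (\<beta> y * P l y))) at_top"
proof -
  have i: "integrable lborel \<alpha>" "integrable lborel \<beta>" using ok by (auto simp: zs_ok_def)
  have P: "\<And>l x. P l x = 1 + cumint (%y. ee (l * y) * (\<alpha> y * E l y)) x"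
    and E: "\<And>l x. E l x = cumint (%y. ee (- (l * y)) * (\<beta> y * P l y)) x"
    using sol unfolding zs_sol_def by blast+
  have "((%x. 1 + cumint (%y. ee (l * y) * (\<alpha> y * E l y)) x) \<longlongrightarrow> 1 + (LBINT y. ee (l * y) * (\<alpha> y * E l y))) at_top"
    by (intro tendsto_add tendsto_const cumint_tendsto_top zs_integrable(2)[OF ok sol i(1) osc_ee(1)])
  then show "(P l \<longlongrightarrow> 1 + (LBINT y. ee (l * y) * (\<alpha> y * E l y))) at_top"
    by (simp only: P[symmetric])
  have "((%x. cumint (%y. ee (- (l * y)) * (\<beta> y * P l y)) x) \<longlongrightarrow> (LBINT y. ee (- (l * y)) * (\<beta> y * P l y))) at_top"
    by (intro cumint_tendsto_top zs_integrable(1)[OF ok sol i(2) osc_ee(2)])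
  then show "(E l \<longlongrightarrow> (LBINT y. ee (- (l * y)) * (\<beta> y * P l y))) at_top"
    by (simp only: E[symmetric])
qed

lemma zs_limits:
  assumes ok: "zs_ok B \<alpha> \<beta>"
  shows "(zs_P \<alpha> \<beta> l \<longlongrightarrow> zs_a \<alpha> \<beta> l) at_top" "(zs_E \<alpha> \<beta> l \<longlongrightarrow> zs_b \<alpha> \<beta> l) at_top"
  unfolding zs_a_def zs_b_def using zs_tendsto[OF ok zs_sol_PE[OF ok]] by auto

lemma zs_PE_measurable:
  assumes ok: "zs_ok B \<alpha> \<beta>"
  shows "borel_fun (%l. zs_P \<alpha> \<beta> l x)" "borel_fun (%l. zs_E \<alpha> \<beta> l x)"
proof -
  have [measurable]: "jointly_borel (zs_P \<alpha> \<beta>)"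
    "jointly_borel (zs_E \<alpha> \<beta>)"
    using zs_sol_PE[OF ok] unfolding zs_sol_def by blast+
  show "borel_fun (%l. zs_P \<alpha> \<beta> l x)" "borel_fun (%l. zs_E \<alpha> \<beta> l x)"
    by measurable
qed

lemma nsq_mult_le:
  assumes "borel_fun f" "\<And>l. cmod (r l) \<le> B" "0 \<le> B"
  shows "nsq (%l. r l * f l) \<le> ennreal (B^2) * nsq f"
  by (rule nsq_bounded_mult[OF assms(1) _ assms(3)]) (simp add: norm_mult mult_right_mono assms)

lemma zs_limits_seq:
  assumes ok: "zs_ok B \<alpha> \<beta>"
  shows "(%n. zs_P \<alpha> \<beta> l (real n)) \<longlonglongrightarrow> zs_a \<alpha> \<beta> l" "(%n. zs_E \<alpha> \<beta> l (real n)) \<longlonglongrightarrow> zs_b \<alpha> \<beta> l"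
  using filterlim_compose[OF zs_limits(1)[OF ok] filterlim_real_sequentially]
    filterlim_compose[OF zs_limits(2)[OF ok] filterlim_real_sequentially] by auto

lemma zs_ab_measurable:
  assumes ok: "zs_ok B \<alpha> \<beta>"
  shows "zs_a \<alpha> \<beta> \<in> borel_measurable borel" "zs_b \<alpha> \<beta> \<in> borel_measurable borel"
proof -
  note sol = zs_sol_PE[OF ok]
  have [measurable]: "jointly_borel (zs_P \<alpha> \<beta>)"
    "jointly_borel (zs_E \<alpha> \<beta>)"
    using sol unfolding zs_sol_def by blast+
  have [measurable]: "borel_fun \<alpha>" "borel_fun \<beta>" using ok by (auto simp: zs_ok_def)
  show "zs_a \<alpha> \<beta> \<in> borel_measurable borel" "zs_b \<alpha> \<beta> \<in> borel_measurable borel"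
    unfolding zs_a_def zs_b_def by measurable
qed

text \<open>E is bounded by \<open>12 / 7 * nm1 \<beta>\<close>, so P deviates from 1 by at most
  \<open>12 / 7 * (5 / 12) = 5 / 7\<close>. This holds for every real l, so the denominator of
  \<open>zs_rho\<close> has no zeros for either sign of z.\<close>

lemma zs_a_lower: assumes ok: "zs_ok B \<alpha> \<beta>" shows "2 / 7 \<le> cmod (zs_a \<alpha> \<beta> l)"
proof -
  note sol = zs_sol_PE[OF ok]
  let ?P = "zs_P \<alpha> \<beta>" and ?E = "zs_E \<alpha> \<beta>"
  from sol obtain D where D: "\<And>l x. cmod (?P l x) \<le> D" "\<And>l x. cmod (?E l x) \<le> D"
    unfolding zs_sol_def by blast
  have P: "\<And>l x. ?P l x = 1 + cumint (%y. ee (l * y) * (\<alpha> y * ?E l y)) x"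
    and E: "\<And>l x. ?E l x = 0 + cumint (%y. ee (- (l * y)) * (\<beta> y * ?P l y)) x"
    using sol unfolding zs_sol_def add_0 by blast+
  have i: "integrable lborel \<alpha>" "integrable lborel \<beta>" and sm: "nm1 \<alpha> * nm1 \<beta> \<le> 5 / 12" using ok by (auto simp: zs_ok_def)
  define M where "M = 12 / 7 * (0 + nm1 \<beta> * 1)"
  have Eb: "cmod (?E l x) \<le> M" for x
    unfolding M_def by (rule forced_system_sup[OF i sm D(2,1) norm_ee norm_ee E P]) simp_all
  have "cmod (1 - ?P l x) \<le> 5 / 7" for x
  proof -
    have "cmod (cumint (%y. ee (l * y) * (\<alpha> y * ?E l y)) x) \<le> (LBINT y. cmod (\<alpha> y) * M)"
      by (rule cumint_norm_le_integral) (use i Eb in \<open>simp_all add: norm_mult mult_left_mono\<close>)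
    also have "\<dots> = (nm1 \<alpha> * nm1 \<beta>) * (12 / 7)" by (simp add: nm1_def M_def)
    also have "\<dots> \<le> 5 / 12 * (12 / 7)" by (rule mult_right_mono[OF sm]) simp
    finally have "cmod (cumint (%y. ee (l * y) * (\<alpha> y * ?E l y)) x) \<le> 5 / 7" by simp
    then show ?thesis unfolding P[of l x] by simp
  qed
  then have "cmod (1 - zs_a \<alpha> \<beta> l) \<le> 5 / 7"
    by (intro LIMSEQ_le_const2[OF tendsto_norm[OF tendsto_diff[OF tendsto_const zs_limits_seq(1)[OF ok]]]]) auto
  then show ?thesis using norm_triangle_ineq2[of 1 "1 - zs_a \<alpha> \<beta> l"] by simp
qed

lemma zs_ab_bound:
  assumes ok: "zs_ok B \<alpha> \<beta>"
  shows "cmod (zs_a \<alpha> \<beta> l) \<le> 2" "cmod (zs_b \<alpha> \<beta> l) \<le> 2 * B"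
  using zs_sol_bound[OF ok zs_sol_PE[OF ok]]
  by (auto intro!: LIMSEQ_le_const2[OF tendsto_norm[OF zs_limits_seq(1)[OF ok]]]
     LIMSEQ_le_const2[OF tendsto_norm[OF zs_limits_seq(2)[OF ok]]])

lemma zs_ab_diff_bound:
  assumes ok: "zs_ok B \<alpha> \<beta>" and B: "1 \<le> B" and ok': "zs_ok B \<alpha>' \<beta>'"
    and d: "nm1 (%y. \<alpha> y - \<alpha>' y) + nm1 (%y. \<beta> y - \<beta>' y) \<le> d"
  shows "cmod (zs_a \<alpha> \<beta> l - zs_a \<alpha>' \<beta>' l) \<le> 8 * B^2 * d" "cmod (zs_b \<alpha> \<beta> l - zs_b \<alpha>' \<beta>' l) \<le> 8 * B^2 * d"
  using zs_diff_bound[OF ok zs_sol_PE[OF ok] B ok' zs_sol_PE[OF ok'] d]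
  by (auto intro!: LIMSEQ_le_const2[OF tendsto_norm[OF tendsto_diff[OF zs_limits_seq(1)[OF ok] zs_limits_seq(1)[OF ok']]]]
     LIMSEQ_le_const2[OF tendsto_norm[OF tendsto_diff[OF zs_limits_seq(2)[OF ok] zs_limits_seq(2)[OF ok']]]])

lemma zs_const_ge_1: "1 \<le> B \<Longrightarrow> 1 \<le> zs_const B"
proof -
  assume "1 \<le> B"
  then have "1 \<le> B ^ 8" by simp
  then have "1 * 1 \<le> 16800 * pi * B ^ 8" using pi_gt3 by (intro mult_mono) auto
  then show ?thesis by (simp add: zs_const_def)
qed

text \<open>The degenerate square 0, 1, 0, 1 with \<open>c2 = 0\<close> in
  \<open>zs_second_difference_aux\<close>: both L1 distances vanish, and \<open>\<zeta>\<close> may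
  be taken infinite because \<open>0 * \<top> = 0\<close> in \<open>ennreal\<close>.\<close>

lemma zs_sol_first_difference:
  fixes \<alpha> \<beta> :: "nat => real => complex" and P E :: "nat => real => real => complex"
  assumes B: "1 \<le> B" and ok: "\<And>i. zs_ok B (\<alpha> i) (\<beta> i)" and sol: "\<And>i. zs_sol (\<alpha> i) (\<beta> i) (P i) (E i)"
    and A: "nm2 (%y. c * (\<alpha> 0 y - \<alpha> 1 y)) + nm2 (%y. c * (\<beta> 0 y - \<beta> 1 y)) \<le> A"
  shows "nsq (%l. c * (P 0 l x - P 1 l x)) \<le> ennreal (zs_const B * A)"
    and "nsq (%l. c * (E 0 l x - E 1 l x)) \<le> ennreal (zs_const B * A)"
proof -
  let ?f = "%i::nat. if even i then 0 else 1 :: nat"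
  have z: "nm1 (%y. 0) = 0" "nm2 (%y. 0) = 0" by (simp_all add: nm1_def nm2_def)
  have "nsq (%l. c * (P (?f 0) l x - P (?f 1) l x) - 0 * (P (?f 2) l x - P (?f 3) l x)) \<le> ennreal (zs_const B * (A + 0^2 * 0)) + ennreal (zs_const B * 0^2) * \<top>"
    by (rule zs_second_difference_aux(1)[where \<alpha>="%i. \<alpha> (?f i)" and \<beta>="%i. \<beta> (?f i)" and P="%i. P (?f i)" and E="%i. E (?f i)", OF B ok sol])
       (use A in \<open>simp_all add: z\<close>)
  then show "nsq (%l. c * (P 0 l x - P 1 l x)) \<le> ennreal (zs_const B * A)" by simp
  have "nsq (%l. c * (E (?f 0) l x - E (?f 1) l x) - 0 * (E (?f 2) l x - E (?f 3) l x)) \<le> ennreal (zs_const B * (A + 0^2 * 0)) + ennreal (zs_const B * 0^2) * \<top>"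
    by (rule zs_second_difference_aux(2)[where \<alpha>="%i. \<alpha> (?f i)" and \<beta>="%i. \<beta> (?f i)" and P="%i. P (?f i)" and E="%i. E (?f i)", OF B ok sol])
       (use A in \<open>simp_all add: z\<close>)
  then show "nsq (%l. c * (E 0 l x - E 1 l x)) \<le> ennreal (zs_const B * A)" by simp
qed

lemma zs_ab_first_difference:
  fixes \<alpha> \<beta> :: "nat => real => complex"
  assumes B: "1 \<le> B" and ok: "\<And>i. zs_ok B (\<alpha> i) (\<beta> i)"
    and A: "nm2 (%y. c * (\<alpha> 0 y - \<alpha> 1 y)) + nm2 (%y. c * (\<beta> 0 y - \<beta> 1 y)) \<le> A"
  shows "nsq (%l. c * (zs_a (\<alpha> 0) (\<beta> 0) l - zs_a (\<alpha> 1) (\<beta> 1) l)) \<le> ennreal (zs_const B * A)"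
    and "nsq (%l. c * (zs_b (\<alpha> 0) (\<beta> 0) l - zs_b (\<alpha> 1) (\<beta> 1) l)) \<le> ennreal (zs_const B * A)"
proof -
  note sol = zs_sol_PE[OF ok]
  have [measurable]: "borel_fun (%l. zs_P (\<alpha> i) (\<beta> i) l x)" "borel_fun (%l. zs_E (\<alpha> i) (\<beta> i) l x)" for i x
    by (rule zs_PE_measurable[OF ok])+
  show "nsq (%l. c * (zs_a (\<alpha> 0) (\<beta> 0) l - zs_a (\<alpha> 1) (\<beta> 1) l)) \<le> ennreal (zs_const B * A)"
    by (rule nsq_liminf[OF _ tendsto_mult[OF tendsto_const tendsto_diff[OF zs_limits_seq(1)[OF ok] zs_limits_seq(1)[OF ok]]]
        zs_sol_first_difference(1)[OF B ok sol A]]) measurable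
  show "nsq (%l. c * (zs_b (\<alpha> 0) (\<beta> 0) l - zs_b (\<alpha> 1) (\<beta> 1) l)) \<le> ennreal (zs_const B * A)"
    by (rule nsq_liminf[OF _ tendsto_mult[OF tendsto_const tendsto_diff[OF zs_limits_seq(2)[OF ok] zs_limits_seq(2)[OF ok]]]
        zs_sol_first_difference(2)[OF B ok sol A]]) measurable
qed

text \<open>The first-difference bound is inserted for \<open>\<zeta>\<close>, which brings in
  \<open>A3\<close>; Fatou's lemma along \<open>x = n\<close> carries the estimate from P and E to
  their limits.\<close>

lemma zs_ab_second_difference:
  fixes \<alpha> \<beta> :: "nat => real => complex"
  assumes B: "1 \<le> B" and ok: "\<And>i. zs_ok B (\<alpha> i) (\<beta> i)"
    and A1: "nm2 (%y. c1 * (\<alpha> 0 y - \<alpha> 1 y) - c2 * (\<alpha> 2 y - \<alpha> 3 y)) + nm2 (%y. c1 * (\<beta> 0 y - \<beta> 1 y) - c2 * (\<beta> 2 y - \<beta> 3 y)) \<le> A1"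
    and A2: "nm2 (%y. c2 * (\<alpha> 2 y - \<alpha> 3 y)) + nm2 (%y. c2 * (\<beta> 2 y - \<beta> 3 y)) \<le> A2"
    and A3: "nm2 (%y. c1 * (\<alpha> 0 y - \<alpha> 1 y)) + nm2 (%y. c1 * (\<beta> 0 y - \<beta> 1 y)) \<le> A3"
    and d02: "nm1 (%y. \<alpha> 0 y - \<alpha> 2 y) + nm1 (%y. \<beta> 0 y - \<beta> 2 y) \<le> d02"
    and d13: "nm1 (%y. \<alpha> 1 y - \<alpha> 3 y) + nm1 (%y. \<beta> 1 y - \<beta> 3 y) \<le> d13"
  defines "S \<equiv> A1 + d02^2 * A2 + d13^2 * A3"
  shows "nsq (%l. c1 * (zs_a (\<alpha> 0) (\<beta> 0) l - zs_a (\<alpha> 1) (\<beta> 1) l) - c2 * (zs_a (\<alpha> 2) (\<beta> 2) l - zs_a (\<alpha> 3) (\<beta> 3) l)) \<le> ennreal ((zs_const B)^2 * S)"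
    and "nsq (%l. c1 * (zs_b (\<alpha> 0) (\<beta> 0) l - zs_b (\<alpha> 1) (\<beta> 1) l) - c2 * (zs_b (\<alpha> 2) (\<beta> 2) l - zs_b (\<alpha> 3) (\<beta> 3) l)) \<le> ennreal ((zs_const B)^2 * S)"
proof -
  note sol = zs_sol_PE[OF ok]
  define K where "K = zs_const B"
  have K: "1 \<le> K" unfolding K_def by (rule zs_const_ge_1[OF B])
  have Ann: "0 \<le> A1" "0 \<le> A2" "0 \<le> A3"
    using A1 A2 A3 nm2_nonneg order_trans add_nonneg_nonneg by meson+
  have [measurable]: "borel_fun (%l. zs_P (\<alpha> i) (\<beta> i) l x)" "borel_fun (%l. zs_E (\<alpha> i) (\<beta> i) l x)" for i x
    by (rule zs_PE_measurable[OF ok])+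
  have S: "ennreal (zs_const B * (A1 + d02^2 * A2)) + ennreal (zs_const B * d13^2) * ennreal (zs_const B * A3) \<le> ennreal ((zs_const B)^2 * S)"
  proof -
    have "ennreal (zs_const B * (A1 + d02^2 * A2)) + ennreal (zs_const B * d13^2) * ennreal (zs_const B * A3)
      = ennreal (K * (A1 + d02^2 * A2) + K * d13^2 * (K * A3))"
      unfolding K_def[symmetric] using K Ann by (subst ennreal_mult'[symmetric], simp, subst ennreal_plus[symmetric]) auto
    also have "\<dots> \<le> ennreal (K^2 * (A1 + d02^2 * A2) + K^2 * (d13^2 * A3))"
    proof (intro ennreal_leI add_mono mult_right_mono)
      show "K \<le> K^2" using K by (simp add: power2_eq_square)
      show "K * d13^2 * (K * A3) \<le> K^2 * (d13^2 * A3)" by (simp add: power2_eq_square)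
    qed (use Ann in auto)
    finally show ?thesis by (simp add: S_def K_def distrib_left)
  qed
  note f = zs_sol_first_difference[OF B ok sol A3]
  show "nsq (%l. c1 * (zs_a (\<alpha> 0) (\<beta> 0) l - zs_a (\<alpha> 1) (\<beta> 1) l) - c2 * (zs_a (\<alpha> 2) (\<beta> 2) l - zs_a (\<alpha> 3) (\<beta> 3) l)) \<le> ennreal ((zs_const B)^2 * S)"
    by (rule nsq_liminf[OF _ tendsto_diff[OF tendsto_mult[OF tendsto_const tendsto_diff[OF zs_limits_seq(1)[OF ok] zs_limits_seq(1)[OF ok]]]
          tendsto_mult[OF tendsto_const tendsto_diff[OF zs_limits_seq(1)[OF ok] zs_limits_seq(1)[OF ok]]]]
        order_trans[OF zs_second_difference_aux(1)[OF B ok sol A1 A2 d02 d13 f] S]]) measurable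
  show "nsq (%l. c1 * (zs_b (\<alpha> 0) (\<beta> 0) l - zs_b (\<alpha> 1) (\<beta> 1) l) - c2 * (zs_b (\<alpha> 2) (\<beta> 2) l - zs_b (\<alpha> 3) (\<beta> 3) l)) \<le> ennreal ((zs_const B)^2 * S)"
    by (rule nsq_liminf[OF _ tendsto_diff[OF tendsto_mult[OF tendsto_const tendsto_diff[OF zs_limits_seq(2)[OF ok] zs_limits_seq(2)[OF ok]]]
          tendsto_mult[OF tendsto_const tendsto_diff[OF zs_limits_seq(2)[OF ok] zs_limits_seq(2)[OF ok]]]]
        order_trans[OF zs_second_difference_aux(2)[OF B ok sol A1 A2 d02 d13 f] S]]) measurable
qed

lemma zs_rho_measurable:
  assumes ok: "zs_ok B \<alpha> \<beta>" shows "zs_rho \<alpha> \<beta> \<in> borel_measurable borel"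
proof -
  note [measurable] = zs_ab_measurable[OF ok]
  show ?thesis unfolding zs_rho_def[abs_def] by measurable
qed

lemma zs_rho_bound:
  assumes ok: "zs_ok B \<alpha> \<beta>" shows "cmod (zs_rho \<alpha> \<beta> l) \<le> 7 * B"
proof -
  have "cmod (zs_b \<alpha> \<beta> l) / cmod (zs_a \<alpha> \<beta> l) \<le> (2 * B) / (2 / 7)"
    using zs_ab_bound(2)[OF ok, of l] zs_a_lower[OF ok, of l] order_trans[OF norm_ge_zero zs_ab_bound(2)[OF ok, of l]]
    by (intro frac_le) auto
  then show ?thesis by (simp add: zs_rho_def norm_divide)
qed

lemma zs_divide_le:
  assumes ok: "zs_ok B \<alpha> \<beta>" shows "cmod (v / zs_a \<alpha> \<beta> l) \<le> 7 / 2 * cmod v"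
proof -
  have "cmod v / cmod (zs_a \<alpha> \<beta> l) \<le> cmod v / (2 / 7)"
    using zs_a_lower[OF ok, of l] by (intro divide_left_mono) auto
  then show ?thesis by (simp add: norm_divide)
qed

lemma zs_rho_difference:
  assumes ok: "zs_ok B \<alpha> \<beta>" and ok': "zs_ok B \<alpha>' \<beta>'"
  shows "zs_rho \<alpha> \<beta> l - zs_rho \<alpha>' \<beta>' l =
    ((zs_b \<alpha> \<beta> l - zs_b \<alpha>' \<beta>' l) - zs_rho \<alpha>' \<beta>' l * (zs_a \<alpha> \<beta> l - zs_a \<alpha>' \<beta>' l)) / zs_a \<alpha> \<beta> l"
proof -
  have "zs_a \<alpha> \<beta> l \<noteq> 0" "zs_a \<alpha>' \<beta>' l \<noteq> 0" using zs_a_lower[OF ok, of l] zs_a_lower[OF ok', of l] by auto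
  then show ?thesis by (simp add: zs_rho_def field_simps)
qed

text \<open>\<open>224 = 7 / 2 * (8 + 7 * 8)\<close>, with \<open>7 / 2\<close> from
  \<open>zs_a_lower\<close>, \<open>7 * B\<close> from \<open>zs_rho_bound\<close> and 8 from
  \<open>zs_ab_diff_bound\<close>.\<close>

lemma zs_rho_diff_bound:
  assumes ok: "zs_ok B \<alpha> \<beta>" and B: "1 \<le> B" and ok': "zs_ok B \<alpha>' \<beta>'"
    and d: "nm1 (%y. \<alpha> y - \<alpha>' y) + nm1 (%y. \<beta> y - \<beta>' y) \<le> d"
  shows "cmod (zs_rho \<alpha> \<beta> l - zs_rho \<alpha>' \<beta>' l) \<le> 224 * B ^ 3 * d"
proof -
  have d0: "0 \<le> d" using d nm1_nonneg[of "%y. \<alpha> y - \<alpha>' y"] nm1_nonneg[of "%y. \<beta> y - \<beta>' y"] by linarith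
  note db = zs_ab_diff_bound[OF ok B ok' d]
  have "cmod (zs_rho \<alpha> \<beta> l - zs_rho \<alpha>' \<beta>' l) \<le> 7 / 2 * cmod ((zs_b \<alpha> \<beta> l - zs_b \<alpha>' \<beta>' l) - zs_rho \<alpha>' \<beta>' l * (zs_a \<alpha> \<beta> l - zs_a \<alpha>' \<beta>' l))"
    unfolding zs_rho_difference[OF ok ok'] by (rule zs_divide_le[OF ok])
  also have "\<dots> \<le> 7 / 2 * (8 * B^2 * d + 7 * B * (8 * B^2 * d))"
  proof (rule mult_left_mono)
    have "cmod (zs_rho \<alpha>' \<beta>' l * (zs_a \<alpha> \<beta> l - zs_a \<alpha>' \<beta>' l)) \<le> 7 * B * (8 * B^2 * d)"
      unfolding norm_mult by (rule mult_mono[OF zs_rho_bound[OF ok'] db(1)]) (use B in auto)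
    then show "cmod ((zs_b \<alpha> \<beta> l - zs_b \<alpha>' \<beta>' l) - zs_rho \<alpha>' \<beta>' l * (zs_a \<alpha> \<beta> l - zs_a \<alpha>' \<beta>' l)) \<le> 8 * B^2 * d + 7 * B * (8 * B^2 * d)"
      by (intro order_trans[OF norm_triangle_ineq4 add_mono[OF db(2)]])
  qed simp
  also have "\<dots> \<le> 7 / 2 * (8 * B ^ 3 * d + 7 * B * (8 * B^2 * d))"
    using B d0 by (intro mult_left_mono add_mono mult_right_mono power_increasing) auto
  also have "\<dots> = 224 * B ^ 3 * d" by (simp add: power2_eq_square power3_eq_cube)
  finally show ?thesis .
qed

text \<open>The constant is \<open>(7 / 2)^2 * (2 + 2 * 49 * B^2)\<close>, rounded up by means of
  \<open>1 \<le> B\<close>.\<close>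

lemma zs_rho_first_difference:
  fixes \<alpha> \<beta> :: "nat => real => complex"
  assumes B: "1 \<le> B" and ok: "\<And>i. zs_ok B (\<alpha> i) (\<beta> i)"
    and A: "nm2 (%y. c * (\<alpha> 0 y - \<alpha> 1 y)) + nm2 (%y. c * (\<beta> 0 y - \<beta> 1 y)) \<le> A"
  shows "nsq (%l. c * (zs_rho (\<alpha> 0) (\<beta> 0) l - zs_rho (\<alpha> 1) (\<beta> 1) l)) \<le> ennreal (1225 * B^2 * zs_const B * A)"
proof -
  note [measurable] = zs_ab_measurable[OF ok] zs_rho_measurable[OF ok]
  have A0: "0 \<le> A" using A nm2_nonneg order_trans add_nonneg_nonneg by meson
  have K: "1 \<le> zs_const B" by (rule zs_const_ge_1[OF B])
  let ?b = "%l. c * (zs_b (\<alpha> 0) (\<beta> 0) l - zs_b (\<alpha> 1) (\<beta> 1) l)"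
  let ?a = "%l. c * (zs_a (\<alpha> 0) (\<beta> 0) l - zs_a (\<alpha> 1) (\<beta> 1) l)"
  let ?r = "zs_rho (\<alpha> 1) (\<beta> 1)"
  have e: "c * (zs_rho (\<alpha> 0) (\<beta> 0) l - zs_rho (\<alpha> 1) (\<beta> 1) l) = (?b l - ?r l * ?a l) / zs_a (\<alpha> 0) (\<beta> 0) l" for l
    unfolding zs_rho_difference[OF ok ok] by (simp add: algebra_simps)
  have "nsq (%l. c * (zs_rho (\<alpha> 0) (\<beta> 0) l - zs_rho (\<alpha> 1) (\<beta> 1) l)) \<le> ennreal ((7 / 2)^2) * nsq (%l. ?b l - ?r l * ?a l)"
    unfolding e by (rule nsq_bounded_mult) (use zs_divide_le[OF ok] in auto)
  also have "\<dots> \<le> ennreal ((7 / 2)^2) * (2 * nsq ?b + 2 * nsq (%l. ?r l * ?a l))"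
    by (intro mult_left_mono nsq_diff) auto
  also have "\<dots> \<le> ennreal ((7 / 2)^2) * (2 * ennreal (zs_const B * A) + 2 * (ennreal ((7 * B)^2) * ennreal (zs_const B * A)))"
  proof (intro mult_left_mono add_mono zs_ab_first_difference(2)[OF B ok A])
    have "nsq (%l. ?r l * ?a l) \<le> ennreal ((7 * B)^2) * nsq ?a"
      by (rule nsq_mult_le[OF _ zs_rho_bound[OF ok]]) (use B in auto)
    also have "\<dots> \<le> ennreal ((7 * B)^2) * ennreal (zs_const B * A)"
      by (intro mult_left_mono zs_ab_first_difference(1)[OF B ok A]) auto
    finally show "nsq (%l. ?r l * ?a l) \<le> \<dots>" .
  qed auto
  also have "\<dots> = ennreal ((7 / 2)^2 * (2 * (zs_const B * A) + 2 * ((7 * B)^2 * (zs_const B * A))))"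
  proof -
    have gen: "ennreal x * (2 * ennreal y + 2 * (ennreal z * ennreal y)) = ennreal (x * (2 * y + 2 * (z * y)))" if "0 \<le> x" "0 \<le> y" "0 \<le> z" for x y z
      using that by (simp add: ennreal_mult ennreal_plus)
    show ?thesis by (rule gen) (use A0 K in auto)
  qed
  also have "\<dots> \<le> ennreal (1225 * B^2 * zs_const B * A)"
  proof (rule ennreal_leI)
    have "(7 / 2)^2 * (2 * (zs_const B * A) + 2 * ((7 * B)^2 * (zs_const B * A))) = (49 / 2 + 2401 / 2 * B^2) * (zs_const B * A)"
      by (simp add: power_mult_distrib power_divide algebra_simps)
    also have "\<dots> \<le> (49 / 2 * B^2 + 2401 / 2 * B^2) * (zs_const B * A)"
      using A0 K B by (intro mult_right_mono add_right_mono) auto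
    finally show "(7 / 2)^2 * (2 * (zs_const B * A) + 2 * ((7 * B)^2 * (zs_const B * A))) \<le> 1225 * B^2 * zs_const B * A"
      by (simp add: algebra_simps)
  qed
  finally show ?thesis .
qed

text \<open>One summand for each of the four terms in the numerator of
  \<open>zs_rho_second_difference\<close>; \<open>49 = 4 * (7 / 2)^2\<close>, where 4 stems from two
  nested triangle inequalities.\<close>

definition rho_const :: "real => real" where
  "rho_const B = 49 * ((zs_const B)^2 + (8 * B^2)^2 * (1225 * B^2 * zs_const B) + (224 * B ^ 3)^2 * zs_const B + (7 * B)^2 * (zs_const B)^2)"

text \<open>Since \<open>b = \<rho> * a\<close>, the second difference of \<open>\<rho>\<close>
  times \<open>a 0\<close> is that of \<open>b\<close> minus \<open>\<rho> 3\<close> times that of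
  \<open>a\<close> and minus two products of first differences, one along each direction of the
  square. Differences along 0-2 and 1-3 are bounded uniformly in l, those along 0-1 and 2-3 in
  norm.\<close>

lemma zs_rho_second_difference:
  fixes \<alpha> \<beta> :: "nat => real => complex"
  assumes B: "1 \<le> B" and ok: "\<And>i. zs_ok B (\<alpha> i) (\<beta> i)"
    and A1: "nm2 (%y. c1 * (\<alpha> 0 y - \<alpha> 1 y) - c2 * (\<alpha> 2 y - \<alpha> 3 y)) + nm2 (%y. c1 * (\<beta> 0 y - \<beta> 1 y) - c2 * (\<beta> 2 y - \<beta> 3 y)) \<le> A1"
    and A2: "nm2 (%y. c2 * (\<alpha> 2 y - \<alpha> 3 y)) + nm2 (%y. c2 * (\<beta> 2 y - \<beta> 3 y)) \<le> A2"
    and A3: "nm2 (%y. c1 * (\<alpha> 0 y - \<alpha> 1 y)) + nm2 (%y. c1 * (\<beta> 0 y - \<beta> 1 y)) \<le> A3"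
    and d02: "nm1 (%y. \<alpha> 0 y - \<alpha> 2 y) + nm1 (%y. \<beta> 0 y - \<beta> 2 y) \<le> d02"
    and d13: "nm1 (%y. \<alpha> 1 y - \<alpha> 3 y) + nm1 (%y. \<beta> 1 y - \<beta> 3 y) \<le> d13"
  shows "nsq (%l. c1 * (zs_rho (\<alpha> 0) (\<beta> 0) l - zs_rho (\<alpha> 1) (\<beta> 1) l) - c2 * (zs_rho (\<alpha> 2) (\<beta> 2) l - zs_rho (\<alpha> 3) (\<beta> 3) l))
     \<le> ennreal (rho_const B * (A1 + d02^2 * A2 + d13^2 * A3))"
proof -
  note [measurable] = zs_ab_measurable[OF ok] zs_rho_measurable[OF ok]
  define S where "S = A1 + d02^2 * A2 + d13^2 * A3"
  define K where "K = zs_const B"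
  have K: "1 \<le> K" unfolding K_def by (rule zs_const_ge_1[OF B])
  have Ann: "0 \<le> A1" "0 \<le> A2" "0 \<le> A3"
    using A1 A2 A3 nm2_nonneg order_trans add_nonneg_nonneg by meson+
  have dnn: "0 \<le> d02" "0 \<le> d13"
    using d02 d13 nm1_nonneg order_trans add_nonneg_nonneg by meson+
  have S: "0 \<le> S" "d02^2 * A2 \<le> S" "d13^2 * A3 \<le> S" using Ann by (auto simp: S_def)
  let ?\<rho> = "%i l. zs_rho (\<alpha> i) (\<beta> i) l" and ?a = "%i l. zs_a (\<alpha> i) (\<beta> i) l" and ?b = "%i l. zs_b (\<alpha> i) (\<beta> i) l"
  let ?A = "%l. c1 * (?a 0 l - ?a 1 l) - c2 * (?a 2 l - ?a 3 l)"
  let ?B = "%l. c1 * (?b 0 l - ?b 1 l) - c2 * (?b 2 l - ?b 3 l)"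
  let ?t1 = "%l. (?a 0 l - ?a 2 l) * (c2 * (?\<rho> 2 l - ?\<rho> 3 l))"
  let ?t2 = "%l. (?\<rho> 1 l - ?\<rho> 3 l) * (c1 * (?a 0 l - ?a 1 l))"
  let ?t3 = "%l. ?\<rho> 3 l * ?A l"
  have e: "c1 * (?\<rho> 0 l - ?\<rho> 1 l) - c2 * (?\<rho> 2 l - ?\<rho> 3 l) = ((?B l - ?t1 l) - (?t2 l + ?t3 l)) / ?a 0 l" for l
  proof -
    have nz: "?a i l \<noteq> 0" for i using zs_a_lower[OF ok, of i l] by auto
    have b: "?b i l = ?\<rho> i l * ?a i l" for i using nz[of i] by (simp add: zs_rho_def)
    have "(?B l - ?t1 l) - (?t2 l + ?t3 l) = (c1 * (?\<rho> 0 l - ?\<rho> 1 l) - c2 * (?\<rho> 2 l - ?\<rho> 3 l)) * ?a 0 l"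
      unfolding b by (simp add: algebra_simps)
    then show ?thesis using nz[of 0] by (simp add: field_simps)
  qed
  have t0: "nsq ?B \<le> ennreal (K^2 * S)" "nsq ?A \<le> ennreal (K^2 * S)"
    unfolding K_def S_def using zs_ab_second_difference[OF B ok A1 A2 A3 d02 d13] by auto
  have t1: "nsq ?t1 \<le> ennreal ((8 * B^2)^2 * (1225 * B^2 * K) * S)"
  proof -
    have "nsq ?t1 \<le> ennreal ((8 * B^2 * d02)^2) * nsq (%l. c2 * (?\<rho> 2 l - ?\<rho> 3 l))"
      by (rule nsq_mult_le[OF _ zs_ab_diff_bound(1)[OF ok B ok d02]]) (use dnn in auto)
    also have "\<dots> \<le> ennreal ((8 * B^2 * d02)^2) * ennreal (1225 * B^2 * K * A2)"
      using zs_rho_first_difference[where \<alpha>="%i. \<alpha> (i + 2)" and \<beta>="%i. \<beta> (i + 2)" and c=c2 and A=A2, OF B ok] A2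
      by (intro mult_left_mono) (auto simp: K_def numeral_3_eq_3 numeral_2_eq_2)
    also have "\<dots> = ennreal ((8 * B^2)^2 * (1225 * B^2 * K) * (d02^2 * A2))"
      by (subst ennreal_mult'[symmetric]) (auto simp: power_mult_distrib mult_ac)
    also have "\<dots> \<le> ennreal ((8 * B^2)^2 * (1225 * B^2 * K) * S)"
      using K B S by (intro ennreal_leI mult_left_mono) auto
    finally show ?thesis .
  qed
  have t2: "nsq ?t2 \<le> ennreal ((224 * B ^ 3)^2 * K * S)"
  proof -
    have "nsq ?t2 \<le> ennreal ((224 * B ^ 3 * d13)^2) * nsq (%l. c1 * (?a 0 l - ?a 1 l))"
      by (rule nsq_mult_le[OF _ zs_rho_diff_bound[OF ok B ok d13]]) (use dnn B in auto)
    also have "\<dots> \<le> ennreal ((224 * B ^ 3 * d13)^2) * ennreal (K * A3)"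
      unfolding K_def by (intro mult_left_mono zs_ab_first_difference(1)[OF B ok A3]) auto
    also have "\<dots> = ennreal ((224 * B ^ 3)^2 * K * (d13^2 * A3))"
      by (subst ennreal_mult'[symmetric]) (auto simp: power_mult_distrib mult_ac)
    also have "\<dots> \<le> ennreal ((224 * B ^ 3)^2 * K * S)"
      using K B S by (intro ennreal_leI mult_left_mono) auto
    finally show ?thesis .
  qed
  have t3: "nsq ?t3 \<le> ennreal ((7 * B)^2 * K^2 * S)"
  proof -
    have "nsq ?t3 \<le> ennreal ((7 * B)^2) * nsq ?A"
      by (rule nsq_mult_le[OF _ zs_rho_bound[OF ok]]) (use B in auto)
    also have "\<dots> \<le> ennreal ((7 * B)^2) * ennreal (K^2 * S)"
      by (intro mult_left_mono t0) auto
    also have "\<dots> = ennreal ((7 * B)^2 * K^2 * S)"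
      by (subst ennreal_mult'[symmetric]) (auto simp: mult_ac)
    finally show ?thesis .
  qed
  have "nsq (%l. c1 * (?\<rho> 0 l - ?\<rho> 1 l) - c2 * (?\<rho> 2 l - ?\<rho> 3 l)) \<le> ennreal ((7 / 2)^2) * nsq (%l. (?B l - ?t1 l) - (?t2 l + ?t3 l))"
    unfolding e by (rule nsq_bounded_mult) (use zs_divide_le[OF ok] in auto)
  also have "\<dots> \<le> ennreal ((7 / 2)^2) * (2 * (2 * nsq ?B + 2 * nsq ?t1) + 2 * (2 * nsq ?t2 + 2 * nsq ?t3))"
    by (intro mult_left_mono order_trans[OF nsq_diff] add_mono nsq_diff nsq_add) auto
  also have "\<dots> \<le> ennreal ((7 / 2)^2) * (2 * (2 * ennreal (K^2 * S) + 2 * ennreal ((8 * B^2)^2 * (1225 * B^2 * K) * S))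
     + 2 * (2 * ennreal ((224 * B ^ 3)^2 * K * S) + 2 * ennreal ((7 * B)^2 * K^2 * S)))"
    by (intro mult_left_mono add_mono t0 t1 t2 t3) auto
  also have "\<dots> = ennreal ((7 / 2)^2 * (2 * (2 * (K^2 * S) + 2 * ((8 * B^2)^2 * (1225 * B^2 * K) * S))
     + 2 * (2 * ((224 * B ^ 3)^2 * K * S) + 2 * ((7 * B)^2 * K^2 * S))))"
  proof -
    have gen: "ennreal x * (2 * (2 * ennreal y + 2 * ennreal z) + 2 * (2 * ennreal u + 2 * ennreal v)) = ennreal (x * (2 * (2 * y + 2 * z) + 2 * (2 * u + 2 * v)))"
      if "0 \<le> x" "0 \<le> y" "0 \<le> z" "0 \<le> u" "0 \<le> v" for x y z u v
      using that by (simp add: ennreal_mult ennreal_plus)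
    show ?thesis by (rule gen) (use S K B in auto)
  qed
  also have "\<dots> = ennreal (rho_const B * S)"
    by (simp add: rho_const_def K_def[symmetric] power_divide algebra_simps)
  finally show ?thesis unfolding S_def .
qed

section \<open>Translation in the spectral parameter\<close>

text \<open>Modulation. Applied to \<open>\<alpha>\<close> with h and to \<open>\<beta>\<close> with
  -h it shifts l by h, the signs being opposite because the phases are
  (\<open>zs_rho_shift\<close>).\<close>

definition md :: "real => (real => complex) => real => complex" where
  "md h f y = ee (h * y) * f y"

lemma md_measurable [measurable]: "f \<in> borel_measurable borel \<Longrightarrow> md h f \<in> borel_measurable borel"
  unfolding md_def[abs_def] by measurable

lemma nm_md [simp]: "nm1 (md h f) = nm1 f" "nm2 (md h f) = nm2 f"
  by (simp_all add: nm1_def nm2_def md_def norm_mult)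

lemma md_diff: "(%y. md h f y - md h g y) = md h (%y. f y - g y)"
  by (auto simp: md_def algebra_simps)

lemma md_integrable: "integrable lborel f \<Longrightarrow> integrable lborel (md h f)"
  unfolding md_def[abs_def] by (rule integrable_bounded_mult(2)[where B=1]) auto

lemma zs_ok_md: "zs_ok B \<alpha> \<beta> \<Longrightarrow> zs_ok B (md h \<alpha>) (md k \<beta>)"
  by (auto simp: zs_ok_def md_integrable) (simp_all add: md_def norm_mult)

text \<open>\<open>zs_diff_bound\<close> at distance 0; it asks for \<open>1 \<le> B\<close>, whence
  the maximum in the proof.\<close>

lemma zs_sol_unique:
  assumes ok: "zs_ok B \<alpha> \<beta>" and sol: "zs_sol \<alpha> \<beta> P E" and sol': "zs_sol \<alpha> \<beta> P' E'"
  shows "P l x = P' l x" "E l x = E' l x"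
proof -
  have ok': "zs_ok (max 1 B) \<alpha> \<beta>" using ok by (auto simp: zs_ok_def)
  have d: "nm1 (%y. \<alpha> y - \<alpha> y) + nm1 (%y. \<beta> y - \<beta> y) \<le> 0" by (simp add: nm1_def)
  show "P l x = P' l x" "E l x = E' l x"
    using zs_diff_bound[OF ok' sol _ ok' sol' d, of l x] by simp_all
qed

lemma zs_sol_md:
  assumes sol: "zs_sol \<alpha> \<beta> P E"
  shows "zs_sol (md h \<alpha>) (md (- h) \<beta>) (%l. P (l + h)) (%l. E (l + h))"
proof -
  have [measurable]: "jointly_borel P"
    "jointly_borel E"
    using sol unfolding zs_sol_def by blast+
  have P: "\<And>l x. P l x = 1 + cumint (%y. ee (l * y) * (\<alpha> y * E l y)) x"
    and E: "\<And>l x. E l x = cumint (%y. ee (- (l * y)) * (\<beta> y * P l y)) x"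
    using sol unfolding zs_sol_def by blast+
  obtain D where D: "\<forall>l x. cmod (P l x) \<le> D \<and> cmod (E l x) \<le> D" using sol unfolding zs_sol_def by blast
  show ?thesis
    unfolding zs_sol_def
  proof (intro conjI allI)
    show "\<exists>D. \<forall>l x. cmod (P (l + h) x) \<le> D \<and> cmod (E (l + h) x) \<le> D" using D by blast
    show "P (l + h) x = 1 + cumint (%y. ee (l * y) * (md h \<alpha> y * E (l + h) y)) x" for l x
      by (subst P) (simp add: md_def ee_add distrib_right mult.assoc)
    have "ee (- ((l + h) * y)) = ee (- (l * y)) * ee (- h * y)" for l y
      by (simp add: ee_add[symmetric] algebra_simps)
    then show "E (l + h) x = cumint (%y. ee (- (l * y)) * (md (- h) \<beta> y * P (l + h) y)) x" for l x
      by (subst E) (simp add: md_def mult.assoc)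
  qed measurable
qed

lemma zs_rho_shift:
  assumes ok: "zs_ok B \<alpha> \<beta>"
  shows "zs_rho (md h \<alpha>) (md (- h) \<beta>) l = zs_rho \<alpha> \<beta> (l + h)"
proof -
  note okh = zs_ok_md[OF ok, of h "- h"]
  have "zs_P (md h \<alpha>) (md (- h) \<beta>) l = zs_P \<alpha> \<beta> (l + h)" "zs_E (md h \<alpha>) (md (- h) \<beta>) l = zs_E \<alpha> \<beta> (l + h)"
    using zs_sol_unique[OF okh zs_sol_PE[OF okh] zs_sol_md[OF zs_sol_PE[OF ok]]] by auto
  then have "zs_a (md h \<alpha>) (md (- h) \<beta>) l = zs_a \<alpha> \<beta> (l + h)" "zs_b (md h \<alpha>) (md (- h) \<beta>) l = zs_b \<alpha> \<beta> (l + h)"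
    using zs_limits(1)[OF okh, of l] zs_limits(1)[OF ok, of "l + h"]
      zs_limits(2)[OF okh, of l] zs_limits(2)[OF ok, of "l + h"]
    by (auto intro: tendsto_unique[OF trivial_limit_at_top_linorder])
  then show ?thesis by (simp add: zs_rho_def)
qed

lemma norm_ee_minus_1: "cmod (ee t - 1) \<le> 2 * \<bar>t\<bar>"
proof -
  have "(cmod (ee t - 1))^2 = (cos (2 * t) - 1)^2 + (sin (2 * t))^2"
    by (simp add: ee_def cmod_power2)
  also have "\<dots> = 2 - 2 * cos (2 * t)"
    using sin_cos_squared_add[of "2 * t"] by (simp add: power2_diff)
  also have "\<dots> = (2 * \<bar>sin t\<bar>)^2" by (simp add: cos_double_sin power_mult_distrib)
  finally have "cmod (ee t - 1) = 2 * \<bar>sin t\<bar>" by (rule power2_eq_imp_eq) auto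
  then show ?thesis using abs_sin_x_le_abs_x[of t] by simp
qed

lemma ee_diff_quotient_tendsto:
  assumes "h \<longlonglongrightarrow> 0" "\<And>n. h n \<noteq> (0::real)"
  shows "(%n. (ee (h n * y) - 1) / of_real (h n)) \<longlonglongrightarrow> 2 * \<i> * of_real y"
proof -
  have "((%t. exp (2 * \<i> * of_real y * t)) has_field_derivative 2 * \<i> * of_real y * exp (2 * \<i> * of_real y * 0)) (at 0)"
    by (auto intro!: derivative_eq_intros)
  then have "((%t. (exp (2 * \<i> * of_real y * t) - 1) / t) \<longlongrightarrow> 2 * \<i> * of_real y) (at 0)"
    by (simp add: has_field_derivative_iff)
  moreover have "filterlim (%n. complex_of_real (h n)) (at 0) sequentially"
    using assms by (auto simp: filterlim_at intro!: tendsto_of_real[where a=0, simplified])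
  ultimately have "(%n. (exp (2 * \<i> * of_real y * of_real (h n)) - 1) / of_real (h n)) \<longlonglongrightarrow> 2 * \<i> * of_real y"
    by (rule filterlim_compose)
  moreover have "exp (2 * \<i> * of_real y * of_real (h n)) = ee (h n * y)" for n
    by (simp add: ee_def cis_conv_exp mult_ac)
  ultimately show ?thesis by simp
qed

definition hs :: "nat => real" where "hs n = 1 / real (Suc n)"

lemma hs: "hs \<longlonglongrightarrow> 0" "hs n \<noteq> 0" "hs n > 0" "1 / hs n = real (Suc n)"
  unfolding hs_def using LIMSEQ_inverse_real_of_nat by (auto simp: inverse_eq_divide simp del: of_nat_Suc)

text \<open>
  Differentiability in \<open>L^2\<close>, along the fixed sequence of increments \<open>1 / (n + 1)\<close>. Unlike weak
  derivatives, difference quotients of \<^const>\<open>zs_rho\<close> can be estimated directly, because a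
  translation in the spectral parameter is a modulation of the potentials.
\<close>

definition l2_deriv :: "(real => complex) => (real => complex) => bool" where
  "l2_deriv f g \<longleftrightarrow> g \<in> borel_measurable borel \<and>
     (\<exists>\<epsilon>. \<epsilon> \<longlonglongrightarrow> 0 \<and> (\<forall>n. nsq (%l. of_real (1 / hs n) * (f (l + hs n) - f l) - g l) \<le> ennreal (\<epsilon> n)))"

lemma nsq_liminf_AE:
  assumes [measurable]: "\<And>n. f n \<in> borel_measurable borel"
    and lim: "AE l in lborel. (%n. f n l) \<longlonglongrightarrow> g l" and C: "(%n. nsq (f n)) \<longlonglongrightarrow> C \<or> (\<forall>n. nsq (f n) \<le> C)"
  shows "nsq g \<le> C"
proof -
  have "nsq g \<le> (\<integral>\<^sup>+ l. liminf (%n. ennreal ((cmod (f n l))^2)) \<partial>lborel)"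
    unfolding nsq_def
  proof (rule nn_integral_mono_AE, use lim in eventually_elim)
    fix l assume "(%n. f n l) \<longlonglongrightarrow> g l"
    then have "(%n. ennreal ((cmod (f n l))^2)) \<longlonglongrightarrow> ennreal ((cmod (g l))^2)"
      by (intro tendsto_intros)
    then show "ennreal ((cmod (g l))^2) \<le> liminf (%n. ennreal ((cmod (f n l))^2))"
      by (metis lim_imp_Liminf sequentially_bot order_refl)
  qed
  also have "\<dots> \<le> liminf (%n. nsq (f n))"
    unfolding nsq_def by (rule nn_integral_liminf) measurable
  also have "\<dots> \<le> C"
    using C
  proof
    assume "(%n. nsq (f n)) \<longlonglongrightarrow> C"
    then show ?thesis by (metis lim_imp_Liminf sequentially_bot order_refl)
  qed (auto intro!: Liminf_le)
  finally show ?thesis .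
qed

text \<open>The standard normal law is a probability measure with positive density at most 1. Hence
  its L1 distances are controlled by \<open>nsq\<close>, a subsequence converges almost everywhere
  for Lebesgue measure too, and Fatou's lemma gives back the bound in \<open>nsq\<close>.\<close>

lemma L2_complete:
  fixes f :: "nat => real => complex"
  assumes [measurable]: "\<And>n. f n \<in> borel_measurable borel"
    and bd: "\<And>n. \<exists>D. \<forall>l. cmod (f n l) \<le> D"
    and \<epsilon>: "\<epsilon> \<longlonglongrightarrow> 0" and c: "\<And>n m. nsq (%l. f n l - f m l) \<le> ennreal (\<epsilon> n + \<epsilon> m)"
  obtains g where "borel_fun g" "\<And>n. nsq (%l. f n l - g l) \<le> ennreal (\<epsilon> n)"
proof -
  let ?M = "std_normal_distribution"
  interpret prob_space ?M by (rule prob_space_normal_density) simp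
  have fi: "integrable ?M (f n)" for n
  proof -
    obtain D where "\<forall>l. cmod (f n l) \<le> D" using bd by blast
    then show ?thesis by (intro integrable_const_bound[where B=D]) auto
  qed
  have L1: "(\<integral>l. cmod (f i l - f j l) \<partial>?M) \<le> sqrt (max 0 (\<epsilon> i + \<epsilon> j))" for i j
  proof -
    have int: "integrable ?M (%l. cmod (f i l - f j l))" using fi by auto
    obtain D where D: "\<forall>l. cmod (f i l) \<le> D" using bd by blast
    obtain D' where D': "\<forall>l. cmod (f j l) \<le> D'" using bd by blast
    have b: "cmod (f i l - f j l) \<le> D + D'" for l
      using D D' norm_triangle_ineq4[of "f i l" "f j l"] by (meson add_mono order_trans)
    have int2: "integrable ?M (%l. (cmod (f i l - f j l))^2)"
      by (rule integrable_const_bound[where B="(D + D')^2"]) (use b in \<open>auto intro!: power_mono\<close>)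
    \<comment> \<open>Jensen's inequality, in the form that a variance is nonnegative.\<close>
    have sq: "(\<integral>l. cmod (f i l - f j l) \<partial>?M)^2 \<le> (\<integral>l. (cmod (f i l - f j l))^2 \<partial>?M)"
      using variance_positive[of "%l. cmod (f i l - f j l)"] variance_eq[OF int int2] by linarith
    have "ennreal (\<integral>l. (cmod (f i l - f j l))^2 \<partial>?M) = (\<integral>\<^sup>+l. ennreal ((cmod (f i l - f j l))^2) \<partial>?M)"
      by (rule nn_integral_eq_integral[symmetric]) (use int2 in auto)
    also have "\<dots> = (\<integral>\<^sup>+l. ennreal (std_normal_density l) * ennreal ((cmod (f i l - f j l))^2) \<partial>lborel)"
      by (subst nn_integral_density) auto
    also have "\<dots> \<le> nsq (%l. f i l - f j l)"
      unfolding nsq_def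
    proof (rule nn_integral_mono)
      fix l :: real
      have "std_normal_density l \<le> 1"
      proof -
        have "1 / sqrt (2 * pi) \<le> 1" using pi_gt3 by simp
        moreover have "exp (- l\<^sup>2 / 2) \<le> 1" by simp
        ultimately have "1 / sqrt (2 * pi) * exp (- l\<^sup>2 / 2) \<le> 1 * 1" by (intro mult_mono) auto
        then show ?thesis by (simp add: normal_density_def)
      qed
      then have "ennreal (std_normal_density l) * ennreal ((cmod (f i l - f j l))^2) \<le> 1 * ennreal ((cmod (f i l - f j l))^2)"
        by (intro mult_right_mono) auto
      then show "ennreal (std_normal_density l) * ennreal ((cmod (f i l - f j l))^2) \<le> ennreal ((cmod (f i l - f j l))^2)" by simp
    qed
    also have "\<dots> \<le> ennreal (\<epsilon> i + \<epsilon> j)" by (rule c)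
    also have "\<dots> \<le> ennreal (max 0 (\<epsilon> i + \<epsilon> j))" by (rule ennreal_leI) simp
    finally have "(\<integral>l. (cmod (f i l - f j l))^2 \<partial>?M) \<le> max 0 (\<epsilon> i + \<epsilon> j)"
      by (subst (asm) ennreal_le_iff) auto
    with sq have "(\<integral>l. cmod (f i l - f j l) \<partial>?M)^2 \<le> max 0 (\<epsilon> i + \<epsilon> j)" by (rule order_trans)
    then show ?thesis by (rule real_le_rsqrt)
  qed
  have "\<exists>N. \<forall>i\<ge>N. \<forall>j\<ge>N. (\<integral>l. norm (f i l - f j l) \<partial>?M) < e" if "e > 0" for e
  proof -
    have "eventually (%n. \<epsilon> n < e^2 / 2) sequentially"
      using \<epsilon> by (rule order_tendstoD(2)) (use that in auto)
    then obtain N where N: "\<And>n. n \<ge> N \<Longrightarrow> \<epsilon> n < e^2 / 2" by (auto simp: eventually_sequentially)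
    show ?thesis
    proof (intro exI allI impI)
      fix i j assume "N \<le> i" "N \<le> j"
      then have "max 0 (\<epsilon> i + \<epsilon> j) < e^2" using N[of i] N[of j] that by (simp add: max_def)
      then have "sqrt (max 0 (\<epsilon> i + \<epsilon> j)) < e" using that by (metis abs_of_pos real_sqrt_abs real_sqrt_less_iff)
      then show "(\<integral>l. norm (f i l - f j l) \<partial>?M) < e" using L1[of i j] by linarith
    qed
  qed
  then obtain r where r: "strict_mono r" "AE l in ?M. Cauchy (%i. f (r i) l)"
    using cauchy_L1_AE_cauchy_subseq[of ?M f] fi by blast
  define g where "g l = lim (%i. f (r i) l)" for l
  have gm [measurable]: "borel_fun g"
    unfolding g_def by measurable
  have AE: "AE l in lborel. (%i. f (r i) l) \<longlonglongrightarrow> g l"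
  proof -
    have "AE l in lborel. 0 < ennreal (std_normal_density l) \<longrightarrow> Cauchy (%i. f (r i) l)"
      using r(2) by (subst (asm) AE_density) auto
    then show ?thesis
    proof eventually_elim
      case (elim l)
      then have "Cauchy (%i. f (r i) l)" by (simp add: normal_density_pos)
      then show ?case unfolding g_def by (simp add: Cauchy_convergent_iff convergent_LIMSEQ_iff)
    qed
  qed
  have "nsq (%l. f n l - g l) \<le> ennreal (\<epsilon> n)" for n
  proof -
    \<comment> \<open>The Cauchy bound \<open>\<epsilon> n + \<epsilon> m\<close> tends to
      \<open>\<epsilon> n\<close> as m grows; an extra \<open>\<delta>\<close> makes it valid for
      all late m at once and is removed at the end.\<close>
    have "nsq (%l. f n l - g l) \<le> ennreal (\<epsilon> n + \<delta>)" if "\<delta> > 0" for \<delta>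
    proof -
      have "eventually (%n. \<epsilon> n < \<delta>) sequentially"
        using \<epsilon> by (rule order_tendstoD(2)) (use that in auto)
      then obtain N where N: "\<And>n. n \<ge> N \<Longrightarrow> \<epsilon> n < \<delta>" by (auto simp: eventually_sequentially)
      show ?thesis
      proof (rule nsq_liminf_AE[where f="%i l. f n l - f (r (i + N)) l"])
        show "AE l in lborel. (%i. f n l - f (r (i + N)) l) \<longlonglongrightarrow> f n l - g l"
          using AE
        proof eventually_elim
          case (elim l)
          show ?case using LIMSEQ_ignore_initial_segment[OF elim, of N] by (intro tendsto_diff tendsto_const)
        qed
        have "nsq (%l. f n l - f (r (i + N)) l) \<le> ennreal (\<epsilon> n + \<delta>)" for i
        proof -
          have "N \<le> r (i + N)" using seq_suble[OF r(1), of "i + N"] by simp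
          then show ?thesis using c[of n "r (i + N)"] N[of "r (i + N)"] by (meson add_left_mono ennreal_leI less_imp_le order_trans)
        qed
        then show "(%i. nsq (%l. f n l - f (r (i + N)) l)) \<longlonglongrightarrow> ennreal (\<epsilon> n + \<delta>) \<or> (\<forall>i. nsq (%l. f n l - f (r (i + N)) l) \<le> ennreal (\<epsilon> n + \<delta>))" by blast
      qed measurable
    qed
    then have "nsq (%l. f n l - g l) \<le> ennreal (\<epsilon> n + hs k)" for k using hs(3) by blast
    moreover have "(%k. ennreal (\<epsilon> n + hs k)) \<longlonglongrightarrow> ennreal (\<epsilon> n + 0)"
      by (intro tendsto_intros hs)
    ultimately show ?thesis by (intro LIMSEQ_le_const) auto
  qed
  then show ?thesis using that gm by blast
qed

lemma nm2_tendsto_0: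
  fixes f :: "nat => real => complex"
  assumes [measurable]: "\<And>n. f n \<in> borel_measurable borel" and w: "integrable lborel w"
    and b: "\<And>n y. (cmod (f n y))^2 \<le> w y" and lim: "\<And>y. (%n. f n y) \<longlonglongrightarrow> 0"
  shows "(%n. nm2 (f n)) \<longlonglongrightarrow> 0"
proof -
  have "(%n. \<integral>y. (cmod (f n y))^2 \<partial>lborel) \<longlonglongrightarrow> (\<integral>y. 0 \<partial>(lborel :: real measure))"
  proof (rule integral_dominated_convergence[where w=w])
    show "AE y in lborel. (%n. (cmod (f n y))^2) \<longlonglongrightarrow> 0"
      using tendsto_power[OF tendsto_norm[OF lim], where n=2] by simp
  qed (use w b in auto)
  then show ?thesis by (simp add: nm2_def)
qed

lemma nm1_tendsto_0:
  fixes f :: "nat => real => complex"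
  assumes [measurable]: "\<And>n. f n \<in> borel_measurable borel" and w: "integrable lborel w"
    and b: "\<And>n y. cmod (f n y) \<le> w y" and lim: "\<And>y. (%n. f n y) \<longlonglongrightarrow> 0"
  shows "(%n. nm1 (f n)) \<longlonglongrightarrow> 0"
proof -
  have "(%n. \<integral>y. cmod (f n y) \<partial>lborel) \<longlonglongrightarrow> (\<integral>y. 0 \<partial>(lborel :: real measure))"
  proof (rule integral_dominated_convergence[where w=w])
    show "AE y in lborel. (%n. cmod (f n y)) \<longlonglongrightarrow> 0"
      using tendsto_norm[OF lim] by simp
  qed (use w b in auto)
  then show ?thesis by (simp add: nm1_def)
qed

lemma nm2_add_le:
  assumes "sq_integrable f" "sq_integrable g"
    "borel_fun f" "borel_fun g"
  shows "nm2 (%y. f y - g y) \<le> 2 * nm2 f + 2 * nm2 g"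
proof -
  have "nm2 (%y. f y - g y) \<le> (LBINT y. 2 * (cmod (f y))^2 + 2 * (cmod (g y))^2)"
    unfolding nm2_def
  proof (rule integral_mono')
    fix y
    show "(cmod (f y - g y))^2 \<le> 2 * (cmod (f y))^2 + 2 * (cmod (g y))^2" by (rule norm_diff_square)
  qed (use assms in auto)
  then show ?thesis using assms by (simp add: nm2_def)
qed

section \<open>Differentiability in the spectral parameter\<close>

definition xm :: "(real => complex) => real => complex" where "xm f y = of_real y * f y"

text \<open>The first three claims rest on the domination of the quotient by
  \<open>2 * cmod (xm f y)\<close>, from \<open>norm_ee_minus_1\<close>, and on dominated
  convergence. The sign \<open>s\<close> covers the opposite modulations of \<open>\<alpha>\<close>
  and \<open>\<beta>\<close>.\<close>

lemma md_quotient: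
  fixes f :: "real => complex"
  assumes f: "integrable lborel f" and xf: "sq_integrable (xm f)" and s: "s = 1 \<or> s = - (1::real)"
  shows "nm2 (%y. of_real (1 / hs n) * (md (s * hs n) f y - f y)) \<le> 4 * nm2 (xm f)"
    and "integrable lborel (%y. (cmod (of_real (1 / hs n) * (md (s * hs n) f y - f y)))^2)"
    and "(%n. nm2 (%y. of_real (1 / hs n) * (md (s * hs n) f y - f y) - 2 * \<i> * of_real s * xm f y)) \<longlonglongrightarrow> 0"
    and "(%n. nm1 (%y. md (s * hs n) f y - f y)) \<longlonglongrightarrow> 0"
proof -
  have [measurable]: "borel_fun f" using f by auto
  have [measurable]: "xm f \<in> borel_measurable borel" unfolding xm_def[abs_def] by measurable
  let ?q = "%n y. of_real (1 / hs n) * (md (s * hs n) f y - f y) :: complex"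
  have [measurable]: "?q n \<in> borel_measurable borel" for n unfolding md_def by measurable
  have q: "cmod (?q n y) \<le> 2 * cmod (xm f y)" for n y
  proof -
    have "cmod (?q n y) = 1 / hs n * cmod (ee (s * hs n * y) - 1) * cmod (f y)"
    proof -
      have "?q n y = of_real (1 / hs n) * ((ee (s * hs n * y) - 1) * f y)" by (simp add: md_def left_diff_distrib)
      then show ?thesis using hs(3)[of n] by (simp add: norm_mult norm_divide)
    qed
    also have "\<dots> \<le> 1 / hs n * (2 * \<bar>s * hs n * y\<bar>) * cmod (f y)"
      using hs(3)[of n] by (intro mult_right_mono mult_left_mono norm_ee_minus_1) auto
    also have "\<dots> = 2 * cmod (xm f y)" using hs(3)[of n] s by (auto simp: abs_mult xm_def norm_mult)
    finally show ?thesis .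
  qed
  have q2: "(cmod (?q n y))^2 \<le> 4 * (cmod (xm f y))^2" for n y
    using power_mono[OF q, of n y 2] by (simp add: power_mult_distrib)
  show "nm2 (?q n) \<le> 4 * nm2 (xm f)"
  proof -
    have "nm2 (?q n) \<le> (LBINT y. 4 * (cmod (xm f y))^2)"
      unfolding nm2_def by (rule integral_mono'[OF integrable_mult_right[OF xf]]) (use q2 in auto)
    then show ?thesis by (simp add: nm2_def)
  qed
  show "integrable lborel (%y. (cmod (?q n y))^2)"
    by (rule Bochner_Integration.integrable_bound[OF integrable_mult_right[OF xf, of 4]]) (use q2 in auto)
  show "(%n. nm2 (%y. ?q n y - 2 * \<i> * of_real s * xm f y)) \<longlonglongrightarrow> 0"
  proof (rule nm2_tendsto_0[where w="%y. 16 * (cmod (xm f y))^2"])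
    show "integrable lborel (%y. 16 * (cmod (xm f y))^2)" using xf by simp
    show "(cmod (?q n y - 2 * \<i> * of_real s * xm f y))^2 \<le> 16 * (cmod (xm f y))^2" for n y
    proof -
      have "cmod (?q n y - 2 * \<i> * of_real s * xm f y) \<le> 2 * cmod (xm f y) + 2 * cmod (xm f y)"
        by (rule order_trans[OF norm_triangle_ineq4 add_mono[OF q]]) (use s in \<open>auto simp: norm_mult\<close>)
      then have "(cmod (?q n y - 2 * \<i> * of_real s * xm f y))^2 \<le> (4 * cmod (xm f y))^2" by (intro power_mono) auto
      then show ?thesis by (simp add: power_mult_distrib)
    qed
    show "(%n. ?q n y - 2 * \<i> * of_real s * xm f y) \<longlonglongrightarrow> 0" for y
    proof -
      have "(%n. s * hs n) \<longlonglongrightarrow> s * 0" by (intro tendsto_intros hs)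
      then have 0: "(%n. s * hs n) \<longlonglongrightarrow> 0" by simp
      have "(%n. of_real s * ((ee (s * hs n * y) - 1) / of_real (s * hs n)) * f y - 2 * \<i> * of_real s * xm f y)
         \<longlonglongrightarrow> of_real s * (2 * \<i> * of_real y) * f y - 2 * \<i> * of_real s * xm f y"
        by (intro tendsto_intros ee_diff_quotient_tendsto[OF 0]) (use s hs in auto)
      moreover have "of_real s * ((ee (s * hs n * y) - 1) / of_real (s * hs n)) * f y = ?q n y" for n
        using s hs(2)[of n] by (auto simp: md_def divide_simps) (simp_all add: algebra_simps)
      ultimately show ?thesis by (simp add: xm_def mult_ac)
    qed
  qed measurable
  show "(%n. nm1 (%y. md (s * hs n) f y - f y)) \<longlonglongrightarrow> 0"
  proof (rule nm1_tendsto_0[where w="%y. 2 * cmod (f y)"])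
    show "cmod (md (s * hs n) f y - f y) \<le> 2 * cmod (f y)" for n y
      using norm_triangle_ineq4[of "md (s * hs n) f y" "f y"] by (simp add: md_def norm_mult)
    show "(%n. md (s * hs n) f y - f y) \<longlonglongrightarrow> 0" for y
    proof -
      have "isCont ee 0" using continuous_ee by (simp add: continuous_on_eq_continuous_at)
      moreover have "(%n. s * hs n * y) \<longlonglongrightarrow> s * 0 * y" by (intro tendsto_intros hs)
      ultimately have "(%n. ee (s * hs n * y)) \<longlonglongrightarrow> ee 0" by (intro isCont_tendsto_compose[of 0 ee]) auto
      then have "(%n. ee (s * hs n * y) * f y - f y) \<longlonglongrightarrow> 1 * f y - f y" by (intro tendsto_intros) auto
      then show ?thesis by (simp add: md_def)
    qed
  qed (use f in \<open>auto simp: md_def\<close>)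
qed

lemma rho_const_nonneg: "1 \<le> B \<Longrightarrow> 0 \<le> rho_const B"
  using zs_const_ge_1[of B] by (simp add: rho_const_def)

definition idx4 :: "'a => 'a => 'a => 'a => nat => 'a" where
  "idx4 a b c d i = (if i = 0 then a else if i = 1 then b else if i = 2 then c else d)"

lemma idx4 [simp]: "idx4 a b c d 0 = a" "idx4 a b c d (Suc 0) = b" "idx4 a b c d 2 = c" "idx4 a b c d 3 = d"
  by (simp_all add: idx4_def)

lemma zs_ok_idx4:
  assumes "zs_ok B a a'" "zs_ok B b b'" "zs_ok B c c'" "zs_ok B d d'"
  shows "zs_ok B (idx4 a b c d i) (idx4 a' b' c' d' i)"
  using assms by (simp add: idx4_def)

lemma nm1_triangle:
  assumes "integrable lborel f" "integrable lborel g"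
  shows "nm1 (%y. f y - g y) \<le> nm1 f + nm1 g"
proof -
  have "nm1 (%y. f y - g y) \<le> (LBINT y. cmod (f y) + cmod (g y))"
    unfolding nm1_def by (rule integral_mono') (use assms norm_triangle_ineq4 in auto)
  then show ?thesis using assms by (simp add: nm1_def)
qed

text \<open>Difference quotients with the increments \<open>hs n\<close> and \<open>hs m\<close> are
  compared by \<open>zs_rho_second_difference\<close>; their distance tends to 0, and
  \<open>L2_complete\<close> supplies the limit.\<close>

lemma zs_rho_l2_deriv:
  assumes B: "1 \<le> B" and ok: "zs_ok B \<alpha> \<beta>"
    and x\<alpha>: "sq_integrable (xm \<alpha>)" and x\<beta>: "sq_integrable (xm \<beta>)"
  obtains g where "l2_deriv (zs_rho \<alpha> \<beta>) g"
proof -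
  have i: "integrable lborel \<alpha>" "integrable lborel \<beta>" using ok by (auto simp: zs_ok_def)
  have [measurable]: "borel_fun \<alpha>" "borel_fun \<beta>" using i by auto
  note [measurable] = zs_rho_measurable[OF ok]
  have [measurable]: "xm \<alpha> \<in> borel_measurable borel" "xm \<beta> \<in> borel_measurable borel" unfolding xm_def[abs_def] by measurable
  define f where "f n l = of_real (1 / hs n) * (zs_rho \<alpha> \<beta> (l + hs n) - zs_rho \<alpha> \<beta> l)" for n l
  have [measurable]: "f n \<in> borel_measurable borel" for n unfolding f_def by measurable
  define q where "q s n \<gamma> y = complex_of_real (1 / hs n) * (md (s * hs n) \<gamma> y - \<gamma> y)" for s n \<gamma> y
  have qm: "q s n \<gamma> \<in> borel_measurable borel" if [measurable]: "borel_fun \<gamma>" for s n \<gamma> unfolding q_def by measurable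
  define e where "e n = nm2 (%y. q 1 n \<alpha> y - 2 * \<i> * of_real 1 * xm \<alpha> y) + nm2 (%y. q (- 1) n \<beta> y - 2 * \<i> * of_real (- 1) * xm \<beta> y)" for n
  define \<delta> where "\<delta> n = nm1 (%y. md (1 * hs n) \<alpha> y - \<alpha> y) + nm1 (%y. md (- 1 * hs n) \<beta> y - \<beta> y)" for n
  define M where "M = 4 * nm2 (xm \<alpha>) + 4 * nm2 (xm \<beta>)"
  have e0: "e \<longlonglongrightarrow> 0"
    unfolding e_def q_def
    using tendsto_add[OF md_quotient(3)[OF i(1) x\<alpha>, of 1] md_quotient(3)[OF i(2) x\<beta>, of "- 1"]] by simp
  have \<delta>0: "\<delta> \<longlonglongrightarrow> 0"
    unfolding \<delta>_def
    using tendsto_add[OF md_quotient(4)[OF i(1) x\<alpha>, of 1] md_quotient(4)[OF i(2) x\<beta>, of "- 1"]] by simp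
  have enn: "0 \<le> e n" "0 \<le> \<delta> n" "0 \<le> M" for n by (auto simp: e_def \<delta>_def M_def)
  define \<epsilon> where "\<epsilon> n = rho_const B * (2 * e n + 2 * (\<delta> n)^2 * M)" for n
  have \<epsilon>: "\<epsilon> \<longlonglongrightarrow> 0"
  proof -
    have "(%n. rho_const B * (2 * e n + 2 * (\<delta> n)^2 * M)) \<longlonglongrightarrow> rho_const B * (2 * 0 + 2 * 0^2 * M)"
      by (intro tendsto_intros e0 \<delta>0)
    then show ?thesis by (simp add: \<epsilon>_def[abs_def])
  qed
  have c: "nsq (%l. f n l - f m l) \<le> ennreal (\<epsilon> n + \<epsilon> m)" for n m
  proof -
    \<comment> \<open>Corners 1 and 3 are the unmodulated potentials, so their distance is 0; the
      multipliers are \<open>1 / hs n\<close> and \<open>1 / hs m\<close>.\<close>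
    let ?\<alpha> = "idx4 (md (1 * hs n) \<alpha>) \<alpha> (md (1 * hs m) \<alpha>) \<alpha>" and ?\<beta> = "idx4 (md (- 1 * hs n) \<beta>) \<beta> (md (- 1 * hs m) \<beta>) \<beta>"
    have okk: "zs_ok B (?\<alpha> i) (?\<beta> i)" for i by (intro zs_ok_idx4 ok zs_ok_md)
    have half: "nm2 (%y. q s n \<gamma> y - q s m \<gamma> y) \<le> 2 * nm2 (%y. q s n \<gamma> y - 2 * \<i> * of_real s * xm \<gamma> y) + 2 * nm2 (%y. q s m \<gamma> y - 2 * \<i> * of_real s * xm \<gamma> y)"
      if \<gamma>: "integrable lborel \<gamma>" "sq_integrable (xm \<gamma>)" and s: "s = 1 \<or> s = - (1::real)" for s \<gamma>
    proof -
      have [measurable]: "borel_fun \<gamma>" using \<gamma> by auto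
      have [measurable]: "xm \<gamma> \<in> borel_measurable borel" unfolding xm_def[abs_def] by measurable
      note [measurable] = qm[of \<gamma>]
      have int: "integrable lborel (%y. (cmod (q s k \<gamma> y - 2 * \<i> * of_real s * xm \<gamma> y))^2)" for k
      proof (rule square_integrable_diff1)
        show "sq_integrable (q s k \<gamma>)" unfolding q_def by (rule md_quotient(2)[OF \<gamma> s])
        show "integrable lborel (%y. (cmod (2 * \<i> * of_real s * xm \<gamma> y))^2)" using \<gamma>(2) by (simp add: norm_mult power_mult_distrib)
      qed measurable
      have "nm2 (%y. (q s n \<gamma> y - 2 * \<i> * of_real s * xm \<gamma> y) - (q s m \<gamma> y - 2 * \<i> * of_real s * xm \<gamma> y)) \<le> 2 * nm2 (%y. q s n \<gamma> y - 2 * \<i> * of_real s * xm \<gamma> y) + 2 * nm2 (%y. q s m \<gamma> y - 2 * \<i> * of_real s * xm \<gamma> y)"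
        by (rule nm2_add_le[OF int int]) measurable
      then show ?thesis by simp
    qed
    have A1: "nm2 (%y. of_real (1 / hs n) * (?\<alpha> 0 y - ?\<alpha> 1 y) - of_real (1 / hs m) * (?\<alpha> 2 y - ?\<alpha> 3 y))
       + nm2 (%y. of_real (1 / hs n) * (?\<beta> 0 y - ?\<beta> 1 y) - of_real (1 / hs m) * (?\<beta> 2 y - ?\<beta> 3 y)) \<le> 2 * e n + 2 * e m"
      using half[OF i(1) x\<alpha>, of 1] half[OF i(2) x\<beta>, of "- 1"] by (simp add: e_def q_def)
    have A2: "nm2 (%y. of_real (1 / hs m) * (?\<alpha> 2 y - ?\<alpha> 3 y)) + nm2 (%y. of_real (1 / hs m) * (?\<beta> 2 y - ?\<beta> 3 y)) \<le> M"
      using md_quotient(1)[OF i(1) x\<alpha>, of 1 m] md_quotient(1)[OF i(2) x\<beta>, of "- 1" m] by (simp add: M_def)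
    have A3: "nm2 (%y. of_real (1 / hs n) * (?\<alpha> 0 y - ?\<alpha> 1 y)) + nm2 (%y. of_real (1 / hs n) * (?\<beta> 0 y - ?\<beta> 1 y)) \<le> M"
      using md_quotient(1)[OF i(1) x\<alpha>, of 1 n] md_quotient(1)[OF i(2) x\<beta>, of "- 1" n] by (simp add: M_def)
    have d: "nm1 (%y. md a \<gamma> y - md b \<gamma> y) \<le> nm1 (%y. md a \<gamma> y - \<gamma> y) + nm1 (%y. md b \<gamma> y - \<gamma> y)" if "integrable lborel \<gamma>" for a b \<gamma>
      using nm1_triangle[of "%y. md a \<gamma> y - \<gamma> y" "%y. md b \<gamma> y - \<gamma> y"] that md_integrable[OF that] by simp
    have d02: "nm1 (%y. ?\<alpha> 0 y - ?\<alpha> 2 y) + nm1 (%y. ?\<beta> 0 y - ?\<beta> 2 y) \<le> \<delta> n + \<delta> m"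
      using d[OF i(1), of "1 * hs n" "1 * hs m"] d[OF i(2), of "- 1 * hs n" "- 1 * hs m"] by (simp add: \<delta>_def)
    have d13: "nm1 (%y. ?\<alpha> 1 y - ?\<alpha> 3 y) + nm1 (%y. ?\<beta> 1 y - ?\<beta> 3 y) \<le> 0" by (simp add: nm1_def)
    have "nsq (%l. of_real (1 / hs n) * (zs_rho (?\<alpha> 0) (?\<beta> 0) l - zs_rho (?\<alpha> 1) (?\<beta> 1) l) - of_real (1 / hs m) * (zs_rho (?\<alpha> 2) (?\<beta> 2) l - zs_rho (?\<alpha> 3) (?\<beta> 3) l))
       \<le> ennreal (rho_const B * ((2 * e n + 2 * e m) + (\<delta> n + \<delta> m)^2 * M + 0^2 * M))"
      by (rule zs_rho_second_difference[where \<alpha>="?\<alpha>" and \<beta>="?\<beta>", OF B okk A1 A2 A3 d02 d13])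
    also have "\<dots> \<le> ennreal (\<epsilon> n + \<epsilon> m)"
    proof (rule ennreal_leI)
      have "(\<delta> n + \<delta> m)^2 * M \<le> (2 * (\<delta> n)^2 + 2 * (\<delta> m)^2) * M"
        using sum_squares_bound[of "\<delta> n" "\<delta> m"] enn by (intro mult_right_mono) (auto simp: power2_sum)
      then have "rho_const B * ((2 * e n + 2 * e m) + (\<delta> n + \<delta> m)^2 * M + 0^2 * M) \<le> rho_const B * ((2 * e n + 2 * e m) + (2 * (\<delta> n)^2 + 2 * (\<delta> m)^2) * M)"
        by (intro mult_left_mono rho_const_nonneg B) auto
      then show "rho_const B * ((2 * e n + 2 * e m) + (\<delta> n + \<delta> m)^2 * M + 0^2 * M) \<le> \<epsilon> n + \<epsilon> m"
        by (simp add: \<epsilon>_def algebra_simps)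
    qed
    finally show ?thesis using zs_rho_shift[OF ok] by (simp add: f_def)
  qed
  have bd: "\<exists>D. \<forall>l. cmod (f n l) \<le> D" for n
  proof (intro exI allI)
    fix l
    have "cmod (f n l) = 1 / hs n * cmod (zs_rho \<alpha> \<beta> (l + hs n) - zs_rho \<alpha> \<beta> l)"
      using hs(3)[of n] by (simp add: f_def norm_mult norm_divide)
    also have "\<dots> \<le> 1 / hs n * (7 * B + 7 * B)"
      using hs(3)[of n] by (intro mult_left_mono order_trans[OF norm_triangle_ineq4] add_mono zs_rho_bound[OF ok]) auto
    finally show "cmod (f n l) \<le> 1 / hs n * (7 * B + 7 * B)" .
  qed
  obtain g where "borel_fun g" "\<And>n. nsq (%l. f n l - g l) \<le> ennreal (\<epsilon> n)"
    using L2_complete[where f=f and \<epsilon>=\<epsilon>, OF _ bd \<epsilon> c] by auto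
  then show ?thesis using that \<epsilon> unfolding l2_deriv_def f_def by blast
qed

text \<open>Same increment, two pairs of potentials: corners 0 and 1 belong to one pair, 2 and 3 to
  the other. The bound on the quotients is uniform in n and passes to the limit; the outer factor 2
  is the triangle inequality.\<close>

lemma zs_rho_l2_deriv_diff:
  assumes B: "1 \<le> B" and ok: "zs_ok B \<alpha> \<beta>" and ok': "zs_ok B \<alpha>' \<beta>'"
    and x: "sq_integrable (xm \<alpha>)" "sq_integrable (xm \<beta>)"
    and x': "sq_integrable (xm \<alpha>')" "sq_integrable (xm \<beta>')"
    and g: "l2_deriv (zs_rho \<alpha> \<beta>) g" "l2_deriv (zs_rho \<alpha>' \<beta>') g'"
    and d: "nm1 (%y. \<alpha> y - \<alpha>' y) + nm1 (%y. \<beta> y - \<beta>' y) \<le> d"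
    and A: "4 * nm2 (xm (%y. \<alpha> y - \<alpha>' y)) + 4 * nm2 (xm (%y. \<beta> y - \<beta>' y)) \<le> A"
    and M: "4 * nm2 (xm \<alpha>) + 4 * nm2 (xm \<beta>) \<le> M" "4 * nm2 (xm \<alpha>') + 4 * nm2 (xm \<beta>') \<le> M"
  shows "nsq (%l. g l - g' l) \<le> ennreal (2 * (rho_const B * (A + d^2 * M + d^2 * M)))"
proof -
  have i: "integrable lborel \<alpha>" "integrable lborel \<beta>" "integrable lborel \<alpha>'" "integrable lborel \<beta>'"
    using ok ok' by (auto simp: zs_ok_def)
  have [measurable]: "borel_fun \<alpha>" "borel_fun \<beta>" "borel_fun \<alpha>'" "borel_fun \<beta>'"
    using i by auto
  note [measurable] = zs_rho_measurable[OF ok] zs_rho_measurable[OF ok']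
  from g(1) obtain \<epsilon> where g1 [measurable]: "borel_fun g" and \<epsilon>: "\<epsilon> \<longlonglongrightarrow> 0"
    "\<And>n. nsq (%l. of_real (1 / hs n) * (zs_rho \<alpha> \<beta> (l + hs n) - zs_rho \<alpha> \<beta> l) - g l) \<le> ennreal (\<epsilon> n)"
    unfolding l2_deriv_def by blast
  from g(2) obtain \<epsilon>' where g2 [measurable]: "borel_fun g'" and \<epsilon>': "\<epsilon>' \<longlonglongrightarrow> 0"
    "\<And>n. nsq (%l. of_real (1 / hs n) * (zs_rho \<alpha>' \<beta>' (l + hs n) - zs_rho \<alpha>' \<beta>' l) - g' l) \<le> ennreal (\<epsilon>' n)"
    unfolding l2_deriv_def by blast
  define R where "R = rho_const B * (A + d^2 * M + d^2 * M)"
  define f where "f n l = of_real (1 / hs n) * (zs_rho \<alpha> \<beta> (l + hs n) - zs_rho \<alpha> \<beta> l)" for n l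
  define f' where "f' n l = of_real (1 / hs n) * (zs_rho \<alpha>' \<beta>' (l + hs n) - zs_rho \<alpha>' \<beta>' l)" for n l
  have [measurable]: "f n \<in> borel_measurable borel" "f' n \<in> borel_measurable borel" for n unfolding f_def f'_def by measurable
  have ff: "nsq (%l. f n l - f' n l) \<le> ennreal R" for n
  proof -
    let ?\<alpha> = "idx4 (md (1 * hs n) \<alpha>) \<alpha> (md (1 * hs n) \<alpha>') \<alpha>'" and ?\<beta> = "idx4 (md (- 1 * hs n) \<beta>) \<beta> (md (- 1 * hs n) \<beta>') \<beta>'"
    have okk: "zs_ok B (?\<alpha> i) (?\<beta> i)" for i by (intro zs_ok_idx4 ok ok' zs_ok_md)
    have xd: "integrable lborel (%y. (cmod (xm (%y. a y - b y) y))^2)"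
      if "sq_integrable (xm a)" "sq_integrable (xm b)" and [measurable]: "borel_fun a" "borel_fun b" for a b
    proof -
      have "xm a \<in> borel_measurable borel" "xm b \<in> borel_measurable borel" unfolding xm_def[abs_def] by measurable
      from square_integrable_diff1[OF this that(1,2)] show ?thesis by (simp add: xm_def right_diff_distrib)
    qed
    have half: "nm2 (%y. of_real (1 / hs n) * (md (s * hs n) a y - a y) - of_real (1 / hs n) * (md (s * hs n) b y - b y)) \<le> 4 * nm2 (xm (%y. a y - b y))"
      if "sq_integrable (xm a)" "sq_integrable (xm b)" "integrable lborel a" "integrable lborel b" "s = 1 \<or> s = - (1::real)" for s a b
    proof -
      have "(%y. of_real (1 / hs n) * (md (s * hs n) a y - a y) - of_real (1 / hs n) * (md (s * hs n) b y - b y))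
        = (%y. complex_of_real (1 / hs n) * (md (s * hs n) (%y. a y - b y) y - (a y - b y)))"
        by (auto simp: md_def algebra_simps)
      then show ?thesis using md_quotient(1)[of "%y. a y - b y" s n] xd[OF that(1,2)] that by simp
    qed
    have A1: "nm2 (%y. of_real (1 / hs n) * (?\<alpha> 0 y - ?\<alpha> 1 y) - of_real (1 / hs n) * (?\<alpha> 2 y - ?\<alpha> 3 y))
       + nm2 (%y. of_real (1 / hs n) * (?\<beta> 0 y - ?\<beta> 1 y) - of_real (1 / hs n) * (?\<beta> 2 y - ?\<beta> 3 y)) \<le> A"
      using half[OF x(1) x'(1) i(1) i(3), of 1] half[OF x(2) x'(2) i(2) i(4), of "- 1"] A by simp
    have A2: "nm2 (%y. of_real (1 / hs n) * (?\<alpha> 2 y - ?\<alpha> 3 y)) + nm2 (%y. of_real (1 / hs n) * (?\<beta> 2 y - ?\<beta> 3 y)) \<le> M"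
      using md_quotient(1)[OF i(3) x'(1), of 1 n] md_quotient(1)[OF i(4) x'(2), of "- 1" n] M by simp
    have A3: "nm2 (%y. of_real (1 / hs n) * (?\<alpha> 0 y - ?\<alpha> 1 y)) + nm2 (%y. of_real (1 / hs n) * (?\<beta> 0 y - ?\<beta> 1 y)) \<le> M"
      using md_quotient(1)[OF i(1) x(1), of 1 n] md_quotient(1)[OF i(2) x(2), of "- 1" n] M by simp
    have d02: "nm1 (%y. ?\<alpha> 0 y - ?\<alpha> 2 y) + nm1 (%y. ?\<beta> 0 y - ?\<beta> 2 y) \<le> d"
      using d by (simp add: md_diff)
    have d13: "nm1 (%y. ?\<alpha> 1 y - ?\<alpha> 3 y) + nm1 (%y. ?\<beta> 1 y - ?\<beta> 3 y) \<le> d" using d by simp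
    have "nsq (%l. of_real (1 / hs n) * (zs_rho (?\<alpha> 0) (?\<beta> 0) l - zs_rho (?\<alpha> 1) (?\<beta> 1) l) - of_real (1 / hs n) * (zs_rho (?\<alpha> 2) (?\<beta> 2) l - zs_rho (?\<alpha> 3) (?\<beta> 3) l))
       \<le> ennreal R"
      unfolding R_def by (rule zs_rho_second_difference[where \<alpha>="?\<alpha>" and \<beta>="?\<beta>", OF B okk A1 A2 A3 d02 d13])
    then show ?thesis using zs_rho_shift[OF ok] zs_rho_shift[OF ok'] by (simp add: f_def f'_def)
  qed
  have "nsq (%l. g l - g' l) \<le> 2 * ennreal R + 2 * (2 * ennreal (\<epsilon> n) + 2 * ennreal (\<epsilon>' n))" for n
  proof -
    have "nsq (%l. (f n l - f' n l) - ((f n l - g l) - (f' n l - g' l))) \<le> 2 * nsq (%l. f n l - f' n l) + 2 * nsq (%l. (f n l - g l) - (f' n l - g' l))"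
      by (rule nsq_diff) measurable
    also have "\<dots> \<le> 2 * ennreal R + 2 * (2 * nsq (%l. f n l - g l) + 2 * nsq (%l. f' n l - g' l))"
      by (intro add_mono mult_left_mono ff nsq_diff) auto
    also have "\<dots> \<le> 2 * ennreal R + 2 * (2 * ennreal (\<epsilon> n) + 2 * ennreal (\<epsilon>' n))"
      unfolding f_def f'_def by (intro add_mono mult_left_mono \<epsilon> \<epsilon>') auto
    finally show ?thesis by (simp add: algebra_simps)
  qed
  moreover have "(%n. 2 * ennreal R + 2 * (2 * ennreal (\<epsilon> n) + 2 * ennreal (\<epsilon>' n))) \<longlonglongrightarrow> 2 * ennreal R + 2 * (2 * ennreal 0 + 2 * ennreal 0)"
    by (intro tendsto_intros \<epsilon> \<epsilon>' ennreal_tendsto_cmult) auto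
  ultimately have "nsq (%l. g l - g' l) \<le> 2 * ennreal R + 2 * (2 * ennreal 0 + 2 * ennreal 0)"
    by (intro LIMSEQ_le_const) auto
  then show ?thesis by (simp add: R_def ennreal_mult')
qed

section \<open>Weak derivatives and absolutely continuous functions\<close>

text \<open>Local absolute continuity in integrated form, with a Borel density \<open>f'\<close> as
  part of the data. Half-open intervals add up without overlap.\<close>

definition ac :: "(real => complex) => (real => complex) => bool" where
  "ac f f' \<longleftrightarrow> f' \<in> borel_measurable borel \<and> (\<forall>a b. set_integrable lborel {a<..b} f') \<and>
     (\<forall>a b. a \<le> b \<longrightarrow> f b - f a = (LBINT t:{a<..b}. f' t))"

lemma ac_D:
  assumes "ac f f'"
  shows "borel_fun f'" "set_integrable lborel {a<..b} f'" "a \<le> b \<Longrightarrow> f b - f a = (LBINT t:{a<..b}. f' t)"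
  using assms by (auto simp: ac_def)

lemma cumint_indicator:
  fixes f' :: "real => complex"
  assumes "a \<le> t" "t \<le> b"
  shows "cumint (%y. indicator {a<..b} y *\<^sub>R f' y) t = (LBINT y:{a<..t}. f' y)"
  unfolding cumint_def set_lebesgue_integral_def
  by (rule Bochner_Integration.integral_cong) (use assms in \<open>auto simp: indicator_def\<close>)

lemma ac_cumint:
  assumes "ac f f'" "a \<le> t" "t \<le> b"
  shows "f t = f a + cumint (%y. indicator {a<..b} y *\<^sub>R f' y) t"
  using ac_D(3)[OF assms(1,2)] cumint_indicator[OF assms(2,3), of f'] by (simp add: algebra_simps)

lemma ac_indicator_integrable: "ac f f' \<Longrightarrow> integrable lborel (%y. indicator {a<..b} y *\<^sub>R f' y)"
  using ac_D(2) by (simp add: set_integrable_def)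

lemma ac_isCont: assumes "ac f f'" shows "isCont f x"
proof -
  let ?F = "%t. f (x - 1) + cumint (%y. indicator {x - 1<..x + 1} y *\<^sub>R f' y) t"
  have "isCont ?F x" by (intro continuous_intros cumint_continuous ac_indicator_integrable[OF assms])
  moreover have "eventually (%t. ?F t = f t) (nhds x)"
    using eventually_nhds_in_open[of "{x - 1<..<x + 1}" x]
    by (auto elim!: eventually_mono intro!: ac_cumint[OF assms, symmetric])
  ultimately show ?thesis using isCont_cong[of ?F f x] by simp
qed

lemma ac_measurable: "ac f f' \<Longrightarrow> f \<in> borel_measurable borel"
  by (intro borel_measurable_continuous_onI continuous_at_imp_continuous_on ballI ac_isCont)

text \<open>\<open>cumint_product\<close> for the densities cut off to \<open>{a<..b}\<close>; the
  other factor is continuous, hence bounded there, which keeps the products integrable.\<close>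

lemma ac_mult:
  assumes f: "ac f f'" and g: "ac g g'"
  shows "ac (%x. f x * g x) (%x. f' x * g x + f x * g' x)"
proof -
  note [measurable] = ac_D(1)[OF f] ac_D(1)[OF g] ac_measurable[OF f] ac_measurable[OF g]
  have bdd: "\<exists>K. \<forall>t\<in>{a..b}. cmod (h t) \<le> K" if "ac h h'" for h h' a b
  proof -
    have "compact (h ` {a..b})"
      by (intro compact_continuous_image continuous_at_imp_continuous_on ballI ac_isCont[OF that] compact_Icc)
    then show ?thesis by (auto dest!: compact_imp_bounded simp: bounded_iff)
  qed
  have si: "set_integrable lborel {a<..b} (%x. h' x * k x)"
    if hm: "borel_fun h'" and h: "set_integrable lborel {a<..b} h'" and k: "ac k k'" for h' k k' a b
  proof -
    note [measurable] = hm ac_measurable[OF k]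
    obtain K where K: "\<forall>t\<in>{a..b}. cmod (k t) \<le> K" using bdd[OF k] by blast
    have "integrable lborel (%y. (indicator {a<..b} y *\<^sub>R h' y) * (indicator {a<..b} y *\<^sub>R k y))"
      by (rule integrable_bounded_mult(1)[where B="max 0 K"])
         (use h K in \<open>auto simp: set_integrable_def indicator_def less_imp_le le_max_iff_disj\<close>)
    also have "(%y. (indicator {a<..b} y *\<^sub>R h' y) * (indicator {a<..b} y *\<^sub>R k y)) = (%y. indicator {a<..b} y *\<^sub>R (h' y * k y))"
      by (auto simp: indicator_def)
    finally show ?thesis by (simp add: set_integrable_def)
  qed
  show ?thesis
    unfolding ac_def
  proof (intro conjI allI impI)
    show "borel_fun (%x. f' x * g x + f x * g' x)" by measurable
    show "set_integrable lborel {a<..b} (%x. f' x * g x + f x * g' x)" for a b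
      using si[OF ac_D(1,2)[OF f] g] si[OF ac_D(1,2)[OF g] f] by (intro set_integral_add) (auto simp: mult.commute)
    fix a b :: real assume ab: "a \<le> b"
    let ?F = "%y. indicator {a<..b} y *\<^sub>R f' y" and ?G = "%y. indicator {a<..b} y *\<^sub>R g' y"
    have "f b * g b = (f a + cumint ?F b) * (g a + cumint ?G b)"
      using ac_cumint[OF f ab order_refl] ac_cumint[OF g ab order_refl] by simp
    also have "\<dots> = f a * g a + cumint (%y. ?F y * (g a + cumint ?G y) + (f a + cumint ?F y) * ?G y) b"
      by (rule cumint_product[OF ac_indicator_integrable[OF f] ac_indicator_integrable[OF g]])
    also have "cumint (%y. ?F y * (g a + cumint ?G y) + (f a + cumint ?F y) * ?G y) b = cumint (%y. indicator {a<..b} y *\<^sub>R (f' y * g y + f y * g' y)) b"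
    proof (rule cumint_cong)
      fix y assume "y \<le> b"
      show "?F y * (g a + cumint ?G y) + (f a + cumint ?F y) * ?G y = indicator {a<..b} y *\<^sub>R (f' y * g y + f y * g' y)"
      proof (cases "a < y")
        case True
        then show ?thesis using \<open>y \<le> b\<close> ac_cumint[OF f, of a y b] ac_cumint[OF g, of a y b] by simp
      qed simp
    qed
    finally show "f b * g b - f a * g a = (LBINT t:{a<..b}. f' t * g t + f t * g' t)"
      using cumint_indicator[OF ab order_refl, of "%y. f' y * g y + f y * g' y"] by simp
  qed
qed

lemma ac_add:
  assumes f: "ac f f'" and g: "ac g g'" shows "ac (%x. f x + g x) (%x. f' x + g' x)"
  unfolding ac_def
proof (intro conjI allI impI)
  note [measurable] = ac_D(1)[OF f] ac_D(1)[OF g]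
  show "borel_fun (%x. f' x + g' x)" by measurable
  show "set_integrable lborel {a<..b} (%x. f' x + g' x)" for a b
    by (intro set_integral_add ac_D(2)[OF f] ac_D(2)[OF g])
  show "f b + g b - (f a + g a) = (LBINT t:{a<..b}. f' t + g' t)" if "a \<le> b" for a b
    using ac_D(3)[OF f that] ac_D(3)[OF g that] set_integral_add(2)[OF ac_D(2)[OF f] ac_D(2)[OF g], of a b]
    by (simp add: algebra_simps)
qed

lemma ac_const: "ac (%x. c) (%x. 0)"
  by (simp add: ac_def set_integrable_def)

lemma ac_cmult: "ac f f' \<Longrightarrow> ac (%x. c * f x) (%x. c * f' x)"
  using ac_mult[OF ac_const[of c], of f f'] by simp

lemma ac_diff: "ac f f' \<Longrightarrow> ac g g' \<Longrightarrow> ac (%x. f x - g x) (%x. f' x - g' x)"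
  using ac_add[of f f' "%x. (-1) * g x" "%x. (-1) * g' x"] ac_cmult[of g g' "-1"] by simp

lemma ac_cnj:
  assumes f: "ac f f'" shows "ac (%x. cnj (f x)) (%x. cnj (f' x))"
  unfolding ac_def
proof (intro conjI allI impI)
  note [measurable] = ac_D(1)[OF f]
  show "borel_fun (%x. cnj (f' x))" by measurable
  show "set_integrable lborel {a<..b} (%x. cnj (f' x))" for a b
    using integrable_cnj[OF ac_indicator_integrable[OF f, of a b]] by (simp add: set_integrable_def)
  show "cnj (f b) - cnj (f a) = (LBINT t:{a<..b}. cnj (f' t))" if "a \<le> b" for a b
  proof -
    have "(LBINT t:{a<..b}. cnj (f' t)) = cnj (LBINT t:{a<..b}. f' t)"
      unfolding set_lebesgue_integral_def Bochner_Integration.integral_cnj[symmetric] by simp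
    then show ?thesis using ac_D(3)[OF f that] by (simp add: complex_cnj_diff[symmetric])
  qed
qed

lemma ac_integral:
  assumes "borel_fun f'" "\<And>a b. set_integrable lborel {a<..b} f'"
    "\<And>x. f x = c + (if 0 \<le> x then (LBINT t:{0<..x}. f' t) else - (LBINT t:{x<..0}. f' t))"
  shows "ac f f'"
proof -
  have split: "(LBINT t:{a<..c}. f' t) = (LBINT t:{a<..b}. f' t) + (LBINT t:{b<..c}. f' t)" if "a \<le> b" "b \<le> c" for a b c
  proof -
    have "{a<..c} = {a<..b} \<union> {b<..c}" using that by auto
    then show ?thesis by (simp only:) (intro set_integral_Un assms, auto)
  qed
  show ?thesis
    unfolding ac_def
  proof (intro conjI allI impI assms(1,2))
    fix a b :: real assume "a \<le> b"
    then show "f b - f a = (LBINT t:{a<..b}. f' t)"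
      using split[of 0 a b] split[of a 0 b] split[of a b 0] by (auto simp: assms(3))
  qed
qed

lemma ac_C1:
  assumes d: "\<And>x. (f has_vector_derivative f' x) (at x)" and c: "continuous_on UNIV f'"
  shows "ac f f'"
proof -
  have [measurable]: "borel_fun f'" by (rule borel_measurable_continuous_onI[OF c])
  have I: "has_bochner_integral lborel (%x. indicator {a..b} x *\<^sub>R f' x) (f b - f a)" if "a \<le> b" for a b
    using that by (rule has_bochner_integral_FTC_Icc)
      (auto intro: has_vector_derivative_at_within d continuous_on_subset[OF c])
  show ?thesis
    unfolding ac_def
  proof (intro conjI allI impI)
    show "set_integrable lborel {a<..b} f'" for a b
    proof (cases "a \<le> b")
      case True
      then have "set_integrable lborel {a..b} f'" using I by (auto simp: set_integrable_def has_bochner_integral_iff)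
      then show ?thesis by (rule set_integrable_subset) auto
    qed (simp add: set_integrable_def)
    show "f b - f a = (LBINT t:{a<..b}. f' t)" if "a \<le> b" for a b
      using I[OF that] LBINT_atLeast_greaterThan[of f' a b] by (simp add: set_lebesgue_integral_def has_bochner_integral_iff)
  qed measurable
qed

lemma emeasure_lborel_half_line: "emeasure lborel {a::real..} = \<infinity>" "emeasure lborel {..a::real} = \<infinity>"
proof -
  have "of_nat n \<le> emeasure lborel {a..}" "of_nat n \<le> emeasure lborel {..a}" for n
  proof -
    have "emeasure lborel {a..a + real n} \<le> emeasure lborel {a..}" "emeasure lborel {a - real n..a} \<le> emeasure lborel {..a}"
      by (intro emeasure_mono; auto)+
    then show "of_nat n \<le> emeasure lborel {a..}" "of_nat n \<le> emeasure lborel {..a}"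
      by (simp_all add: ennreal_of_nat_eq_real_of_nat)
  qed
  then show "emeasure lborel {a..} = \<infinity>" "emeasure lborel {..a} = \<infinity>"
    by (metis ennreal_Ex_less_of_nat infinity_ennreal_def leD less_top)+
qed

text \<open>An integrable density gives limits at both ends; a nonzero limit would keep
  \<open>cmod (f x) ^ n\<close> away from 0 on a half-line, which has infinite measure.\<close>

lemma ac_tendsto_0:
  assumes f: "ac f f'" and i: "integrable lborel f'" and p: "integrable lborel (%x. cmod (f x) ^ n)"
  shows "(f \<longlongrightarrow> 0) at_top" "(f \<longlongrightarrow> 0) at_bot"
proof -
  have eq: "f x = (f 0 - cumint f' 0) + cumint f' x" for x
  proof (cases "0 \<le> x")
    case True
    then show ?thesis using ac_D(3)[OF f True] cumint_diff[OF i True] by (simp add: algebra_simps)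
  next
    case False
    then have "x \<le> 0" by simp
    show ?thesis using ac_D(3)[OF f \<open>x \<le> 0\<close>] cumint_diff[OF i \<open>x \<le> 0\<close>] by (simp add: algebra_simps)
  qed
  note [measurable] = ac_measurable[OF f]
  have z: "L = 0" if L: "(f \<longlongrightarrow> L) F" and F: "F = at_top \<or> F = at_bot" for L and F :: "real filter"
  proof (rule ccontr)
    assume "L \<noteq> 0"
    then have "eventually (%x. cmod L / 2 < cmod (f x)) F"
      using tendsto_norm[OF L] by (intro order_tendstoD(1)) auto
    then have "\<exists>a. (\<forall>x\<in>{a..}. cmod L / 2 < cmod (f x)) \<or> (\<forall>x\<in>{..a}. cmod L / 2 < cmod (f x))"
      using F unfolding eventually_at_top_linorder eventually_at_bot_linorder
      by (elim disjE) (metis atLeast_iff atMost_iff eventually_at_top_linorder eventually_at_bot_linorder)+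
    then obtain S where S: "S \<in> sets borel" "emeasure lborel S = \<infinity>" "\<forall>x\<in>S. cmod L / 2 < cmod (f x)"
    proof (elim exE disjE)
      fix a assume "\<forall>x\<in>{a..}. cmod L / 2 < cmod (f x)"
      then show thesis using that[of "{a..}"] emeasure_lborel_half_line[of a] by auto
    next
      fix a assume "\<forall>x\<in>{..a}. cmod L / 2 < cmod (f x)"
      then show thesis using that[of "{..a}"] emeasure_lborel_half_line[of a] by auto
    qed
    have "(\<integral>\<^sup>+x. ennreal ((cmod L / 2) ^ n) * indicator S x \<partial>lborel) \<le> (\<integral>\<^sup>+x. ennreal (cmod (f x) ^ n) \<partial>lborel)"
    proof (rule nn_integral_mono)
      fix x show "ennreal ((cmod L / 2) ^ n) * indicator S x \<le> ennreal (cmod (f x) ^ n)"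
      proof (cases "x \<in> S")
        case True
        then have "(cmod L / 2) ^ n \<le> cmod (f x) ^ n" using S(3) by (intro power_mono) (auto simp: less_imp_le)
        then show ?thesis using True by (simp add: ennreal_leI)
      qed simp
    qed
    also have "\<dots> = ennreal (LBINT x. cmod (f x) ^ n)" using p by (intro nn_integral_eq_integral) auto
    finally have "ennreal ((cmod L / 2) ^ n) * \<infinity> < \<infinity>" using S(1,2)
      by (simp add: nn_integral_cmult_indicator le_less_trans)
    then show False using \<open>L \<noteq> 0\<close> by (simp add: ennreal_mult_top)
  qed
  have "((%x. (f 0 - cumint f' 0) + cumint f' x) \<longlongrightarrow> (f 0 - cumint f' 0) + (LBINT y. f' y)) at_top"
    by (intro tendsto_intros cumint_tendsto_top i)
  then have 1: "(f \<longlongrightarrow> (f 0 - cumint f' 0) + (LBINT y. f' y)) at_top" by (simp only: eq[symmetric])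
  have "((%x. (f 0 - cumint f' 0) + cumint f' x) \<longlongrightarrow> (f 0 - cumint f' 0) + 0) at_bot"
    by (intro tendsto_intros cumint_tendsto_bot i)
  then have 2: "(f \<longlongrightarrow> (f 0 - cumint f' 0) + 0) at_bot" by (simp only: eq[symmetric])
  show "(f \<longlongrightarrow> 0) at_top" using 1 z[OF 1] by simp
  show "(f \<longlongrightarrow> 0) at_bot" using 2 z[OF 2] by simp
qed

section \<open>Smooth cutoff functions\<close>

definition bf :: "nat => real => real" where
  "bf k t = (if t \<le> 0 then 0 else inverse t ^ k * exp (- inverse t))"

lemma bf_tendsto_0: "(bf k \<longlongrightarrow> 0) (at 0)"
proof -
  have "((%t. inverse t ^ k / exp (inverse t)) \<longlongrightarrow> 0) (at_right (0::real))"
    using filterlim_compose[OF tendsto_power_div_exp_0 filterlim_inverse_at_top_right] .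
  then have "(bf k \<longlongrightarrow> 0) (at_right 0)"
    by (rule Lim_transform_eventually) (auto simp: bf_def eventually_at_filter exp_minus field_simps)
  moreover have "(bf k \<longlongrightarrow> 0) (at_left 0)"
    by (rule tendsto_eventually) (auto simp: bf_def eventually_at_filter)
  ultimately show ?thesis by (simp add: filterlim_split_at)
qed

text \<open>Differentiation only raises the power of \<open>1 / t\<close>, so the family over all
  \<open>k\<close> is closed under derivatives up to linear combination. At 0 the difference
  quotient is \<open>bf (k + 1)\<close>, which tends to 0.\<close>

lemma bf_deriv: "(bf k has_real_derivative (bf (k + 2) t - real k * bf (k + 1) t)) (at t)"
proof -
  consider "t < 0" | "t = 0" | "t > 0" by linarith
  then show ?thesis
  proof cases
    case 1
    have "((%_. 0) has_real_derivative 0) (at t)" by simp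
    then have "(bf k has_real_derivative 0) (at t)"
      by (rule DERIV_cong_ev[THEN iffD1, rotated -1])
         (use 1 eventually_nhds_in_open[of "{..<0}" t] in \<open>auto simp: bf_def elim!: eventually_mono\<close>)
    then show ?thesis using 1 by (simp add: bf_def)
  next
    case 2
    have "((%h. (bf k h - bf k 0) / (h - 0)) \<longlongrightarrow> 0) (at 0)"
    proof (rule Lim_transform_eventually[OF bf_tendsto_0[of "k + 1"]])
      show "eventually (%h. bf (k + 1) h = (bf k h - bf k 0) / (h - 0)) (at 0)"
        by (auto simp: bf_def eventually_at_filter field_simps)
    qed
    then have "(bf k has_real_derivative 0) (at 0)" by (simp add: has_field_derivative_iff)
    then show ?thesis using 2 by (simp add: bf_def)
  next
    case 3
    have "((%t. inverse t ^ k * exp (- inverse t)) has_real_derivative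
       (real k * inverse t ^ (k - 1) * (- (inverse t * inverse t)) * exp (- inverse t) + inverse t ^ k * (exp (- inverse t) * (inverse t * inverse t)))) (at t)"
      using 3 by (auto intro!: derivative_eq_intros)
    moreover have "real k * inverse t ^ (k - 1) * (- (inverse t * inverse t)) * exp (- inverse t) + inverse t ^ k * (exp (- inverse t) * (inverse t * inverse t)) = bf (k + 2) t - real k * bf (k + 1) t"
      using 3 by (cases k) (simp_all add: bf_def algebra_simps)
    ultimately have "((%t. inverse t ^ k * exp (- inverse t)) has_real_derivative (bf (k + 2) t - real k * bf (k + 1) t)) (at t)" by simp
    then show ?thesis
      by (rule DERIV_cong_ev[THEN iffD1, rotated -1])
         (use 3 eventually_nhds_in_open[of "{0<..}" t] in \<open>auto simp: bf_def elim!: eventually_mono\<close>)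
  qed
qed

text \<open>An algebra closed under \<open>deriv\<close>, so that smoothness of all orders follows
  from one induction instead of formulas for higher derivatives.\<close>

inductive bump_alg :: "(real => real) => bool" where
  gen: "bump_alg (%x. bf k (c * x + d))"
| const: "bump_alg (%x. r)"
| add: "bump_alg f \<Longrightarrow> bump_alg g \<Longrightarrow> bump_alg (%x. f x + g x)"
| mult: "bump_alg f \<Longrightarrow> bump_alg g \<Longrightarrow> bump_alg (%x. f x * g x)"

lemma bump_alg_deriv: "bump_alg f \<Longrightarrow> \<exists>f'. bump_alg f' \<and> (\<forall>x. (f has_real_derivative f' x) (at x))"
proof (induction rule: bump_alg.induct)
  case (gen k c d)
  have "((%x. bf k (c * x + d)) has_real_derivative ((bf (k + 2) (c * x + d) + (- real k) * bf (k + 1) (c * x + d)) * c)) (at x)" for x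
    by (rule DERIV_chain2[where g="%x. c * x + d"]) (use bf_deriv[of k] in \<open>auto intro!: derivative_eq_intros\<close>)
  moreover have "bump_alg (%x. (bf (k + 2) (c * x + d) + (- real k) * bf (k + 1) (c * x + d)) * c)"
    by (intro bump_alg.intros)
  ultimately show ?case by blast
next
  case (const r)
  show ?case by (rule exI[of _ "%x. 0"]) (auto intro: bump_alg.const)
next
  case (add f g)
  then obtain f' g' where "bump_alg f'" "\<forall>x. (f has_real_derivative f' x) (at x)" "bump_alg g'" "\<forall>x. (g has_real_derivative g' x) (at x)" by blast
  then show ?case by (intro exI[of _ "%x. f' x + g' x"]) (auto intro!: bump_alg.add derivative_intros)
next
  case (mult f g)
  then obtain f' g' where "bump_alg f'" "\<forall>x. (f has_real_derivative f' x) (at x)" "bump_alg g'" "\<forall>x. (g has_real_derivative g' x) (at x)" by blast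
  then show ?case using mult
    by (intro exI[of _ "%x. f' x * g x + g' x * f x"]) (auto intro!: bump_alg.add bump_alg.mult derivative_intros)
qed

lemma bump_alg_deriv': "bump_alg f \<Longrightarrow> bump_alg (deriv f)" "bump_alg f \<Longrightarrow> f differentiable (at x)"
proof -
  assume "bump_alg f"
  then obtain f' where f': "bump_alg f'" "\<And>x. (f has_real_derivative f' x) (at x)" using bump_alg_deriv by blast
  have "deriv f = f'" using f'(2) by (auto intro: DERIV_imp_deriv)
  then show "bump_alg (deriv f)" using f'(1) by simp
  show "f differentiable (at x)" using f'(2)[of x] by (auto simp: real_differentiable_def)
qed

lemma bump_alg_smooth: "bump_alg f \<Longrightarrow> (deriv ^^ n) f differentiable (at x)"
proof -
  assume "bump_alg f"
  then have "bump_alg ((deriv ^^ n) f)" by (induction n) (auto intro: bump_alg_deriv')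
  then show ?thesis by (rule bump_alg_deriv')
qed

lemma compact_support_iff: "compact (closure {x::real. \<eta> x \<noteq> (0::real)}) \<longleftrightarrow> (\<exists>R. \<forall>x. R < \<bar>x\<bar> \<longrightarrow> \<eta> x = 0)"
proof
  assume "compact (closure {x. \<eta> x \<noteq> 0})"
  then have "bounded {x. \<eta> x \<noteq> 0}" by (simp add: compact_closure)
  then obtain R where "\<forall>x\<in>{x. \<eta> x \<noteq> 0}. norm x \<le> R" by (auto simp: bounded_iff)
  then show "\<exists>R. \<forall>x. R < \<bar>x\<bar> \<longrightarrow> \<eta> x = 0" by (intro exI[of _ R]) force
next
  assume "\<exists>R. \<forall>x. R < \<bar>x\<bar> \<longrightarrow> \<eta> x = 0"
  then obtain R where "\<forall>x. R < \<bar>x\<bar> \<longrightarrow> \<eta> x = 0" by blast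
  then have "bounded {x. \<eta> x \<noteq> 0}" unfolding bounded_iff by (intro exI[of _ R]) force
  then show "compact (closure {x. \<eta> x \<noteq> 0})" by (simp add: compact_closure)
qed

lemma bump_test_function:
  assumes "bump_alg \<eta>" "\<And>x. R < \<bar>x\<bar> \<Longrightarrow> \<eta> x = 0"
  shows "test_function \<eta>"
  unfolding test_function_def compact_support_iff using assms bump_alg_smooth by blast

lemma test_function_D:
  assumes "test_function \<eta>"
  obtains R K where "\<And>x. R < \<bar>x\<bar> \<Longrightarrow> \<eta> x = 0" "\<And>x. R < \<bar>x\<bar> \<Longrightarrow> deriv \<eta> x = 0"
    "\<And>x. (\<eta> has_real_derivative deriv \<eta> x) (at x)" "continuous_on UNIV \<eta>" "continuous_on UNIV (deriv \<eta>)"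
    "\<And>x. \<bar>\<eta> x\<bar> \<le> K" "\<And>x. \<bar>deriv \<eta> x\<bar> \<le> K" "R > 0"
proof -
  from assms have sm: "\<And>n x. (deriv ^^ n) \<eta> differentiable (at x)" and cs: "compact (closure {x. \<eta> x \<noteq> 0})"
    by (auto simp: test_function_def)
  from cs obtain R0 where R0: "\<forall>x. R0 < \<bar>x\<bar> \<longrightarrow> \<eta> x = 0" unfolding compact_support_iff by blast
  define R where "R = max R0 1"
  have R: "R < \<bar>x\<bar> \<Longrightarrow> \<eta> x = 0" for x using R0 by (auto simp: R_def)
  have d: "(\<eta> has_real_derivative deriv \<eta> x) (at x)" for x
    using sm[of 0 x] by (simp add: DERIV_deriv_iff_real_differentiable)
  have c0: "continuous_on UNIV \<eta>" using d by (meson DERIV_continuous continuous_at_imp_continuous_on)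
  have c1: "continuous_on UNIV (deriv \<eta>)"
    using sm[of 1] by (intro continuous_at_imp_continuous_on ballI differentiable_imp_continuous_within) simp
  have dR: "deriv \<eta> x = 0" if "R < \<bar>x\<bar>" for x
  proof -
    have "eventually (%y. \<eta> y = 0) (nhds x)"
    proof (rule eventually_mono)
      have "open {y::real. R < \<bar>y\<bar>}" by (intro open_Collect_less continuous_intros)
      then show "eventually (%y. y \<in> {y. R < \<bar>y\<bar>}) (nhds x)" using that by (intro eventually_nhds_in_open) auto
    qed (use R in auto)
    then have "(\<eta> has_real_derivative 0) (at x)"
      by (subst DERIV_cong_ev[OF refl _ refl, where g="%_. 0"]) auto
    then show ?thesis by (rule DERIV_imp_deriv)
  qed
  have bdd: "\<exists>K. \<forall>x. \<bar>h x\<bar> \<le> K" if "continuous_on UNIV h" "\<And>x. R < \<bar>x\<bar> \<Longrightarrow> h x = 0" for h :: "real => real"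
  proof -
    have "compact (h ` {-R..R})" by (intro compact_continuous_image continuous_on_subset[OF that(1)]) auto
    then obtain K where K: "\<forall>x\<in>{-R..R}. \<bar>h x\<bar> \<le> K" by (auto dest!: compact_imp_bounded simp: bounded_iff)
    have "\<bar>h x\<bar> \<le> max K 0" for x
    proof (cases "R < \<bar>x\<bar>")
      case False
      then have "x \<in> {-R..R}" by auto
      then show ?thesis using K by (auto simp: le_max_iff_disj)
    qed (use that(2) in auto)
    then show ?thesis by blast
  qed
  obtain K where K: "\<forall>x. \<bar>\<eta> x\<bar> \<le> K" using bdd[OF c0 R] by blast
  obtain K' where K': "\<forall>x. \<bar>deriv \<eta> x\<bar> \<le> K'" using bdd[OF c1 dR] by blast
  show ?thesis
    by (rule that[of R "max K K'", OF R dR d c0 c1]) (use K K' in \<open>auto simp: R_def le_max_iff_disj\<close>)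
qed

lemma test_function_ac:
  assumes "test_function \<eta>"
  shows "ac (%x. of_real (\<eta> x)) (%x. of_real (deriv \<eta> x))"
proof -
  obtain R K where e: "\<And>x. R < \<bar>x\<bar> \<Longrightarrow> \<eta> x = 0" "\<And>x. R < \<bar>x\<bar> \<Longrightarrow> deriv \<eta> x = 0"
    "\<And>x. (\<eta> has_real_derivative deriv \<eta> x) (at x)" "continuous_on UNIV \<eta>" "continuous_on UNIV (deriv \<eta>)"
    "\<And>x. \<bar>\<eta> x\<bar> \<le> K" "\<And>x. \<bar>deriv \<eta> x\<bar> \<le> K" "R > 0" by (rule test_function_D[OF assms]) blast
  show ?thesis
    by (rule ac_C1) (auto intro!: has_vector_derivative_of_real continuous_intros e(5) simp: e(3) has_real_derivative_iff_has_vector_derivative[symmetric])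
qed

text \<open>Written with explicit affine arguments to match the generators of
  \<open>bump_alg\<close>. The slope \<open>Suc n\<close> makes the functions converge to the
  indicator of \<open>{a<..<b}\<close> while staying below it.\<close>

definition cutoff :: "real => real => nat => real => real" where
  "cutoff a b n x = bf 0 (real (Suc n) * x + (- real (Suc n) * a)) * bf 0 (- real (Suc n) * x + real (Suc n) * b)"

lemma cutoff_alg: "bump_alg (cutoff a b n)"
  unfolding cutoff_def[abs_def] by (intro bump_alg.intros)

lemma bf0_bounds: "0 \<le> bf 0 t" "bf 0 t \<le> 1" by (auto simp: bf_def)

lemma cutoff_bounds: "0 \<le> cutoff a b n x" "cutoff a b n x \<le> 1"
  unfolding cutoff_def using bf0_bounds by (auto intro: mult_le_one)

lemma cutoff_eq: "cutoff a b n x = bf 0 (real (Suc n) * (x - a)) * bf 0 (real (Suc n) * (b - x))"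
  by (simp add: cutoff_def algebra_simps)

lemma cutoff_zero: "x \<notin> {a<..<b} \<Longrightarrow> cutoff a b n x = 0"
proof -
  assume "x \<notin> {a<..<b}"
  then consider "x - a \<le> 0" | "b - x \<le> 0" by force
  then show ?thesis
  proof cases
    case 1
    then have "real (Suc n) * (x - a) \<le> 0" by (intro mult_nonneg_nonpos) auto
    then show ?thesis by (simp add: cutoff_eq bf_def del: of_nat_Suc)
  next
    case 2
    then have "real (Suc n) * (b - x) \<le> 0" by (intro mult_nonneg_nonpos) auto
    then show ?thesis by (simp add: cutoff_eq bf_def del: of_nat_Suc)
  qed
qed

lemma bf0_pos: "0 < t \<Longrightarrow> bf 0 t = exp (- inverse t)"
  by (simp add: bf_def)

lemma cutoff_pos: "x \<in> {a<..<b} \<Longrightarrow> 0 < cutoff a b n x"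
  by (simp add: cutoff_eq bf0_pos del: of_nat_Suc)

lemma cutoff_test: "test_function (cutoff a b n)"
  by (rule bump_test_function[OF cutoff_alg, where R="max \<bar>a\<bar> \<bar>b\<bar>"]) (auto intro!: cutoff_zero)

lemma cutoff_tendsto: "(%n. cutoff a b n x) \<longlonglongrightarrow> indicator {a<..<b} x"
proof (cases "x \<in> {a<..<b}")
  case False
  then show ?thesis by (simp add: cutoff_zero)
next
  case True
  have lim: "(%n. bf 0 (real (Suc n) * t)) \<longlonglongrightarrow> 1" if "t > 0" for t
  proof -
    have "(%n. exp (- (inverse (real (Suc n)) * inverse t))) \<longlonglongrightarrow> exp (- (0 * inverse t))"
      by (intro tendsto_intros LIMSEQ_inverse_real_of_nat)
    moreover have "bf 0 (real (Suc n) * t) = exp (- (inverse (real (Suc n)) * inverse t))" for n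
      using that by (subst bf0_pos) (auto simp: inverse_mult_distrib)
    ultimately show ?thesis by simp
  qed
  have "(%n. bf 0 (real (Suc n) * (x - a)) * bf 0 (real (Suc n) * (b - x))) \<longlonglongrightarrow> 1 * 1"
    using True by (intro tendsto_mult lim) auto
  then show ?thesis using True by (simp add: cutoff_eq)
qed

lemma cutoff_measurable [measurable]: "cutoff a b n \<in> borel_measurable borel"
proof -
  have "continuous_on UNIV (cutoff a b n)"
    by (intro continuous_at_imp_continuous_on ballI differentiable_imp_continuous_within bump_alg_deriv'(2) cutoff_alg)
  then show ?thesis by (rule borel_measurable_continuous_onI)
qed

section \<open>The fundamental lemma of the calculus of variations\<close>

text \<open>The positive and the negative part of \<open>k\<close> are densities of finite measures
  that agree on all rays \<open>{x<..}\<close>, hence coincide; densities are unique almost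
  everywhere.\<close>

lemma AE_zero_of_cumint_zero:
  fixes k :: "real => real"
  assumes k: "integrable lborel k" and z: "\<And>x. cumint k x = 0"
  shows "AE x in lborel. k x = 0"
proof -
  have [measurable]: "borel_fun k" using k by auto
  have tot: "(LBINT y. k y) = 0"
  proof -
    have "(cumint k \<longlongrightarrow> 0) at_top" using z by (simp add: tendsto_eventually)
    then show ?thesis by (rule tendsto_unique[OF trivial_limit_at_top_linorder cumint_tendsto_top[OF k]])
  qed
  let ?p = "%y. max 0 (k y)" and ?m = "%y. max 0 (- k y)"
  have pm: "integrable lborel ?p" "integrable lborel ?m" using k by auto
  have ray: "(LBINT y:{x<..}. k y) = 0" for x
  proof -
    have "{..x} \<union> {x<..} = UNIV" by auto
    moreover have "(LBINT y:{..x} \<union> {x<..}. k y) = (LBINT y:{..x}. k y) + (LBINT y:{x<..}. k y)"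
      by (intro set_integral_Un set_integrable_lborel k) auto
    ultimately have "(LBINT y:UNIV. k y) = (LBINT y:{..x}. k y) + (LBINT y:{x<..}. k y)" by simp
    then show ?thesis using z[of x] tot by (simp add: cumint_def set_lebesgue_integral_def)
  qed
  have em: "emeasure (density lborel (%y. ennreal (f y))) {x<..} = ennreal (LBINT y:{x<..}. f y)" if "integrable lborel f" "\<And>y. 0 \<le> f y" for f :: "real => real" and x
  proof -
    have "emeasure (density lborel (%y. ennreal (f y))) {x<..} = (\<integral>\<^sup>+y. ennreal (f y) * indicator {x<..} y \<partial>lborel)"
      using that by (subst emeasure_density) auto
    also have "\<dots> = (\<integral>\<^sup>+y. ennreal (indicator {x<..} y *\<^sub>R f y) \<partial>lborel)"
      by (intro nn_integral_cong) (auto simp: indicator_def)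
    also have "\<dots> = ennreal (LBINT y:{x<..}. f y)"
      unfolding set_lebesgue_integral_def
      by (rule nn_integral_eq_integral) (use set_integrable_lborel[OF that(1), of "{x<..}"] that(2) in \<open>auto simp: set_integrable_def\<close>)
    finally show ?thesis .
  qed
  have "density lborel (%y. ennreal (?p y)) = density lborel (%y. ennreal (?m y))"
  proof (rule measure_eqI_lessThan)
    fix x
    show "emeasure (density lborel (%y. ennreal (?p y))) {x<..} < \<infinity>" by (subst em) (use pm in auto)
    have "(LBINT y:{x<..}. ?p y) - (LBINT y:{x<..}. ?m y) = (LBINT y:{x<..}. ?p y - ?m y)"
      by (rule set_integral_diff(2)[symmetric]) (intro set_integrable_lborel pm, auto)+
    also have "(%y. ?p y - ?m y) = k" by auto
    finally have "(LBINT y:{x<..}. ?p y) = (LBINT y:{x<..}. ?m y)" using ray[of x] by simp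
    then show "emeasure (density lborel (%y. ennreal (?p y))) {x<..} = emeasure (density lborel (%y. ennreal (?m y))) {x<..}"
      using em[OF pm(1)] em[OF pm(2)] by simp
  qed auto
  then have "AE y in lborel. ennreal (?p y) = ennreal (?m y)"
    using pm by (subst (asm) sigma_finite_measure.density_unique_iff[OF sigma_finite_lborel]) auto
  then show ?thesis by eventually_elim (auto simp: max_def split: if_splits)
qed

text \<open>The cutoffs converge to indicators of intervals, so \<open>h\<close> has integral 0 over
  each interval; \<open>AE_zero_of_cumint_zero\<close> then applies to its real and imaginary parts
  on \<open>{-R<..<R}\<close>.\<close>

lemma AE_zero_of_test_zero:
  assumes h [measurable]: "borel_fun h" and li: "\<And>R. set_integrable lborel {-R..R} h"
    and z: "\<And>a b n. (LBINT x. cutoff a b n x *\<^sub>R h x) = (0::complex)"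
  shows "AE x in lborel. h x = 0"
proof -
  have iv: "(LBINT x:{a<..<b}. h x) = 0" for a b
  proof -
    define R where "R = max \<bar>a\<bar> \<bar>b\<bar>"
    have "(%n. LBINT x. cutoff a b n x *\<^sub>R h x) \<longlonglongrightarrow> (LBINT x. indicator {a<..<b} x *\<^sub>R h x)"
    proof (rule integral_dominated_convergence[where w="%x. indicator {-R..R} x *\<^sub>R cmod (h x)"])
      show "integrable lborel (%x. indicator {-R..R} x *\<^sub>R cmod (h x))"
        using set_integrable_norm[OF li[of R]] by (simp add: set_integrable_def)
      show "AE x in lborel. norm (cutoff a b n x *\<^sub>R h x) \<le> indicator {-R..R} x *\<^sub>R cmod (h x)" for n
      proof (rule AE_I2)
        fix x
        show "norm (cutoff a b n x *\<^sub>R h x) \<le> indicator {-R..R} x *\<^sub>R cmod (h x)"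
        proof (cases "x \<in> {-R..R}")
          case True
          then show ?thesis using cutoff_bounds[of a b n x] by (simp add: mult_left_le_one_le)
        next
          case False
          then have "x \<notin> {a<..<b}" by (auto simp: R_def)
          then show ?thesis using cutoff_zero by simp
        qed
      qed
    qed (auto intro!: tendsto_scaleR cutoff_tendsto)
    then have "(LBINT x. indicator {a<..<b} x *\<^sub>R h x) = 0"
      using LIMSEQ_unique[OF _ tendsto_const] by (simp add: z)
    then show ?thesis by (simp add: set_lebesgue_integral_def)
  qed
  have R: "AE x in lborel. x \<in> {-R<..<R} \<longrightarrow> h x = 0" for R
  proof -
    let ?g = "%x. indicator {-R<..<R} x *\<^sub>R h x"
    have gi: "integrable lborel ?g"
    proof -
      have "set_integrable lborel {-R<..<R} h" by (rule set_integrable_subset[OF li[of R]]) auto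
      then show ?thesis by (simp add: set_integrable_def)
    qed
    have cz: "cumint ?g x = 0" for x
    proof -
      have "cumint ?g x = (LBINT y:{-R<..<min R x}. h y)"
        unfolding cumint_def set_lebesgue_integral_def
        by (rule integral_cong_AE) (use AE_lborel_singleton[of x] in \<open>auto simp: indicator_def elim!: eventually_mono\<close>)
      then show ?thesis by (simp add: iv)
    qed
    have "AE x in lborel. Re (?g x) = 0"
    proof (rule AE_zero_of_cumint_zero)
      show "integrable lborel (%x. Re (?g x))" by (rule integrable_Re[OF gi])
      show "cumint (%x. Re (?g x)) x = 0" for x
        using cumint_bounded_linear[OF bounded_linear_Re set_integrable_lborel[OF gi], of x] cz[of x] by simp
    qed
    moreover have "AE x in lborel. Im (?g x) = 0"
    proof (rule AE_zero_of_cumint_zero)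
      show "integrable lborel (%x. Im (?g x))" by (rule integrable_Im[OF gi])
      show "cumint (%x. Im (?g x)) x = 0" for x
        using cumint_bounded_linear[OF bounded_linear_Im set_integrable_lborel[OF gi], of x] cz[of x] by simp
    qed
    ultimately show ?thesis by eventually_elim (auto simp: complex_eq_iff)
  qed
  have "AE x in lborel. \<forall>n. x \<in> {- real n<..<real n} \<longrightarrow> h x = 0"
    unfolding AE_all_countable using R by blast
  then show ?thesis
  proof eventually_elim
    case (elim x)
    obtain n where "\<bar>x\<bar> < real n" using reals_Archimedean2 by blast
    then have "x \<in> {- real n<..<real n}" by auto
    then show ?case using elim by blast
  qed
qed

section \<open>Borel representatives\<close>

text \<open>Completeness of Lebesgue measure. Potentials are given as Lebesgue measurable functions,
  while all estimates are made for Borel functions agreeing with them off a null set.\<close>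

lemma lebesgue_measurable_AE:
  fixes f F :: "real => complex"
  assumes F: "borel_fun F" and ae: "AE x in lborel. f x = F x"
  shows "f \<in> borel_measurable lebesgue"
proof (rule measurableI)
  fix A :: "complex set" assume A: "A \<in> sets borel"
  have "f -` A \<in> sets lebesgue"
  proof (rule completion.in_sets_AE[where A="F -` A"])
    show "AE x in lebesgue. (x \<in> F -` A) = (x \<in> f -` A)"
      using AE_completion[OF ae] by eventually_elim simp
    have "F -` A \<in> sets borel" using measurable_sets[OF F A] by simp
    then show "F -` A \<in> sets lebesgue" by auto
  qed auto
  then show "f -` A \<inter> space lebesgue \<in> sets lebesgue" by simp
qed auto

lemma lebesgue_borel_rep:
  fixes f :: "real => complex"
  assumes "f \<in> borel_measurable lebesgue"
  obtains F where "borel_fun F" "AE x in lborel. f x = F x"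
proof -
  have "(%x. Re (f x)) \<in> borel_measurable lebesgue" "(%x. Im (f x)) \<in> borel_measurable lebesgue"
    using assms by auto
  then obtain r i where r: "r \<in> borel_measurable lborel" "AE x in lborel. Re (f x) = r x"
    and i: "i \<in> borel_measurable lborel" "AE x in lborel. Im (f x) = i x"
    using completion_ex_borel_measurable_real by blast
  show ?thesis
  proof (rule that[of "%x. Complex (r x) (i x)"])
    have "borel_fun (%x. complex_of_real (r x) + \<i> * of_real (i x))" using r(1) i(1) by simp
    then show "borel_fun (%x. Complex (r x) (i x))" by (simp add: Complex_eq)
    show "AE x in lborel. f x = Complex (r x) (i x)"
      using r(2) i(2) by eventually_elim (simp add: complex_eq_iff)
  qed
qed

lemma lebesgue_integral_AE:
  fixes f F :: "real => 'a::{banach, second_countable_topology}"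
  assumes f: "f \<in> borel_measurable lebesgue" and F: "borel_fun F" and ae: "AE x in lborel. f x = F x"
  shows "integrable lebesgue f \<longleftrightarrow> integrable lborel F" "(LINT x|lebesgue. f x) = (LBINT x. F x)"
proof -
  have F': "F \<in> borel_measurable lebesgue" using F by (simp add: measurable_completion)
  have "integrable lebesgue f \<longleftrightarrow> integrable lebesgue F"
    by (rule integrable_cong_AE[OF f F' AE_completion[OF ae]])
  then show "integrable lebesgue f \<longleftrightarrow> integrable lborel F" using F by (simp add: integrable_completion)
  have "(LINT x|lebesgue. f x) = (LINT x|lebesgue. F x)" by (rule integral_cong_AE[OF f F' AE_completion[OF ae]])
  then show "(LINT x|lebesgue. f x) = (LBINT x. F x)" using F by (simp add: integral_completion)
qed

lemma locally_integrable_measurable: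
  assumes "locally_integrable f" shows "f \<in> borel_measurable lebesgue"
proof (rule borel_measurable_LIMSEQ_metric)
  show "(%x. indicator {- real n..real n} x *\<^sub>R f x) \<in> borel_measurable lebesgue" for n
  proof -
    have "set_integrable lebesgue {- real n..real n} f" using assms by (simp add: locally_integrable_def)
    then show ?thesis unfolding set_integrable_def by (rule borel_measurable_integrable)
  qed
  show "(%n. indicator {- real n..real n} x *\<^sub>R f x) \<longlonglongrightarrow> f x" for x
  proof (rule tendsto_eventually)
    obtain N where N: "\<bar>x\<bar> \<le> real N" using real_arch_simple by blast
    show "eventually (%n. indicator {- real n..real n} x *\<^sub>R f x = f x) sequentially"
      using eventually_ge_at_top[of N] by eventually_elim (use N in \<open>auto simp: indicator_def\<close>)
  qed
qed

lemma set_integrable_lebesgue_AE: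
  fixes f F :: "real => complex"
  assumes f: "f \<in> borel_measurable lebesgue" and F: "borel_fun F" and ae: "AE x in lborel. f x = F x"
    and S: "S \<in> sets borel"
  shows "set_integrable lebesgue S f \<longleftrightarrow> set_integrable lborel S F"
  unfolding set_integrable_def
proof (rule lebesgue_integral_AE(1))
  have "S \<in> sets lebesgue" using S by auto
  then show "(%x. indicator S x *\<^sub>R f x) \<in> borel_measurable lebesgue" using f by (intro borel_measurable_scaleR borel_measurable_indicator)
  show "borel_fun (%x. indicator S x *\<^sub>R F x)" using F S by (intro borel_measurable_scaleR borel_measurable_indicator)
  show "AE x in lborel. indicator S x *\<^sub>R f x = indicator S x *\<^sub>R F x" using ae by eventually_elim simp
qed

lemma locally_integrable_AE:
  assumes F: "borel_fun F" and ae: "AE x in lborel. f x = F x"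
  shows "locally_integrable f \<longleftrightarrow> (\<forall>R. set_integrable lborel {-R..R} F)"
proof -
  note f = lebesgue_measurable_AE[OF F ae]
  show ?thesis
  proof
    assume "locally_integrable f"
    then show "\<forall>R. set_integrable lborel {-R..R} F"
      using set_integrable_lebesgue_AE[OF f F ae] by (auto simp: locally_integrable_def)
  next
    assume R: "\<forall>R. set_integrable lborel {-R..R} F"
    show "locally_integrable f"
      unfolding locally_integrable_def
    proof (intro allI impI)
      fix K :: "real set" assume K: "compact K"
      then obtain R where "\<forall>x\<in>K. norm x \<le> R" using compact_imp_bounded[OF K] unfolding bounded_iff by blast
      then have "K \<subseteq> {-R..R}" by (auto simp: abs_le_iff minus_le_iff)
      moreover have "K \<in> sets borel" using K by (simp add: borel_compact)
      ultimately show "set_integrable lebesgue K f"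
        unfolding set_integrable_lebesgue_AE[OF f F ae \<open>K \<in> sets borel\<close>]
        by (intro set_integrable_subset[OF R[rule_format, of R]]) auto
    qed
  qed
qed

lemma test_function_measurable:
  assumes "test_function \<eta>" shows "borel_fun \<eta>" "deriv \<eta> \<in> borel_measurable borel"
proof -
  obtain R K where e: "\<And>x. R < \<bar>x\<bar> \<Longrightarrow> \<eta> x = 0" "\<And>x. R < \<bar>x\<bar> \<Longrightarrow> deriv \<eta> x = 0"
    "\<And>x. (\<eta> has_real_derivative deriv \<eta> x) (at x)" "continuous_on UNIV \<eta>" "continuous_on UNIV (deriv \<eta>)"
    "\<And>x. \<bar>\<eta> x\<bar> \<le> K" "\<And>x. \<bar>deriv \<eta> x\<bar> \<le> K" "R > 0" by (rule test_function_D[OF assms]) blast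
  show "borel_fun \<eta>" "deriv \<eta> \<in> borel_measurable borel"
    using e(4,5) by (auto intro: borel_measurable_continuous_onI)
qed

lemma has_weak_deriv_borel:
  assumes F: "borel_fun F" "AE x in lborel. f x = F x" and G: "borel_fun G" "AE x in lborel. g x = G x"
  shows "has_weak_deriv f g \<longleftrightarrow> (\<forall>R. set_integrable lborel {-R..R} F) \<and> (\<forall>R. set_integrable lborel {-R..R} G) \<and>
    (\<forall>\<eta>. test_function \<eta> \<longrightarrow> (LBINT x. deriv \<eta> x *\<^sub>R F x) = - (LBINT x. \<eta> x *\<^sub>R G x))"
proof -
  have "(LINT x|lebesgue. \<psi> x *\<^sub>R f x) = (LBINT x. \<psi> x *\<^sub>R F x)"
    if \<psi>: "borel_fun \<psi>" and F: "borel_fun F" "AE x in lborel. f x = F x" for \<psi> and f F :: "real => complex"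
  proof (rule lebesgue_integral_AE(2))
    have "\<psi> \<in> borel_measurable lebesgue" using \<psi> by (simp add: measurable_completion)
    then show "(%x. \<psi> x *\<^sub>R f x) \<in> borel_measurable lebesgue" using lebesgue_measurable_AE[OF F] by (rule borel_measurable_scaleR)
    show "borel_fun (%x. \<psi> x *\<^sub>R F x)" using \<psi> F(1) by (rule borel_measurable_scaleR)
    show "AE x in lborel. \<psi> x *\<^sub>R f x = \<psi> x *\<^sub>R F x" using F(2) by eventually_elim simp
  qed
  then have "(LINT x|lebesgue. deriv \<eta> x *\<^sub>R f x) = (LBINT x. deriv \<eta> x *\<^sub>R F x)" "(LINT x|lebesgue. \<eta> x *\<^sub>R g x) = (LBINT x. \<eta> x *\<^sub>R G x)"
    if "test_function \<eta>" for \<eta>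
    using test_function_measurable[OF that] F G by blast+
  then show ?thesis
    unfolding has_weak_deriv_def locally_integrable_AE[OF F] locally_integrable_AE[OF G] by auto
qed

lemma has_weak_deriv_rep:
  assumes "has_weak_deriv f g"
  obtains F G where "borel_fun F" "AE x in lborel. f x = F x" "borel_fun G" "AE x in lborel. g x = G x"
proof -
  have fg: "f \<in> borel_measurable lebesgue" "g \<in> borel_measurable lebesgue"
    using assms by (auto simp: has_weak_deriv_def intro: locally_integrable_measurable)
  obtain F where F: "borel_fun F" "AE x in lborel. f x = F x" by (rule lebesgue_borel_rep[OF fg(1)])
  obtain G where G: "borel_fun G" "AE x in lborel. g x = G x" by (rule lebesgue_borel_rep[OF fg(2)])
  show ?thesis by (rule that[OF F G])
qed

lemma set_integrable_cutoff:
  fixes F :: "real => complex"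
  assumes \<psi>: "borel_fun \<psi>" "\<And>x. R < \<bar>x\<bar> \<Longrightarrow> \<psi> x = 0" "\<And>x. \<bar>\<psi> x\<bar> \<le> K" and F: "set_integrable lborel {-R..R} F"
  shows "integrable lborel (%x. \<psi> x *\<^sub>R F x)"
proof -
  have "integrable lborel (%x. (indicator {-R..R} x *\<^sub>R F x) * of_real (\<psi> x))"
    by (rule integrable_bounded_mult(1)[where B=K]) (use F \<psi> in \<open>auto simp: set_integrable_def\<close>)
  moreover have "(indicator {-R..R} x *\<^sub>R F x) * of_real (\<psi> x) = \<psi> x *\<^sub>R F x" for x
    using \<psi>(2)[of x] by (cases "R < \<bar>x\<bar>") (auto simp: indicator_def scaleR_conv_of_real mult.commute not_less abs_le_iff)
  ultimately show ?thesis by simp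
qed

lemma ac_set_integrable:
  assumes "ac f f'" shows "set_integrable lborel {-R..R} f'" "set_integrable lborel {-R..R} f"
proof -
  have "set_integrable lborel {-R - 1<..R} f'" by (rule ac_D(2)[OF assms])
  then show "set_integrable lborel {-R..R} f'" by (rule set_integrable_subset) auto
  have "continuous_on {-R..R} f" by (intro continuous_at_imp_continuous_on ballI ac_isCont[OF assms])
  then show "set_integrable lborel {-R..R} f"
    unfolding set_integrable_def by (intro borel_integrable_compact) auto
qed

section \<open>Weak derivatives as densities of absolutely continuous functions\<close>

text \<open>The product rule \<open>ac_mult\<close> on \<open>{- R - 1<..R + 1}\<close>, at whose
  ends the test function vanishes.\<close>

lemma ac_weak:
  assumes f: "ac f f'" and \<eta>: "test_function \<eta>"
  shows "(LBINT x. deriv \<eta> x *\<^sub>R f x) = - (LBINT x. \<eta> x *\<^sub>R f' x)"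
proof -
  obtain R K where e: "\<And>x. R < \<bar>x\<bar> \<Longrightarrow> \<eta> x = 0" "\<And>x. R < \<bar>x\<bar> \<Longrightarrow> deriv \<eta> x = 0"
    "\<And>x. (\<eta> has_real_derivative deriv \<eta> x) (at x)" "continuous_on UNIV \<eta>" "continuous_on UNIV (deriv \<eta>)"
    "\<And>x. \<bar>\<eta> x\<bar> \<le> K" "\<And>x. \<bar>deriv \<eta> x\<bar> \<le> K" "R > 0" by (rule test_function_D[OF \<eta>]) blast
  note i = set_integrable_cutoff[OF test_function_measurable(2)[OF \<eta>] e(2) e(7) ac_set_integrable(2)[OF f]]
    set_integrable_cutoff[OF test_function_measurable(1)[OF \<eta>] e(1) e(6) ac_set_integrable(1)[OF f]]
  have "of_real (\<eta> (R + 1)) * f (R + 1) - of_real (\<eta> (- R - 1)) * f (- R - 1) = (LBINT x:{- R - 1<..R + 1}. of_real (deriv \<eta> x) * f x + of_real (\<eta> x) * f' x)"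
    by (rule ac_D(3)[OF ac_mult[OF test_function_ac[OF \<eta>] f]]) (use e(8) in auto)
  also have "(LBINT x:{- R - 1<..R + 1}. of_real (deriv \<eta> x) * f x + of_real (\<eta> x) * f' x) = (LBINT x. deriv \<eta> x *\<^sub>R f x + \<eta> x *\<^sub>R f' x)"
    unfolding set_lebesgue_integral_def
  proof (rule Bochner_Integration.integral_cong[OF refl])
    fix x show "indicator {- R - 1<..R + 1} x *\<^sub>R (of_real (deriv \<eta> x) * f x + of_real (\<eta> x) * f' x) = deriv \<eta> x *\<^sub>R f x + \<eta> x *\<^sub>R f' x"
      using e(1,2)[of x] by (cases "R < \<bar>x\<bar>") (auto simp: indicator_def scaleR_conv_of_real)
  qed
  also have "\<dots> = (LBINT x. deriv \<eta> x *\<^sub>R f x) + (LBINT x. \<eta> x *\<^sub>R f' x)"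
    by (rule Bochner_Integration.integral_add[OF i])
  finally show ?thesis using e(1)[of "R + 1"] e(1)[of "- R - 1"] e(8) by (simp add: eq_neg_iff_add_eq_0)
qed

text \<open>The du Bois-Reymond lemma: every cutoff minus a suitable multiple of the fixed
  \<open>cutoff 0 1 0\<close> has mean zero, hence is the derivative of a test function and
  integrates to 0 against \<open>D\<close>. For the right constant \<open>c\<close>, every cutoff
  then integrates to 0 against \<open>D - c\<close>.\<close>

lemma AE_const_of_weak_zero:
  assumes D [measurable]: "borel_fun D" and li: "\<And>R. set_integrable lborel {-R..R} D"
    and z: "\<And>\<eta>. test_function \<eta> \<Longrightarrow> (LBINT x. deriv \<eta> x *\<^sub>R D x) = (0::complex)"
  obtains c where "AE x in lborel. D x = c"
proof -
  define m where "m = (LBINT x. cutoff 0 1 0 x)"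
  have ci: "integrable lborel (%x. cutoff a b n x *\<^sub>R F x)" if "\<And>R. set_integrable lborel {-R..R} F" for a b n and F :: "real => complex"
  proof (rule set_integrable_cutoff[where R="max \<bar>a\<bar> \<bar>b\<bar>" and K=1])
    show "\<bar>cutoff a b n x\<bar> \<le> 1" for x using cutoff_bounds[of a b n x] by simp
  qed (use that in \<open>auto intro!: cutoff_zero\<close>)
  have one: "set_integrable lborel {-R..R} (%x. 1::complex)" for R :: real
    unfolding set_integrable_def by (intro borel_integrable_compact) auto
  have cr: "integrable lborel (cutoff a b n)" for a b n
    using integrable_Re[OF ci[OF one, of a b n]] by simp
  have m: "m \<noteq> 0"
  proof
    assume "m = 0"
    then have "AE x in lborel. cutoff 0 1 0 x = 0"
      unfolding m_def using integral_nonneg_eq_0_iff_AE[OF cr] cutoff_bounds(1) by simp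
    then have "AE x::real in lborel. x \<notin> {0<..<1}"
    proof eventually_elim
      case (elim x)
      then show ?case using cutoff_pos[of x 0 1 0] by force
    qed
    then have "emeasure lborel {0<..<1::real} = 0" by (subst (asm) AE_iff_measurable[where N="{0<..<1}"]) auto
    then show False by simp
  qed
  define c where "c = (LBINT x. cutoff 0 1 0 x *\<^sub>R D x) / of_real m"
  have "AE x in lborel. D x - c = 0"
  proof (rule AE_zero_of_test_zero)
    show "set_integrable lborel {-R..R} (%x. D x - c)" for R
    proof (rule set_integral_diff[OF li])
      show "set_integrable lborel {-R..R} (%x. c)" unfolding set_integrable_def by (intro borel_integrable_compact) auto
    qed
    fix a b :: real and n
    define k where "k = (LBINT x. cutoff a b n x) / m"
    define \<zeta> where "\<zeta> x = cutoff a b n x + (- k) * cutoff 0 1 0 x" for x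
    have \<zeta>alg: "bump_alg \<zeta>" unfolding \<zeta>_def by (intro bump_alg.intros cutoff_alg)
    have \<zeta>i: "integrable lborel \<zeta>" unfolding \<zeta>_def using cr by auto
    have \<zeta>z: "(LBINT x. \<zeta> x) = 0" unfolding \<zeta>_def k_def using cr m by (simp add: m_def)
    define R where "R = max 1 (max \<bar>a\<bar> \<bar>b\<bar>)"
    have \<zeta>R: "\<zeta> x = 0" if "R \<le> \<bar>x\<bar>" for x
    proof -
      have "x \<notin> {a<..<b}" "x \<notin> {0<..<1}" using that by (auto simp: R_def)
      then show ?thesis using cutoff_zero by (simp add: \<zeta>_def)
    qed
    have \<zeta>c: "continuous_on UNIV \<zeta>"
      by (intro continuous_at_imp_continuous_on ballI differentiable_imp_continuous_within bump_alg_deriv'(2)[OF \<zeta>alg])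
    \<comment> \<open>Mean zero of \<open>\<zeta>\<close> gives its primitive \<open>Z\<close>
      compact support. \<open>Z\<close> is not built from the generators of \<open>bump_alg\<close>,
      but its derivative is, which yields smoothness.\<close>
    define Z where "Z = cumint \<zeta>"
    have Zd: "(Z has_real_derivative \<zeta> x) (at x)" for x
    proof -
      have eq: "Z t = Z (x - 1) + integral {x - 1..t} \<zeta>" if "x - 1 \<le> t" for t
      proof -
        have "Z t - Z (x - 1) = (LBINT y:{x - 1<..t}. \<zeta> y)" unfolding Z_def by (rule cumint_diff[OF \<zeta>i that])
        also have "\<dots> = (LBINT y:{x - 1..t}. \<zeta> y)"
          by (rule LBINT_atLeast_greaterThan[symmetric]) (rule borel_measurable_continuous_onI[OF \<zeta>c])
        also have "\<dots> = integral {x - 1..t} \<zeta>"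
          by (rule set_borel_integral_eq_integral(2)[OF set_integrable_lborel[OF \<zeta>i]]) auto
        finally show ?thesis by simp
      qed
      have "((%t. Z (x - 1) + integral {x - 1..t} \<zeta>) has_real_derivative \<zeta> x) (at x within {x - 1..x + 1})"
        using DERIV_add[OF DERIV_const integral_has_real_derivative[OF continuous_on_subset[OF \<zeta>c subset_UNIV], of x "x - 1" "x + 1"], of "Z (x - 1)"]
        by simp
      then have "((%t. Z (x - 1) + integral {x - 1..t} \<zeta>) has_real_derivative \<zeta> x) (at x)"
        by (subst (asm) at_within_interior) (auto simp: interior_atLeastAtMost_real)
      moreover have "eventually (%t. Z (x - 1) + integral {x - 1..t} \<zeta> = Z t) (nhds x)"
      proof (rule eventually_mono)
        show "eventually (%t. t \<in> {x - 1<..}) (nhds x)" by (rule eventually_nhds_in_open) auto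
        show "Z (x - 1) + integral {x - 1..t} \<zeta> = Z t" if "t \<in> {x - 1<..}" for t
          by (rule eq[symmetric]) (use that in simp)
      qed
      ultimately show ?thesis by (rule DERIV_cong_ev[OF refl _ refl, THEN iffD1, rotated])
    qed
    have dZ: "deriv Z = \<zeta>" using Zd by (auto intro: DERIV_imp_deriv)
    have "test_function Z"
      unfolding test_function_def compact_support_iff
    proof (intro conjI allI exI impI)
      fix n x show "(deriv ^^ n) Z differentiable (at x)"
      proof (cases n)
        case 0
        then show ?thesis using Zd[of x] by (auto simp: real_differentiable_def)
      next
        case (Suc k)
        show ?thesis unfolding Suc funpow_Suc_right comp_def dZ by (rule bump_alg_smooth[OF \<zeta>alg])
      qed
    next
      fix x assume x: "R < \<bar>x\<bar>"
      show "Z x = 0"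
      proof (cases "x < 0")
        case True
        then have "Z x = cumint (%y. 0) x" unfolding Z_def using x by (intro cumint_cong \<zeta>R) auto
        then show ?thesis by (simp add: cumint_def)
      next
        case False
        have "Z x = (LBINT y. indicator {..x} y *\<^sub>R \<zeta> y)" by (simp add: Z_def cumint_def set_lebesgue_integral_def)
        also have "\<dots> = (LBINT y. \<zeta> y)"
          by (rule Bochner_Integration.integral_cong) (use False x \<zeta>R in \<open>auto simp: indicator_def\<close>)
        finally show ?thesis by (simp add: \<zeta>z)
      qed
    qed
    from z[OF this] have "(LBINT x. \<zeta> x *\<^sub>R D x) = 0" by (simp add: dZ)
    also have "(%x. \<zeta> x *\<^sub>R D x) = (%x. cutoff a b n x *\<^sub>R D x - of_real k * (cutoff 0 1 0 x *\<^sub>R D x))"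
      by (auto simp: \<zeta>_def scaleR_conv_of_real algebra_simps)
    also have "(LBINT x. cutoff a b n x *\<^sub>R D x - of_real k * (cutoff 0 1 0 x *\<^sub>R D x)) = (LBINT x. cutoff a b n x *\<^sub>R D x) - of_real k * (LBINT x. cutoff 0 1 0 x *\<^sub>R D x)"
      by (subst Bochner_Integration.integral_diff[OF ci[OF li] integrable_mult_right[OF ci[OF li]]]) (simp only: integral_mult_right_zero)
    finally have 1: "(LBINT x. cutoff a b n x *\<^sub>R D x) = of_real k * (LBINT x. cutoff 0 1 0 x *\<^sub>R D x)" by simp
    have "(LBINT x. cutoff a b n x *\<^sub>R (D x - c)) = (LBINT x. cutoff a b n x *\<^sub>R D x - of_real (cutoff a b n x) * c)"
      by (simp add: scaleR_conv_of_real algebra_simps)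
    also have "\<dots> = (LBINT x. cutoff a b n x *\<^sub>R D x) - of_real (LBINT x. cutoff a b n x) * c"
      using ci[OF li] cr by (simp add: integral_complex_of_real)
    also have "\<dots> = 0" using m by (simp add: 1 k_def c_def)
    finally show "(LBINT x. cutoff a b n x *\<^sub>R (D x - c)) = 0" .
  qed measurable
  then have "AE x in lborel. D x = c" by (rule eventually_mono) simp
  then show ?thesis by (rule that)
qed

text \<open>From left to right, \<open>AE_const_of_weak_zero\<close> applies to the difference of
  \<open>f\<close> and a primitive of \<open>g\<close>. Statements about Sobolev functions thereby
  become statements about absolutely continuous representatives.\<close>

lemma has_weak_deriv_iff_ac:
  "has_weak_deriv f g \<longleftrightarrow> (\<exists>F G. ac F G \<and> (AE x in lborel. f x = F x) \<and> (AE x in lborel. g x = G x))"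
proof
  assume w: "has_weak_deriv f g"
  then obtain F G where FG: "borel_fun F" "AE x in lborel. f x = F x" "borel_fun G" "AE x in lborel. g x = G x"
    by (rule has_weak_deriv_rep)
  note [measurable] = FG(1,3)
  have wB: "\<And>R. set_integrable lborel {-R..R} F" "\<And>R. set_integrable lborel {-R..R} G"
    "\<And>\<eta>. test_function \<eta> \<Longrightarrow> (LBINT x. deriv \<eta> x *\<^sub>R F x) = - (LBINT x. \<eta> x *\<^sub>R G x)"
    using w unfolding has_weak_deriv_borel[OF FG] by auto
  define I where "I x = (if 0 \<le> x then (LBINT t:{0<..x}. G t) else - (LBINT t:{x<..0}. G t))" for x
  have I: "ac I G"
  proof (rule ac_integral[where c=0])
    fix a b
    show "set_integrable lborel {a<..b} G"
      by (rule set_integrable_subset[OF wB(2)[of "max \<bar>a\<bar> \<bar>b\<bar>"]]) auto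
  qed (auto simp: I_def)
  note [measurable] = ac_measurable[OF I]
  have "(LBINT x. deriv \<eta> x *\<^sub>R (F x - I x)) = 0" if \<eta>: "test_function \<eta>" for \<eta>
  proof -
    obtain R K where e: "\<And>x. R < \<bar>x\<bar> \<Longrightarrow> \<eta> x = 0" "\<And>x. R < \<bar>x\<bar> \<Longrightarrow> deriv \<eta> x = 0"
      "\<And>x. (\<eta> has_real_derivative deriv \<eta> x) (at x)" "continuous_on UNIV \<eta>" "continuous_on UNIV (deriv \<eta>)"
      "\<And>x. \<bar>\<eta> x\<bar> \<le> K" "\<And>x. \<bar>deriv \<eta> x\<bar> \<le> K" "R > 0" by (rule test_function_D[OF \<eta>]) blast
    have i: "integrable lborel (%x. deriv \<eta> x *\<^sub>R H x)" if "\<And>R. set_integrable lborel {-R..R} H" for H :: "real => complex"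
      by (rule set_integrable_cutoff[where R=R and K=K]) (use e test_function_measurable(2)[OF \<eta>] that in auto)
    show ?thesis
      using wB(3)[OF \<eta>] ac_weak[OF I \<eta>] i[OF wB(1)] i[OF ac_set_integrable(2)[OF I]]
      by (simp add: scaleR_diff_right)
  qed
  moreover have "set_integrable lborel {-R..R} (%x. F x - I x)" for R
    by (rule set_integral_diff(1)[OF wB(1) ac_set_integrable(2)[OF I]])
  ultimately obtain c where c: "AE x in lborel. F x - I x = c"
    using AE_const_of_weak_zero[of "%x. F x - I x"] by auto
  have "ac (%x. c + I x) G" using ac_add[OF ac_const I, of c] by simp
  moreover have "AE x in lborel. f x = c + I x" using c FG(2) by eventually_elim (simp add: algebra_simps)
  ultimately show "\<exists>F G. ac F G \<and> (AE x in lborel. f x = F x) \<and> (AE x in lborel. g x = G x)" using FG(4) by blast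
next
  assume "\<exists>F G. ac F G \<and> (AE x in lborel. f x = F x) \<and> (AE x in lborel. g x = G x)"
  then obtain F G where F: "ac F G" and ae: "AE x in lborel. f x = F x" "AE x in lborel. g x = G x" by blast
  show "has_weak_deriv f g"
    unfolding has_weak_deriv_borel[OF ac_measurable[OF F] ae(1) ac_D(1)[OF F] ae(2)]
    using ac_weak[OF F] ac_set_integrable[OF F] by blast
qed

lemma has_weak_deriv_unique:
  assumes "has_weak_deriv f g" "has_weak_deriv f h"
  shows "AE x in lborel. g x = h x"
proof -
  obtain F G where FG: "borel_fun F" "AE x in lborel. f x = F x" "borel_fun G" "AE x in lborel. g x = G x"
    using assms(1) by (rule has_weak_deriv_rep)
  obtain F' H where FH: "borel_fun F'" "AE x in lborel. f x = F' x" "borel_fun H" "AE x in lborel. h x = H x"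
    using assms(2) by (rule has_weak_deriv_rep)
  note [measurable] = FG(3) FH(3)
  have 1: "\<And>R. set_integrable lborel {-R..R} G" "\<And>\<eta>. test_function \<eta> \<Longrightarrow> (LBINT x. deriv \<eta> x *\<^sub>R F x) = - (LBINT x. \<eta> x *\<^sub>R G x)"
    using assms(1) unfolding has_weak_deriv_borel[OF FG] by auto
  have 2: "\<And>R. set_integrable lborel {-R..R} H" "\<And>\<eta>. test_function \<eta> \<Longrightarrow> (LBINT x. deriv \<eta> x *\<^sub>R F x) = - (LBINT x. \<eta> x *\<^sub>R H x)"
    using assms(2) unfolding has_weak_deriv_borel[OF FG(1,2) FH(3,4)] by auto
  have "AE x in lborel. G x - H x = 0"
  proof (rule AE_zero_of_test_zero)
    show "set_integrable lborel {-R..R} (%x. G x - H x)" for R by (rule set_integral_diff(1)[OF 1(1) 2(1)])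
    fix a b n
    have ci: "integrable lborel (%x. cutoff a b n x *\<^sub>R F x)" if "\<And>R. set_integrable lborel {-R..R} F" for F :: "real => complex"
    proof (rule set_integrable_cutoff[where R="max \<bar>a\<bar> \<bar>b\<bar>" and K=1])
      show "\<bar>cutoff a b n x\<bar> \<le> 1" for x using cutoff_bounds[of a b n x] by simp
    qed (use that in \<open>auto intro!: cutoff_zero\<close>)
    show "(LBINT x. cutoff a b n x *\<^sub>R (G x - H x)) = 0"
      using 1(2)[OF cutoff_test, of a b n] 2(2)[OF cutoff_test, of a b n] ci[OF 1(1)] ci[OF 2(1)]
      by (simp add: scaleR_diff_right)
  qed measurable
  then show ?thesis using FG(4) FH(4) by eventually_elim simp
qed

lemma weakly_differentiable_wderiv: "weakly_differentiable f \<Longrightarrow> has_weak_deriv f (wderiv f)"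
  using someI_ex[of "has_weak_deriv f"] by (auto simp: weakly_differentiable_def wderiv_def)

lemma wderiv_AE: "has_weak_deriv f g \<Longrightarrow> AE x in lborel. wderiv f x = g x"
  using has_weak_deriv_unique[OF weakly_differentiable_wderiv] by (auto simp: weakly_differentiable_def)

lemma nsq_Cauchy_Schwarz:
  fixes f g :: "real => complex"
  assumes [measurable]: "borel_fun f" "borel_fun g" and fin: "nsq f < \<infinity>" "nsq g < \<infinity>"
  shows "integrable lborel (%x. f x * g x)" "ennreal ((cmod (LBINT x. f x * g x))^2) \<le> nsq f * nsq g"
proof -
  have cs: "(\<integral>\<^sup>+x. ennreal (cmod (f x * g x)) \<partial>lborel)^2 \<le> nsq f * nsq g"
  proof -
    have "(\<integral>\<^sup>+x. ennreal (cmod (f x * g x)) \<partial>lborel)^2 = (\<integral>\<^sup>+x. ennreal (cmod (f x)) * ennreal (cmod (g x)) \<partial>lborel)^2"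
      by (simp add: norm_mult ennreal_mult')
    also have "\<dots> \<le> (\<integral>\<^sup>+x. (ennreal (cmod (f x)))^2 \<partial>lborel) * (\<integral>\<^sup>+x. (ennreal (cmod (g x)))^2 \<partial>lborel)"
      by (rule Cauchy_Schwarz_nn_integral) measurable
    finally show ?thesis by (simp add: nsq_def ennreal_power)
  qed
  have "nsq f * nsq g < \<infinity>" using fin by (simp add: ennreal_mult_less_top)
  then have "(\<integral>\<^sup>+x. ennreal (cmod (f x * g x)) \<partial>lborel)^2 < \<infinity>" by (rule le_less_trans[OF cs])
  then have "(\<integral>\<^sup>+x. ennreal (cmod (f x * g x)) \<partial>lborel) < \<infinity>" by (auto simp: power2_eq_square ennreal_mult_less_top)
  then show int: "integrable lborel (%x. f x * g x)" by (intro integrableI_bounded) auto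
  have "ennreal (cmod (LBINT x. f x * g x)) \<le> (\<integral>\<^sup>+x. ennreal (cmod (f x * g x)) \<partial>lborel)"
    by (rule integral_norm_bound_ennreal[OF int])
  then have "(ennreal (cmod (LBINT x. f x * g x)))^2 \<le> (\<integral>\<^sup>+x. ennreal (cmod (f x * g x)) \<partial>lborel)^2"
    by (rule power_mono) simp
  also note cs
  finally show "ennreal ((cmod (LBINT x. f x * g x))^2) \<le> nsq f * nsq g" by (simp add: ennreal_power)
qed

lemma nsq_indicator: "nsq (%x. indicator {-R..R} x) < \<infinity>"
proof -
  have "nsq (%x. indicator {-R..R} x) = (\<integral>\<^sup>+x. indicator {-R..R} x \<partial>lborel)"
    unfolding nsq_def by (intro nn_integral_cong) (auto simp: indicator_def)
  also have "\<dots> < \<infinity>" by (cases "R \<ge> 0") auto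
  finally show ?thesis .
qed

lemma nsq_set_integrable:
  assumes [measurable]: "borel_fun g" and fin: "nsq g < \<infinity>"
  shows "set_integrable lborel {-R..R} g"
proof -
  have "integrable lborel (%x. indicator {-R..R} x * g x)"
    by (rule nsq_Cauchy_Schwarz(1)[OF _ _ nsq_indicator fin]) auto
  then show ?thesis
    by (simp add: set_integrable_def indicator_scaleR_eq_if indicator_times_eq_if(1))
qed

text \<open>Tested against \<open>\<eta>\<close>, the difference quotients have two limits: by
  Cauchy--Schwarz the integral against \<open>g\<close>, and, after the translation is moved to
  \<open>\<eta>\<close>, minus the integral of \<open>f\<close> against \<open>deriv \<eta>\<close>.
  The bound on \<open>f\<close> gives local integrability and the dominating function.\<close>

lemma l2_deriv_weak:
  assumes f [measurable]: "borel_fun f" and D: "\<And>l. cmod (f l) \<le> D"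
    and fg: "l2_deriv f g" and fin: "nsq g < \<infinity>"
  shows "has_weak_deriv f g"
proof -
  from fg obtain \<epsilon> where g [measurable]: "borel_fun g" and \<epsilon>: "\<epsilon> \<longlonglongrightarrow> 0"
    "\<And>n. nsq (%l. of_real (1 / hs n) * (f (l + hs n) - f l) - g l) \<le> ennreal (\<epsilon> n)"
    unfolding l2_deriv_def by blast
  have fR: "set_integrable lborel {-R..R} f" for R
  proof -
    have "integrable lborel (%x. (indicator {-R..R} x *\<^sub>R (1::complex)) * f x)"
      by (rule integrable_bounded_mult(1)[OF _ _ D]) (auto intro!: borel_integrable_compact)
    then show ?thesis by (simp add: set_integrable_def indicator_scaleR_eq_if indicator_times_eq_if(1))
  qed
  have gR: "set_integrable lborel {-R..R} g" for R by (rule nsq_set_integrable[OF g fin])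
  have test: "(LBINT x. deriv \<eta> x *\<^sub>R f x) = - (LBINT x. \<eta> x *\<^sub>R g x)" if \<eta>: "test_function \<eta>" for \<eta>
  proof -
    obtain R K where e: "\<And>x. R < \<bar>x\<bar> \<Longrightarrow> \<eta> x = 0" "\<And>x. R < \<bar>x\<bar> \<Longrightarrow> deriv \<eta> x = 0"
      "\<And>x. (\<eta> has_real_derivative deriv \<eta> x) (at x)" "continuous_on UNIV \<eta>" "continuous_on UNIV (deriv \<eta>)"
      "\<And>x. \<bar>\<eta> x\<bar> \<le> K" "\<And>x. \<bar>deriv \<eta> x\<bar> \<le> K" "R > 0" by (rule test_function_D[OF \<eta>]) blast
    note [measurable] = test_function_measurable[OF \<eta>]
    have K: "K \<ge> 0" using e(6)[of 0] by linarith
    have D0: "D \<ge> 0" using D[of 0] by (meson norm_ge_zero order_trans)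
    define I where "I n = (LBINT l. of_real (\<eta> l) * (of_real (1 / hs n) * (f (l + hs n) - f l)))" for n
    have \<eta>2: "nsq (%l. of_real (\<eta> l)) < \<infinity>"
    proof -
      have "nsq (%l. of_real (\<eta> l)) \<le> ennreal (K^2) * nsq (%x. indicator {-R..R} x)"
      proof (rule nsq_bounded_mult)
        show "cmod (of_real (\<eta> l)) \<le> K * cmod (indicator {-R..R} l)" for l
          using e(1)[of l] e(6)[of l] by (cases "R < \<bar>l\<bar>") (auto simp: indicator_def abs_le_iff not_less)
      qed (use K in auto)
      also have "\<dots> < \<infinity>" using nsq_indicator[of R] by (simp add: ennreal_mult_less_top)
      finally show ?thesis .
    qed
    have lim1: "I \<longlonglongrightarrow> (LBINT l. of_real (\<eta> l) * g l)"
    proof -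
      have "(%n. ennreal ((cmod (I n - (LBINT l. of_real (\<eta> l) * g l)))^2)) \<longlonglongrightarrow> 0"
      proof (rule tendsto_sandwich[OF _ _ tendsto_const])
        have bd: "ennreal ((cmod (I n - (LBINT l. of_real (\<eta> l) * g l)))^2) \<le> nsq (%l. of_real (\<eta> l)) * ennreal (\<epsilon> n)" for n
        proof -
          let ?d = "%l. of_real (1 / hs n) * (f (l + hs n) - f l) - g l"
          have fd: "nsq ?d < \<infinity>" using \<epsilon>(2)[of n] by (rule le_less_trans) simp
          have ig: "integrable lborel (%l. of_real (\<eta> l) * g l)" by (rule nsq_Cauchy_Schwarz(1)[OF _ _ \<eta>2 fin]) auto
          have id: "integrable lborel (%l. of_real (\<eta> l) * ?d l)" by (rule nsq_Cauchy_Schwarz(1)[OF _ _ \<eta>2 fd]) auto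
          have "I n = (LBINT l. of_real (\<eta> l) * ?d l + of_real (\<eta> l) * g l)" unfolding I_def by (simp add: algebra_simps)
          also have "\<dots> = (LBINT l. of_real (\<eta> l) * ?d l) + (LBINT l. of_real (\<eta> l) * g l)" by (rule Bochner_Integration.integral_add[OF id ig])
          finally have "I n - (LBINT l. of_real (\<eta> l) * g l) = (LBINT l. of_real (\<eta> l) * ?d l)" by simp
          then have "ennreal ((cmod (I n - (LBINT l. of_real (\<eta> l) * g l)))^2) \<le> nsq (%l. of_real (\<eta> l)) * nsq ?d"
            using nsq_Cauchy_Schwarz(2)[OF _ _ \<eta>2 fd] by simp
          also have "\<dots> \<le> nsq (%l. of_real (\<eta> l)) * ennreal (\<epsilon> n)" by (intro mult_left_mono \<epsilon>(2)) auto
          finally show ?thesis .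
        qed
        then show "\<forall>\<^sub>F n in sequentially. ennreal ((cmod (I n - (LBINT l. of_real (\<eta> l) * g l)))^2) \<le> nsq (%l. of_real (\<eta> l)) * ennreal (\<epsilon> n)" by simp
        have "(%n. nsq (%l. of_real (\<eta> l)) * ennreal (\<epsilon> n)) \<longlonglongrightarrow> nsq (%l. of_real (\<eta> l)) * ennreal 0"
          using \<eta>2 by (intro ennreal_tendsto_cmult tendsto_ennrealI \<epsilon>(1)) simp
        then show "(%n. nsq (%l. of_real (\<eta> l)) * ennreal (\<epsilon> n)) \<longlonglongrightarrow> 0" by simp
      qed simp
      then have "(%n. (cmod (I n - (LBINT l. of_real (\<eta> l) * g l)))^2) \<longlonglongrightarrow> 0"
        by (subst (asm) ennreal_tendsto_0_iff) auto
      then have "(%n. sqrt ((cmod (I n - (LBINT l. of_real (\<eta> l) * g l)))^2)) \<longlonglongrightarrow> sqrt 0" by (rule tendsto_real_sqrt)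
      then have "(%n. cmod (I n - (LBINT l. of_real (\<eta> l) * g l))) \<longlonglongrightarrow> 0" by simp
      then show ?thesis by (simp add: tendsto_norm_zero_iff LIM_zero_iff)
    qed
    have lim2: "I \<longlonglongrightarrow> - (LBINT l. of_real (deriv \<eta> l) * f l)"
    proof -
      have i\<eta>: "integrable lborel (%l. of_real (\<eta> l) * F l)" if [measurable]: "borel_fun F" and "\<And>l. cmod (F l) \<le> D" for F
      proof -
        have "set_integrable lborel {-R..R} F"
        proof -
          have "integrable lborel (%x. (indicator {-R..R} x *\<^sub>R (1::complex)) * F x)"
            by (rule integrable_bounded_mult(1)[OF _ _ that(2)]) (auto intro!: borel_integrable_compact)
          then show ?thesis by (simp add: set_integrable_def indicator_scaleR_eq_if indicator_times_eq_if(1))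
        qed
        then have "integrable lborel (%l. \<eta> l *\<^sub>R F l)"
          by (intro set_integrable_cutoff[where R=R and K=K]) (use e in auto)
        then show ?thesis by (simp add: scaleR_conv_of_real)
      qed
      have In: "I n = (LBINT l. of_real ((\<eta> (l - hs n) - \<eta> l) / hs n) * f l)" for n
      proof -
        have i1: "integrable lborel (%l. of_real (\<eta> l) * f (l + hs n))" by (rule i\<eta>) (use D in auto)
        have i2: "integrable lborel (%l. of_real (\<eta> l) * f l)" by (rule i\<eta>) (use D in auto)
        have i3: "integrable lborel (%l. of_real (\<eta> (l - hs n)) * f l)"
          using lborel_integrable_real_affine[OF i1, of 1 "- hs n"] by (simp add: algebra_simps)
        have "(LBINT l. of_real (\<eta> l) * f (l + hs n)) = (LBINT l. of_real (\<eta> (l - hs n)) * f l)"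
          using lborel_integral_real_affine[of 1 "%l. of_real (\<eta> l) * f (l + hs n)" "- hs n"] by (simp add: algebra_simps)
        moreover have "I n = (LBINT l. of_real (1 / hs n) * (of_real (\<eta> l) * f (l + hs n) - of_real (\<eta> l) * f l))"
          unfolding I_def by (simp add: algebra_simps)
        moreover have "(LBINT l. of_real ((\<eta> (l - hs n) - \<eta> l) / hs n) * f l) = (LBINT l. of_real (1 / hs n) * (of_real (\<eta> (l - hs n)) * f l - of_real (\<eta> l) * f l))"
          by (simp add: algebra_simps diff_divide_distrib)
        ultimately show ?thesis using i1 i2 i3 hs(2)[of n] by simp
      qed
      have "(%n. LBINT l. of_real ((\<eta> (l - hs n) - \<eta> l) / hs n) * f l) \<longlonglongrightarrow> (LBINT l. of_real (- deriv \<eta> l) * f l)"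
      proof (rule integral_dominated_convergence[where w="%l. indicator {-(R + 1)..R + 1} l *\<^sub>R (K * D)"])
        show "integrable lborel (%l. indicator {-(R + 1)..R + 1} l *\<^sub>R (K * D))"
          by (rule borel_integrable_compact[where f="%_. K * D"]) auto
        show "AE l in lborel. (%n. of_real ((\<eta> (l - hs n) - \<eta> l) / hs n) * f l) \<longlonglongrightarrow> of_real (- deriv \<eta> l) * f l"
        proof (rule AE_I2)
          fix l
          have "((%h. (\<eta> (l + h) - \<eta> l) / h) \<longlongrightarrow> deriv \<eta> l) (at 0)" using e(3)[of l] by (simp add: DERIV_def)
          moreover have "filterlim (%n. - hs n) (at 0) sequentially"
            using tendsto_minus[OF hs(1)] hs(2) by (auto simp: filterlim_at)
          ultimately have "(%n. (\<eta> (l + - hs n) - \<eta> l) / (- hs n)) \<longlonglongrightarrow> deriv \<eta> l" by (rule filterlim_compose)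
          then have "(%n. - ((\<eta> (l + - hs n) - \<eta> l) / (- hs n))) \<longlonglongrightarrow> - deriv \<eta> l" by (rule tendsto_minus)
          then have "(%n. (\<eta> (l - hs n) - \<eta> l) / hs n) \<longlonglongrightarrow> - deriv \<eta> l" by simp
          then show "(%n. of_real ((\<eta> (l - hs n) - \<eta> l) / hs n) * f l) \<longlonglongrightarrow> of_real (- deriv \<eta> l) * f l"
            by (intro tendsto_mult tendsto_of_real tendsto_const)
        qed
        show "AE l in lborel. norm (of_real ((\<eta> (l - hs n) - \<eta> l) / hs n) * f l) \<le> indicator {-(R + 1)..R + 1} l *\<^sub>R (K * D)" for n
        proof (rule AE_I2)
          fix l
          \<comment> \<open>Increments are at most 1, so every shifted test function vanishes
            outside \<open>{-(R + 1)..R + 1}\<close>, where the dominating function is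
            supported.\<close>
          have h1: "hs n \<le> 1" by (simp add: hs_def)
          show "norm (of_real ((\<eta> (l - hs n) - \<eta> l) / hs n) * f l) \<le> indicator {-(R + 1)..R + 1} l *\<^sub>R (K * D)"
          proof (cases "R + 1 < \<bar>l\<bar>")
            case True
            then have "R < \<bar>l\<bar>" "R < \<bar>l - hs n\<bar>" using h1 hs(3)[of n] by auto
            then show ?thesis using e(1) True K D0 by (simp add: indicator_def)
          next
            case False
            obtain z where z: "\<eta> l - \<eta> (l - hs n) = (l - (l - hs n)) * deriv \<eta> z"
              using MVT2[of "l - hs n" l \<eta> "deriv \<eta>"] hs(3)[of n] e(3) by auto
            then have "(\<eta> (l - hs n) - \<eta> l) / hs n = - deriv \<eta> z" using hs(3)[of n] by (simp add: field_simps)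
            then have "norm (of_real ((\<eta> (l - hs n) - \<eta> l) / hs n) * f l) \<le> K * D"
              using e(7)[of z] D[of l] K by (simp add: norm_mult mult_mono)
            then show ?thesis using False by (auto simp: indicator_def)
          qed
        qed
      qed measurable
      then show ?thesis unfolding In[abs_def] by simp
    qed
    have "(LBINT l. of_real (\<eta> l) * g l) = - (LBINT l. of_real (deriv \<eta> l) * f l)" by (rule LIMSEQ_unique[OF lim1 lim2])
    then show ?thesis by (simp add: scaleR_conv_of_real)
  qed
  show ?thesis
    by (subst has_weak_deriv_borel[OF f _ g]) (use fR gR test in auto)
qed

section \<open>Weights in the spectral parameter\<close>

lemma nm1_mult_le:
  assumes [measurable]: "borel_fun f" "borel_fun g"
    and i: "sq_integrable f" "sq_integrable g"
  shows "integrable lborel (%y. f y * g y)" "(nm1 (%y. f y * g y))^2 \<le> nm2 f * nm2 g"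
proof -
  have fin: "nsq f < \<infinity>" "nsq g < \<infinity>" using nsq_eq_nm2[OF i(1)] nsq_eq_nm2[OF i(2)] by auto
  show fg: "integrable lborel (%y. f y * g y)" by (rule nsq_Cauchy_Schwarz(1)[OF _ _ fin]) auto
  let ?f = "%y. complex_of_real (cmod (f y))" and ?g = "%y. complex_of_real (cmod (g y))"
  have fin': "nsq ?f < \<infinity>" "nsq ?g < \<infinity>" using fin by (simp_all add: nsq_def)
  have "ennreal ((cmod (LBINT y. ?f y * ?g y))^2) \<le> nsq ?f * nsq ?g"
    by (rule nsq_Cauchy_Schwarz(2)[OF _ _ fin']) auto
  also have "nsq ?f * nsq ?g = ennreal (nm2 f * nm2 g)"
    using nsq_eq_nm2[OF i(1)] nsq_eq_nm2[OF i(2)] by (simp add: nsq_def ennreal_mult)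
  also have "(LBINT y. ?f y * ?g y) = complex_of_real (nm1 (%y. f y * g y))"
    unfolding nm1_def norm_mult by (simp add: integral_complex_of_real[symmetric])
  finally show "(nm1 (%y. f y * g y))^2 \<le> nm2 f * nm2 g" by (simp add: ennreal_le_iff)
qed

lemma ac_exp: "ac (%y. ee (- (l * y))) (%y. - (2 * \<i> * of_real l) * ee (- (l * y)))"
proof (rule ac_C1)
  fix x
  have "((%y. exp (- (2 * \<i> * of_real l * y))) has_field_derivative - (2 * \<i> * of_real l) * exp (- (2 * \<i> * of_real l * of_real x))) (at (of_real x))"
    by (auto intro!: derivative_eq_intros)
  then have "((%y::real. exp (- (2 * \<i> * of_real l * of_real y))) has_vector_derivative - (2 * \<i> * of_real l) * exp (- (2 * \<i> * of_real l * of_real x))) (at x)"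
    by (rule has_vector_derivative_real_field)
  moreover have "exp (- (2 * \<i> * of_real l * of_real y)) = ee (- (l * y))" for y
    by (simp add: ee_def cis_conv_exp mult_ac)
  ultimately show "((%y. ee (- (l * y))) has_vector_derivative - (2 * \<i> * of_real l) * ee (- (l * x))) (at x)" by simp
next
  have "continuous_on UNIV (%y. ee (- (l * y)))"
    by (intro continuous_on_compose2[OF continuous_ee] continuous_intros) auto
  then show "continuous_on UNIV (%y. - (2 * \<i> * of_real l) * ee (- (l * y)))" by (intro continuous_intros)
qed

text \<open>The square of a sum of three terms is at most three times the sum of squares; for
  nonnegative terms, the latter is at most the square of twice the sum. So the result is again the
  square of an expression linear in the norms, as a Lipschitz bound requires. It is used with the
  weights \<open>1 + y^2\<close> and 1.\<close>

lemma weighted_square_bound: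
  fixes f g1 g2 g3 :: "real => complex" and \<omega> :: "real => real"
  assumes [measurable]: "borel_fun f" "borel_fun \<omega>"
    and b: "\<And>y. cmod (f y) \<le> c1 * cmod (g1 y) + c2 * cmod (g2 y) + c3 * cmod (g3 y)"
    and \<omega>: "\<And>y. 0 \<le> \<omega> y"
    and i: "integrable lborel (%y. \<omega> y * (cmod (g1 y))^2)" "integrable lborel (%y. \<omega> y * (cmod (g2 y))^2)" "integrable lborel (%y. \<omega> y * (cmod (g3 y))^2)"
    and n: "(LBINT y. \<omega> y * (cmod (g1 y))^2) \<le> n1^2" "(LBINT y. \<omega> y * (cmod (g2 y))^2) \<le> n2^2" "(LBINT y. \<omega> y * (cmod (g3 y))^2) \<le> n3^2"
    and pos: "0 \<le> c1" "0 \<le> c2" "0 \<le> c3" "0 \<le> n1" "0 \<le> n2" "0 \<le> n3"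
  shows "integrable lborel (%y. \<omega> y * (cmod (f y))^2)" "(LBINT y. \<omega> y * (cmod (f y))^2) \<le> (2 * (c1 * n1 + c2 * n2 + c3 * n3))^2"
proof -
  let ?h = "%y. 3 * c1^2 * (\<omega> y * (cmod (g1 y))^2) + 3 * c2^2 * (\<omega> y * (cmod (g2 y))^2) + 3 * c3^2 * (\<omega> y * (cmod (g3 y))^2)"
  have sq: "(x + y + z)^2 \<le> 3 * x^2 + 3 * y^2 + 3 * z^2" for x y z :: real
  proof -
    have "0 \<le> (x - y)^2 + (y - z)^2 + (x - z)^2" by simp
    then show ?thesis by (simp add: power2_eq_square algebra_simps)
  qed
  have le: "\<omega> y * (cmod (f y))^2 \<le> ?h y" for y
  proof -
    have "(cmod (f y))^2 \<le> (c1 * cmod (g1 y) + c2 * cmod (g2 y) + c3 * cmod (g3 y))^2" by (intro power_mono b) simp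
    also note sq
    finally have "\<omega> y * (cmod (f y))^2 \<le> \<omega> y * (3 * (c1 * cmod (g1 y))^2 + 3 * (c2 * cmod (g2 y))^2 + 3 * (c3 * cmod (g3 y))^2)"
      using \<omega> by (rule mult_left_mono)
    then show ?thesis by (simp add: power_mult_distrib algebra_simps)
  qed
  have hi: "integrable lborel ?h" using i by auto
  show fi: "integrable lborel (%y. \<omega> y * (cmod (f y))^2)"
  proof (rule Bochner_Integration.integrable_bound[OF hi])
    show "AE y in lborel. norm (\<omega> y * (cmod (f y))^2) \<le> norm (?h y)"
    proof (rule AE_I2)
      fix y
      have "0 \<le> \<omega> y * (cmod (f y))^2" using \<omega> by simp
      then show "norm (\<omega> y * (cmod (f y))^2) \<le> norm (?h y)" using le[of y] unfolding real_norm_def by linarith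
    qed
  qed measurable
  have "(LBINT y. \<omega> y * (cmod (f y))^2) \<le> (LBINT y. ?h y)" by (rule integral_mono[OF fi hi le])
  also have "\<dots> = 3 * c1^2 * (LBINT y. \<omega> y * (cmod (g1 y))^2) + 3 * c2^2 * (LBINT y. \<omega> y * (cmod (g2 y))^2) + 3 * c3^2 * (LBINT y. \<omega> y * (cmod (g3 y))^2)"
    using i by simp
  also have "\<dots> \<le> 3 * c1^2 * n1^2 + 3 * c2^2 * n2^2 + 3 * c3^2 * n3^2" by (intro add_mono mult_left_mono n) auto
  also have "\<dots> \<le> (2 * (c1 * n1 + c2 * n2 + c3 * n3))^2"
  proof -
    have "0 \<le> c1 * n1" "0 \<le> c2 * n2" "0 \<le> c3 * n3" using pos by auto
    moreover have "3 * x^2 + 3 * y^2 + 3 * z^2 \<le> (2 * (x + y + z))^2" if "0 \<le> x" "0 \<le> y" "0 \<le> z" for x y z :: real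
    proof -
      have "0 \<le> x * y" "0 \<le> y * z" "0 \<le> x * z" using that by auto
      moreover have "(2 * (x + y + z))^2 = 4 * x^2 + 4 * y^2 + 4 * z^2 + 8 * (x * y) + 8 * (y * z) + 8 * (x * z)"
        by (simp add: power2_eq_square algebra_simps)
      ultimately show ?thesis using zero_le_power2[of x] zero_le_power2[of y] zero_le_power2[of z] by linarith
    qed
    ultimately show ?thesis by (metis (no_types, lifting) mult.assoc power_mult_distrib)
  qed
  finally show "(LBINT y. \<omega> y * (cmod (f y))^2) \<le> (2 * (c1 * n1 + c2 * n2 + c3 * n3))^2" .
qed

lemma nsq_le_nm2:
  assumes [measurable]: "borel_fun f" and le: "nsq f \<le> ennreal c" and c: "0 \<le> c"
  shows "sq_integrable f" "nm2 f \<le> c"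
proof -
  have "nsq f < \<infinity>" using le by (rule le_less_trans) simp
  then show i: "sq_integrable f" unfolding nsq_def by (intro integrableI_bounded) auto
  show "nm2 f \<le> c" using le c unfolding nsq_eq_nm2[OF i] by simp
qed

definition l2ac :: "(real => complex) => (real => complex) => bool" where
  "l2ac f f' \<longleftrightarrow> ac f f' \<and> sq_integrable f'"

lemma l2ac_diff:
  assumes "l2ac f f'" "l2ac g g'" shows "l2ac (%y. f y - g y) (%y. f' y - g' y)"
  using assms square_integrable_diff1[of f' g'] by (auto simp: l2ac_def ac_diff dest: ac_D(1))

section \<open>Translation of the potentials\<close>

text \<open>The quotient is the average of the translates of \<open>f'\<close> by \<open>s\<close>
  in \<open>{0<..t}\<close>, and an average does not increase the norm:
  \<open>nsq_integral_le\<close> is applied with a weight of mass 1.\<close>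

lemma translate_quotient:
  assumes f: "l2ac f f'" and t: "0 < t"
  shows "nm2 (%y. of_real (1 / t) * (f (y + t) - f y)) \<le> nm2 f'"
proof -
  have ac: "ac f f'" and i: "sq_integrable f'" using f by (auto simp: l2ac_def)
  note [measurable] = ac_D(1)[OF ac] ac_measurable[OF ac]
  let ?q = "%y. of_real (1 / t) * (f (y + t) - f y)"
  have q: "?q y = (LBINT s. of_real (1 / t) * (indicator {0<..t} s *\<^sub>R f' (y + s)))" for y
  proof -
    have "f (y + t) - f y = (LBINT s:{y<..y + t}. f' s)" using ac_D(3)[OF ac, of y "y + t"] t by simp
    also have "\<dots> = (LBINT s. indicator {0<..t} s *\<^sub>R f' (y + s))"
      unfolding set_lebesgue_integral_def
      by (subst lborel_integral_real_affine[of 1 _ y]) (auto intro!: Bochner_Integration.integral_cong simp: indicator_def)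
    finally have e: "f (y + t) - f y = (LBINT s. indicator {0<..t} s *\<^sub>R f' (y + s))" .
    show ?thesis unfolding e by (rule integral_mult_right_zero[symmetric])
  qed
  have H: "integrable lborel (%s. 1 / t * indicator {0<..t} s)" "(LBINT s. 1 / t * indicator {0<..t} s) = 1" using t by auto
  have "nsq ?q \<le> ennreal ((LBINT s. 1 / t * indicator {0<..t} s)^2) * ennreal (nm2 f')"
    unfolding q
  proof (rule nsq_integral_le[where q="%y s. f' (y + s)", OF _ _ H(1)])
    show "cmod (of_real (1 / t) * (indicator {0<..t} s *\<^sub>R f' (y + s))) \<le> 1 / t * indicator {0<..t} s * cmod (f' (y + s))" for y s
      using t by (simp add: norm_mult norm_divide indicator_def)
    show "nsq (%y. f' (y + s)) \<le> ennreal (nm2 f')" for s using nsq_shift[of f' s] nsq_eq_nm2[OF i] by simp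
  qed (use t in auto)
  then have "nsq ?q \<le> ennreal (nm2 f')" unfolding H(2) by simp
  then show ?thesis by (rule nsq_le_nm2(2)[rotated]) simp_all
qed

definition tr :: "real => (real => complex) => real => complex" where "tr t f y = f (y + t)"

lemma tr_integral:
  fixes g :: "real => 'a::{banach, second_countable_topology}"
  shows "integrable lborel g \<Longrightarrow> integrable lborel (%y. g (y + t))" "(LBINT y. g (y + t)) = (LBINT y. g y)"
    "cumint (%y. g (y + t)) x = cumint g (x + t)"
proof -
  show "integrable lborel g \<Longrightarrow> integrable lborel (%y. g (y + t))"
    using lborel_integrable_real_affine[of g 1 t] by (simp add: add.commute)
  show int: "(LBINT y. g (y + t)) = (LBINT y. g y)" for g :: "real => 'a"
    using lborel_integral_real_affine[of 1 g t] by (simp add: add.commute)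
  have "(%y. indicator {..x} y *\<^sub>R g (y + t)) = (%y. indicator {..x + t} (y + t) *\<^sub>R g (y + t))" by (auto simp: indicator_def)
  then show "cumint (%y. g (y + t)) x = cumint g (x + t)"
    unfolding cumint_def set_lebesgue_integral_def using int[of "%y. indicator {..x + t} y *\<^sub>R g y"] by simp
qed

lemma zs_ok_tr: "zs_ok B \<alpha> \<beta> \<Longrightarrow> zs_ok B (tr t \<alpha>) (tr t \<beta>)"
  using tr_integral(1)[of \<alpha> t] tr_integral(1)[of \<beta> t] tr_integral(1)[of "%y. (cmod (\<alpha> y))^2" t] tr_integral(1)[of "%y. (cmod (\<beta> y))^2" t]
    tr_integral(2)[of "%y. cmod (\<alpha> y)" t] tr_integral(2)[of "%y. cmod (\<beta> y)" t]
  by (simp add: zs_ok_def tr_def[abs_def] nm1_def)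

text \<open>Translating the phase puts \<open>ee (l * t)\<close> on E and leaves P alone, so that of
  the two limits b acquires this unimodular factor and a does not.\<close>

lemma zs_sol_tr:
  assumes sol: "zs_sol \<alpha> \<beta> P E"
  shows "zs_sol (tr t \<alpha>) (tr t \<beta>) (%l x. P l (x + t)) (%l x. ee (l * t) * E l (x + t))"
proof -
  have [measurable]: "jointly_borel P"
    "jointly_borel E"
    using sol unfolding zs_sol_def by blast+
  have P: "\<And>l x. P l x = 1 + cumint (%y. ee (l * y) * (\<alpha> y * E l y)) x"
    and E: "\<And>l x. E l x = cumint (%y. ee (- (l * y)) * (\<beta> y * P l y)) x"
    using sol unfolding zs_sol_def by blast+
  obtain D where D: "\<forall>l x. cmod (P l x) \<le> D \<and> cmod (E l x) \<le> D" using sol unfolding zs_sol_def by blast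
  show ?thesis
    unfolding zs_sol_def
  proof (intro conjI allI)
    show "\<exists>D. \<forall>l x. cmod (P l (x + t)) \<le> D \<and> cmod (ee (l * t) * E l (x + t)) \<le> D" using D by (auto simp: norm_mult)
    have e: "ee (l * (y + t)) * (\<alpha> (y + t) * E l (y + t)) = ee (l * y) * (tr t \<alpha> y * (ee (l * t) * E l (y + t)))"
      "ee (l * t) * (ee (- (l * (y + t))) * (\<beta> (y + t) * P l (y + t))) = ee (- (l * y)) * (tr t \<beta> y * P l (y + t))" for l y
    proof -
      have "ee (l * (y + t)) = ee (l * y) * ee (l * t)" "ee (- (l * y)) = ee (l * t) * ee (- (l * (y + t)))"
        by (simp_all add: ee_add[symmetric] algebra_simps)
      then show "ee (l * (y + t)) * (\<alpha> (y + t) * E l (y + t)) = ee (l * y) * (tr t \<alpha> y * (ee (l * t) * E l (y + t)))"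
        "ee (l * t) * (ee (- (l * (y + t))) * (\<beta> (y + t) * P l (y + t))) = ee (- (l * y)) * (tr t \<beta> y * P l (y + t))"
        by (simp_all only: tr_def mult_ac)
    qed
    show "P l (x + t) = 1 + cumint (%y. ee (l * y) * (tr t \<alpha> y * (ee (l * t) * E l (y + t)))) x" for l x
      unfolding e(1)[symmetric] tr_integral(3)[of "%y. ee (l * y) * (\<alpha> y * E l y)"] by (rule P)
    show "ee (l * t) * E l (x + t) = cumint (%y. ee (- (l * y)) * (tr t \<beta> y * P l (y + t))) x" for l x
      unfolding e(2)[symmetric] cumint_cmult tr_integral(3)[of "%y. ee (- (l * y)) * (\<beta> y * P l y)"] E[symmetric] ..
  qed measurable
qed

lemma zs_rho_tr:
  assumes ok: "zs_ok B \<alpha> \<beta>"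
  shows "zs_rho (tr t \<alpha>) (tr t \<beta>) l = ee (l * t) * zs_rho \<alpha> \<beta> l"
proof -
  note ok' = zs_ok_tr[OF ok, of t]
  note un = zs_sol_unique[OF ok' zs_sol_PE[OF ok'] zs_sol_tr[OF zs_sol_PE[OF ok]], of l]
  have t: "filterlim (%x. x + t) at_top at_top" by (rule filterlim_tendsto_add_at_top[OF tendsto_const filterlim_ident, of t, simplified add.commute])
  have "((%x. zs_P \<alpha> \<beta> l (x + t)) \<longlongrightarrow> zs_a \<alpha> \<beta> l) at_top" "((%x. ee (l * t) * zs_E \<alpha> \<beta> l (x + t)) \<longlongrightarrow> ee (l * t) * zs_b \<alpha> \<beta> l) at_top"
    by (rule filterlim_compose[OF zs_limits(1)[OF ok] t], intro tendsto_mult tendsto_const filterlim_compose[OF zs_limits(2)[OF ok] t])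
  then have "zs_a (tr t \<alpha>) (tr t \<beta>) l = zs_a \<alpha> \<beta> l" "zs_b (tr t \<alpha>) (tr t \<beta>) l = ee (l * t) * zs_b \<alpha> \<beta> l"
    using zs_limits(1)[OF ok', of l] zs_limits(2)[OF ok', of l] unfolding un[symmetric]
    by (auto intro: tendsto_unique[OF trivial_limit_at_top_linorder])
  then show ?thesis by (simp add: zs_rho_def)
qed

text \<open>
  Translating the potentials by \<open>t\<close> multiplies \<open>zs_rho\<close> by \<open>ee (l * t)\<close>, so that multiplication by
  \<open>2 * \<i> * l\<close> is a limit of difference quotients of the potentials.
\<close>

lemma zs_rho_weighted_diff:
  assumes B: "1 \<le> B" and ok: "zs_ok B \<alpha> \<beta>" and ok': "zs_ok B \<gamma> \<delta>"
    and l: "l2ac \<alpha> \<alpha>'" "l2ac \<beta> \<beta>'" "l2ac \<gamma> \<gamma>'" "l2ac \<delta> \<delta>'"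
    and d: "nm1 (%y. \<alpha> y - \<gamma> y) + nm1 (%y. \<beta> y - \<delta> y) \<le> d"
    and A: "nm2 (%y. \<alpha>' y - \<gamma>' y) + nm2 (%y. \<beta>' y - \<delta>' y) \<le> A"
    and M: "nm2 \<alpha>' + nm2 \<beta>' \<le> M" "nm2 \<gamma>' + nm2 \<delta>' \<le> M"
  shows "nsq (%l. of_real l * (zs_rho \<alpha> \<beta> l - zs_rho \<gamma> \<delta> l)) \<le> ennreal (rho_const B * (A + d^2 * M + d^2 * M))"
proof -
  note [measurable] = zs_rho_measurable[OF ok] zs_rho_measurable[OF ok']
  let ?r = "%l. zs_rho \<alpha> \<beta> l - zs_rho \<gamma> \<delta> l"
  have n: "nsq (%l. (ee (hs n * l) - 1) / of_real (hs n) * ?r l) \<le> ennreal (rho_const B * (A + d^2 * M + d^2 * M))" for n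
  proof -
    let ?\<alpha> = "idx4 (tr (hs n) \<alpha>) \<alpha> (tr (hs n) \<gamma>) \<gamma>" and ?\<beta> = "idx4 (tr (hs n) \<beta>) \<beta> (tr (hs n) \<delta>) \<delta>"
    have okk: "zs_ok B (?\<alpha> i) (?\<beta> i)" for i by (intro zs_ok_idx4 ok ok' zs_ok_tr)
    have tq: "nm2 (%y. of_real (1 / hs n) * (tr (hs n) f y - f y)) \<le> nm2 f'" if "l2ac f f'" for f f'
      unfolding tr_def by (rule translate_quotient[OF that hs(3)])
    have half: "nm2 (%y. of_real (1 / hs n) * (tr (hs n) f y - f y) - of_real (1 / hs n) * (tr (hs n) g y - g y)) \<le> nm2 (%y. f' y - g' y)"
      if "l2ac f f'" "l2ac g g'" for f f' g g'
    proof -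
      have "(%y. of_real (1 / hs n) * (tr (hs n) f y - f y) - of_real (1 / hs n) * (tr (hs n) g y - g y))
        = (%y. complex_of_real (1 / hs n) * (tr (hs n) (%y. f y - g y) y - (f y - g y)))"
        by (simp add: tr_def algebra_simps)
      then show ?thesis using tq[OF l2ac_diff[OF that]] by simp
    qed
    have nt: "nm1 (%y. tr (hs n) f y - tr (hs n) g y) = nm1 (%y. f y - g y)" for f g
      using tr_integral(2)[of "%y. cmod (f y - g y)" "hs n"] by (simp add: tr_def nm1_def)
    have "nsq (%l. of_real (1 / hs n) * (zs_rho (?\<alpha> 0) (?\<beta> 0) l - zs_rho (?\<alpha> 1) (?\<beta> 1) l) - of_real (1 / hs n) * (zs_rho (?\<alpha> 2) (?\<beta> 2) l - zs_rho (?\<alpha> 3) (?\<beta> 3) l))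
      \<le> ennreal (rho_const B * (A + d^2 * M + d^2 * M))"
    proof (rule zs_rho_second_difference[OF B okk])
      show "nm2 (%y. of_real (1 / hs n) * (?\<alpha> 0 y - ?\<alpha> 1 y) - of_real (1 / hs n) * (?\<alpha> 2 y - ?\<alpha> 3 y))
         + nm2 (%y. of_real (1 / hs n) * (?\<beta> 0 y - ?\<beta> 1 y) - of_real (1 / hs n) * (?\<beta> 2 y - ?\<beta> 3 y)) \<le> A"
        using half[OF l(1,3)] half[OF l(2,4)] A by simp
      show "nm2 (%y. of_real (1 / hs n) * (?\<alpha> 2 y - ?\<alpha> 3 y)) + nm2 (%y. of_real (1 / hs n) * (?\<beta> 2 y - ?\<beta> 3 y)) \<le> M"
        using tq[OF l(3)] tq[OF l(4)] M by simp
      show "nm2 (%y. of_real (1 / hs n) * (?\<alpha> 0 y - ?\<alpha> 1 y)) + nm2 (%y. of_real (1 / hs n) * (?\<beta> 0 y - ?\<beta> 1 y)) \<le> M"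
        using tq[OF l(1)] tq[OF l(2)] M by simp
    qed (use d nt in simp_all)
    also have "(%l. of_real (1 / hs n) * (zs_rho (?\<alpha> 0) (?\<beta> 0) l - zs_rho (?\<alpha> 1) (?\<beta> 1) l) - of_real (1 / hs n) * (zs_rho (?\<alpha> 2) (?\<beta> 2) l - zs_rho (?\<alpha> 3) (?\<beta> 3) l))
      = (%l. (ee (hs n * l) - 1) / of_real (hs n) * ?r l)"
      by (simp add: zs_rho_tr[OF ok] zs_rho_tr[OF ok'] mult.commute[of "hs n"]) (simp add: fun_eq_iff field_simps hs(2))
    finally show ?thesis .
  qed
  have "nsq (%l. 2 * \<i> * of_real l * ?r l) \<le> ennreal (rho_const B * (A + d^2 * M + d^2 * M))"
  proof (rule nsq_liminf[OF _ _ n])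
    show "(%n. (ee (hs n * l) - 1) / of_real (hs n) * ?r l) \<longlonglongrightarrow> 2 * \<i> * of_real l * ?r l" for l
      by (intro tendsto_mult tendsto_const ee_diff_quotient_tendsto hs(1,2))
  qed measurable
  moreover have "nsq (%l. of_real l * ?r l) \<le> nsq (%l. 2 * \<i> * of_real l * ?r l)"
    by (rule nsq_mono) (simp add: norm_mult)
  ultimately show ?thesis by (rule order_trans[rotated])
qed

section \<open>Lipschitz bounds for weighted potentials\<close>

text \<open>The square of \<open>L21_norm\<close> for a Borel representative, see
  \<open>l21_rep\<close>.\<close>

definition wn :: "(real => complex) => real" where "wn f = (LBINT y. (1 + y^2) * (cmod (f y))^2)"

definition l21 :: "(real => complex) => bool" where
  "l21 f \<longleftrightarrow> f \<in> borel_measurable borel \<and> integrable lborel (%y. (1 + y^2) * (cmod (f y))^2)"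

lemma l21_D:
  assumes "l21 f"
  shows "borel_fun f" "integrable lborel (%y. (1 + y^2) * (cmod (f y))^2)"
  using assms by (auto simp: l21_def)

lemma wn_nonneg [simp]: "0 \<le> wn f" unfolding wn_def by (rule Bochner_Integration.integral_nonneg) auto

lemma l21_nm2:
  assumes f: "l21 f"
  shows "sq_integrable f" "sq_integrable (xm f)" "nm2 f \<le> wn f" "nm2 (xm f) \<le> wn f"
proof -
  note [measurable] = l21_D(1)[OF f]
  have 1: "(cmod (f y))^2 \<le> (1 + y^2) * (cmod (f y))^2" for y by (simp add: algebra_simps)
  have 2: "(cmod (xm f y))^2 \<le> (1 + y^2) * (cmod (f y))^2" for y
    by (simp add: xm_def norm_mult power_mult_distrib algebra_simps)
  have [measurable]: "xm f \<in> borel_measurable borel" unfolding xm_def[abs_def] by measurable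
  show i1: "sq_integrable f"
    by (rule Bochner_Integration.integrable_bound[OF l21_D(2)[OF f]]) (use 1 in auto)
  show i2: "sq_integrable (xm f)"
    by (rule Bochner_Integration.integrable_bound[OF l21_D(2)[OF f]]) (use 2 in auto)
  show "nm2 f \<le> wn f" unfolding nm2_def wn_def by (rule integral_mono[OF i1 l21_D(2)[OF f] 1])
  show "nm2 (xm f) \<le> wn f" unfolding nm2_def wn_def by (rule integral_mono[OF i2 l21_D(2)[OF f] 2])
qed

lemma integrable_inverse_1_plus_square: "integrable lborel (%y::real. 1 / (1 + y^2))" "(LBINT y. 1 / (1 + y^2)) = pi"
proof -
  have d: "(arctan has_real_derivative 1 / (1 + x^2)) (at x)" for x by (auto intro!: derivative_eq_intros simp: field_simps)
  have "set_integrable lborel (einterval (-\<infinity>) \<infinity>) (%y::real. 1 / (1 + y^2)) \<and> (LBINT x=-\<infinity>..\<infinity>. 1 / (1 + x^2)) = pi / 2 - (- (pi / 2))"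
  proof (intro conjI)
    show "set_integrable lborel (einterval (-\<infinity>) \<infinity>) (%y::real. 1 / (1 + y^2))"
      by (rule interval_integral_FTC_nonneg(1)[where F=arctan and A="- (pi / 2)" and B="pi / 2"])
        (auto intro!: d tendsto_arctan_at_top tendsto_arctan_at_bot continuous_intros simp: add_nonneg_eq_0_iff ereal_tendsto_simps)
    show "(LBINT x=-\<infinity>..\<infinity>. 1 / (1 + x^2)) = pi / 2 - (- (pi / 2))"
      by (rule interval_integral_FTC_nonneg(2)[where F=arctan and A="- (pi / 2)" and B="pi / 2"])
        (auto intro!: d tendsto_arctan_at_top tendsto_arctan_at_bot continuous_intros simp: add_nonneg_eq_0_iff ereal_tendsto_simps)
  qed
  then show "integrable lborel (%y::real. 1 / (1 + y^2))" "(LBINT y. 1 / (1 + y^2)) = pi"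
    by (auto simp: interval_lebesgue_integral_def set_integrable_def set_lebesgue_integral_def)
qed

text \<open>Cauchy--Schwarz against \<open>1 / sqrt (1 + y^2)\<close>, whose square has integral
  \<open>pi\<close>.\<close>

lemma l21_nm1:
  assumes f: "l21 f"
  shows "integrable lborel f" "(nm1 f)^2 \<le> pi * wn f"
proof -
  note [measurable] = l21_D(1)[OF f]
  let ?j = "%y::real. complex_of_real (1 / sqrt (1 + y^2))" and ?g = "%y. complex_of_real (sqrt (1 + y^2)) * f y"
  have p: "0 < 1 + y^2" for y :: real by (simp add: add_pos_nonneg)
  have j: "(cmod (?j y))^2 = 1 / (1 + y^2)" for y using p[of y] by (simp only: norm_of_real power2_abs power_divide real_sqrt_pow2[OF less_imp_le[OF p]] power_one)
  have g: "(cmod (?g y))^2 = (1 + y^2) * (cmod (f y))^2" for y using p[of y]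
    by (simp only: norm_mult norm_of_real power_mult_distrib power2_abs real_sqrt_pow2[OF less_imp_le[OF p]])
  have jg: "?j y * ?g y = f y" for y
  proof -
    have "sqrt (1 + y^2) \<noteq> 0" using p[of y] by simp
    then have "?j y * complex_of_real (sqrt (1 + y^2)) = 1" unfolding of_real_mult[symmetric] by simp
    then show ?thesis by (simp only: mult.assoc[symmetric] mult_1)
  qed
  have i: "integrable lborel (%y. (cmod (?j y))^2)" "integrable lborel (%y. (cmod (?g y))^2)"
    unfolding j g by (rule integrable_inverse_1_plus_square(1), rule l21_D(2)[OF f])
  have "nm2 ?j = pi" "nm2 ?g = wn f" unfolding nm2_def wn_def j g using integrable_inverse_1_plus_square(2) by auto
  then show "integrable lborel f" "(nm1 f)^2 \<le> pi * wn f" using nm1_mult_le[OF _ _ i] unfolding jg by auto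
qed

text \<open>From \<open>pi < 4\<close>; this is the source of the factors 2 in
  \<open>sobdat_sup\<close> and \<open>pot_bound\<close>.\<close>

lemma l21_nm1_le: "l21 f \<Longrightarrow> wn f \<le> c^2 \<Longrightarrow> 0 \<le> c \<Longrightarrow> nm1 f \<le> 2 * c"
proof -
  assume f: "l21 f" and w: "wn f \<le> c^2" and c: "0 \<le> c"
  have "(nm1 f)^2 \<le> pi * wn f" by (rule l21_nm1(2)[OF f])
  also have "\<dots> \<le> 4 * c^2" using w pi_less_4 by (intro mult_mono) auto
  finally have "(nm1 f)^2 \<le> (2 * c)^2" by (simp add: power_mult_distrib)
  then show ?thesis by (rule power2_le_imp_le) (use c in simp)
qed

lemma zs_zero: "zs_ok B (%y. 0) (%y. 0)" if "0 \<le> B"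
  using that by (auto simp: zs_ok_def nm1_def)

lemma zs_b_zero [simp]: "zs_b \<alpha> (%y. 0) l = 0" "zs_rho \<alpha> (%y. 0) l = 0"
  by (simp_all add: zs_rho_def zs_b_def)

definition dist_le :: "real => (real => complex) => (real => complex) => bool" where
  "dist_le N f g \<longleftrightarrow> l21 (%y. f y - g y) \<and> wn (%y. f y - g y) \<le> N^2"

text \<open>One constant for three estimates: \<open>2450 = 2 * 1225\<close> from
  \<open>zs_rho_dist\<close>, and \<open>8 + 256 * B^2\<close> from
  \<open>zs_rho_deriv_dist\<close>, where \<open>256 = 2 * 4^2 * 8\<close>; the constant of
  \<open>zs_rho_weighted_dist\<close> lies below the latter.\<close>

definition lip_const :: "real => real" where
  "lip_const B = 2450 * B^2 * zs_const B + 2 * rho_const B * (8 + 256 * B^2)"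

context
  fixes B N :: real and \<alpha>0 \<beta>0 \<alpha>1 \<beta>1 :: "real => complex"
  assumes B: "1 \<le> B" and N: "0 \<le> N" and ok: "zs_ok B \<alpha>0 \<beta>0" "zs_ok B \<alpha>1 \<beta>1"
    and l: "l21 \<alpha>0" "l21 \<beta>0" "l21 \<alpha>1" "l21 \<beta>1" and wB: "wn \<alpha>0 \<le> B^2" "wn \<beta>0 \<le> B^2" "wn \<alpha>1 \<le> B^2" "wn \<beta>1 \<le> B^2"
    and d: "dist_le N \<alpha>0 \<alpha>1" "dist_le N \<beta>0 \<beta>1"
begin

lemma zs_dist_nm1: "nm1 (%y. \<alpha>0 y - \<alpha>1 y) + nm1 (%y. \<beta>0 y - \<beta>1 y) \<le> 4 * N"
  using l21_nm1_le[OF _ _ N, of "%y. \<alpha>0 y - \<alpha>1 y"] l21_nm1_le[OF _ _ N, of "%y. \<beta>0 y - \<beta>1 y"] d by (auto simp: dist_le_def)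

lemma zs_dist_nm2:
  "nm2 (%y. \<alpha>0 y - \<alpha>1 y) + nm2 (%y. \<beta>0 y - \<beta>1 y) \<le> 2 * N^2"
  "4 * nm2 (xm (%y. \<alpha>0 y - \<alpha>1 y)) + 4 * nm2 (xm (%y. \<beta>0 y - \<beta>1 y)) \<le> 8 * N^2"
  using l21_nm2(3,4)[of "%y. \<alpha>0 y - \<alpha>1 y"] l21_nm2(3,4)[of "%y. \<beta>0 y - \<beta>1 y"] d by (auto simp: dist_le_def)

lemma zs_size_nm2: "nm2 \<alpha>0 + nm2 \<beta>0 \<le> 2 * B^2" "nm2 \<alpha>1 + nm2 \<beta>1 \<le> 2 * B^2"
  "4 * nm2 (xm \<alpha>0) + 4 * nm2 (xm \<beta>0) \<le> 8 * B^2" "4 * nm2 (xm \<alpha>1) + 4 * nm2 (xm \<beta>1) \<le> 8 * B^2"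
  using l21_nm2(3,4)[OF l(1)] l21_nm2(3,4)[OF l(2)] l21_nm2(3,4)[OF l(3)] l21_nm2(3,4)[OF l(4)] wB by auto

lemma lip_const_nonneg: "0 \<le> lip_const B"
  using B zs_const_ge_1[OF B] rho_const_nonneg[OF B] by (simp add: lip_const_def)

lemma zs_rho_dist: "nsq (%l. zs_rho \<alpha>0 \<beta>0 l - zs_rho \<alpha>1 \<beta>1 l) \<le> ennreal (lip_const B * N^2)"
proof -
  have "nsq (%l. 1 * (zs_rho (idx4 \<alpha>0 \<alpha>1 \<alpha>0 \<alpha>0 0) (idx4 \<beta>0 \<beta>1 \<beta>0 \<beta>0 0) l - zs_rho (idx4 \<alpha>0 \<alpha>1 \<alpha>0 \<alpha>0 1) (idx4 \<beta>0 \<beta>1 \<beta>0 \<beta>0 1) l))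
      \<le> ennreal (1225 * B^2 * zs_const B * (2 * N^2))"
    by (rule zs_rho_first_difference[OF B zs_ok_idx4]) (use ok zs_dist_nm2(1) in \<open>simp_all add: idx4\<close>)
  also have "\<dots> \<le> ennreal (lip_const B * N^2)"
  proof (rule ennreal_leI)
    have "1225 * B^2 * zs_const B * 2 \<le> lip_const B" using B zs_const_ge_1[OF B] rho_const_nonneg[OF B] by (simp add: lip_const_def)
    then have "1225 * B^2 * zs_const B * 2 * N^2 \<le> lip_const B * N^2" by (rule mult_right_mono) simp
    then show "1225 * B^2 * zs_const B * (2 * N^2) \<le> lip_const B * N^2" by (simp only: mult.assoc)
  qed
  finally show ?thesis by simp
qed

lemma zs_rho_deriv_dist:
  assumes g: "l2_deriv (zs_rho \<alpha>0 \<beta>0) g0" "l2_deriv (zs_rho \<alpha>1 \<beta>1) g1"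
  shows "nsq (%l. g0 l - g1 l) \<le> ennreal (lip_const B * N^2)"
proof -
  have "nsq (%l. g0 l - g1 l) \<le> ennreal (2 * (rho_const B * (8 * N^2 + (4 * N)^2 * (8 * B^2) + (4 * N)^2 * (8 * B^2))))"
    by (rule zs_rho_l2_deriv_diff[OF B ok _ _ _ _ g zs_dist_nm1 zs_dist_nm2(2) zs_size_nm2(3,4)]) (intro l21_nm2 l)+
  also have "\<dots> \<le> ennreal (lip_const B * N^2)"
  proof (rule ennreal_leI)
    have "2 * rho_const B * (8 + 256 * B^2) \<le> lip_const B" using B zs_const_ge_1[OF B] rho_const_nonneg[OF B] by (simp add: lip_const_def)
    then have "2 * rho_const B * (8 + 256 * B^2) * N^2 \<le> lip_const B * N^2" by (rule mult_right_mono) simp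
    then show "2 * (rho_const B * (8 * N^2 + (4 * N)^2 * (8 * B^2) + (4 * N)^2 * (8 * B^2))) \<le> lip_const B * N^2" by (simp add: algebra_simps power_mult_distrib)
  qed
  finally show ?thesis .
qed

lemma zs_rho_weighted_dist:
  assumes "l2ac \<alpha>0 \<alpha>0'" "l2ac \<beta>0 \<beta>0'" "l2ac \<alpha>1 \<alpha>1'" "l2ac \<beta>1 \<beta>1'"
    and "nm2 \<alpha>0' \<le> B^2" "nm2 \<beta>0' \<le> B^2" "nm2 \<alpha>1' \<le> B^2" "nm2 \<beta>1' \<le> B^2"
    and "nm2 (%y. \<alpha>0' y - \<alpha>1' y) \<le> N^2" "nm2 (%y. \<beta>0' y - \<beta>1' y) \<le> N^2"
  shows "nsq (%l. of_real l * (zs_rho \<alpha>0 \<beta>0 l - zs_rho \<alpha>1 \<beta>1 l)) \<le> ennreal (lip_const B * N^2)"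
proof -
  have "nsq (%l. of_real l * (zs_rho \<alpha>0 \<beta>0 l - zs_rho \<alpha>1 \<beta>1 l)) \<le>
     ennreal (rho_const B * (2 * N^2 + (4 * N)^2 * (2 * B^2) + (4 * N)^2 * (2 * B^2)))"
    by (rule zs_rho_weighted_diff[OF B ok assms(1-4) zs_dist_nm1]) (use assms(5-) in simp_all)
  also have "\<dots> \<le> ennreal (lip_const B * N^2)"
  proof (rule ennreal_leI)
    have "rho_const B * (2 + 64 * B^2) \<le> rho_const B * (16 + 512 * B^2)" by (intro mult_left_mono rho_const_nonneg[OF B]) auto
    also have "\<dots> \<le> lip_const B" using B zs_const_ge_1[OF B] by (simp add: lip_const_def algebra_simps)
    finally have "rho_const B * (2 + 64 * B^2) * N^2 \<le> lip_const B * N^2" by (rule mult_right_mono) simp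
    then show "rho_const B * (2 * N^2 + (4 * N)^2 * (2 * B^2) + (4 * N)^2 * (2 * B^2)) \<le> lip_const B * N^2" by (simp add: algebra_simps power_mult_distrib)
  qed
  finally show ?thesis .
qed

end

text \<open>Turns the Lipschitz estimates into plain bounds: for zero potentials
  \<open>zs_rho\<close> vanishes.\<close>

lemma dist_le_zero: "l21 f \<Longrightarrow> wn f \<le> B^2 \<Longrightarrow> dist_le B f (%y. 0)" by (simp add: dist_le_def)

lemma l21_zero: "l21 (%y. 0)" "wn (%y. 0) = 0" by (simp_all add: l21_def wn_def)

section \<open>The potentials\<close>

text \<open>Links the definitions over \<open>lebesgue\<close> to Borel representatives; the weight
  is \<open>(japanese x)^2 = 1 + x^2\<close>.\<close>

lemma l21_rep:
  assumes F: "borel_fun F" and ae: "AE x in lborel. f x = F x"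
  shows "f \<in> L21 \<longleftrightarrow> l21 F" "L21_norm f = sqrt (wn F)"
proof -
  have p: "0 \<le> 1 + x^2" for x :: real by simp
  have j: "(cmod (japanese x *\<^sub>R g))^2 = (1 + x^2) * (cmod g)^2" for x g
    by (simp add: japanese_def power_mult_distrib)
  have jm [measurable]: "borel_fun (%x. japanese x *\<^sub>R F x)" using F unfolding japanese_def[abs_def] by measurable
  have ae': "AE x in lborel. japanese x *\<^sub>R f x = japanese x *\<^sub>R F x" using ae by eventually_elim simp
  have m: "(%x. japanese x *\<^sub>R f x) \<in> borel_measurable lebesgue" by (rule lebesgue_measurable_AE[OF jm ae'])
  note F [measurable]
  have m2: "(%x. (cmod (japanese x *\<^sub>R f x))^2) \<in> borel_measurable lebesgue" using m by measurable
  have F2: "borel_fun (%x. (1 + x^2) * (cmod (F x))^2)" by measurable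
  have ae2: "AE x in lborel. (cmod (japanese x *\<^sub>R f x))^2 = (1 + x^2) * (cmod (F x))^2"
    using ae by eventually_elim (simp only: j)
  note I = lebesgue_integral_AE[OF m2 F2 ae2]
  show "f \<in> L21 \<longleftrightarrow> l21 F" unfolding L21_def L2_def l21_def using m F I(1) by simp
  show "L21_norm f = sqrt (wn F)" unfolding L21_norm_def L2_norm_def wn_def I(2) ..
qed

lemma L2_rep:
  assumes F: "borel_fun F" and ae: "AE x in lborel. f x = F x"
  shows "f \<in> L2 \<longleftrightarrow> sq_integrable F" "L2_norm f = sqrt (nm2 F)"
proof -
  note F [measurable]
  have m: "f \<in> borel_measurable lebesgue" by (rule lebesgue_measurable_AE[OF F ae])
  have m2: "(%x. (cmod (f x))^2) \<in> borel_measurable lebesgue" using m by measurable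
  have F2: "borel_fun (%x. (cmod (F x))^2)" by measurable
  have ae2: "AE x in lborel. (cmod (f x))^2 = (cmod (F x))^2" using ae by eventually_elim simp
  note I = lebesgue_integral_AE[OF m2 F2 ae2]
  show "f \<in> L2 \<longleftrightarrow> sq_integrable F" unfolding L2_def using m I(1) by simp
  show "L2_norm f = sqrt (nm2 F)" unfolding L2_norm_def nm2_def I(2) ..
qed

lemma ac_cong_AE:
  assumes ac: "ac F G" and H: "borel_fun H" and ae: "AE x in lborel. G x = H x"
  shows "ac F H"
proof -
  note [measurable] = ac_D(1)[OF ac] H
  have "set_integrable lborel {a<..b} G \<longleftrightarrow> set_integrable lborel {a<..b} H" "(LBINT t:{a<..b}. G t) = (LBINT t:{a<..b}. H t)" for a b
    unfolding set_integrable_def set_lebesgue_integral_def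
    by (rule integrable_cong_AE; use ae in auto) (rule integral_cong_AE; use ae in auto)
  then show ?thesis using ac H unfolding ac_def by simp
qed

lemma has_weak_deriv_ac: "ac F G \<Longrightarrow> AE x in lborel. f x = F x \<Longrightarrow> has_weak_deriv f G"
  unfolding has_weak_deriv_iff_ac by blast

text \<open>The data of an \<open>H11\<close> function in terms of a representative and its density.
  The number \<open>b\<close> bounds both weighted norms; it is used for single potentials and, as
  \<open>n\<close>, for differences of two.\<close>

definition sobdat :: "real => (real => complex) => (real => complex) => bool" where
  "sobdat b U U' \<longleftrightarrow> 0 \<le> b \<and> ac U U' \<and> l21 U \<and> l21 U' \<and> wn U \<le> b^2 \<and> wn U' \<le> b^2"

definition wW :: "(real => complex) => (real => complex) => real => complex" where
  "wW U U' x = - \<i> * U' x + 2 * U x - 1/2 * of_real ((cmod (U x))^2) * U x"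

text \<open>The density of \<open>wW\<close>, with \<open>(cmod (U x))^2\<close> read as
  \<open>U x * cnj (U x)\<close> so that the product rule applies (\<open>ac_wW\<close>).\<close>

definition wW' :: "(real => complex) => (real => complex) => (real => complex) => real => complex" where
  "wW' U U' U'' x = - \<i> * U'' x + 2 * U' x - 1/2 * ((U' x * cnj (U x) + U x * cnj (U' x)) * U x + (U x * cnj (U x)) * U' x)"

lemma ac_eq_cumint:
  assumes ac: "ac f g" and g: "integrable lborel g" and lim: "(f \<longlongrightarrow> c) at_bot"
  shows "f x = c + cumint g x"
proof -
  have "((%a. f x - cumint g x + cumint g a) \<longlongrightarrow> f x - cumint g x + 0) at_bot"
    by (intro tendsto_intros cumint_tendsto_bot g)
  moreover have "\<forall>\<^sub>F a in at_bot. f x - cumint g x + cumint g a = f a"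
    using eventually_le_at_bot[of x]
  proof eventually_elim
    fix a assume a: "a \<le> x"
    show "f x - cumint g x + cumint g a = f a" using ac_D(3)[OF ac a] cumint_diff[OF g a] by (simp add: algebra_simps)
  qed
  ultimately have "f x - cumint g x + 0 = c" using lim by (blast intro: tendsto_unique[OF trivial_limit_at_bot_linorder] Lim_transform_eventually)
  then show ?thesis by (simp add: algebra_simps)
qed

lemma sobdat_tendsto:
  assumes U: "sobdat b U U'"
  shows "(U \<longlongrightarrow> 0) at_top" "(U \<longlongrightarrow> 0) at_bot"
proof -
  have a: "ac U U'" and l: "l21 U" "l21 U'" using U by (auto simp: sobdat_def)
  show "(U \<longlongrightarrow> 0) at_top" "(U \<longlongrightarrow> 0) at_bot"
    by (rule ac_tendsto_0[OF a l21_nm1(1)[OF l(2)], of 2], rule l21_nm2(1)[OF l(1)])+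
qed

lemma sobdat_eq_cumint:
  assumes U: "sobdat b U U'"
  shows "U x = cumint U' x"
  using ac_eq_cumint[OF _ _ sobdat_tendsto(2)[OF U], of U' x] U l21_nm1(1)[of U'] by (simp add: sobdat_def)

text \<open>\<open>U\<close> tends to 0 at minus infinity, so it is bounded by the L1 norm of
  \<open>U'\<close>, and \<open>l21_nm1_le\<close> bounds the latter by
  \<open>2 * b\<close>.\<close>

lemma sobdat_sup:
  assumes s: "sobdat b U U'"
  shows "cmod (U x) \<le> 2 * b"
proof -
  have l: "l21 U'" "wn U' \<le> b^2" "0 \<le> b" using s by (auto simp: sobdat_def)
  have "cmod (U x) \<le> nm1 U'" unfolding sobdat_eq_cumint[OF s] nm1_def by (rule cumint_bounded[OF l21_nm1(1)[OF l(1)]])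
  also have "\<dots> \<le> 2 * b" by (rule l21_nm1_le[OF l])
  finally show ?thesis .
qed

lemma sobdat_zero: "0 \<le> b \<Longrightarrow> sobdat b (%y. 0) (%y. 0)" by (simp add: sobdat_def ac_const l21_zero)

lemma wW_zero: "wW (%y. 0) (%y. 0) = (%y. 0)" "wW' (%y. 0) (%y. 0) (%y. 0) = (%y. 0)" by (auto simp: wW_def wW'_def)

text \<open>\<open>2 * (1 + (2 + 6 * b^2) + 12 * b^2)\<close>, collected from the coefficients in
  \<open>wW'_dist\<close>; it also covers \<open>wW_dist\<close>.\<close>

definition sob_const :: "real => real" where "sob_const b = 6 + 36 * b^2"

section \<open>Lipschitz dependence of w on the potential\<close>

lemma norm_cube_diff:
  assumes "cmod x \<le> c" "cmod y \<le> c" "cmod X \<le> D" "0 \<le> c"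
  shows "cmod (x * cnj x * X - y * cnj y * Y) \<le> c^2 * cmod (X - Y) + 2 * c * cmod (x - y) * cmod Y"
    and "cmod (x * x * X - y * y * Y) \<le> c^2 * cmod (X - Y) + 2 * c * cmod (x - y) * cmod Y"
proof -
  have A: "cmod (p * q * X - r * s * Y) \<le> c^2 * cmod (X - Y) + 2 * c * cmod (x - y) * cmod Y"
    if pq: "cmod p \<le> c" "cmod q \<le> c" "cmod s \<le> c" "cmod (p - r) = cmod (x - y)" "cmod (q - s) = cmod (x - y)" for p q r s
  proof -
    have "p * q * X - r * s * Y = p * q * (X - Y) + (p * (q - s) + (p - r) * s) * Y" by (simp add: algebra_simps)
    then have "cmod (p * q * X - r * s * Y) \<le> cmod p * cmod q * cmod (X - Y) + (cmod p * cmod (q - s) + cmod (p - r) * cmod s) * cmod Y"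
      using norm_triangle_ineq[of "p * q * (X - Y)" "(p * (q - s) + (p - r) * s) * Y"]
        mult_right_mono[OF norm_triangle_ineq[of "p * (q - s)" "(p - r) * s"], of "cmod Y"] by (simp add: norm_mult)
    also have "\<dots> \<le> c * c * cmod (X - Y) + (c * cmod (x - y) + cmod (x - y) * c) * cmod Y"
      unfolding pq(4,5) using pq assms(4) by (intro add_mono mult_right_mono mult_mono) auto
    finally show ?thesis by (simp add: power2_eq_square algebra_simps)
  qed
  show "cmod (x * cnj x * X - y * cnj y * Y) \<le> c^2 * cmod (X - Y) + 2 * c * cmod (x - y) * cmod Y"
    by (rule A) (use assms in \<open>auto simp: complex_cnj_diff[symmetric] simp del: complex_cnj_diff\<close>)
  show "cmod (x * x * X - y * y * Y) \<le> c^2 * cmod (X - Y) + 2 * c * cmod (x - y) * cmod Y"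
    by (rule A) (use assms in auto)
qed

context
  fixes b n :: real and U U' V V' :: "real => complex"
  assumes U: "sobdat b U U'" and V: "sobdat b V V'" and UV: "sobdat n (%y. U y - V y) (%y. U' y - V' y)"
begin

text \<open>The cubic term is Lipschitz because both potentials are bounded by \<open>2 * b\<close>:
  half of \<open>(2 * b)^2 + 2 * (2 * b) * (2 * b)\<close> is the \<open>6 * b^2\<close>, and 2
  comes from the linear term.\<close>

lemma wW_dist: "dist_le (sob_const b * n) (wW U U') (wW V V')"
proof -
  have l: "l21 U" "l21 U'" "l21 V" "l21 V'" "l21 (%y. U y - V y)" "l21 (%y. U' y - V' y)" "wn (%y. U y - V y) \<le> n^2" "wn (%y. U' y - V' y) \<le> n^2" "0 \<le> b" "0 \<le> n"
    using U V UV by (auto simp: sobdat_def)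
  note [measurable] = l(1-6)[THEN l21_D(1)]
  have [measurable]: "borel_fun (%y. wW U U' y - wW V V' y)" unfolding wW_def by measurable
  have bd: "cmod (wW U U' y - wW V V' y) \<le> 1 * cmod (U' y - V' y) + (2 + 6 * b^2) * cmod (U y - V y) + 0 * cmod (U y - V y)" for y
  proof -
    have "wW U U' y - wW V V' y = - \<i> * (U' y - V' y) + 2 * (U y - V y) - 1/2 * (U y * cnj (U y) * U y - V y * cnj (V y) * V y)"
      unfolding wW_def complex_norm_square by (simp add: algebra_simps)
    then have "cmod (wW U U' y - wW V V' y) \<le> cmod (- \<i> * (U' y - V' y)) + cmod (2 * (U y - V y)) + cmod (1/2 * (U y * cnj (U y) * U y - V y * cnj (V y) * V y))"
      using norm_triangle_ineq4[of "- \<i> * (U' y - V' y) + 2 * (U y - V y)" "1/2 * (U y * cnj (U y) * U y - V y * cnj (V y) * V y)"]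
        norm_triangle_ineq[of "- \<i> * (U' y - V' y)" "2 * (U y - V y)"] by simp
    also have "\<dots> = cmod (U' y - V' y) + 2 * cmod (U y - V y) + 1/2 * cmod (U y * cnj (U y) * U y - V y * cnj (V y) * V y)"
      by (simp only: norm_mult) simp
    also have "cmod (U y * cnj (U y) * U y - V y * cnj (V y) * V y) \<le> (2 * b)^2 * cmod (U y - V y) + 2 * (2 * b) * cmod (U y - V y) * cmod (V y)"
      by (rule norm_cube_diff(1)[OF sobdat_sup[OF U] sobdat_sup[OF V] sobdat_sup[OF U]]) (use l in simp)
    also have "\<dots> \<le> (2 * b)^2 * cmod (U y - V y) + 2 * (2 * b) * cmod (U y - V y) * (2 * b)"
      using sobdat_sup[OF V, of y] l by (intro add_mono mult_left_mono) auto
    finally show ?thesis by (simp add: power2_eq_square algebra_simps)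
  qed
  note R = weighted_square_bound[OF _ _ bd, where \<omega>="%y. 1 + y^2" and ?n1.0=n and ?n2.0=n and ?n3.0=n]
  have "integrable lborel (%y. (1 + y^2) * (cmod (wW U U' y - wW V V' y))^2)"
    "(LBINT y. (1 + y^2) * (cmod (wW U U' y - wW V V' y))^2) \<le> (2 * (1 * n + (2 + 6 * b^2) * n + 0 * n))^2"
    by (rule R; use l in \<open>simp add: l21_D wn_def\<close>)+
  then have l': "l21 (%y. wW U U' y - wW V V' y)" and w: "wn (%y. wW U U' y - wW V V' y) \<le> (2 * (1 * n + (2 + 6 * b^2) * n + 0 * n))^2"
    by (simp_all add: l21_def wn_def)
  have "(2 * (1 * n + (2 + 6 * b^2) * n + 0 * n))^2 \<le> (sob_const b * n)^2"
  proof (rule power_mono)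
    have "2 * (1 * n + (2 + 6 * b^2) * n + 0 * n) = (6 + 12 * b^2) * n" by (simp add: algebra_simps)
    also have "\<dots> \<le> sob_const b * n" using l unfolding sob_const_def by (intro mult_right_mono) auto
    finally show "2 * (1 * n + (2 + 6 * b^2) * n + 0 * n) \<le> sob_const b * n" .
  qed (use l in auto)
  with l' w show ?thesis unfolding dist_le_def by simp
qed

text \<open>The norm carries no weight, since second derivatives are only known to be square
  integrable. In the nonlinear terms the difference \<open>U - V\<close> is taken in the supremum
  norm, at most \<open>2 * n\<close>, and \<open>V'\<close> in L2.\<close>

lemma wW'_dist:
  assumes UU [measurable]: "borel_fun U''" "borel_fun V''"
    and i: "integrable lborel (%y. (cmod (U'' y - V'' y))^2)" and n'': "nm2 (%y. U'' y - V'' y) \<le> n^2"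
  shows "integrable lborel (%y. (cmod (wW' U U' U'' y - wW' V V' V'' y))^2)" "nm2 (%y. wW' U U' U'' y - wW' V V' V'' y) \<le> (sob_const b * n)^2"
proof -
  have l: "l21 U" "l21 U'" "l21 V" "l21 V'" "l21 (%y. U' y - V' y)" "wn (%y. U' y - V' y) \<le> n^2" "wn V' \<le> b^2" "0 \<le> b" "0 \<le> n"
    using U V UV by (auto simp: sobdat_def)
  note [measurable] = l(1-5)[THEN l21_D(1)]
  have m [measurable]: "borel_fun (%y. wW' U U' U'' y - wW' V V' V'' y)" unfolding wW'_def by measurable
  have bd: "cmod (wW' U U' U'' y - wW' V V' V'' y) \<le> 1 * cmod (U'' y - V'' y) + (2 + 6 * b^2) * cmod (U' y - V' y) + 12 * b * n * cmod (V' y)" for y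
  proof -
    let ?X = "U y * cnj (U y) * U' y - V y * cnj (V y) * V' y" and ?Y = "U y * U y * cnj (U' y) - V y * V y * cnj (V' y)"
    have eq: "wW' U U' U'' y - wW' V V' V'' y = - \<i> * (U'' y - V'' y) + 2 * (U' y - V' y) - (?X + 1/2 * ?Y)"
      unfolding wW'_def by (simp add: algebra_simps)
    have "cmod (wW' U U' U'' y - wW' V V' V'' y) \<le> cmod (- \<i> * (U'' y - V'' y)) + cmod (2 * (U' y - V' y)) + (cmod ?X + cmod (1/2 * ?Y))"
      unfolding eq using norm_triangle_ineq4[of "- \<i> * (U'' y - V'' y) + 2 * (U' y - V' y)" "?X + 1/2 * ?Y"]
        norm_triangle_ineq[of "- \<i> * (U'' y - V'' y)" "2 * (U' y - V' y)"] norm_triangle_ineq[of ?X "1/2 * ?Y"] by linarith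
    also have "\<dots> = cmod (U'' y - V'' y) + 2 * cmod (U' y - V' y) + (cmod ?X + 1/2 * cmod ?Y)"
      by (simp only: norm_mult) simp
    also have "cmod ?X + 1/2 * cmod ?Y \<le> 3 / 2 * ((2 * b)^2 * cmod (U' y - V' y) + 2 * (2 * b) * (2 * n) * cmod (V' y))"
    proof -
      have d: "2 * (2 * b) * cmod (U y - V y) * cmod (V' y) \<le> 2 * (2 * b) * (2 * n) * cmod (V' y)"
        using sobdat_sup[OF UV, of y] l by (intro mult_right_mono mult_left_mono) auto
      have X: "cmod ?X \<le> (2 * b)^2 * cmod (U' y - V' y) + 2 * (2 * b) * cmod (U y - V y) * cmod (V' y)"
        by (rule norm_cube_diff(1)[OF sobdat_sup[OF U] sobdat_sup[OF V] order_refl]) (use l in simp)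
      have "cmod (cnj (U' y) - cnj (V' y)) = cmod (U' y - V' y)" by (simp only: complex_cnj_diff[symmetric] complex_mod_cnj)
      moreover have "cmod ?Y \<le> (2 * b)^2 * cmod (cnj (U' y) - cnj (V' y)) + 2 * (2 * b) * cmod (U y - V y) * cmod (cnj (V' y))"
        by (rule norm_cube_diff(2)[OF sobdat_sup[OF U] sobdat_sup[OF V] order_refl]) (use l in simp)
      ultimately have Y: "cmod ?Y \<le> (2 * b)^2 * cmod (U' y - V' y) + 2 * (2 * b) * cmod (U y - V y) * cmod (V' y)"
        by (simp only: complex_mod_cnj)
      have gen: "x + 1/2 * z \<le> 3 / 2 * (p + r)" if "x \<le> p + q" "z \<le> p + q" "q \<le> r" for x z p q r :: real
      proof -
        have "x + 1/2 * z \<le> (p + q) + 1/2 * (p + q)" by (intro add_mono mult_left_mono that) simp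
        also have "\<dots> = 3 / 2 * (p + q)" by (simp add: field_simps)
        also have "\<dots> \<le> 3 / 2 * (p + r)" using that(3) by (intro mult_left_mono add_left_mono) auto
        finally show ?thesis .
      qed
      show ?thesis by (rule gen[OF X Y d])
    qed
    finally show ?thesis by (simp add: power2_eq_square algebra_simps)
  qed
  note R = weighted_square_bound[OF _ _ bd, where \<omega>="%y. 1" and ?n1.0=n and ?n2.0=n and ?n3.0=b]
  have fin: "integrable lborel (%y. 1 * (cmod (wW' U U' U'' y - wW' V V' V'' y))^2)"
    "(LBINT y. 1 * (cmod (wW' U U' U'' y - wW' V V' V'' y))^2) \<le> (2 * (1 * n + (2 + 6 * b^2) * n + 12 * b * n * b))^2"
    by (rule R; use l i n'' l21_nm2(1,3)[OF l(5)] l21_nm2(1,3)[OF l(4)] in \<open>simp add: nm2_def\<close>)+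
  show "integrable lborel (%y. (cmod (wW' U U' U'' y - wW' V V' V'' y))^2)" using fin(1) by simp
  have "2 * (1 * n + (2 + 6 * b^2) * n + 12 * b * n * b) = sob_const b * n" by (simp add: sob_const_def power2_eq_square algebra_simps)
  then show "nm2 (%y. wW' U U' U'' y - wW' V V' V'' y) \<le> (sob_const b * n)^2" using fin(2) by (simp add: nm2_def)
qed

end

lemma wW_bound:
  assumes U: "sobdat b U U'"
  shows "l21 (wW U U')" "wn (wW U U') \<le> (sob_const b * b)^2"
proof -
  have "0 \<le> b" using U by (simp add: sobdat_def)
  then show "l21 (wW U U')" "wn (wW U U') \<le> (sob_const b * b)^2"
    using wW_dist[OF U sobdat_zero, of b] U by (simp_all add: dist_le_def wW_zero)
qed

lemma ac_wW:
  assumes U: "ac U U'" "ac U' U''" shows "ac (wW U U') (wW' U U' U'')"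
proof -
  have "ac (%x. (- \<i>) * U' x + 2 * U x - 1/2 * ((U x * cnj (U x)) * U x)) (%x. (- \<i>) * U'' x + 2 * U' x - 1/2 * ((U' x * cnj (U x) + U x * cnj (U' x)) * U x + (U x * cnj (U x)) * U' x))"
    by (intro ac_diff ac_add ac_cmult ac_mult ac_cnj U)
  moreover have "(%x. (- \<i>) * U' x + 2 * U x - 1/2 * ((U x * cnj (U x)) * U x)) = wW U U'"
    unfolding wW_def complex_norm_square by (simp add: mult.assoc)
  ultimately show ?thesis by (simp add: wW'_def[abs_def])
qed

lemma l2ac_wW:
  assumes U: "sobdat b U U'" and U'': "ac U' U''" "sq_integrable U''" "nm2 U'' \<le> b^2"
  shows "l2ac (wW U U') (wW' U U' U'')" "nm2 (wW' U U' U'') \<le> (sob_const b * b)^2"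
proof -
  have b: "0 \<le> b" and aU: "ac U U'" using U by (auto simp: sobdat_def)
  note [measurable] = ac_D(1)[OF U''(1)]
  have U0: "sobdat b (%y. U y - 0) (%y. U' y - 0)" using U by simp
  have i': "sq_integrable (wW' U U' U'')" and n': "nm2 (wW' U U' U'') \<le> (sob_const b * b)^2"
    using wW'_dist[OF U sobdat_zero[OF b] U0, of U'' "%y. 0"] U'' by (simp_all add: wW_zero)
  show "l2ac (wW U U') (wW' U U' U'')" using ac_wW[OF aU U''(1)] i' by (simp add: l2ac_def)
  show "nm2 (wW' U U' U'') \<le> (sob_const b * b)^2" by (rule n')
qed

lemma l2ac_sobdat: "sobdat b U U' \<Longrightarrow> l2ac U U'"
  using l21_nm2(1) by (auto simp: sobdat_def l2ac_def)

section \<open>Representatives of potentials in the function spaces\<close>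

text \<open>Uniqueness of weak derivatives identifies the chosen representative
  \<open>wderiv d\<close> with \<open>D'\<close> almost everywhere, so the norm of \<open>d\<close>
  can be read off from \<open>D\<close> and \<open>D'\<close>.\<close>

lemma sobdat_H11_norm:
  assumes D: "ac D D'" "AE x in lborel. d x = D x" and l: "l21 D" "l21 D'"
  shows "sobdat (H11_norm d) D D'"
proof -
  have "AE x in lborel. wderiv d x = D' x" by (rule wderiv_AE[OF has_weak_deriv_ac[OF D]])
  then have "H11_norm d = sqrt ((sqrt (wn D))^2 + (sqrt (wn D'))^2)"
    unfolding H11_norm_def using l21_rep(2)[OF l21_D(1)[OF l(1)] D(2)] l21_rep(2)[OF l21_D(1)[OF l(2)]] by simp
  then have "(H11_norm d)^2 = wn D + wn D'" by simp
  then show ?thesis using D(1) l by (simp add: sobdat_def H11_norm_def)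
qed

lemma sobdat_H2_H11_norm:
  assumes D: "ac D D'" "AE x in lborel. d x = D x" and D'': "ac D' D''" and l: "l21 D" "l21 D'"
  shows "sobdat (H2_H11_norm d) D D'" "nm2 D'' \<le> (H2_H11_norm d)^2"
proof -
  have w1: "AE x in lborel. wderiv d x = D' x" by (rule wderiv_AE[OF has_weak_deriv_ac[OF D]])
  have w2: "AE x in lborel. wderiv (wderiv d) x = D'' x" by (rule wderiv_AE[OF has_weak_deriv_ac[OF D'' w1]])
  have n2: "L2_norm (wderiv (wderiv d)) = sqrt (nm2 D'')" by (rule L2_rep(2)[OF ac_D(1)[OF D''] w2])
  have "(L2_norm (wderiv (wderiv d)))^2 = (L2_norm ((wderiv ^^ 2) d))^2" by (simp add: numeral_2_eq_2)
  also have "\<dots> \<le> (\<Sum>j\<le>2. (L2_norm ((wderiv ^^ j) d))^2)" by (rule member_le_sum) auto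
  finally have n2': "nm2 D'' \<le> (Hm_norm 2 d)^2" unfolding n2 Hm_norm_def by (simp add: sum_nonneg)
  have pos: "0 \<le> Hm_norm 2 d" "0 \<le> H11_norm d" by (simp_all add: Hm_norm_def H11_norm_def sum_nonneg)
  have le: "(H11_norm d)^2 \<le> (H2_H11_norm d)^2" "(Hm_norm 2 d)^2 \<le> (H2_H11_norm d)^2"
    unfolding H2_H11_norm_def by (intro power_mono; use pos in simp)+
  show "nm2 D'' \<le> (H2_H11_norm d)^2" using n2' le(2) by linarith
  have "sobdat (H11_norm d) D D'" by (rule sobdat_H11_norm[OF D l])
  moreover have "0 \<le> H2_H11_norm d" using pos by (simp add: H2_H11_norm_def)
  ultimately show "sobdat (H2_H11_norm d) D D'" by (auto simp: sobdat_def intro: order_trans[OF _ le(1)])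
qed

lemma H11_rep:
  assumes "u \<in> H11"
  obtains U U' where "ac U U'" "AE x in lborel. u x = U x" "AE x in lborel. wderiv u x = U' x" "l21 U" "l21 U'"
proof -
  have u: "weakly_differentiable u" "u \<in> L21" "wderiv u \<in> L21" using assms by (auto simp: H11_def)
  then obtain U U' where U: "ac U U'" "AE x in lborel. u x = U x" "AE x in lborel. wderiv u x = U' x"
    using weakly_differentiable_wderiv[OF u(1)] unfolding has_weak_deriv_iff_ac by blast
  have "l21 U" "l21 U'"
    using l21_rep(1)[OF ac_measurable[OF U(1)] U(2)] l21_rep(1)[OF ac_D(1)[OF U(1)] U(3)] u(2,3) by auto
  with U show ?thesis by (rule that)
qed

text \<open>Two representatives of \<open>wderiv u\<close> arise: the density of \<open>U\<close>
  and an absolutely continuous one. The second replaces the first by \<open>ac_cong_AE\<close>, so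
  that a single triple serves all orders of differentiation.\<close>

lemma H2_H11_rep:
  assumes u: "u \<in> Hm 2 \<inter> H11"
  obtains U U' U'' where "ac U U'" "AE x in lborel. u x = U x" "AE x in lborel. wderiv u x = U' x" "l21 U" "l21 U'"
    "ac U' U''" "sq_integrable U''"
proof -
  have H: "u \<in> H11" "u \<in> Hm 2" using u by auto
  obtain U V where U: "ac U V" "AE x in lborel. u x = U x" "AE x in lborel. wderiv u x = V x" "l21 U" "l21 V"
    by (rule H11_rep[OF H(1)])
  have "\<forall>j<2. weakly_differentiable ((wderiv ^^ j) u)" "\<forall>j\<le>2. (wderiv ^^ j) u \<in> L2" using H(2) unfolding Hm_def by blast+
  then have "weakly_differentiable ((wderiv ^^ 1) u)" "(wderiv ^^ 2) u \<in> L2" by (meson one_less_numeral_iff semiring_norm(76) order_refl)+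
  then have w: "weakly_differentiable (wderiv u)" "wderiv (wderiv u) \<in> L2" by (simp_all add: numeral_2_eq_2)
  then obtain U' U'' where U': "ac U' U''" "AE x in lborel. wderiv u x = U' x" "AE x in lborel. wderiv (wderiv u) x = U'' x"
    using weakly_differentiable_wderiv[OF w(1)] unfolding has_weak_deriv_iff_ac by blast
  have "AE x in lborel. V x = U' x" using U(3) U'(2) by eventually_elim simp
  then have a: "ac U U'" by (rule ac_cong_AE[OF U(1) ac_measurable[OF U'(1)]])
  have "l21 U'" using l21_rep(1)[OF ac_measurable[OF U'(1)] U'(2)] H(1) by (simp add: H11_def)
  moreover have "sq_integrable U''" using L2_rep(1)[OF ac_D(1)[OF U'(1)] U'(3)] w(2) by simp
  ultimately show ?thesis using that[OF a U(2) U'(2) U(4) _ U'(1)] by blast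
qed

lemma w_pot_AE:
  assumes "AE x in lborel. u x = U x" "AE x in lborel. wderiv u x = U' x"
  shows "AE x in lborel. w_pot u x = wW U U' x"
  using assms by eventually_elim (simp add: w_pot_def wW_def)

text \<open>\<open>12 / 5\<close> is a rational number below e; the quadratic Taylor polynomial
  exceeds \<open>12 / 5 * x\<close> by \<open>((x - 7 / 5)^2 + 1 / 25) / 2\<close>. Together with
  the bound 2 in \<open>admissible_small\<close> it produces
  \<open>2 * 5 / 12 = 5 / 6\<close>.\<close>

lemma exp_ge_12_5: "12 / 5 * x \<le> exp x" if "0 \<le> x" for x :: real
proof -
  have "12 / 5 * x \<le> 1 + x + x^2 / 2"
  proof -
    have "0 \<le> (x - 7 / 5)^2" by simp
    then show ?thesis by (simp add: power2_eq_square algebra_simps)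
  qed
  also have "\<dots> \<le> exp x" by (rule exp_lower_Taylor_quadratic[OF that])
  finally show ?thesis .
qed

text \<open>
  The only use of admissibility. Since \<open>nm1 (wW U U') \<le> q\<close> for \<open>q = Q1_L1_norm u\<close>, the product is at
  most \<open>2 x e\<^sup>-\<^sup>x\<close> with \<open>x = nm1 (wW U U')\<close>.
\<close>

lemma admissible_small:
  assumes u: "admissible u" and U: "ac U U'" "AE x in lborel. u x = U x" "AE x in lborel. wderiv u x = U' x" "l21 U" "l21 U'"
  shows "nm1 U * nm1 (wW U U') \<le> 5 / 6"
proof -
  note w = w_pot_AE[OF U(2,3)]
  have W: "l21 (wW U U')" by (rule wW_bound(1)[OF sobdat_H11_norm[OF U(1,2,4,5)]])
  note [measurable] = l21_D(1)[OF U(4)] l21_D(1)[OF W]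
  have um [measurable]: "u \<in> borel_measurable lebesgue" "w_pot u \<in> borel_measurable lebesgue"
    by (rule lebesgue_measurable_AE[OF _ U(2)], measurable, rule lebesgue_measurable_AE[OF _ w], measurable)
  have "L1_norm u = nm1 U" unfolding L1_norm_def nm1_def
    by (rule lebesgue_integral_AE(2)) (measurable, use U(2) in eventually_elim, simp)
  moreover have "Q1_L1_norm u = (LBINT y. sqrt ((cmod (U y))^2 / 4 + (cmod (wW U U' y))^2))"
  proof -
    have "Re (trace (adjoint_mat (Q1 u x) ** Q1 u x)) = (cmod (u x))^2 / 4 + (cmod (w_pot u x))^2" for x
      using cmod_power2[of "u x"] cmod_power2[of "w_pot u x"]
      by (simp add: trace_def matrix_matrix_mult_def adjoint_mat_def Q1_def mat22_def sum_2 power2_eq_square)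
    then show ?thesis unfolding Q1_L1_norm_def
      by (simp only:) (rule lebesgue_integral_AE(2), measurable, use U(2) w in eventually_elim, simp)
  qed
  moreover have "nm1 (wW U U') \<le> (LBINT y. sqrt ((cmod (U y))^2 / 4 + (cmod (wW U U' y))^2))"
  proof -
    have iW: "integrable lborel (%y. cmod (wW U U' y))" using l21_nm1(1)[OF W] by simp
    show ?thesis unfolding nm1_def
    proof (rule integral_mono[OF iW])
      show "integrable lborel (%y. sqrt ((cmod (U y))^2 / 4 + (cmod (wW U U' y))^2))"
      proof (rule Bochner_Integration.integrable_bound)
        show "integrable lborel (%y. cmod (U y) + cmod (wW U U' y))" using iW l21_nm1(1)[OF U(4)] by simp
        have "sqrt ((cmod (U y))^2 / 4 + (cmod (wW U U' y))^2) \<le> cmod (U y) + cmod (wW U U' y)" for y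
        proof -
          have "(cmod (U y))^2 / 4 + (cmod (wW U U' y))^2 \<le> (cmod (U y) + cmod (wW U U' y))^2"
            by (simp add: power2_sum)
          then show ?thesis by (intro real_le_lsqrt) auto
        qed
        then show "AE y in lborel. norm (sqrt ((cmod (U y))^2 / 4 + (cmod (wW U U' y))^2)) \<le> norm (cmod (U y) + cmod (wW U U' y))" by simp
      qed measurable
      show "cmod (wW U U' y) \<le> sqrt ((cmod (U y))^2 / 4 + (cmod (wW U U' y))^2)" for y by (rule real_le_rsqrt) simp
    qed
  qed
  ultimately have q: "nm1 (wW U U') \<le> Q1_L1_norm u" "nm1 U * exp (Q1_L1_norm u) \<le> 2"
    using u unfolding admissible_def by auto
  have "nm1 U * (12 / 5 * nm1 (wW U U')) \<le> nm1 U * exp (Q1_L1_norm u)"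
    by (intro mult_left_mono order_trans[OF exp_ge_12_5]) (use q in auto)
  then show ?thesis using q(2) by simp
qed

section \<open>The potentials of the two systems\<close>

text \<open>Serves as the \<open>B\<close> of \<open>zs_ok\<close>: it is at least 1 and dominates
  the bounds \<open>2 * b\<close> and \<open>2 * (sob_const b * b)\<close> for the L1 norms of
  \<open>U\<close> and \<open>wW\<close>, as well as the bounds for their weighted L2 norms.\<close>

definition pot_bound :: "real => real" where "pot_bound b = 2 * (sob_const b + 1) * b + 1"

lemma pot_bound:
  assumes "0 \<le> b"
  shows "1 \<le> pot_bound b" "2 * b \<le> pot_bound b" "b^2 \<le> (pot_bound b)^2" "2 * (sob_const b * b) \<le> pot_bound b" "(sob_const b * b)^2 \<le> (pot_bound b)^2"
proof -
  have s: "0 \<le> sob_const b * b" using assms by (simp add: sob_const_def)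
  have e: "pot_bound b = 2 * (sob_const b * b) + 2 * b + 1" by (simp add: pot_bound_def algebra_simps)
  show "1 \<le> pot_bound b" "2 * b \<le> pot_bound b" "2 * (sob_const b * b) \<le> pot_bound b" using e s assms by auto
  have "b \<le> pot_bound b" "sob_const b * b \<le> pot_bound b" using e s assms by linarith+
  then show "b^2 \<le> (pot_bound b)^2" "(sob_const b * b)^2 \<le> (pot_bound b)^2" using s assms by (simp_all only: power_mono)
qed

text \<open>
  With \<open>\<phi>\<^sub>- = (p, q)\<close>, \<open>s = q / k\<close> and \<open>l = z + 1\<close>, both \<open>(p, e\<^sup>-\<^sup>2\<^sup>i\<^sup>l\<^sup>x (2 i z s - cnj u p))\<close> and
  \<open>(p + i u s / 2, e\<^sup>-\<^sup>2\<^sup>i\<^sup>l\<^sup>x s)\<close> solve Zakharov--Shabat systems in which \<open>z\<close> occurs only through \<open>l\<close>.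
  The first (index \<^const>\<open>True\<close>) yields \<^const>\<open>r_minus\<close>, the second \<^const>\<open>r_plus\<close>.
\<close>

definition sysA :: "bool => (real => complex) => (real => complex) => real => complex" where
  "sysA s U U' = (if s then (%y. - (\<i> / 2) * U y) else (%y. - (1 / 2) * wW U U' y))"

definition sysB :: "bool => (real => complex) => (real => complex) => real => complex" where
  "sysB s U U' = (if s then (%y. \<i> * cnj (wW U U' y)) else (%y. - cnj (U y)))"

definition sysA' :: "bool => (real => complex) => (real => complex) => (real => complex) => real => complex" where
  "sysA' s U U' U'' = (if s then (%y. - (\<i> / 2) * U' y) else (%y. - (1 / 2) * wW' U U' U'' y))"

definition sysB' :: "bool => (real => complex) => (real => complex) => (real => complex) => real => complex" where
  "sysB' s U U' U'' = (if s then (%y. \<i> * cnj (wW' U U' U'' y)) else (%y. - cnj (U' y)))"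

lemma l21_cmod_le:
  assumes f: "l21 f" and g [measurable]: "borel_fun g" and le: "\<And>y. cmod (g y) \<le> cmod (f y)"
  shows "l21 g" "wn g \<le> wn f" "nm1 g \<le> nm1 f"
proof -
  have p: "(1 + y^2) * (cmod (g y))^2 \<le> (1 + y^2) * (cmod (f y))^2" for y by (intro mult_left_mono power_mono le) auto
  have i: "integrable lborel (%y. (1 + y^2) * (cmod (g y))^2)"
    by (rule Bochner_Integration.integrable_bound[OF l21_D(2)[OF f]]) (use p in \<open>auto simp: abs_mult\<close>)
  then show l: "l21 g" by (simp add: l21_def g)
  show "wn g \<le> wn f" unfolding wn_def by (rule integral_mono[OF i l21_D(2)[OF f] p])
  show "nm1 g \<le> nm1 f" unfolding nm1_def by (rule integral_mono) (use l21_nm1(1)[OF f] l21_nm1(1)[OF l] le in auto)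
qed

lemma sys_props:
  assumes U: "sobdat b U U'"
  shows "l21 (sysA s U U')" "l21 (sysB s U U')" "wn (sysA s U U') \<le> (pot_bound b)^2" "wn (sysB s U U') \<le> (pot_bound b)^2"
    and "nm1 U * nm1 (wW U U') \<le> 5 / 6 \<Longrightarrow> zs_ok (pot_bound b) (sysA s U U') (sysB s U U')"
proof -
  have b: "0 \<le> b" and l: "l21 U" "wn U \<le> b^2" using U by (auto simp: sobdat_def)
  note W = wW_bound[OF U]
  note [measurable] = l21_D(1)[OF l(1)] l21_D(1)[OF W(1)]
  have [measurable]: "sysA s U U' \<in> borel_measurable borel" "sysB s U U' \<in> borel_measurable borel" unfolding sysA_def sysB_def by (cases s; simp)+
  let ?A = "if s then U else wW U U'" and ?B = "if s then wW U U' else U"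
  have AB: "l21 ?A" "l21 ?B" "wn ?A \<le> (pot_bound b)^2" "wn ?B \<le> (pot_bound b)^2" using l W pot_bound[OF b] by auto
  have n: "nm1 U \<le> pot_bound b" "nm1 (wW U U') \<le> pot_bound b"
    using l21_nm1_le[OF l(1,2) b] l21_nm1_le[OF W] pot_bound[OF b] b by (auto simp: sob_const_def)
  have leA: "cmod (sysA s U U' y) \<le> cmod (?A y)" and leB: "cmod (sysB s U U' y) \<le> cmod (?B y)" for y by (auto simp: sysA_def sysB_def norm_mult)
  note A = l21_cmod_le[OF AB(1) _ leA] and B = l21_cmod_le[OF AB(2) _ leB]
  show lA: "l21 (sysA s U U')" and lB: "l21 (sysB s U U')" and "wn (sysA s U U') \<le> (pot_bound b)^2" "wn (sysB s U U') \<le> (pot_bound b)^2"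
    using A B AB(3,4) by (auto intro: order_trans)
  assume small: "nm1 U * nm1 (wW U U') \<le> 5 / 6"
  \<comment> \<open>The coefficient in \<open>sysA\<close> has modulus \<open>1 / 2\<close> and
    turns \<open>5 / 6\<close> into \<open>5 / 12\<close>; the one in \<open>sysB\<close> has
    modulus 1.\<close>
  have half: "nm1 (sysA s U U') = 1 / 2 * nm1 ?A" by (auto simp: nm1_def sysA_def norm_mult)
  have "nm1 (sysA s U U') * nm1 (sysB s U U') \<le> 1 / 2 * nm1 ?A * nm1 ?B" unfolding half using B(3) by (intro mult_left_mono) auto
  also have "\<dots> = 1 / 2 * (nm1 U * nm1 (wW U U'))" by simp
  also have "\<dots> \<le> 5 / 12" using small by simp
  finally have "nm1 (sysA s U U') * nm1 (sysB s U U') \<le> 5 / 12" .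
  moreover have "nm1 (sysA s U U') \<le> pot_bound b" "nm1 (sysB s U U') \<le> pot_bound b" using A(3) B(3) n by (auto split: if_splits)
  ultimately show "zs_ok (pot_bound b) (sysA s U U') (sysB s U U')"
    using l21_nm1(1)[OF lA] l21_nm1(1)[OF lB] l21_nm2(1)[OF lA] l21_nm2(1)[OF lB] by (simp add: zs_ok_def)
qed

lemma sys_dist:
  assumes U: "sobdat b U U'" and V: "sobdat b V V'" and UV: "sobdat n (%y. U y - V y) (%y. U' y - V' y)"
  shows "dist_le (sob_const b * n) (sysA s U U') (sysA s V V')" "dist_le (sob_const b * n) (sysB s U U') (sysB s V V')"
proof -
  have n: "0 \<le> n" and l: "l21 (%y. U y - V y)" "wn (%y. U y - V y) \<le> n^2" "l21 U" "l21 V" using U V UV by (auto simp: sobdat_def)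
  have "n^2 \<le> (sob_const b * n)^2" using n by (intro power_mono) (auto simp: sob_const_def algebra_simps)
  then have dU: "dist_le (sob_const b * n) U V" using l by (auto simp: dist_le_def)
  note dW = wW_dist[OF U V UV]
  note [measurable] = l21_D(1)[OF l(3)] l21_D(1)[OF l(4)] l21_D(1)[OF wW_bound(1)[OF U]] l21_D(1)[OF wW_bound(1)[OF V]]
  have gen: "dist_le N f g" if "dist_le N F G" "borel_fun f" "borel_fun g" "\<And>y. cmod (f y - g y) \<le> cmod (F y - G y)" for N f g F G
    using l21_cmod_le(1,2)[of "%y. F y - G y" "%y. f y - g y"] that unfolding dist_le_def by (auto intro: order_trans)
  have c: "cmod (c * x - c * y) = cmod c * cmod (x - y)" for c x y :: complex by (simp only: right_diff_distrib[symmetric] norm_mult)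
  have cc: "cmod (cnj x - cnj y) = cmod (x - y)" "cmod (- cnj x - - cnj y) = cmod (x - y)" for x y
    by (simp_all only: minus_diff_minus norm_minus_cancel complex_cnj_diff[symmetric] complex_mod_cnj)
  show "dist_le (sob_const b * n) (sysA s U U') (sysA s V V')"
  proof (cases s)
    case True
    show ?thesis unfolding sysA_def if_P[OF True] by (rule gen[OF dU]) (measurable, simp only: c, simp add: norm_mult)
  next
    case False
    show ?thesis unfolding sysA_def if_not_P[OF False] by (rule gen[OF dW]) (measurable, simp only: c, simp add: norm_mult)
  qed
  show "dist_le (sob_const b * n) (sysB s U U') (sysB s V V')"
  proof (cases s)
    case True
    show ?thesis unfolding sysB_def if_P[OF True] by (rule gen[OF dW]) (measurable, simp only: c cc, simp)
  next
    case False
    show ?thesis unfolding sysB_def if_not_P[OF False] by (rule gen[OF dU]) (simp, simp, simp only: cc order_refl)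
  qed
qed

section \<open>Jost functions\<close>

lemma borel_measurable_fst_snd:
  fixes f :: "'x => complex \<times> complex"
  assumes "f \<in> borel_measurable M"
  shows "(%x. fst (f x)) \<in> borel_measurable M" "(%x. snd (f x)) \<in> borel_measurable M"
  by (rule borel_measurable_continuous_on[OF _ assms], intro continuous_intros)+

lemma lebesgue_measurable_AE_pair:
  fixes f F :: "real => complex \<times> complex"
  assumes F: "borel_fun F" and ae: "AE x in lborel. f x = F x"
  shows "f \<in> borel_measurable lebesgue"
proof -
  have "AE x in lborel. fst (f x) = fst (F x)" "AE x in lborel. snd (f x) = snd (F x)" using ae by (eventually_elim, simp)+
  from lebesgue_measurable_AE[OF borel_measurable_fst_snd(1)[OF F] this(1)] lebesgue_measurable_AE[OF borel_measurable_fst_snd(2)[OF F] this(2)] have "(%x. (fst (f x), snd (f x))) \<in> borel_measurable lebesgue" by (rule borel_measurable_Pair)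
  then show ?thesis by simp
qed

text \<open>Open rays come from \<open>einterval\<close> in the interval integrals of the Jost
  equations, closed ones from \<open>cumint\<close>; they differ by a null set.\<close>

lemma set_lebesgue_integral_AE:
  fixes f F :: "real => complex \<times> complex"
  assumes F: "borel_fun F" and ae: "AE x in lborel. f x = F x"
  shows "set_integrable lebesgue {..<x} f \<longleftrightarrow> set_integrable lborel {..x} F" "(LINT y:{..<x}|lebesgue. f y) = cumint F x"
proof -
  have "AE y in lborel. y \<noteq> x" by (rule AE_lborel_singleton)
  with ae have ae': "AE y in lborel. indicator {..<x} y *\<^sub>R f y = indicator {..x} y *\<^sub>R F y"
    by eventually_elim (auto simp: indicator_def)
  have F': "borel_fun (%y. indicator {..x} y *\<^sub>R F y)" using F by (intro borel_measurable_scaleR borel_measurable_indicator) auto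
  note I = lebesgue_integral_AE[OF lebesgue_measurable_AE_pair[OF F' ae'] F' ae']
  show "set_integrable lebesgue {..<x} f \<longleftrightarrow> set_integrable lborel {..x} F" "(LINT y:{..<x}|lebesgue. f y) = cumint F x"
    using I unfolding set_integrable_def set_lebesgue_integral_def cumint_def by auto
qed

lemma lebesgue_borel_rep_pair:
  fixes f :: "real => complex \<times> complex"
  assumes f: "\<And>x. set_integrable lebesgue {..<x} f"
  obtains F where "borel_fun F" "AE x in lborel. f x = F x"
proof -
  have m: "f \<in> borel_measurable lebesgue"
  proof (rule borel_measurable_LIMSEQ_metric)
    show "(%x. indicator {..<real n} x *\<^sub>R f x) \<in> borel_measurable lebesgue" for n
      using f[of "real n"] unfolding set_integrable_def by (rule borel_measurable_integrable)
    show "(%n. indicator {..<real n} x *\<^sub>R f x) \<longlonglongrightarrow> f x" for x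
    proof (rule tendsto_eventually)
      obtain N where N: "x < real N" using reals_Archimedean2 by blast
      show "eventually (%n. indicator {..<real n} x *\<^sub>R f x = f x) sequentially"
        using eventually_ge_at_top[of N] by eventually_elim (use N in \<open>auto simp: indicator_def\<close>)
    qed
  qed
  have "(%x. fst (f x)) \<in> borel_measurable lebesgue" "(%x. snd (f x)) \<in> borel_measurable lebesgue"
    by (rule borel_measurable_fst_snd[OF m])+
  then obtain p q where pq: "borel_fun p" "AE x in lborel. fst (f x) = p x" "borel_fun q" "AE x in lborel. snd (f x) = q x"
    by (metis lebesgue_borel_rep)
  show ?thesis
  proof (rule that[of "%x. (p x, q x)"])
    show "borel_fun (%x. (p x, q x))" using pq by simp
    show "AE x in lborel. f x = (p x, q x)" using pq(2,4) by eventually_elim (simp add: prod_eq_iff)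
  qed
qed

text \<open>
  Conversion between the Lebesgue integral equation for a merely pointwise given potential and the
  Borel equation for a representative. Solutions of the former are not assumed measurable.
\<close>

lemma lebesgue_volterra:
  fixes ku kU :: "real => complex \<times> complex => complex \<times> complex"
  assumes \<kappa>: "integrable lborel \<kappa>" "\<And>y. 0 \<le> \<kappa> y"
    and k: "\<And>y a b. norm (kU y a - kU y b) \<le> \<kappa> y * norm (a - b)" "\<And>y. kU y 0 = 0"
    and km: "jointly_borel kU"
    and ae: "AE y in lborel. \<forall>v. ku y v = kU y v"
  obtains F D where "borel_fun F" "\<And>x. norm (F x) \<le> D" "integrable lborel (%y. kU y (F y))"
    "\<And>x. F x = c + cumint (%y. kU y (F y)) x"
    "\<And>h. (\<forall>x. set_integrable lebesgue {..<x} (%y. ku y (h y)) \<and> h x = c + (LINT y:{..<x}|lebesgue. ku y (h y))) \<longleftrightarrow> h = F"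
proof -
  have kf: "(%y. kU (g y) (f y)) \<in> borel_measurable M" if "f \<in> borel_measurable M" "g \<in> borel_measurable M" for f g M
    using measurable_compose[OF measurable_Pair[OF that(2) that(1)] km] by simp
  have km': "(%(l, y). kU y (f l y)) \<in> borel_measurable (borel \<Otimes>\<^sub>M borel)"
    if f: "jointly_borel f" for f :: "real => real => complex \<times> complex"
    using kf[OF f measurable_snd] by (simp only: case_prod_beta')
  have k': "norm (kU y a - kU y b) \<le> \<kappa> y * norm (a - b)" "kU y 0 = 0" for l :: real and y a b by (rule k)+
  \<comment> \<open>\<open>volterra_exists\<close> solves for all values of a parameter; here the
    parameter is a dummy real number, set to 0 below.\<close>
  obtain F' where F': "(%(l::real, y). F' l y) \<in> borel_measurable (borel \<Otimes>\<^sub>M borel)"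
    "\<And>l x. F' l x = c + cumint (%y. kU y (F' l y)) x" "\<And>l x. norm (F' l x) \<le> norm c * exp (LBINT y. \<kappa> y)"
    "\<And>l. integrable lborel (%y. kU y (F' l y))"
  proof (rule volterra_exists[where k="%l::real. kU" and \<kappa>=\<kappa> and M=borel and c=c, OF \<kappa> k' km' space_borel])
    fix F
    assume F: "(%(l::real, y). F l y) \<in> borel_measurable (borel \<Otimes>\<^sub>M borel)"
      "\<And>l x. F l x = c + cumint (%y. kU y (F l y)) x" "\<And>l x. norm (F l x) \<le> norm c * exp (LBINT y. \<kappa> y)"
      "\<And>l. integrable lborel (%y. kU y (F l y))"
    show thesis by (rule that[of F, OF F])
  qed
  define F where "F = F' 0"
  have Fm: "borel_fun F"
    using measurable_compose[OF measurable_Pair1' F'(1), of 0] by (simp add: F_def)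
  have F: "\<And>x. F x = c + cumint (%y. kU y (F y)) x" "integrable lborel (%y. kU y (F y))"
    unfolding F_def by (rule F'(2), rule F'(4))
  have aeh: "AE y in lborel. ku y (h y) = kU y (h y)" for h using ae by eventually_elim blast
  have kFm: "borel_fun (%y. kU y (F y))" by (rule kf[OF Fm]) simp
  have "(\<forall>x. set_integrable lebesgue {..<x} (%y. ku y (h y)) \<and> h x = c + (LINT y:{..<x}|lebesgue. ku y (h y))) \<longleftrightarrow> h = F" for h
  proof
    assume h: "\<forall>x. set_integrable lebesgue {..<x} (%y. ku y (h y)) \<and> h x = c + (LINT y:{..<x}|lebesgue. ku y (h y))"
    then have h1: "\<And>x. set_integrable lebesgue {..<x} (%y. ku y (h y))" and h2: "\<And>x. h x = c + (LINT y:{..<x}|lebesgue. ku y (h y))" by blast+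
    \<comment> \<open>Measurability of \<open>h\<close> is extracted from the equation: the
      integrand has a Borel representative \<open>G\<close>, and \<open>h\<close> is
      \<open>c\<close> plus the indefinite integral of \<open>G\<close>.\<close>
    obtain G where G: "borel_fun G" "AE x in lborel. ku x (h x) = G x" by (rule lebesgue_borel_rep_pair[OF h1])
    have "h = (%x. c + cumint G x)" by (rule ext, subst h2) (simp only: set_lebesgue_integral_AE(2)[OF G])
    then have hm: "borel_fun h" using borel_measurable_add[OF borel_measurable_const cumint_measurable1[OF G(1)]] by simp
    have kh: "borel_fun (%y. kU y (h y))" by (rule kf[OF hm]) simp
    note S = set_lebesgue_integral_AE[OF kh aeh]
    show "h = F"
    proof
      fix z
      show "h z = F z"
      proof (rule volterra_unique[OF \<kappa>(1) k(1)])
        show "h x = c + cumint (%y. kU y (h y)) x" for x using h2[of x] unfolding S(2) .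
        show "set_integrable lborel {..z} (%y. kU y (h y))" using h1 S(1) by blast
        show "set_integrable lborel {..z} (%y. kU y (F y))" by (rule set_integrable_lborel[OF F(2)]) simp
      qed (rule F(1))
    qed
  next
    assume h: "h = F"
    note S = set_lebesgue_integral_AE[OF kFm aeh]
    show "\<forall>x. set_integrable lebesgue {..<x} (%y. ku y (h y)) \<and> h x = c + (LINT y:{..<x}|lebesgue. ku y (h y))"
      unfolding h S by (intro allI conjI F(1) set_integrable_lborel[OF F(2)]) simp
  qed
  then show ?thesis by (rule that[OF Fm F'(3)[of 0, folded F_def] F(2) F(1)])
qed

lemma set_integral_lebesgue_reflect:
  fixes f :: "real => complex \<times> complex"
  shows "set_integrable lebesgue {..<- x} (%y. f (- y)) \<longleftrightarrow> set_integrable lebesgue {x<..} f"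
    "(LINT y:{..<- x}|lebesgue. f (- y)) = (LINT y:{x<..}|lebesgue. f y)"
proof -
  have e: "(%y. indicator {..<- x} y *\<^sub>R f (- y)) = (%y. (%y. indicator {x<..} y *\<^sub>R f y) (0 + (-1) * y))"
    by (auto simp: indicator_def)
  show "set_integrable lebesgue {..<- x} (%y. f (- y)) \<longleftrightarrow> set_integrable lebesgue {x<..} f"
    unfolding set_integrable_def e by (rule lebesgue_integrable_real_affine_iff) simp
  show "(LINT y:{..<- x}|lebesgue. f (- y)) = (LINT y:{x<..}|lebesgue. f y)"
    unfolding set_lebesgue_integral_def e
    by (subst lebesgue_integral_real_affine[of "-1" "%y. indicator {x<..} y *\<^sub>R f y" 0]) simp_all
qed

text \<open>The reflection of y turns integration from plus infinity into integration from minus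
  infinity, with the sign of the oriented integral absorbed into the kernel.\<close>

lemma lebesgue_volterra_top:
  fixes ku kU :: "real => complex \<times> complex => complex \<times> complex"
  assumes \<kappa>: "integrable lborel \<kappa>" "\<And>y. 0 \<le> \<kappa> y"
    and k: "\<And>y a b. norm (kU y a - kU y b) \<le> \<kappa> y * norm (a - b)" "\<And>y. kU y 0 = 0"
    and km: "jointly_borel kU"
    and ae: "AE y in lborel. \<forall>v. ku y v = kU y v"
  obtains F where "integrable lborel (%y. - kU (- y) (F y))" "\<And>x. F x = c + cumint (%y. - kU (- y) (F y)) x"
    "\<And>h. (\<forall>x. set_integrable lebesgue {x<..} (%y. ku y (h y)) \<and> h x = c - (LINT y:{x<..}|lebesgue. ku y (h y))) \<longleftrightarrow> h = (%x. F (- x))"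
proof -
  let ?\<kappa> = "%y. \<kappa> (- y)" and ?kU = "%y v. - kU (- y) v" and ?ku = "%y v. - ku (- y) v"
  have 1: "integrable lborel ?\<kappa>" using lborel_integrable_real_affine[OF \<kappa>(1), of "-1" 0] by simp
  have 2: "0 \<le> ?\<kappa> y" for y by (rule \<kappa>(2))
  have 3: "norm (?kU y a - ?kU y b) \<le> ?\<kappa> y * norm (a - b)" for y a b
    using k(1)[of "- y" b a] by (simp add: norm_minus_commute)
  have 4: "?kU y 0 = 0" for y using k(2) by simp
  have "(%p. (- fst p, snd p)) \<in> (borel :: real measure) \<Otimes>\<^sub>M (borel :: (complex \<times> complex) measure) \<rightarrow>\<^sub>M borel \<Otimes>\<^sub>M borel"
    by (intro measurable_Pair borel_measurable_uminus measurable_fst measurable_snd)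
  from borel_measurable_uminus[OF measurable_compose[OF this km]]
  have 5: "(%(y, v). ?kU y v) \<in> borel_measurable (borel \<Otimes>\<^sub>M borel)" by (simp only: case_prod_beta' fst_conv snd_conv)
  have "AE y in distr lborel borel uminus. \<forall>v. ku y v = kU y v" using ae by (simp only: lborel_distr_uminus)
  then have "AE y in lborel. \<forall>v. ku (- y) v = kU (- y) v" by (rule AE_distrD[rotated]) simp
  then have 6: "AE y in lborel. \<forall>v. ?ku y v = ?kU y v" by eventually_elim simp
  obtain F D where F: "borel_fun F" "\<And>x. norm (F x) \<le> D" "integrable lborel (%y. - kU (- y) (F y))"
    "\<And>x. F x = c + cumint (%y. - kU (- y) (F y)) x"
    "\<And>h. (\<forall>x. set_integrable lebesgue {..<x} (%y. - ku (- y) (h y)) \<and> h x = c + (LINT y:{..<x}|lebesgue. - ku (- y) (h y))) \<longleftrightarrow> h = F"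
  proof (rule lebesgue_volterra[where c=c, OF 1 2 3 4 5 6])
    fix F D
    assume F: "borel_fun F" "\<And>x. norm (F x) \<le> D" "integrable lborel (%y. ?kU y (F y))"
      "\<And>x. F x = c + cumint (%y. ?kU y (F y)) x"
      "\<And>h. (\<forall>x. set_integrable lebesgue {..<x} (%y. ?ku y (h y)) \<and> h x = c + (LINT y:{..<x}|lebesgue. ?ku y (h y))) \<longleftrightarrow> h = F"
    show thesis by (rule that[of F D, OF F])
  qed
  have "(\<forall>x. set_integrable lebesgue {x<..} (%y. ku y (h y)) \<and> h x = c - (LINT y:{x<..}|lebesgue. ku y (h y))) \<longleftrightarrow> h = (%x. F (- x))" for h
  proof -
    have i: "set_integrable lebesgue {..<x} (%y. - ku (- y) (h (- y))) \<longleftrightarrow> set_integrable lebesgue {- x<..} (%y. ku y (h y))" for x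
      using set_integral_lebesgue_reflect(1)[of "- x" "%y. ku y (h y)"] by (simp add: set_integrable_def)
    have j: "(LINT y:{..<x}|lebesgue. - ku (- y) (h (- y))) = - (LINT y:{- x<..}|lebesgue. ku y (h y))" for x
      using set_integral_lebesgue_reflect(2)[of "- x" "%y. ku y (h y)"] by (simp add: set_lebesgue_integral_def)
    have "(\<forall>x. set_integrable lebesgue {x<..} (%y. ku y (h y)) \<and> h x = c - (LINT y:{x<..}|lebesgue. ku y (h y))) \<longleftrightarrow>
      (\<forall>x. set_integrable lebesgue {- x<..} (%y. ku y (h y)) \<and> h (- x) = c - (LINT y:{- x<..}|lebesgue. ku y (h y)))" (is "(\<forall>x. ?p x) \<longleftrightarrow> (\<forall>x. ?p (- x))")
    proof
      assume a: "\<forall>x. ?p (- x)"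
      show "\<forall>x. ?p x"
      proof
        fix x show "?p x" using spec[OF a, of "- x"] unfolding minus_minus .
      qed
    qed (rule allI, erule allE)
    also have "\<dots> \<longleftrightarrow> (%x. h (- x)) = F" using F(5)[of "%x. h (- x)"] unfolding i j by (simp only: diff_conv_add_uminus)
    also have "\<dots> \<longleftrightarrow> h = (%x. F (- x))" unfolding fun_eq_iff by (metis minus_minus)
    finally show ?thesis .
  qed
  then show ?thesis by (rule that[OF F(3,4)])
qed

text \<open>The coefficient matrix in the interaction picture: the diagonal free evolution is
  conjugated away, so the kernel does not depend on the endpoint x and the phases sit off the
  diagonal. Both normalizations of the Jost functions lead to this kernel.\<close>

definition jk :: "(real => complex) => complex => real => real => complex \<times> complex => complex \<times> complex" where
  "jk u k l y v = (\<i> / 2 * of_real ((cmod (u y))^2) * fst v + k * u y * ee (l * y) * snd v,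
     - k * cnj (u y) * ee (- (l * y)) * fst v - \<i> / 2 * of_real ((cmod (u y))^2) * snd v)"

text \<open>The diagonal matrix at \<open>x - y\<close> factorizes, so multiplication by its value
  at \<open>- x\<close> leaves the value at \<open>- y\<close>, which is absorbed into the unknown
  \<open>h f\<close>. The exponentials \<open>d1\<close>, \<open>d2\<close> are abstract to cover
  both Jost normalizations; the assumptions on \<open>c\<close> say that the free evolution fixes
  the inhomogeneity.\<close>

lemma volterra_solution_transform:
  assumes d: "\<And>s t. d1 (s + t) = d1 s * d1 t" "\<And>s t. d2 (s + t) = d2 s * d2 t" "d1 0 = 1" "d2 0 = 1"
    and e: "\<And>y. d1 (- y) * d2 y = ee (l * y)" "\<And>y. d2 (- y) * d1 y = ee (- (l * y))"
    and c: "\<And>x. c $ 1 * d1 x = c $ 1" "\<And>x. c $ 2 * d2 x = c $ 2"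
  defines "h f \<equiv> (%x. (d1 (- x) * f x $ 1, d2 (- x) * f x $ 2))"
  shows "volterra_solution (-\<infinity>) c (%t. mat22 (d1 t) 0 0 (d2 t)) (Q u k) f \<longleftrightarrow>
      (\<forall>x. set_integrable lebesgue {..<x} (%y. jk u k l y (h f y)) \<and> h f x = (c $ 1, c $ 2) + (LINT y:{..<x}|lebesgue. jk u k l y (h f y)))"
    and "volterra_solution \<infinity> c (%t. mat22 (d1 t) 0 0 (d2 t)) (Q u k) f \<longleftrightarrow>
      (\<forall>x. set_integrable lebesgue {x<..} (%y. jk u k l y (h f y)) \<and> h f x = (c $ 1, c $ 2) - (LINT y:{x<..}|lebesgue. jk u k l y (h f y)))"
proof -
  have di: "d1 (- x) * d1 x = 1" "d2 (- x) * d2 x = 1" for x using d(1)[of "- x" x] d(2)[of "- x" x] d(3,4) by simp_all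
  define R where "R x v = (d1 (- x) * v $ 1, d2 (- x) * v $ 2)" for x and v :: "complex^2"
  define R' where "R' x w = (vector [d1 x * fst w, d2 x * snd w] :: complex^2)" for x and w :: "complex \<times> complex"
  have R: "bounded_linear (R x)" "bounded_linear (R' x)" for x
    unfolding linear_conv_bounded_linear[symmetric] R_def R'_def
    by (rule linearI; simp add: vec_eq_iff forall_2 algebra_simps)+
  have inv: "R' x (R x v) = v" for x v
  proof -
    have "d1 x * (d1 (- x) * a) = (d1 (- x) * d1 x) * a" "d2 x * (d2 (- x) * a) = (d2 (- x) * d2 x) * a" for a by (simp_all only: mult_ac)
    then show ?thesis by (simp add: R_def R'_def vec_eq_iff forall_2 di)
  qed
  have inj: "R x v = R x w \<longleftrightarrow> v = w" for x v w by (metis inv)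
  have Rk: "R x (mat22 (d1 (x - y)) 0 0 (d2 (x - y)) *v (Q u k y *v f y)) = jk u k l y (h f y)" for x y
  proof -
    have 1: "d1 (- x) * d1 (x - y) = d1 (- y)" "d2 (- x) * d2 (x - y) = d2 (- y)" using d(1)[of "- x" "x - y"] d(2)[of "- x" "x - y"] by simp_all
    have 2: "ee (l * y) * (d2 (- y) * z) = d1 (- y) * z" "ee (- (l * y)) * (d1 (- y) * z) = d2 (- y) * z" for z
    proof -
      have "(d1 (- y) * d2 y) * (d2 (- y) * z) = (d2 (- y) * d2 y) * (d1 (- y) * z)" "(d2 (- y) * d1 y) * (d1 (- y) * z) = (d1 (- y) * d1 y) * (d2 (- y) * z)"
        by (simp_all only: mult_ac)
      then show "ee (l * y) * (d2 (- y) * z) = d1 (- y) * z" "ee (- (l * y)) * (d1 (- y) * z) = d2 (- y) * z"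
        unfolding e di by simp_all
    qed
    have "R x (mat22 (d1 (x - y)) 0 0 (d2 (x - y)) *v (Q u k y *v f y)) =
      ((d1 (- x) * d1 (x - y)) * (\<i> / 2 * of_real ((cmod (u y))^2) * f y $ 1 + k * u y * f y $ 2),
       (d2 (- x) * d2 (x - y)) * (- k * cnj (u y) * f y $ 1 - \<i> / 2 * of_real ((cmod (u y))^2) * f y $ 2))"
      by (simp add: R_def matrix_vector_mult_def sum_2 mat22_def Q_def mult.assoc)
    also have "\<dots> = jk u k l y (h f y)" unfolding 1 jk_def h_def fst_conv snd_conv
      by (simp only: mult.assoc 2) (simp add: algebra_simps)
    finally show ?thesis .
  qed
  have i: "set_integrable lebesgue S (%y. mat22 (d1 (x - y)) 0 0 (d2 (x - y)) *v (Q u k y *v f y)) \<longleftrightarrow> set_integrable lebesgue S (%y. jk u k l y (h f y))" for x S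
  proof -
    let ?v = "%y. mat22 (d1 (x - y)) 0 0 (d2 (x - y)) *v (Q u k y *v f y)"
    have s: "indicator S y *\<^sub>R jk u k l y (h f y) = R x (indicator S y *\<^sub>R ?v y)" for y
      unfolding Rk[symmetric, of y x] by (simp add: linear_scale[OF bounded_linear.linear[OF R(1)]])
    show ?thesis unfolding set_integrable_def s
    proof
      assume "integrable lebesgue (%y. R x (indicator S y *\<^sub>R ?v y))"
      from integrable_bounded_linear[OF R(2)[of x] this] show "integrable lebesgue (%y. indicator S y *\<^sub>R ?v y)" unfolding inv .
    qed (rule integrable_bounded_linear[OF R(1)])
  qed
  have j: "R x (LINT y:S|lebesgue. mat22 (d1 (x - y)) 0 0 (d2 (x - y)) *v (Q u k y *v f y)) = (LINT y:S|lebesgue. jk u k l y (h f y))"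
    if "set_integrable lebesgue S (%y. jk u k l y (h f y))" for x S
  proof -
    let ?v = "%y. mat22 (d1 (x - y)) 0 0 (d2 (x - y)) *v (Q u k y *v f y)"
    have "set_integrable lebesgue S ?v" using that i by blast
    then have "R x (LINT y:S|lebesgue. ?v y) = (LINT y|lebesgue. R x (indicator S y *\<^sub>R ?v y))"
      unfolding set_integrable_def set_lebesgue_integral_def by (rule integral_bounded_linear[OF R(1), symmetric])
    also have "\<dots> = (LINT y:S|lebesgue. jk u k l y (h f y))"
      unfolding set_lebesgue_integral_def Rk[symmetric, of _ x] by (simp add: linear_scale[OF bounded_linear.linear[OF R(1)]])
    finally show ?thesis .
  qed
  have Rc: "R x c = (c $ 1, c $ 2)" for x using c by (simp add: R_def mult.commute)
  have hf: "h f x = R x (f x)" for x by (simp add: h_def R_def)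
  have "f x = c + I \<longleftrightarrow> h f x = (c $ 1, c $ 2) + R x I" "f x = c - I \<longleftrightarrow> h f x = (c $ 1, c $ 2) - R x I" for x I
    unfolding hf Rc[symmetric, of x] linear_add[OF bounded_linear.linear[OF R(1)], symmetric] linear_diff[OF bounded_linear.linear[OF R(1)], symmetric] inj by simp_all
  note S = this
  have einf: "einterval (-\<infinity>) (ereal x) = {..<x}" "einterval (ereal x) \<infinity> = {x<..}" for x by (auto simp: einterval_def)
  show "volterra_solution (-\<infinity>) c (%t. mat22 (d1 t) 0 0 (d2 t)) (Q u k) f \<longleftrightarrow>
      (\<forall>x. set_integrable lebesgue {..<x} (%y. jk u k l y (h f y)) \<and> h f x = (c $ 1, c $ 2) + (LINT y:{..<x}|lebesgue. jk u k l y (h f y)))"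
    unfolding volterra_solution_def
  proof (rule iff_allI, rule conj_cong)
    fix x
    show "interval_lebesgue_integrable lebesgue (-\<infinity>) (ereal x) (%y. mat22 (d1 (x - y)) 0 0 (d2 (x - y)) *v (Q u k y *v f y)) \<longleftrightarrow> set_integrable lebesgue {..<x} (%y. jk u k l y (h f y))"
      by (simp only: interval_lebesgue_integrable_def einf i) simp
    assume a: "set_integrable lebesgue {..<x} (%y. jk u k l y (h f y))"
    show "f x = c + interval_lebesgue_integral lebesgue (-\<infinity>) (ereal x) (%y. mat22 (d1 (x - y)) 0 0 (d2 (x - y)) *v (Q u k y *v f y)) \<longleftrightarrow> h f x = (c $ 1, c $ 2) + (LINT y:{..<x}|lebesgue. jk u k l y (h f y))"
      unfolding S(1) j[OF a, of x, symmetric] by (simp only: interval_lebesgue_integral_def einf) simp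
  qed
  show "volterra_solution \<infinity> c (%t. mat22 (d1 t) 0 0 (d2 t)) (Q u k) f \<longleftrightarrow>
      (\<forall>x. set_integrable lebesgue {x<..} (%y. jk u k l y (h f y)) \<and> h f x = (c $ 1, c $ 2) - (LINT y:{x<..}|lebesgue. jk u k l y (h f y)))"
    unfolding volterra_solution_def
  proof (rule iff_allI, rule conj_cong)
    fix x
    show "interval_lebesgue_integrable lebesgue \<infinity> (ereal x) (%y. mat22 (d1 (x - y)) 0 0 (d2 (x - y)) *v (Q u k y *v f y)) \<longleftrightarrow> set_integrable lebesgue {x<..} (%y. jk u k l y (h f y))"
      by (simp only: interval_lebesgue_integrable_def einf i) simp
    assume a: "set_integrable lebesgue {x<..} (%y. jk u k l y (h f y))"
    have "interval_lebesgue_integral lebesgue \<infinity> (ereal x) (%y. mat22 (d1 (x - y)) 0 0 (d2 (x - y)) *v (Q u k y *v f y)) = - (LINT y:{x<..}|lebesgue. mat22 (d1 (x - y)) 0 0 (d2 (x - y)) *v (Q u k y *v f y))"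
      by (simp only: interval_lebesgue_integral_def einf) simp
    then show "f x = c + interval_lebesgue_integral lebesgue \<infinity> (ereal x) (%y. mat22 (d1 (x - y)) 0 0 (d2 (x - y)) *v (Q u k y *v f y)) \<longleftrightarrow> h f x = (c $ 1, c $ 2) - (LINT y:{x<..}|lebesgue. jk u k l y (h f y))"
      using S(2)[of x] unfolding j[OF a, of x, symmetric] by (simp only: diff_conv_add_uminus)
  qed
qed

lemma cumint_reflect:
  fixes g :: "real => 'a::{banach, second_countable_topology}"
  assumes g: "integrable lborel g"
  shows "integrable lborel (%y. g (- y))" "cumint (%y. g (- y)) x = (LBINT y. g y) - cumint g (- x)"
proof -
  have [measurable]: "borel_fun g" using g by simp
  show "integrable lborel (%y. g (- y))" using lborel_integrable_real_affine[OF g, of "-1" 0] by simp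
  have s: "integrable lborel (%y. indicator {- x..} y *\<^sub>R g y)" "integrable lborel (%y. indicator {..- x} y *\<^sub>R g y)"
    using g by (auto intro!: integrable_mult_indicator)
  have "cumint (%y. g (- y)) x = (LBINT y. indicator {- x..} y *\<^sub>R g y)"
    unfolding cumint_def set_lebesgue_integral_def
    by (subst lborel_integral_real_affine[of "-1" _ 0]) (auto intro!: Bochner_Integration.integral_cong simp: indicator_def)
  moreover have "(LBINT y. indicator {- x..} y *\<^sub>R g y) + cumint g (- x) = (LBINT y. indicator {- x..} y *\<^sub>R g y + indicator {..- x} y *\<^sub>R g y)"
    unfolding cumint_def set_lebesgue_integral_def by (rule Bochner_Integration.integral_add[symmetric, OF s])
  moreover have "(LBINT y. indicator {- x..} y *\<^sub>R g y + indicator {..- x} y *\<^sub>R g y) = (LBINT y. g y)"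
  proof (rule integral_cong_AE)
    show "AE y in lborel. indicator {- x..} y *\<^sub>R g y + indicator {..- x} y *\<^sub>R g y = g y"
      using AE_lborel_singleton[of "- x"] by eventually_elim (auto simp: indicator_def)
  qed measurable
  ultimately show "cumint (%y. g (- y)) x = (LBINT y. g y) - cumint g (- x)" by (simp add: algebra_simps)
qed

lemma cumint_uminus: "cumint (%y. - g y) x = - cumint g x"
  by (simp add: cumint_def set_lebesgue_integral_def)

lemma jk_linear:
  "jk u k l y v - jk u k l y w = jk u k l y (v - w)"
  "jk u k l y (a * fst v + b * fst w, a * snd v + b * snd w) =
     (a * fst (jk u k l y v) + b * fst (jk u k l y w), a * snd (jk u k l y v) + b * snd (jk u k l y w))"
  "jk u k l y 0 = 0"
  by (simp_all add: jk_def zero_prod_def algebra_simps del: times_divide_eq_left times_divide_eq_right)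

lemma jk_bound: "norm (jk u k l y v) \<le> ((cmod (u y))^2 + 2 * cmod k * cmod (u y)) * norm v"
proof -
  have n: "cmod (fst v) \<le> norm v" "cmod (snd v) \<le> norm v" by (metis norm_fst_le prod.collapse, metis norm_snd_le prod.collapse)
  have "norm (jk u k l y v) \<le> cmod (fst (jk u k l y v)) + cmod (snd (jk u k l y v))" by (metis norm_Pair_le prod.collapse)
  also have "\<dots> \<le> ((cmod (u y))^2 / 2 * cmod (fst v) + cmod k * cmod (u y) * cmod (snd v)) + (cmod k * cmod (u y) * cmod (fst v) + (cmod (u y))^2 / 2 * cmod (snd v))"
  proof (rule add_mono)
    show "cmod (fst (jk u k l y v)) \<le> (cmod (u y))^2 / 2 * cmod (fst v) + cmod k * cmod (u y) * cmod (snd v)"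
      unfolding jk_def fst_conv by (rule order_trans[OF norm_triangle_ineq]) (simp add: norm_mult norm_divide norm_power)
    show "cmod (snd (jk u k l y v)) \<le> cmod k * cmod (u y) * cmod (fst v) + (cmod (u y))^2 / 2 * cmod (snd v)"
      unfolding jk_def snd_conv by (rule order_trans[OF norm_triangle_ineq4]) (simp add: norm_mult norm_divide norm_power)
  qed
  also have "\<dots> \<le> ((cmod (u y))^2 / 2 * norm v + cmod k * cmod (u y) * norm v) + (cmod k * cmod (u y) * norm v + (cmod (u y))^2 / 2 * norm v)"
    by (intro add_mono mult_left_mono n) auto
  finally show ?thesis by (simp add: algebra_simps)
qed

lemma phase_ee: "k^2 = of_real z \<Longrightarrow> phase k x = ee ((z + 1) * x)"
  by (simp add: phase_def ee_def cis_conv_exp mult_ac distrib_left)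

text \<open>The change of unknown is a bijection, so unique solvability of the transformed equation
  gives meaning to the \<open>THE\<close> in the definitions of the Jost functions.\<close>

lemma ex1_transform:
  fixes d1 d2 :: "real => complex"
  assumes "\<And>x. d1 (- x) * d1 x = 1" "\<And>x. d2 (- x) * d2 x = 1"
  shows "\<exists>!f :: real => complex^2. (%x. (d1 (- x) * f x $ 1, d2 (- x) * f x $ 2)) = F"
proof (rule ex1I[of _ "%x. vector [d1 x * fst (F x), d2 x * snd (F x)]"])
  show "(%x. (d1 (- x) * (vector [d1 x * fst (F x), d2 x * snd (F x)] :: complex^2) $ 1, d2 (- x) * (vector [d1 x * fst (F x), d2 x * snd (F x)] :: complex^2) $ 2)) = F"
    by (simp add: mult.assoc[symmetric] assms)
  fix f :: "real => complex^2" assume f: "(%x. (d1 (- x) * f x $ 1, d2 (- x) * f x $ 2)) = F"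
  have "d1 x * (d1 (- x) * a) = (d1 (- x) * d1 x) * a" "d2 x * (d2 (- x) * a) = (d2 (- x) * d2 x) * a" for x a by (simp_all only: mult_ac)
  then show "f = (%x. vector [d1 x * fst (F x), d2 x * snd (F x)])"
    unfolding f[symmetric] by (simp add: fun_eq_iff vec_eq_iff forall_2 assms)
qed

text \<open>In the interaction picture the solution \<open>F\<close> normalized at minus infinity
  has a limit \<open>L\<close> at plus infinity, where the two solutions normalized there tend to
  the unit vectors. Comparing limits forces the scattering coefficients to be the components of
  \<open>L\<close>; that these work follows from uniqueness for the equation started at plus
  infinity.\<close>

lemma scattering_system:
  assumes aeU: "AE x in lborel. u x = U x" and Um: "borel_fun U"
    and Ui: "integrable lborel U" "sq_integrable U" and kz: "k^2 = of_real z" and l: "l = z + 1"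
  obtains p \<sigma> D where "borel_fun p" "borel_fun \<sigma>" "\<And>x. cmod (p x) \<le> D" "\<And>x. cmod (\<sigma> x) \<le> D"
    "integrable lborel (%y. \<i> / 2 * of_real ((cmod (U y))^2) * p y + k * U y * ee (l * y) * \<sigma> y)"
    "integrable lborel (%y. - k * cnj (U y) * ee (- (l * y)) * p y - \<i> / 2 * of_real ((cmod (U y))^2) * \<sigma> y)"
    "\<And>x. p x = 1 + cumint (%y. \<i> / 2 * of_real ((cmod (U y))^2) * p y + k * U y * ee (l * y) * \<sigma> y) x"
    "\<And>x. \<sigma> x = cumint (%y. - k * cnj (U y) * ee (- (l * y)) * p y - \<i> / 2 * of_real ((cmod (U y))^2) * \<sigma> y) x"
    "(p \<longlongrightarrow> coeff_a u k) at_top" "(\<sigma> \<longlongrightarrow> coeff_b u k) at_top"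
proof -
  let ?\<kappa> = "%y. (cmod (U y))^2 + 2 * cmod k * cmod (U y)"
  have \<kappa>: "integrable lborel ?\<kappa>" "\<And>y. 0 \<le> ?\<kappa> y" using Ui by auto
  have K: "norm (jk U k l y a - jk U k l y b) \<le> ?\<kappa> y * norm (a - b)" "jk U k l y 0 = 0" for y a b
    unfolding jk_linear by (rule jk_bound, rule refl)
  have km: "jointly_borel (jk U k l)"
  proof -
    have [measurable]: "(%p :: real \<times> complex \<times> complex. fst (snd p)) \<in> borel_measurable (borel \<Otimes>\<^sub>M borel)"
      "(%p :: real \<times> complex \<times> complex. snd (snd p)) \<in> borel_measurable (borel \<Otimes>\<^sub>M borel)"
      by (rule borel_measurable_fst_snd[OF measurable_snd])+
    note [measurable] = Um
    show ?thesis unfolding jk_def case_prod_beta' by (intro borel_measurable_Pair) measurable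
  qed
  have ae: "AE y in lborel. \<forall>v. jk u k l y v = jk U k l y v" using aeU by eventually_elim (simp add: jk_def)
  obtain F D where F: "borel_fun F" "\<And>x. norm (F x) \<le> D" "integrable lborel (%y. jk U k l y (F y))"
    "\<And>x. F x = (1, 0) + cumint (%y. jk U k l y (F y)) x"
    "\<And>h. (\<forall>x. set_integrable lebesgue {..<x} (%y. jk u k l y (h y)) \<and> h x = (1, 0) + (LINT y:{..<x}|lebesgue. jk u k l y (h y))) \<longleftrightarrow> h = F"
    by (rule lebesgue_volterra[where c="(1, 0)", OF \<kappa> K km ae]) blast
  have top: "\<exists>G. integrable lborel (%y. - jk U k l (- y) (G y)) \<and> (\<forall>x. G x = c + cumint (%y. - jk U k l (- y) (G y)) x) \<and>
    (\<forall>h. (\<forall>x. set_integrable lebesgue {x<..} (%y. jk u k l y (h y)) \<and> h x = c - (LINT y:{x<..}|lebesgue. jk u k l y (h y))) \<longleftrightarrow> h = (%x. G (- x)))" for c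
    by (rule lebesgue_volterra_top[where c=c, OF \<kappa> K km ae]) blast
  obtain G1 where G1: "integrable lborel (%y. - jk U k l (- y) (G1 y))" "\<And>x. G1 x = (1, 0) + cumint (%y. - jk U k l (- y) (G1 y)) x"
    "\<And>h. (\<forall>x. set_integrable lebesgue {x<..} (%y. jk u k l y (h y)) \<and> h x = (1, 0) - (LINT y:{x<..}|lebesgue. jk u k l y (h y))) \<longleftrightarrow> h = (%x. G1 (- x))"
    using top[of "(1, 0)"] by blast
  obtain G2 where G2: "integrable lborel (%y. - jk U k l (- y) (G2 y))" "\<And>x. G2 x = (0, 1) + cumint (%y. - jk U k l (- y) (G2 y)) x"
    "\<And>h. (\<forall>x. set_integrable lebesgue {x<..} (%y. jk u k l y (h y)) \<and> h x = (0, 1) - (LINT y:{x<..}|lebesgue. jk u k l y (h y))) \<longleftrightarrow> h = (%x. G2 (- x))"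
    using top[of "(0, 1)"] by blast
  have ph: "phase k x = ee (l * x)" for x using phase_ee[OF kz] l by simp
  have e1: "ee (l * (s + t)) = ee (l * s) * ee (l * t)" "ee (- (l * (s + t))) = ee (- (l * s)) * ee (- (l * t))" for s t
    by (simp_all add: distrib_left ee_add[symmetric])
  have c1: "e1 $ 1 = 1" "e1 $ 2 = 0" "e2 $ 1 = 0" "e2 $ 2 = 1" by (simp_all add: e1_def e2_def)
  note T1 = volterra_solution_transform[of "%t. 1" "%t. ee (l * t)" l e1 u k, unfolded c1]
  note T2 = volterra_solution_transform[of "%t. ee (- (l * t))" "%t. 1" l e2 u k, unfolded c1]
  define Jm Jp Kp where "Jm = jost_varphi (-\<infinity>) u k" and "Jp = jost_varphi \<infinity> u k" and "Kp = jost_phi \<infinity> u k"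
  have Jm: "(%x. (1 * Jm x $ 1, ee (l * - x) * Jm x $ 2)) = F"
  proof -
    have eq: "volterra_solution (-\<infinity>) e1 (%t. mat22 1 0 0 (phase k t)) (Q u k) f \<longleftrightarrow> (%x. (1 * f x $ 1, ee (l * - x) * f x $ 2)) = F" for f
      unfolding ph F(5)[symmetric] by (rule T1(1)) (simp_all add: e1)
    show ?thesis unfolding Jm_def jost_varphi_def eq by (rule theI'[OF ex1_transform[of "%x. 1" "%x. ee (l * x)"]]) auto
  qed
  have Jp: "(%x. (1 * Jp x $ 1, ee (l * - x) * Jp x $ 2)) = (%x. G1 (- x))"
  proof -
    have eq: "volterra_solution \<infinity> e1 (%t. mat22 1 0 0 (phase k t)) (Q u k) f \<longleftrightarrow> (%x. (1 * f x $ 1, ee (l * - x) * f x $ 2)) = (%x. G1 (- x))" for f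
      unfolding ph G1(3)[symmetric] by (rule T1(2)) (simp_all add: e1)
    show ?thesis unfolding Jp_def jost_varphi_def eq by (rule theI'[OF ex1_transform[of "%x. 1" "%x. ee (l * x)"]]) auto
  qed
  have Kp: "(%x. (ee (- (l * - x)) * Kp x $ 1, 1 * Kp x $ 2)) = (%x. G2 (- x))"
  proof -
    have eq: "volterra_solution \<infinity> e2 (%t. mat22 (phase k (- t)) 0 0 1) (Q u k) f \<longleftrightarrow> (%x. (ee (- (l * - x)) * f x $ 1, 1 * f x $ 2)) = (%x. G2 (- x))" for f
    proof -
      have "phase k (- t) = ee (- (l * t))" for t unfolding ph by simp
      then show ?thesis unfolding G2(3)[symmetric] by (simp only:) (rule T2(2); simp add: e1)
    qed
    show ?thesis unfolding Kp_def jost_phi_def eq by (rule theI'[OF ex1_transform[of "%x. ee (- (l * x))" "%x. 1"]]) auto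
  qed
  define S where "S a b v w = (a * fst v + b * fst w, a * snd v + b * snd w)" for a b and v w :: "complex \<times> complex"
  \<comment> \<open>The factor \<open>phase k x\<close> in the definition of b is what turns the
    relation into one with constant coefficients between the transformed unknowns.\<close>
  have rel: "(Jm x = a *s Jp x + (b * phase k x) *s Kp x) \<longleftrightarrow> F x = S a b (G1 (- x)) (G2 (- x))" for a b x
  proof -
    have 1: "F x = (Jm x $ 1, ee (- (l * x)) * Jm x $ 2)" "G1 (- x) = (Jp x $ 1, ee (- (l * x)) * Jp x $ 2)" "G2 (- x) = (ee (l * x) * Kp x $ 1, Kp x $ 2)"
      using fun_cong[OF Jm, of x] fun_cong[OF Jp, of x] fun_cong[OF Kp, of x] by simp_all
    have nz: "ee t \<noteq> 0" for t using norm_ee[of t] by (metis norm_zero zero_neq_one)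
    have "b * Kp x $ 2 = ee (- (l * x)) * (b * ee (l * x) * Kp x $ 2)"
    proof -
      have "ee (- (l * x)) * (b * ee (l * x) * Kp x $ 2) = (ee (- (l * x)) * ee (l * x)) * (b * Kp x $ 2)" by (simp only: mult_ac)
      then show ?thesis by simp
    qed
    then have "a * (ee (- (l * x)) * Jp x $ 2) + b * Kp x $ 2 = ee (- (l * x)) * (a * Jp x $ 2 + b * ee (l * x) * Kp x $ 2)"
      by (simp add: distrib_left mult.left_commute)
    then show ?thesis unfolding 1 S_def vec_eq_iff forall_2 ph by (simp add: nz mult.assoc)
  qed
  define L where "L = (1, 0) + (LBINT y. jk U k l y (F y))"
  have S: "bounded_linear (%v. S a b v 0)" "bounded_linear (%v. S a b 0 v)" "S a b v w = S a b v 0 + S a b 0 w" for a b v w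
    unfolding S_def by (auto intro!: bounded_linear_Pair bounded_linear_add bounded_linear_const_mult bounded_linear_fst bounded_linear_snd bounded_linear_zero simp: )
  have FL: "(F \<longlongrightarrow> L) at_top"
    unfolding L_def by (subst F(4)[abs_def]) (intro tendsto_intros cumint_tendsto_top F(3))
  have Gl: "((%x. G (- x)) \<longlongrightarrow> c) at_top" if "integrable lborel g" "\<And>x. G x = c + cumint g x" for G g and c :: "complex \<times> complex"
  proof -
    have "((%x. c + cumint g (- x)) \<longlongrightarrow> c + 0) at_top"
      by (intro tendsto_add tendsto_const filterlim_compose[OF cumint_tendsto_bot[OF that(1)] filterlim_uminus_at_bot_at_top])
    then show ?thesis unfolding that(2)[symmetric] by simp
  qed
  have uniq: "a = fst L \<and> b = snd L" if P: "\<And>x. F x = S a b (G1 (- x)) (G2 (- x))" for a b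
  proof -
    have "((%x. S a b (G1 (- x)) (G2 (- x))) \<longlongrightarrow> S a b (1, 0) (0, 1)) at_top"
      unfolding S_def by (intro tendsto_intros Gl[OF G1(1,2)] Gl[OF G2(1,2)])
    then have "(F \<longlongrightarrow> S a b (1, 0) (0, 1)) at_top" unfolding P[symmetric] .
    then have "L = S a b (1, 0) (0, 1)" by (rule tendsto_unique[OF trivial_limit_at_top_linorder FL])
    then show ?thesis by (simp add: S_def)
  qed
  \<comment> \<open>Both sides, reflected, solve the Volterra equation from plus infinity with value
    \<open>L\<close> there, so \<open>volterra_unique\<close> applies.\<close>
  have ex: "F x = S (fst L) (snd L) (G1 (- x)) (G2 (- x))" for x
  proof -
    let ?S = "S (fst L) (snd L)" and ?k = "%y v. - jk U k l (- y) v"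
    have "F (- (- x)) = ?S (G1 (- x)) (G2 (- x))"
    proof (rule volterra_unique[where \<kappa>="%y. ?\<kappa> (- y)" and k="?k" and c=L and F="%x. F (- x)" and G="%x. ?S (G1 x) (G2 x)"])
      show "integrable lborel (%y. ?\<kappa> (- y))" by (rule cumint_reflect(1)[OF \<kappa>(1)])
      show "norm (?k y a - ?k y b) \<le> ?\<kappa> (- y) * norm (a - b)" for y a b
        using K(1)[of "- y" b a] by (simp add: norm_minus_commute)
      note R = cumint_reflect[OF F(3)]
      show "set_integrable lborel {..- x} (%y. ?k y (F (- y)))"
        by (rule set_integrable_lborel) (use R(1) in simp_all)
      show "F (- x) = L + cumint (%y. ?k y (F (- y))) x" for x
        unfolding cumint_uminus R(2) L_def by (subst F(4)) simp
      have kS: "?k y (?S v w) = ?S (?k y v) (?k y w)" for y v w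
        unfolding S_def jk_linear by (simp add: prod_eq_iff)
      have iS: "integrable lborel (%y. ?S (?k y (G1 y)) 0)" "integrable lborel (%y. ?S 0 (?k y (G2 y)))"
        by (rule integrable_bounded_linear[OF S(1) G1(1)], rule integrable_bounded_linear[OF S(2) G2(1)])
      have sum: "(%y. ?k y (?S (G1 y) (G2 y))) = (%y. ?S (?k y (G1 y)) 0 + ?S 0 (?k y (G2 y)))"
        unfolding kS S(3)[symmetric] ..
      show "set_integrable lborel {..- x} (%y. ?k y (?S (G1 y) (G2 y)))"
        unfolding sum by (rule set_integrable_lborel) (use iS in simp_all)
      show "?S (G1 x) (G2 x) = L + cumint (%y. ?k y (?S (G1 y) (G2 y))) x" for x
      proof -
        let ?c1 = "cumint (%y. ?k y (G1 y)) x" and ?c2 = "cumint (%y. ?k y (G2 y)) x"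
        have "?S (G1 x) (G2 x) = ?S ((1, 0) + ?c1) ((0, 1) + ?c2)" unfolding G1(2)[symmetric] G2(2)[symmetric] ..
        also have "\<dots> = L + (?S ?c1 0 + ?S 0 ?c2)" by (simp add: S_def prod_eq_iff algebra_simps)
        also have "?S ?c1 0 = cumint (%y. ?S (?k y (G1 y)) 0) x" by (rule cumint_bounded_linear[OF S(1) set_integrable_lborel[OF G1(1)]]) simp
        also have "?S 0 ?c2 = cumint (%y. ?S 0 (?k y (G2 y))) x" by (rule cumint_bounded_linear[OF S(2) set_integrable_lborel[OF G2(1)]]) simp
        finally show ?thesis unfolding sum cumint_add[OF iS] .
      qed
    qed
    then show ?thesis by simp
  qed
  have "scattering_coeffs u k = L"
    unfolding scattering_coeffs_def Jm_def[symmetric] Jp_def[symmetric] Kp_def[symmetric] rel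
  proof (rule the_equality)
    show "case L of (a, b) => \<forall>x. F x = S a b (G1 (- x)) (G2 (- x))" using ex by (simp only: case_prod_beta) blast
    show "q = L" if "case q of (a, b) => \<forall>x. F x = S a b (G1 (- x)) (G2 (- x))" for q
    proof (cases q)
      case (Pair a b)
      then have "\<And>x. F x = S a b (G1 (- x)) (G2 (- x))" using that by (simp only: case_prod_conv)
      then show ?thesis using uniq[of a b] Pair by (simp add: prod_eq_iff)
    qed
  qed
  then have ab: "coeff_a u k = fst L" "coeff_b u k = snd L" by (simp_all add: coeff_a_def coeff_b_def)
  have fj: "fst (jk U k l y (F y)) = \<i> / 2 * of_real ((cmod (U y))^2) * fst (F y) + k * U y * ee (l * y) * snd (F y)"
    "snd (jk U k l y (F y)) = - k * cnj (U y) * ee (- (l * y)) * fst (F y) - \<i> / 2 * of_real ((cmod (U y))^2) * snd (F y)" for y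
    by (simp_all add: jk_def)
  note SI = set_integrable_lborel[OF F(3), of "{..x}" for x, simplified]
  show ?thesis
  proof (rule that[of "%x. fst (F x)" "%x. snd (F x)" D])
    show "cmod (fst (F x)) \<le> D" "cmod (snd (F x)) \<le> D" for x
      using F(2)[of x] norm_fst_le[of "fst (F x)" "snd (F x)"] norm_snd_le[of "snd (F x)" "fst (F x)"] by simp_all
    show "fst (F x) = 1 + cumint (%y. \<i> / 2 * of_real ((cmod (U y))^2) * fst (F y) + k * U y * ee (l * y) * snd (F y)) x" for x
      unfolding fj[symmetric] cumint_bounded_linear[OF bounded_linear_fst SI, symmetric] by (subst F(4)) simp
    show "snd (F x) = cumint (%y. - k * cnj (U y) * ee (- (l * y)) * fst (F y) - \<i> / 2 * of_real ((cmod (U y))^2) * snd (F y)) x" for x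
      unfolding fj[symmetric] cumint_bounded_linear[OF bounded_linear_snd SI, symmetric] by (subst F(4)) simp
    show "((%x. fst (F x)) \<longlongrightarrow> coeff_a u k) at_top" "((%x. snd (F x)) \<longlongrightarrow> coeff_b u k) at_top"
      unfolding ab by (intro tendsto_fst FL, intro tendsto_snd FL)
  qed (use borel_measurable_fst_snd[OF F(1)] integrable_bounded_linear[OF bounded_linear_fst F(3)] integrable_bounded_linear[OF bounded_linear_snd F(3)] in \<open>simp_all only: fj\<close>)
qed

section \<open>From Jost functions to Zakharov--Shabat systems\<close>

lemma cumint_ac:
  assumes g: "integrable lborel g" and f: "\<And>x. f x = c + cumint g x"
  shows "ac f g"
  unfolding ac_def f using g set_integrable_lborel[OF g] by (auto simp: cumint_diff[OF g, symmetric])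

text \<open>Uniqueness at one value of l: the Jost functions for a given k provide a solution only
  at \<open>l = z + 1\<close>, whereas \<open>zs_sol\<close> concerns all l. The difference solves
  the unforced system and vanishes by \<open>forced_system_sup\<close>.\<close>

lemma zs_unique_at:
  assumes ok: "zs_ok B \<alpha> \<beta>" and m: "borel_fun p" "borel_fun e"
    and D: "\<And>x. cmod (p x) \<le> D" "\<And>x. cmod (e x) \<le> D"
    and p: "\<And>x. p x = 1 + cumint (%y. ee (l * y) * (\<alpha> y * e y)) x"
    and e: "\<And>x. e x = cumint (%y. ee (- (l * y)) * (\<beta> y * p y)) x"
  shows "p = zs_P \<alpha> \<beta> l" "e = zs_E \<alpha> \<beta> l"
proof -
  let ?P = "zs_P \<alpha> \<beta> l" and ?E = "zs_E \<alpha> \<beta> l"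
  note sol = zs_sol_PE[OF ok]
  have i: "integrable lborel \<alpha>" "integrable lborel \<beta>" and small: "nm1 \<alpha> * nm1 \<beta> \<le> 5 / 12" using ok by (auto simp: zs_ok_def)
  have P: "?P x = 1 + cumint (%y. ee (l * y) * (\<alpha> y * ?E y)) x" and E: "?E x = cumint (%y. ee (- (l * y)) * (\<beta> y * ?P y)) x" for x
    using sol unfolding zs_sol_def by blast+
  have em: "borel_fun (%y. ee (l * y))" "borel_fun (%y. ee (- (l * y)))" by measurable
  have ep: "integrable lborel (%y. ee (l * y) * (\<alpha> y * e y))" "integrable lborel (%y. ee (- (l * y)) * (\<beta> y * p y))"
    by (rule integrable_bounded_mult(2)[OF integrable_bounded_mult(1)[OF i(1) m(2) D(2)] em(1), where B=1], simp)
      (rule integrable_bounded_mult(2)[OF integrable_bounded_mult(1)[OF i(2) m(1) D(1)] em(2), where B=1], simp)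
  note EP = zs_integrable(2)[OF ok sol i(1) osc_ee(1), of l] zs_integrable(1)[OF ok sol i(2) osc_ee(2), of l]
  have X: "e x - ?E x = 0 + cumint (%y. ee (- (l * y)) * (\<beta> y * (p y - ?P y))) x" for x
    unfolding right_diff_distrib cumint_minus[OF ep(2) EP(2)] by (simp only: e[symmetric] E[symmetric] add_0)
  have Y: "p x - ?P x = 0 + cumint (%y. ee (l * y) * (\<alpha> y * (e y - ?E y))) x" for x
  proof -
    have "p x - ?P x = (1 + cumint (%y. ee (l * y) * (\<alpha> y * e y)) x) - (1 + cumint (%y. ee (l * y) * (\<alpha> y * ?E y)) x)"
      by (simp only: p[symmetric] P[symmetric])
    then show ?thesis unfolding right_diff_distrib cumint_minus[OF ep(1) EP(1)] by simp
  qed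
  note bd = zs_sol_bound[OF ok sol]
  have X0: "cmod (e x - ?E x) \<le> 12 / 7 * (0 + nm1 \<beta> * 0)" for x
  proof (rule forced_system_sup[OF i small, where D="D + (2 + 2 * B)" and F="%x. 0" and G="%x. 0" and \<theta>X="%y. ee (- (l * y))" and \<theta>Y="%y. ee (l * y)" and Y="%x. p x - ?P x"])
    have B: "0 \<le> B" using ok nm1_nonneg[of \<alpha>] unfolding zs_ok_def by linarith
    show "cmod (e x - ?E x) \<le> D + (2 + 2 * B)" "cmod (p x - ?P x) \<le> D + (2 + 2 * B)" for x
      using norm_triangle_ineq4[of "e x" "?E x"] norm_triangle_ineq4[of "p x" "?P x"] D[of x] bd[of l x] B by linarith+
    show "e x - ?E x = 0 + cumint (%y. ee (- (l * y)) * (\<beta> y * (p y - ?P y))) x" for x by (rule X)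
    show "p x - ?P x = 0 + cumint (%y. ee (l * y) * (\<alpha> y * (e y - ?E y))) x" for x by (rule Y)
  qed simp_all
  then have e0: "e x = ?E x" for x by simp
  then show "e = ?E" by blast
  show "p = ?P" proof
    fix x show "p x = ?P x" using Y[of x] unfolding e0 by (simp add: cumint_def)
  qed
qed

text \<open>The two substitutions are differentiated as absolutely continuous functions and seen to
  satisfy the systems. Since \<open>U\<close> tends to 0 at both ends and is multiplied by bounded
  factors, the correction terms disappear in the limits, leaving \<open>coeff_a\<close> and a
  multiple of \<open>coeff_b\<close>.\<close>

lemma scattering_zs:
  assumes u: "AE x in lborel. u x = U x" and U: "sobdat B0 U U'" and ok: "\<And>s. zs_ok B (sysA s U U') (sysB s U U')"
    and kz: "k^2 = of_real z" and k0: "k \<noteq> 0"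
  shows "zs_a (sysA s U U') (sysB s U U') (z + 1) = coeff_a u k \<and>
    zs_b (sysA s U U') (sysB s U U') (z + 1) = (if s then 2 * \<i> * k * coeff_b u k else coeff_b u k / k)"
proof -
  define l where "l = z + 1"
  have aU: "ac U U'" and lU: "l21 U" "l21 U'" using U by (auto simp: sobdat_def)
  note Um [measurable] = ac_measurable[OF aU]
  note Ut = sobdat_tendsto[OF U]
  obtain p \<sigma> D where pm [measurable]: "borel_fun p" "borel_fun \<sigma>" and D: "\<And>x. cmod (p x) \<le> D" "\<And>x. cmod (\<sigma> x) \<le> D"
    and i: "integrable lborel (%y. \<i> / 2 * of_real ((cmod (U y))^2) * p y + k * U y * ee (l * y) * \<sigma> y)"
    "integrable lborel (%y. - k * cnj (U y) * ee (- (l * y)) * p y - \<i> / 2 * of_real ((cmod (U y))^2) * \<sigma> y)"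
    and p: "\<And>x. p x = 1 + cumint (%y. \<i> / 2 * of_real ((cmod (U y))^2) * p y + k * U y * ee (l * y) * \<sigma> y) x"
    and \<sigma>: "\<And>x. \<sigma> x = cumint (%y. - k * cnj (U y) * ee (- (l * y)) * p y - \<i> / 2 * of_real ((cmod (U y))^2) * \<sigma> y) x"
    and lim: "(p \<longlongrightarrow> coeff_a u k) at_top" "(\<sigma> \<longlongrightarrow> coeff_b u k) at_top"
    by (rule scattering_system[OF u Um l21_nm1(1)[OF lU(1)] l21_nm2(1)[OF lU(1)] kz l_def]) blast
  have D0: "0 \<le> D" using D(1)[of 0] norm_ge_zero order_trans by blast
  have \<sigma>': "\<sigma> x = 0 + cumint (%y. - k * cnj (U y) * ee (- (l * y)) * p y - \<i> / 2 * of_real ((cmod (U y))^2) * \<sigma> y) x" for x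
    by (subst \<sigma>) simp
  note ap = cumint_ac[OF i(1) p] and as = cumint_ac[OF i(2) \<sigma>']
  have pb: "(p \<longlongrightarrow> 1) at_bot" "(\<sigma> \<longlongrightarrow> 0) at_bot"
  proof -
    have "((%x. 1 + cumint (%y. \<i> / 2 * of_real ((cmod (U y))^2) * p y + k * U y * ee (l * y) * \<sigma> y) x) \<longlongrightarrow> 1 + 0) at_bot"
      by (intro tendsto_intros cumint_tendsto_bot i)
    then show "(p \<longlongrightarrow> 1) at_bot" unfolding p[symmetric] by simp
    have "(cumint (%y. - k * cnj (U y) * ee (- (l * y)) * p y - \<i> / 2 * of_real ((cmod (U y))^2) * \<sigma> y) \<longlongrightarrow> 0) at_bot"
      by (rule cumint_tendsto_bot[OF i(2)])
    then show "(\<sigma> \<longlongrightarrow> 0) at_bot" unfolding \<sigma>[symmetric] .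
  qed
  have U0: "((%x. c * (U x * (ee (l * x) * q x))) \<longlongrightarrow> 0) F" "((%x. c * (ee (- (l * x)) * (cnj (U x) * q x))) \<longlongrightarrow> 0) F"
    if "(U \<longlongrightarrow> 0) F" "\<And>x. cmod (q x) \<le> D" for c q F
  proof -
    have "((%x. cmod c * D * cmod (U x)) \<longlongrightarrow> 0) F" using tendsto_mult_right_zero[OF tendsto_norm_zero[OF that(1)]] .
    moreover have "cmod c * (cmod (U x) * cmod (q x)) \<le> cmod c * D * cmod (U x)" for x
      using mult_left_mono[OF mult_left_mono[OF that(2)[of x] norm_ge_zero[of "U x"]] norm_ge_zero[of c]] by (simp only: mult_ac)
    ultimately show "((%x. c * (U x * (ee (l * x) * q x))) \<longlongrightarrow> 0) F" "((%x. c * (ee (- (l * x)) * (cnj (U x) * q x))) \<longlongrightarrow> 0) F"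
      by (auto intro!: Lim_null_comparison[of _ "%x. cmod c * D * cmod (U x)"] always_eventually simp: norm_mult)
  qed
  have E1: "ee (- (l * x)) * ee (l * x) = 1" for x by simp
  have kk: "k * k = of_real l - 1" using kz by (simp add: l_def power2_eq_square)
  have Ub: "cmod (U x) \<le> 2 * B0" for x by (rule sobdat_sup[OF U])
  have B0: "0 \<le> B0" using U by (simp add: sobdat_def)
  note zl = zs_limits[OF ok, of _ l]
  show ?thesis (is ?goal)
  proof (cases s)
    case True
    \<comment> \<open>\<open>\<sigma>\<close> is the second component q stripped of its phase, and
      \<open>s = q / k\<close> with \<open>z = k^2\<close>, so the term \<open>2 i z s\<close> times
      the phase becomes \<open>2 * \<i> * k * \<sigma> x\<close>.\<close>
    define e where "e x = 2 * \<i> * k * \<sigma> x - ee (- (l * x)) * (cnj (U x) * p x)" for x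
    have eD: "cmod (e x) \<le> 2 * cmod k * D + 2 * B0 * D + D" for x
    proof -
      have "cmod (e x) \<le> cmod (2 * \<i> * k * \<sigma> x) + cmod (ee (- (l * x)) * (cnj (U x) * p x))" unfolding e_def by (rule norm_triangle_ineq4)
      also have "\<dots> = 2 * cmod k * cmod (\<sigma> x) + cmod (U x) * cmod (p x)" by (simp add: norm_mult)
      also have "\<dots> \<le> 2 * cmod k * D + 2 * B0 * D" by (intro add_mono mult_left_mono mult_mono D Ub) (use B0 in auto)
      finally show ?thesis using D0 by linarith
    qed
    have pe: "\<i> / 2 * of_real ((cmod (U y))^2) * p y + k * U y * ee (l * y) * \<sigma> y = ee (l * y) * (sysA s U U' y * e y)" for y
    proof -
      have "ee (l * y) * (sysA s U U' y * e y) = (k * U y * ee (l * y) * \<sigma> y) + (\<i> / 2) * (ee (- (l * y)) * ee (l * y)) * (U y * cnj (U y) * p y)"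
        using True by (simp add: sysA_def e_def algebra_simps)
      then show ?thesis unfolding complex_norm_square E1 by (simp add: mult.assoc)
    qed
    have ae: "ac e (%x. (2 * \<i> * k) * (- k * cnj (U x) * ee (- (l * x)) * p x - \<i> / 2 * of_real ((cmod (U x))^2) * \<sigma> x) -
      ((- (2 * \<i> * of_real l) * ee (- (l * x))) * (cnj (U x) * p x) + ee (- (l * x)) * (cnj (U' x) * p x + cnj (U x) * (\<i> / 2 * of_real ((cmod (U x))^2) * p x + k * U x * ee (l * x) * \<sigma> x))))"
      unfolding e_def by (intro ac_diff ac_cmult ac_mult as ac_exp ac_cnj aU ap)
    have de: "(2 * \<i> * k) * (- k * cnj (U x) * ee (- (l * x)) * p x - \<i> / 2 * of_real ((cmod (U x))^2) * \<sigma> x) -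
      ((- (2 * \<i> * of_real l) * ee (- (l * x))) * (cnj (U x) * p x) + ee (- (l * x)) * (cnj (U' x) * p x + cnj (U x) * (\<i> / 2 * of_real ((cmod (U x))^2) * p x + k * U x * ee (l * x) * \<sigma> x)))
      = ee (- (l * x)) * (sysB s U U' x * p x)" for x
    proof -
      \<comment> \<open>\<open>k * k = L - 1\<close> is where z disappears: the terms with
        \<open>L\<close> cancel against the derivative of the phase, leaving the summand
        \<open>2 * V\<close> of the conjugate of w.\<close>
      have A: "(2 * j * k) * (- k * V * Em * P - j / 2 * (W * V) * S) - ((- (2 * j * L) * Em) * (V * P) + Em * (V' * P + V * (j / 2 * (W * V) * P + k * W * E * S)))
        = Em * ((j * (j * V' + 2 * V - 1/2 * (W * V) * V)) * P)"
        if "j * j = - 1" "k * k = L - 1" "Em * E = 1" for j V Em P W S L V' E :: complex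
        using that by algebra
      have "sysB s U U' x = \<i> * (\<i> * cnj (U' x) + 2 * cnj (U x) - 1/2 * (U x * cnj (U x)) * cnj (U x))"
        using True unfolding sysB_def wW_def complex_norm_square by simp
      then show ?thesis unfolding complex_norm_square using A[OF _ kk E1[of x], of \<i> "cnj (U x)" "p x" "U x" "\<sigma> x" "cnj (U' x)"] by simp
    qed
    note ae' = ae[unfolded de]
    have [measurable]: "borel_fun e" by (rule ac_measurable[OF ae'])
    have iB: "integrable lborel (sysB s U U')" using ok[of s] by (auto simp: zs_ok_def)
    have ei: "integrable lborel (%y. ee (- (l * y)) * (sysB s U U' y * p y))"
      by (rule integrable_bounded_mult(2)[OF integrable_bounded_mult(1)[OF iB pm(1) D(1)], where B=1]) simp_all
    have "(e \<longlongrightarrow> 2 * \<i> * k * 0 - 0) at_bot"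
      unfolding e_def using U0(2)[of at_bot p 1] Ut D by (intro tendsto_diff tendsto_mult tendsto_const pb) auto
    then have e0: "(e \<longlongrightarrow> 0) at_bot" by simp
    have ee: "e x = cumint (%y. ee (- (l * y)) * (sysB s U U' y * p y)) x" for x
      using ac_eq_cumint[OF ae' ei e0, of x] by simp
    have pd: "cmod (p x) \<le> 2 * cmod k * D + 2 * B0 * D + D" for x
    proof -
      have "0 \<le> 2 * cmod k * D + 2 * B0 * D" using D0 B0 by simp
      then show ?thesis using D(1)[of x] by linarith
    qed
    note un = zs_unique_at[OF ok _ _ pd eD p[unfolded pe] ee]
    have "p = zs_P (sysA s U U') (sysB s U U') l" "e = zs_E (sysA s U U') (sysB s U U') l" by (rule un; measurable)+
    then have za: "(p \<longlongrightarrow> zs_a (sysA s U U') (sysB s U U') l) at_top" "(e \<longlongrightarrow> zs_b (sysA s U U') (sysB s U U') l) at_top"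
      using zl(1)[of s] zl(2)[of s] by simp_all
    have "(e \<longlongrightarrow> 2 * \<i> * k * coeff_b u k - 0) at_top"
      unfolding e_def using U0(2)[of at_top p 1] Ut D by (intro tendsto_diff tendsto_mult tendsto_const lim) auto
    then show ?goal using tendsto_unique[OF trivial_limit_at_top_linorder za(1) lim(1)] tendsto_unique[OF trivial_limit_at_top_linorder za(2)] True
      by (simp add: l_def)
  next
    case False
    define e where "e x = 1 / k * \<sigma> x" for x
    \<comment> \<open>The density of \<open>p\<close> contains
      \<open>k^2 * U x * ee (l * x) * e x\<close>; differentiating the phase in the correction term
      cancels the part with l and leaves the summand \<open>2 * U x\<close> of w.\<close>
    define q where "q x = p x + (\<i> / 2) * (U x * (ee (l * x) * e x))" for x
    have eD: "cmod (e x) \<le> D / cmod k" for x using D(2)[of x] k0 by (simp add: e_def norm_divide divide_right_mono)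
    have ae: "ac e (%y. 1 / k * (- k * cnj (U y) * ee (- (l * y)) * p y - \<i> / 2 * of_real ((cmod (U y))^2) * \<sigma> y))"
      unfolding e_def by (intro ac_cmult as)
    have aE: "ac (%y. ee (l * y)) (%y. 2 * \<i> * of_real l * ee (l * y))" using ac_exp[of "- l"] by simp
    have de: "1 / k * (- k * cnj (U y) * ee (- (l * y)) * p y - \<i> / 2 * of_real ((cmod (U y))^2) * \<sigma> y) = ee (- (l * y)) * (sysB s U U' y * q y)" for y
    proof -
      have A: "1 / k * (- k * V * Em * P - \<i> / 2 * (W * V) * S) = Em * (- V * (P + \<i> / 2 * (W * (E * (1 / k * S)))))"
        if "Em * E = 1" for V Em P W S E :: complex
      proof -
        have "Em * (- V * (P + \<i> / 2 * (W * (E * (1 / k * S))))) = - Em * V * P - (Em * E) * (\<i> / 2 * W * V * (1 / k * S))" by (simp add: algebra_simps)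
        then show ?thesis unfolding that using k0 by (simp add: field_simps)
      qed
      show ?thesis using False unfolding complex_norm_square q_def e_def sysB_def by (simp only: if_False A[OF E1])
    qed
    note ae' = ae[unfolded de]
    have aq: "ac q (%x. (\<i> / 2 * of_real ((cmod (U x))^2) * p x + k * U x * ee (l * x) * \<sigma> x) +
      \<i> / 2 * (U' x * (ee (l * x) * e x) + U x * ((2 * \<i> * of_real l * ee (l * x)) * e x + ee (l * x) * (ee (- (l * x)) * (sysB s U U' x * q x)))))"
      unfolding q_def by (intro ac_add ac_cmult ac_mult ap aU aE ae'[unfolded q_def])
    have dq: "(\<i> / 2 * of_real ((cmod (U x))^2) * p x + k * U x * ee (l * x) * \<sigma> x) +
      \<i> / 2 * (U' x * (ee (l * x) * e x) + U x * ((2 * \<i> * of_real l * ee (l * x)) * e x + ee (l * x) * (ee (- (l * x)) * (sysB s U U' x * q x))))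
      = ee (l * x) * (sysA s U U' x * e x)" for x
    proof -
      have A: "(j / 2 * (W * V) * P + k * W * E * (k * S)) + j / 2 * (W' * (E * S) + W * ((2 * j * L * E) * S + E * (Em * (- V * (P + j / 2 * (W * (E * S)))))))
        = E * ((- (1/2) * (- j * W' + 2 * W - 1/2 * (W * V) * W)) * S)"
        if "j * j = - 1" "k * k = L - 1" "Em * E = 1" for j V Em P W S L W' E :: complex
        using that by algebra
      have s: "\<sigma> x = k * e x" using k0 by (simp add: e_def)
      have "sysA s U U' x = - (1/2) * (- \<i> * U' x + 2 * U x - 1/2 * (U x * cnj (U x)) * U x)" "sysB s U U' x = - cnj (U x)"
        using False unfolding sysA_def sysB_def wW_def complex_norm_square by simp_all
      then show ?thesis unfolding complex_norm_square q_def s using A[OF _ kk E1[of x], of \<i> "U x" "cnj (U x)" "p x" "e x" "U' x"] by simp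
    qed
    note aq' = aq[unfolded dq]
    have [measurable]: "borel_fun e" "borel_fun q" by (rule ac_measurable[OF ae'], rule ac_measurable[OF aq'])
    have iA: "integrable lborel (sysA s U U')" "integrable lborel (sysB s U U')" using ok[of s] by (auto simp: zs_ok_def)
    have qD: "cmod (q x) \<le> D + B0 * (D / cmod k) + D / cmod k" for x
    proof -
      have "cmod (q x) \<le> cmod (p x) + cmod ((\<i> / 2) * (U x * (ee (l * x) * e x)))" unfolding q_def by (rule norm_triangle_ineq)
      also have "\<dots> = cmod (p x) + 1 / 2 * (cmod (U x) * cmod (e x))" by (simp add: norm_mult norm_divide)
      also have "\<dots> \<le> D + 1 / 2 * ((2 * B0) * (D / cmod k))" by (intro add_mono mult_left_mono mult_mono D Ub eD) (use B0 in auto)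
      finally have "cmod (q x) \<le> D + B0 * (D / cmod k)" by simp
      moreover have "0 \<le> D / cmod k" using D0 by simp
      ultimately show ?thesis by linarith
    qed
    have eD': "cmod (e x) \<le> D + B0 * (D / cmod k) + D / cmod k" for x
    proof -
      have "0 \<le> B0 * (D / cmod k)" using D0 B0 by simp
      then show ?thesis using D0 eD[of x] by linarith
    qed
    have ei: "integrable lborel (%y. ee (- (l * y)) * (sysB s U U' y * q y))"
      by (rule integrable_bounded_mult(2)[OF integrable_bounded_mult(1)[OF iA(2) _ qD], where B=1]) simp_all
    have qi: "integrable lborel (%y. ee (l * y) * (sysA s U U' y * e y))"
      by (rule integrable_bounded_mult(2)[OF integrable_bounded_mult(1)[OF iA(1) _ eD], where B=1]) simp_all
    have e0: "(e \<longlongrightarrow> 0) at_bot" unfolding e_def using tendsto_mult_right_zero[OF pb(2)] .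
    have Ue: "((%x. (\<i> / 2) * (U x * (ee (l * x) * e x))) \<longlongrightarrow> 0) F" if "(U \<longlongrightarrow> 0) F" for F
      using U0(1)[OF that D(2), of "\<i> / 2 * (1 / k)"] by (simp add: e_def mult_ac)
    have "(q \<longlongrightarrow> 1 + 0) at_bot" unfolding q_def using Ut by (intro tendsto_add pb Ue) auto
    then have q0: "(q \<longlongrightarrow> 1) at_bot" by simp
    have ee: "e x = cumint (%y. ee (- (l * y)) * (sysB s U U' y * q y)) x" for x
      using ac_eq_cumint[OF ae' ei e0, of x] by simp
    note un = zs_unique_at[OF ok _ _ qD eD' ac_eq_cumint[OF aq' qi q0] ee]
    have "q = zs_P (sysA s U U') (sysB s U U') l" "e = zs_E (sysA s U U') (sysB s U U') l" by (rule un; measurable)+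
    then have za: "(q \<longlongrightarrow> zs_a (sysA s U U') (sysB s U U') l) at_top" "(e \<longlongrightarrow> zs_b (sysA s U U') (sysB s U U') l) at_top"
      using zl(1)[of s] zl(2)[of s] by simp_all
    have "(q \<longlongrightarrow> coeff_a u k + 0) at_top" unfolding q_def using Ut by (intro tendsto_add lim Ue) auto
    moreover have "(e \<longlongrightarrow> 1 / k * coeff_b u k) at_top" unfolding e_def by (intro tendsto_mult tendsto_const lim)
    ultimately show ?goal using tendsto_unique[OF trivial_limit_at_top_linorder za(1)] tendsto_unique[OF trivial_limit_at_top_linorder za(2)] False
      by (simp add: l_def)
  qed
qed

section \<open>Reflection coefficients\<close>

lemma l2_deriv_shift:
  assumes f [measurable]: "borel_fun f" and d: "l2_deriv f g" and \<kappa>: "cmod \<kappa> \<le> 1"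
  shows "l2_deriv (%z. \<kappa> * f (z + 1)) (%z. \<kappa> * g (z + 1))"
proof -
  from d obtain \<epsilon> where g [measurable]: "borel_fun g" and \<epsilon>: "\<epsilon> \<longlonglongrightarrow> 0"
    "\<And>n. nsq (%l. of_real (1 / hs n) * (f (l + hs n) - f l) - g l) \<le> ennreal (\<epsilon> n)"
    unfolding l2_deriv_def by blast
  have "nsq (%l. of_real (1 / hs n) * (\<kappa> * f (l + hs n + 1) - \<kappa> * f (l + 1)) - \<kappa> * g (l + 1)) \<le> ennreal (\<epsilon> n)" for n
  proof -
    let ?D = "%l. of_real (1 / hs n) * (f (l + hs n) - f l) - g l"
    have "nsq (%l. of_real (1 / hs n) * (\<kappa> * f (l + hs n + 1) - \<kappa> * f (l + 1)) - \<kappa> * g (l + 1)) \<le> nsq (%l. ?D (l + 1))"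
    proof (rule nsq_mono)
      fix l
      have "of_real (1 / hs n) * (\<kappa> * f (l + hs n + 1) - \<kappa> * f (l + 1)) - \<kappa> * g (l + 1) = \<kappa> * ?D (l + 1)"
        by (simp add: algebra_simps)
      then show "cmod (of_real (1 / hs n) * (\<kappa> * f (l + hs n + 1) - \<kappa> * f (l + 1)) - \<kappa> * g (l + 1)) \<le> cmod (?D (l + 1))"
        using mult_right_mono[OF \<kappa> norm_ge_zero[of "?D (l + 1)"]] by (simp only: norm_mult mult_1)
    qed
    also have "\<dots> = nsq ?D" by (rule nsq_shift) measurable
    finally show ?thesis using \<epsilon>(2)[of n] by (rule order_trans)
  qed
  then show ?thesis unfolding l2_deriv_def using \<epsilon>(1) by auto
qed

text \<open>\<open>1 + z^2 \<le> 3 + 2 * (z + 1)^2\<close>, the difference being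
  \<open>(z + 2)^2\<close>, transfers the weight from \<open>l = z + 1\<close> to z.\<close>

lemma l21_shift:
  assumes [measurable]: "borel_fun f" and a: "nsq f \<le> ennreal a" "nsq (%l. of_real l * f l) \<le> ennreal b" "0 \<le> a" "0 \<le> b"
    and \<kappa>: "cmod \<kappa> \<le> 1"
  shows "l21 (%z. \<kappa> * f (z + 1))" "wn (%z. \<kappa> * f (z + 1)) \<le> 3 * a + 2 * b"
proof -
  have "nsq (%z. f (z + 1)) \<le> ennreal a" using a(1) by (subst nsq_shift) auto
  from nsq_le_nm2[OF _ this a(3)] have 1: "integrable lborel (%z. (cmod (f (z + 1)))^2)" "nm2 (%z. f (z + 1)) \<le> a" by auto
  have "nsq (%z. of_real (z + 1) * f (z + 1)) \<le> ennreal b" using a(2) by (subst nsq_shift[of "%l. of_real l * f l"]) auto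
  from nsq_le_nm2[OF _ this a(4)] have 2: "integrable lborel (%z. (cmod (of_real (z + 1) * f (z + 1)))^2)" "nm2 (%z. of_real (z + 1) * f (z + 1)) \<le> b" by auto
  let ?h = "%z. 3 * (cmod (f (z + 1)))^2 + 2 * (cmod (of_real (z + 1) * f (z + 1)))^2"
  have le: "(1 + z^2) * (cmod (\<kappa> * f (z + 1)))^2 \<le> ?h z" for z
  proof -
    have "cmod (\<kappa> * f (z + 1)) \<le> cmod (f (z + 1))" using mult_right_mono[OF \<kappa> norm_ge_zero[of "f (z + 1)"]] by (simp add: norm_mult)
    then have "(1 + z^2) * (cmod (\<kappa> * f (z + 1)))^2 \<le> (1 + z^2) * (cmod (f (z + 1)))^2" by (intro mult_left_mono power_mono) auto
    also have "\<dots> \<le> (3 + 2 * (z + 1)^2) * (cmod (f (z + 1)))^2"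
    proof (rule mult_right_mono)
      have "0 \<le> (z + 2)^2" by simp
      then show "1 + z^2 \<le> 3 + 2 * (z + 1)^2" by (simp add: power2_eq_square algebra_simps)
    qed simp
    also have "\<dots> = ?h z"
    proof -
      have "(cmod (of_real (z + 1) * f (z + 1)))^2 = (z + 1)^2 * (cmod (f (z + 1)))^2"
        by (simp only: norm_mult norm_of_real power_mult_distrib power2_abs)
      then show ?thesis by (simp only: distrib_right mult.assoc)
    qed
    finally show ?thesis .
  qed
  have hi: "integrable lborel ?h" using 1(1) 2(1) by (intro Bochner_Integration.integrable_add integrable_mult_right) auto
  have i: "integrable lborel (%z. (1 + z^2) * (cmod (\<kappa> * f (z + 1)))^2)"
  proof (rule Bochner_Integration.integrable_bound[OF hi])
    show "AE z in lborel. norm ((1 + z^2) * (cmod (\<kappa> * f (z + 1)))^2) \<le> norm (?h z)"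
    proof (rule AE_I2)
      fix z :: real
      have "0 \<le> (1 + z^2) * (cmod (\<kappa> * f (z + 1)))^2" by simp
      then show "norm ((1 + z^2) * (cmod (\<kappa> * f (z + 1)))^2) \<le> norm (?h z)" using le[of z] unfolding real_norm_def by linarith
    qed
  qed measurable
  then show "l21 (%z. \<kappa> * f (z + 1))" by (simp add: l21_def)
  have "wn (%z. \<kappa> * f (z + 1)) \<le> (LBINT z. ?h z)" unfolding wn_def by (rule integral_mono[OF i hi le])
  also have "\<dots> = 3 * nm2 (%z. f (z + 1)) + 2 * nm2 (%z. of_real (z + 1) * f (z + 1))"
    unfolding nm2_def using 1(1) 2(1) by (subst Bochner_Integration.integral_add) (auto intro!: integrable_mult_right)
  finally show "wn (%z. \<kappa> * f (z + 1)) \<le> 3 * a + 2 * b" using 1(2) 2(2) by linarith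
qed

lemma has_weak_deriv_cong_AE:
  assumes "has_weak_deriv f g" "AE x in lborel. r x = f x" shows "has_weak_deriv r g"
proof -
  obtain F G where F: "ac F G" "AE x in lborel. f x = F x" "AE x in lborel. g x = G x" using assms(1) unfolding has_weak_deriv_iff_ac by blast
  have "AE x in lborel. r x = F x" using assms(2) F(2) by eventually_elim simp
  then show ?thesis unfolding has_weak_deriv_iff_ac using F by blast
qed

lemma has_weak_deriv_diff:
  assumes "has_weak_deriv f g" "has_weak_deriv f' g'" shows "has_weak_deriv (%x. f x - f' x) (%x. g x - g' x)"
proof -
  obtain F G where F: "ac F G" "AE x in lborel. f x = F x" "AE x in lborel. g x = G x" using assms(1) unfolding has_weak_deriv_iff_ac by blast
  obtain F' G' where F': "ac F' G'" "AE x in lborel. f' x = F' x" "AE x in lborel. g' x = G' x" using assms(2) unfolding has_weak_deriv_iff_ac by blast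
  have "AE x in lborel. f x - f' x = F x - F' x" "AE x in lborel. g x - g' x = G x - G' x"
    using F(2) F'(2) F(3) F'(3) by (eventually_elim, simp)+
  then show ?thesis unfolding has_weak_deriv_iff_ac using ac_diff[OF F(1) F'(1)] by blast
qed

lemma Hm1_rep:
  assumes f: "AE x in lborel. f x = F x" "borel_fun F" and g: "has_weak_deriv f G" "borel_fun G"
    and i: "sq_integrable F" "sq_integrable G"
  shows "f \<in> Hm 1" "Hm_norm 1 f = sqrt (nm2 F + nm2 G)"
proof -
  have w: "weakly_differentiable f" using g(1) by (auto simp: weakly_differentiable_def)
  note R = L2_rep[OF f(2,1)] L2_rep[OF g(2) wderiv_AE[OF g(1)]]
  have two: "j \<le> 1 \<longleftrightarrow> j = 0 \<or> j = 1" for j :: nat by auto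
  show "f \<in> Hm 1" using w i R(1,3) unfolding Hm_def two by auto
  show "Hm_norm 1 f = sqrt (nm2 F + nm2 G)" unfolding Hm_norm_def by (simp add: R(2,4))
qed

definition reflection :: "bool => (real => complex) => real => complex" where
  "reflection s u = (if s then r_minus u else r_plus u)"

definition refl_rho :: "bool => (real => complex) => (real => complex) => real => complex" where
  "refl_rho s U U' = zs_rho (sysA s U U') (sysB s U U')"

text \<open>For \<open>True\<close> the quotient \<open>zs_rho\<close> is
  \<open>2 * \<i> * k * b / a\<close>, so \<open>- \<i>\<close> gives \<open>2 * k * r\<close>; for
  \<open>False\<close> it is \<open>b / (k * a)\<close>, so \<open>1 / 2\<close> gives
  \<open>r / (2 * k)\<close>.\<close>

definition refl_factor :: "bool => complex" where "refl_factor s = (if s then - \<i> else 1 / 2)"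

lemma refl_factor: "cmod (refl_factor s) \<le> 1" by (simp add: refl_factor_def)

definition good :: "real => (real => complex) => (real => complex) => (real => complex) => bool" where
  "good b u U U' \<longleftrightarrow> sobdat b U U' \<and> (AE x in lborel. u x = U x) \<and> nm1 U * nm1 (wW U U') \<le> 5 / 6"

lemma good_D:
  assumes "good b u U U'"
  shows "sobdat b U U'" "AE x in lborel. u x = U x" "zs_ok (pot_bound b) (sysA s U U') (sysB s U U')" "1 \<le> pot_bound b"
    and "refl_rho s U U' \<in> borel_measurable borel" "cmod (refl_rho s U U' l) \<le> 7 * pot_bound b"
proof -
  have s: "sobdat b U U'" "AE x in lborel. u x = U x" "nm1 U * nm1 (wW U U') \<le> 5 / 6" using assms by (auto simp: good_def)
  show "sobdat b U U'" "AE x in lborel. u x = U x" by (fact s)+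
  show ok: "zs_ok (pot_bound b) (sysA s U U') (sysB s U U')" for s by (rule sys_props(5)[OF s(1,3)])
  show "1 \<le> pot_bound b" using s(1) by (intro pot_bound(1)) (simp add: sobdat_def)
  show "refl_rho s U U' \<in> borel_measurable borel" "cmod (refl_rho s U U' l) \<le> 7 * pot_bound b"
    unfolding refl_rho_def by (rule zs_rho_measurable[OF ok], rule zs_rho_bound[OF ok])
qed

text \<open>The point z = 0 is excluded because \<open>scattering_zs\<close> assumes k nonzero. For
  z < 0 the root k is imaginary, but l stays real and the bounds on \<open>zs_rho\<close> apply
  unchanged.\<close>

lemma refl_AE:
  assumes g: "good b u U U'"
  shows "AE z in lborel. reflection s u z = refl_factor s * refl_rho s U U' (z + 1)"
  using AE_lborel_singleton[of 0]
proof eventually_elim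
  fix z :: real assume z: "z \<noteq> 0"
  define k where "k = csqrt (of_real z)"
  have k: "k^2 = of_real z" "k \<noteq> 0" using z by (simp_all add: k_def)
  have ab: "zs_a (sysA s U U') (sysB s U U') (z + 1) = coeff_a u k"
    "zs_b (sysA s U U') (sysB s U U') (z + 1) = (if s then 2 * \<i> * k * coeff_b u k else coeff_b u k / k)"
    using scattering_zs[OF good_D(2,1,3)[OF g] k] by auto
  show "reflection s u z = refl_factor s * refl_rho s U U' (z + 1)"
  proof -
    have "- \<i> * (2 * \<i> * k * x / y) = 2 * k * (x / y)" for x y
    proof -
      have "2 * \<i> * k * x / y = \<i> * (2 * k * (x / y))" by simp
      then show ?thesis by (simp only: mult_minus_left mult.assoc[symmetric, of \<i> \<i>] i_squared) simp
    qed
    then show ?thesis unfolding refl_rho_def zs_rho_def ab using k(2)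
      by (simp add: reflection_def r_minus_def r_plus_def refl_coeff_def Let_def refl_factor_def k_def[symmetric])
  qed
qed

lemma zero_l2_deriv: "l2_deriv (%l. 0) (%l. 0)"
  unfolding l2_deriv_def by (auto intro!: exI[of _ "%n. 0"] simp: nsq_def)

text \<open>Finiteness comes from comparison with zero potentials, for which \<open>zs_rho\<close>
  and its L2 derivative vanish; \<open>l2_deriv_weak\<close> then identifies the L2 derivative as
  the weak one.\<close>

lemma refl_deriv:
  assumes g: "good b u U U'"
  obtains d where "l2_deriv (refl_rho s U U') d" "borel_fun d" "nsq (refl_rho s U U') < \<infinity>" "nsq d < \<infinity>"
    "has_weak_deriv (reflection s u) (%z. refl_factor s * d (z + 1))"
proof -
  let ?B = "pot_bound b" and ?z = "%y::real. 0::complex"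
  note G = good_D[OF g]
  note P = sys_props(1-4)[OF G(1), of s]
  have B0: "0 \<le> ?B" using G(4) by simp
  obtain d where d: "l2_deriv (refl_rho s U U') d"
    unfolding refl_rho_def by (rule zs_rho_l2_deriv[OF G(4) G(3)[of s] l21_nm2(2)[OF P(1)] l21_nm2(2)[OF P(2)]])
  then have dm [measurable]: "borel_fun d" by (simp add: l2_deriv_def)
  have z2: "wn ?z \<le> ?B^2" by (simp add: l21_zero)
  note prem = G(4) B0 G(3)[of s] zs_zero[OF B0] P(1,2) l21_zero(1) l21_zero(1) P(3,4) z2 z2 dist_le_zero[OF P(1,3)] dist_le_zero[OF P(2,4)]
  have z: "zs_rho ?z ?z = ?z" by (rule ext) simp
  have "nsq (%l. refl_rho s U U' l - 0) \<le> ennreal (lip_const ?B * ?B^2)" using zs_rho_dist[OF prem] unfolding z refl_rho_def .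
  then have 1: "nsq (refl_rho s U U') < \<infinity>" by (simp add: le_less_trans)
  have "nsq (%l. d l - 0) \<le> ennreal (lip_const ?B * ?B^2)"
    by (rule zs_rho_deriv_dist[OF prem d[unfolded refl_rho_def]]) (unfold z, rule zero_l2_deriv)
  then have 2: "nsq d < \<infinity>" by (simp add: le_less_trans)
  have "nsq (%z. refl_factor s * d (z + 1)) \<le> nsq (%z. d (z + 1))"
    using refl_factor[of s] by (intro nsq_mono) (simp add: norm_mult mult_left_le_one_le)
  also have "\<dots> < \<infinity>" using 2 by (subst nsq_shift) auto
  finally have fin: "nsq (%z. refl_factor s * d (z + 1)) < \<infinity>" .
  note [measurable] = G(5)[of s]
  have bd: "cmod (refl_factor s * refl_rho s U U' (z + 1)) \<le> 7 * ?B" for z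
    using mult_mono[OF refl_factor[of s] G(6)[of s "z + 1"]] by (simp add: norm_mult)
  have "has_weak_deriv (%z. refl_factor s * refl_rho s U U' (z + 1)) (%z. refl_factor s * d (z + 1))"
    by (rule l2_deriv_weak[OF _ bd l2_deriv_shift[OF G(5) d refl_factor] fin]) measurable
  from has_weak_deriv_cong_AE[OF this refl_AE[OF g]] show ?thesis by (rule that[OF d dm 1 2])
qed

lemma shift_factor_nm2:
  assumes [measurable]: "borel_fun f" and f: "nsq f \<le> ennreal c" "0 \<le> c"
  shows "integrable lborel (%z. (cmod (refl_factor s * f (z + 1)))^2)" "nm2 (%z. refl_factor s * f (z + 1)) \<le> c"
proof -
  have "nsq (%z. refl_factor s * f (z + 1)) \<le> nsq (%z. f (z + 1))"
    using refl_factor[of s] by (intro nsq_mono) (simp add: norm_mult mult_left_le_one_le)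
  also have "\<dots> \<le> ennreal c" using f by (subst nsq_shift) auto
  finally show "integrable lborel (%z. (cmod (refl_factor s * f (z + 1)))^2)" "nm2 (%z. refl_factor s * f (z + 1)) \<le> c"
    using nsq_le_nm2[of "%z. refl_factor s * f (z + 1)" c] f(2) by auto
qed

lemma refl_Hm1:
  assumes g: "good b u U U'"
  shows "reflection s u \<in> Hm 1"
proof -
  obtain d where d: "borel_fun d" "nsq (refl_rho s U U') < \<infinity>" "nsq d < \<infinity>"
    "has_weak_deriv (reflection s u) (%z. refl_factor s * d (z + 1))" by (rule refl_deriv[OF g, of s])
  note [measurable] = d(1) good_D(5)[OF g, of s]
  have e: "nsq (refl_rho s U U') \<le> ennreal (enn2real (nsq (refl_rho s U U')))" "nsq d \<le> ennreal (enn2real (nsq d))" using d(2,3) by simp_all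
  show ?thesis
    by (rule Hm1_rep(1)[OF refl_AE[OF g] _ d(4)]; (rule shift_factor_nm2(1)[OF _ e(1)] shift_factor_nm2(1)[OF _ e(2)])?) simp_all
qed

lemma sys_l2ac:
  assumes U: "sobdat b U U'" "ac U' U''" "sq_integrable U''" "nm2 U'' \<le> b^2"
  shows "l2ac (sysA s U U') (sysA' s U U' U'')" "l2ac (sysB s U U') (sysB' s U U' U'')"
    "nm2 (sysA' s U U' U'') \<le> (pot_bound b)^2" "nm2 (sysB' s U U' U'') \<le> (pot_bound b)^2"
proof -
  have b: "0 \<le> b" and l: "l21 U'" "wn U' \<le> b^2" using U(1) by (auto simp: sobdat_def)
  note W = l2ac_wW[OF U] l2ac_sobdat[OF U(1)]
  have c: "l2ac (%y. c * f y) (%y. c * f' y)" "l2ac (%y. c * cnj (f y)) (%y. c * cnj (f' y))" if "l2ac f f'" for c f f'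
    using that ac_cmult[OF ac_cnj, of f f' c] ac_cmult[of f f' c] by (simp_all add: l2ac_def norm_mult power_mult_distrib)
  show "l2ac (sysA s U U') (sysA' s U U' U'')" using c(1)[OF W(3)] c(1)[OF W(1)] unfolding sysA_def sysA'_def by (cases s) (simp_all only: if_True if_False)
  show "l2ac (sysB s U U') (sysB' s U U' U'')" using c(2)[OF W(1), of \<i>] c(2)[OF W(3), of "- 1"] by (simp add: sysB_def sysB'_def)
  have n: "nm2 U' \<le> (pot_bound b)^2" "nm2 (wW' U U' U'') \<le> (pot_bound b)^2"
    using W(2) l21_nm2(3)[OF l(1)] l(2) pot_bound(3,5)[OF b] by simp_all
  have "nm2 (sysA' s U U' U'') = (if s then 1 / 4 * nm2 U' else 1 / 4 * nm2 (wW' U U' U''))"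
    "nm2 (sysB' s U U' U'') = (if s then nm2 (wW' U U' U'') else nm2 U')"
    by (simp_all add: sysA'_def sysB'_def nm2_def norm_mult norm_divide power_divide)
  then show "nm2 (sysA' s U U' U'') \<le> (pot_bound b)^2" "nm2 (sysB' s U U' U'') \<le> (pot_bound b)^2"
    using n nm2_nonneg[of U'] nm2_nonneg[of "wW' U U' U''"] by (auto split: if_splits simp del: nm2_nonneg)
qed

lemma sys'_dist:
  assumes U: "sobdat b U U'" and V: "sobdat b V V'" and UV: "sobdat n (%y. U y - V y) (%y. U' y - V' y)"
    and m: "borel_fun U''" "borel_fun V''"
    and i: "integrable lborel (%y. (cmod (U'' y - V'' y))^2)" "nm2 (%y. U'' y - V'' y) \<le> n^2"
  shows "nm2 (%y. sysA' s U U' U'' y - sysA' s V V' V'' y) \<le> (sob_const b * n)^2"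
    "nm2 (%y. sysB' s U U' U'' y - sysB' s V V' V'' y) \<le> (sob_const b * n)^2"
proof -
  have n: "0 \<le> n" and l: "l21 (%y. U' y - V' y)" "wn (%y. U' y - V' y) \<le> n^2" using UV by (auto simp: sobdat_def)
  have "n^2 \<le> (sob_const b * n)^2" using n by (intro power_mono) (auto simp: sob_const_def algebra_simps)
  then have 1: "nm2 (%y. U' y - V' y) \<le> (sob_const b * n)^2" using l21_nm2(3)[OF l(1)] l(2) by linarith
  note 2 = wW'_dist(2)[OF U V UV m i]
  have "cmod (\<i> * cnj x - \<i> * cnj y) = cmod (x - y)" "cmod (- cnj x - - cnj y) = cmod (x - y)" for x y
    by (simp_all only: right_diff_distrib[symmetric] minus_diff_minus norm_minus_cancel complex_cnj_diff[symmetric] complex_mod_cnj norm_mult norm_ii mult_1)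
  then have "nm2 (%y. sysB' s U U' U'' y - sysB' s V V' V'' y) =
    (if s then nm2 (%y. wW' U U' U'' y - wW' V V' V'' y) else nm2 (%y. U' y - V' y))"
    by (cases s) (simp_all only: sysB'_def nm2_def if_True if_False)
  also have "\<dots> \<le> (sob_const b * n)^2" using 1 2 by simp
  finally show "nm2 (%y. sysB' s U U' U'' y - sysB' s V V' V'' y) \<le> (sob_const b * n)^2" .
  have "(cmod (- (\<i> / 2) * x - - (\<i> / 2) * y))^2 = 1 / 4 * (cmod (x - y))^2" "(cmod (- (1 / 2) * x - - (1 / 2) * y))^2 = 1 / 4 * (cmod (x - y))^2" for x y
    by (simp_all only: right_diff_distrib[symmetric] norm_mult power_mult_distrib) (simp_all add: norm_divide power_divide)
  then have "nm2 (%y. sysA' s U U' U'' y - sysA' s V V' V'' y) =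
    (if s then 1 / 4 * nm2 (%y. U' y - V' y) else 1 / 4 * nm2 (%y. wW' U U' U'' y - wW' V V' V'' y))"
    by (cases s) (simp_all only: sysA'_def nm2_def if_True if_False integral_mult_right_zero)
  also have "\<dots> \<le> (sob_const b * n)^2"
  proof -
    have q: "1 / 4 * x \<le> (sob_const b * n)^2" if "x \<le> (sob_const b * n)^2" for x using that zero_le_power2[of "sob_const b * n"] by linarith
    show ?thesis using q[OF 1] q[OF 2] by (cases s) (simp_all only: if_True if_False)
  qed
  finally show "nm2 (%y. sysA' s U U' U'' y - sysA' s V V' V'' y) \<le> (sob_const b * n)^2" .
qed

context
  fixes b n :: real and u v U U' U'' V V' V'' :: "real => complex"
  assumes u: "good b u U U'" "ac U' U''" "sq_integrable U''" "nm2 U'' \<le> b^2"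
    and v: "good b v V V'" "ac V' V''" "sq_integrable V''" "nm2 V'' \<le> b^2"
    and uv: "sobdat n (%y. U y - V y) (%y. U' y - V' y)" "integrable lborel (%y. (cmod (U'' y - V'' y))^2)" "nm2 (%y. U'' y - V'' y) \<le> n^2"
begin

text \<open>\<open>2 * C\<close> collects the function and its derivative in
  \<open>Hm_norm 1\<close>; \<open>5 = 3 + 2\<close> are the constants of
  \<open>l21_shift\<close>.\<close>

lemma refl_lipschitz:
  defines "C \<equiv> lip_const (pot_bound b) * (sob_const b * n)^2"
  shows "H1_L21_norm (%z. reflection s u z - reflection s v z) \<le> sqrt (2 * C) + sqrt (5 * C)"
proof -
  let ?B = "pot_bound b" and ?N = "sob_const b * n"
  note GU = good_D[OF u(1)] and GV = good_D[OF v(1)]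
  note PU = sys_props(1-4)[OF GU(1), of s] and PV = sys_props(1-4)[OF GV(1), of s]
  have N0: "0 \<le> ?N" using uv(1) by (simp add: sobdat_def sob_const_def)
  have B0: "0 \<le> ?B" using GU(4) by simp
  note prem = GU(4) N0 GU(3)[of s] GV(3)[of s] PU(1,2) PV(1,2) PU(3,4) PV(3,4) sys_dist[OF GU(1) GV(1) uv(1), of s]
  have C0: "0 \<le> C" using lip_const_nonneg[OF prem] by (simp add: C_def)
  let ?f = "%l. refl_rho s U U' l - refl_rho s V V' l"
  obtain d where d: "l2_deriv (refl_rho s U U') d" "borel_fun d" "has_weak_deriv (reflection s u) (%z. refl_factor s * d (z + 1))"
    by (rule refl_deriv[OF u(1), of s])
  obtain d' where d': "l2_deriv (refl_rho s V V') d'" "borel_fun d'" "has_weak_deriv (reflection s v) (%z. refl_factor s * d' (z + 1))"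
    by (rule refl_deriv[OF v(1), of s])
  note [measurable] = d(2) d'(2) GU(5)[of s] GV(5)[of s]
  have n1: "nsq ?f \<le> ennreal C" unfolding C_def refl_rho_def by (rule zs_rho_dist[OF prem])
  have n2: "nsq (%l. d l - d' l) \<le> ennreal C" unfolding C_def by (rule zs_rho_deriv_dist[OF prem d(1)[unfolded refl_rho_def] d'(1)[unfolded refl_rho_def]])
  have n3: "nsq (%l. of_real l * ?f l) \<le> ennreal C" unfolding C_def refl_rho_def
    by (rule zs_rho_weighted_dist[OF prem sys_l2ac(1,2)[OF GU(1) u(2-4)] sys_l2ac(1,2)[OF GV(1) v(2-4)]
      sys_l2ac(3,4)[OF GU(1) u(2-4)] sys_l2ac(3,4)[OF GV(1) v(2-4)] sys'_dist[OF GU(1) GV(1) uv(1) ac_D(1)[OF u(2)] ac_D(1)[OF v(2)] uv(2,3)]])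
  let ?F = "%z. refl_factor s * ?f (z + 1)" and ?G = "%z. refl_factor s * (d (z + 1) - d' (z + 1))"
  have ae: "AE z in lborel. reflection s u z - reflection s v z = ?F z"
    using refl_AE[OF u(1), of s] refl_AE[OF v(1), of s] by eventually_elim (simp add: right_diff_distrib)
  have w: "has_weak_deriv (%z. reflection s u z - reflection s v z) ?G"
    using has_weak_deriv_diff[OF d(3) d'(3)] by (simp only: right_diff_distrib)
  note F = shift_factor_nm2[OF _ n1 C0, of s] and G = shift_factor_nm2[OF _ n2 C0, of s]
  have fm: "?f \<in> borel_measurable borel" "borel_fun (%l. d l - d' l)" by measurable
  have Fm: "?F \<in> borel_measurable borel" and Gm: "?G \<in> borel_measurable borel" by measurable
  have "Hm_norm 1 (%z. reflection s u z - reflection s v z) = sqrt (nm2 ?F + nm2 ?G)"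
    by (rule Hm1_rep(2)[OF ae Fm w Gm F(1)[OF fm(1)] G(1)[OF fm(2)]])
  also have "\<dots> \<le> sqrt (2 * C)" using F(2)[OF fm(1)] G(2)[OF fm(2)] by simp
  finally have H: "Hm_norm 1 (%z. reflection s u z - reflection s v z) \<le> sqrt (2 * C)" .
  have L: "L21_norm (%z. reflection s u z - reflection s v z) \<le> sqrt (5 * C)"
    unfolding l21_rep(2)[OF Fm ae] using l21_shift(2)[OF fm(1) n1 n3 C0 C0 refl_factor, of s] by simp
  show ?thesis unfolding H1_L21_norm_def by (rule add_mono[OF H L])
qed

lemma refl_L21: "reflection s u \<in> L21"
proof -
  let ?B = "pot_bound b" and ?z = "%y::real. 0::complex"
  note GU = good_D[OF u(1)]
  note PU = sys_props(1-4)[OF GU(1), of s]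
  have B0: "0 \<le> ?B" using GU(4) by simp
  have z2: "wn ?z \<le> ?B^2" by (simp add: l21_zero)
  note prem = GU(4) B0 GU(3)[of s] zs_zero[OF B0] PU(1,2) l21_zero(1) l21_zero(1) PU(3,4) z2 z2 dist_le_zero[OF PU(1,3)] dist_le_zero[OF PU(2,4)]
  have z: "zs_rho ?z ?z l = 0" for l by simp
  note R = zs_rho_dist[OF prem, unfolded z diff_0_right]
  have W: "nsq (%l. of_real l * zs_rho (sysA s U U') (sysB s U U') l) \<le> ennreal (lip_const ?B * ?B^2)"
    using zs_rho_weighted_dist[OF prem sys_l2ac(1,2)[OF GU(1) u(2-4)], of ?z ?z] sys_l2ac(3,4)[OF GU(1) u(2-4), of s]
    by (simp add: l2ac_def ac_const nm2_def)
  note [measurable] = GU(5)[of s]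
  have "0 \<le> lip_const ?B" by (rule lip_const_nonneg[OF prem])
  then have C0: "0 \<le> lip_const ?B * ?B^2" by simp
  have "l21 (%z. refl_factor s * refl_rho s U U' (z + 1))"
    by (rule l21_shift(1)[OF GU(5) _ _ C0 C0 refl_factor]) (unfold refl_rho_def, rule R, rule W)
  then show ?thesis by (subst l21_rep(1)[OF _ refl_AE[OF u(1)]]) simp_all
qed

end

lemma good_H11:
  assumes a: "admissible u" and U: "ac U U'" "AE x in lborel. u x = U x" "AE x in lborel. wderiv u x = U' x" "l21 U" "l21 U'" and b: "sobdat b U U'"
  shows "good b u U U'"
  using admissible_small[OF a U] U(2) b by (simp add: good_def)

lemma sobdat_mono: "sobdat b U U' \<Longrightarrow> b \<le> c \<Longrightarrow> sobdat c U U'"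
  unfolding sobdat_def using power_mono[of b c 2] by (auto intro: order_trans)

theorem lemma5:
  shows "(\<forall>u. admissible u \<and> u \<in> H11 \<longrightarrow> r_plus u \<in> Hm 1 \<and> r_minus u \<in> Hm 1) \<and>
    (\<forall>u. admissible u \<and> u \<in> Hm 2 \<inter> H11 \<longrightarrow> r_plus u \<in> L21 \<and> r_minus u \<in> L21) \<and>
    (\<forall>B>0. \<exists>C>0. \<forall>u v.
       u \<in> Hm 2 \<inter> H11 \<and> admissible u \<and> H2_H11_norm u \<le> B \<and>
       v \<in> Hm 2 \<inter> H11 \<and> admissible v \<and> H2_H11_norm v \<le> B \<longrightarrow>
         H1_L21_norm (\<lambda>z. r_minus u z - r_minus v z) + H1_L21_norm (\<lambda>z. r_plus u z - r_plus v z)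
           \<le> C * H2_H11_norm (\<lambda>x. u x - v x))"
proof (intro conjI[of "\<forall>u. _ u"] conjI allI impI)
  fix u assume u: "admissible u \<and> u \<in> H11"
  then have uH: "u \<in> H11" by simp
  obtain U U' where U: "ac U U'" "AE x in lborel. u x = U x" "AE x in lborel. wderiv u x = U' x" "l21 U" "l21 U'"
    by (rule H11_rep[OF uH])
  have g: "good (H11_norm u) u U U'" by (rule good_H11[OF _ U sobdat_H11_norm[OF U(1,2,4,5)]]) (use u in simp)
  show "r_plus u \<in> Hm 1" "r_minus u \<in> Hm 1" using refl_Hm1[OF g, of False] refl_Hm1[OF g, of True] by (simp_all add: reflection_def)
next
  fix u assume u: "admissible u \<and> u \<in> Hm 2 \<inter> H11"
  then have uH: "u \<in> Hm 2 \<inter> H11" by simp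
  obtain U U' U'' where U: "ac U U'" "AE x in lborel. u x = U x" "AE x in lborel. wderiv u x = U' x" "l21 U" "l21 U'"
    "ac U' U''" "integrable lborel (%y. (cmod (U'' y))^2)"
    by (rule H2_H11_rep[OF uH])
  note S = sobdat_H2_H11_norm[OF U(1,2,6,4,5)]
  have g: "good (H2_H11_norm u) u U U'" by (rule good_H11[OF _ U(1-5) S(1)]) (use u in simp)
  \<comment> \<open>The context of \<open>refl_L21\<close> compares two potentials; it is entered
    with \<open>v = u\<close>, for which the difference data vanish.\<close>
  have "sobdat (H2_H11_norm u) (%y. U y - U y) (%y. U' y - U' y)" using sobdat_zero[of "H2_H11_norm u"] S(1) by (simp add: sobdat_def)
  from refl_L21[OF g U(6,7) S(2) g U(6,7) S(2) this] have "reflection s u \<in> L21" for s by (simp add: nm2_def)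
  from this[of False] this[of True] show "r_plus u \<in> L21" "r_minus u \<in> L21" by (simp_all add: reflection_def)
next
  fix B :: real assume B: "0 < B"
  define K where "K = lip_const (pot_bound B)"
  \<comment> \<open>The factor 2 counts the two reflection coefficients,
    \<open>\<bar>K\<bar>\<close> keeps the radicands nonnegative, and \<open>+ 1\<close> makes
    \<open>C\<close> positive.\<close>
  define C where "C = 2 * (sqrt (2 * \<bar>K\<bar>) + sqrt (5 * \<bar>K\<bar>)) * sob_const B + 1"
  have sc: "0 \<le> sob_const B" by (simp add: sob_const_def)
  have "C > 0" using sc by (simp add: C_def add_nonneg_pos)
  moreover have "H1_L21_norm (%z. r_minus u z - r_minus v z) + H1_L21_norm (%z. r_plus u z - r_plus v z) \<le> C * H2_H11_norm (%x. u x - v x)"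
    if uv: "u \<in> Hm 2 \<inter> H11 \<and> admissible u \<and> H2_H11_norm u \<le> B \<and> v \<in> Hm 2 \<inter> H11 \<and> admissible v \<and> H2_H11_norm v \<le> B" for u v
  proof -
    have rep: "\<exists>U U' U''. good B u U U' \<and> (AE x in lborel. u x = U x) \<and> ac U U' \<and> l21 U \<and> l21 U' \<and> ac U' U'' \<and> integrable lborel (%y. (cmod (U'' y))^2) \<and> nm2 U'' \<le> B^2"
      if u: "u \<in> Hm 2 \<inter> H11" "admissible u" "H2_H11_norm u \<le> B" for u
    proof -
      obtain U U' U'' where U: "ac U U'" "AE x in lborel. u x = U x" "AE x in lborel. wderiv u x = U' x" "l21 U" "l21 U'"
        "ac U' U''" "integrable lborel (%y. (cmod (U'' y))^2)"
        by (rule H2_H11_rep[OF u(1)])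
      note S = sobdat_H2_H11_norm[OF U(1,2,6,4,5)]
      have "good B u U U'" by (rule good_H11[OF u(2) U(1-5) sobdat_mono[OF S(1) u(3)]])
      moreover have "nm2 U'' \<le> B^2" using S(1) u(3) by (intro order_trans[OF S(2)] power_mono) (auto simp: sobdat_def)
      ultimately show ?thesis using U by blast
    qed
    obtain U U' U'' where U: "good B u U U'" "AE x in lborel. u x = U x" "ac U U'" "l21 U" "l21 U'" "ac U' U''" "integrable lborel (%y. (cmod (U'' y))^2)" "nm2 U'' \<le> B^2"
      using rep[of u] uv by blast
    obtain V V' V'' where V: "good B v V V'" "AE x in lborel. v x = V x" "ac V V'" "l21 V" "l21 V'" "ac V' V''" "integrable lborel (%y. (cmod (V'' y))^2)" "nm2 V'' \<le> B^2"
      using rep[of v] uv by blast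
    let ?n = "H2_H11_norm (%x. u x - v x)"
    have l: "l21 (%y. U y - V y)" "l21 (%y. U' y - V' y)"
      unfolding l21_def
      using square_integrable_diff[OF l21_D(1)[OF U(4)] l21_D(1)[OF V(4)] _ _ l21_D(2)[OF U(4)] l21_D(2)[OF V(4)]]
        square_integrable_diff[OF l21_D(1)[OF U(5)] l21_D(1)[OF V(5)] _ _ l21_D(2)[OF U(5)] l21_D(2)[OF V(5)]]
        l21_D(1)[OF U(4)] l21_D(1)[OF V(4)] l21_D(1)[OF U(5)] l21_D(1)[OF V(5)] by simp_all
    have i: "integrable lborel (%y. (cmod (U'' y - V'' y))^2)"
      using square_integrable_diff1[OF ac_D(1)[OF U(6)] ac_D(1)[OF V(6)] U(7) V(7)] .
    have "AE x in lborel. u x - v x = U x - V x" using U(2) V(2) by eventually_elim simp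
    note S = sobdat_H2_H11_norm[OF ac_diff[OF U(3) V(3)] this ac_diff[OF U(6) V(6)] l]
    have n: "0 \<le> ?n" using S(1) by (simp add: sobdat_def)
    have le: "H1_L21_norm (%z. reflection s u z - reflection s v z) \<le> (sqrt (2 * \<bar>K\<bar>) + sqrt (5 * \<bar>K\<bar>)) * (sob_const B * ?n)" for s
    proof -
      have sq: "sqrt (c * (K * (sob_const B * ?n)^2)) \<le> sqrt (c * \<bar>K\<bar>) * (sob_const B * ?n)" if "0 \<le> c" for c
      proof -
        have "c * (K * (sob_const B * ?n)^2) \<le> (c * \<bar>K\<bar>) * (sob_const B * ?n)^2"
          using that by (simp add: mult.assoc mult_left_mono mult_right_mono)
        then have "sqrt (c * (K * (sob_const B * ?n)^2)) \<le> sqrt ((c * \<bar>K\<bar>) * (sob_const B * ?n)^2)" by (rule real_sqrt_le_mono)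
        also have "\<dots> = sqrt (c * \<bar>K\<bar>) * (sob_const B * ?n)" using sc n by (simp only: real_sqrt_mult real_sqrt_abs abs_of_nonneg mult_nonneg_nonneg)
        finally show ?thesis .
      qed
      show ?thesis
        using refl_lipschitz[OF U(1,6-8) V(1,6-8) S(1) i S(2), of s] sq[of 2] sq[of 5] unfolding K_def[symmetric] by (simp add: distrib_right)
    qed
    have "H1_L21_norm (%z. r_minus u z - r_minus v z) + H1_L21_norm (%z. r_plus u z - r_plus v z) \<le> 2 * ((sqrt (2 * \<bar>K\<bar>) + sqrt (5 * \<bar>K\<bar>)) * (sob_const B * ?n))"
      using le[of True] le[of False] by (simp add: reflection_def)
    also have "\<dots> \<le> C * ?n" using n by (simp add: C_def algebra_simps)
    finally show ?thesis .
  qed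
  ultimately show "\<exists>C>0. \<forall>u v. u \<in> Hm 2 \<inter> H11 \<and> admissible u \<and> H2_H11_norm u \<le> B \<and> v \<in> Hm 2 \<inter> H11 \<and> admissible v \<and> H2_H11_norm v \<le> B \<longrightarrow>
         H1_L21_norm (%z. r_minus u z - r_minus v z) + H1_L21_norm (%z. r_plus u z - r_plus v z) \<le> C * H2_H11_norm (%x. u x - v x)"
    by blast
qed

end
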